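(* Let $H$ be a Hilbert space of finite or infinite dimension and $E$ a Banach space that is either finite-dimensional or a Hilbert space with an orthonormal basis $\{f_l\}_{l\ge1}$. Let $\{\eta_k\}_{k\in\mathbb Z}$ be a stationary process in $E$ such that $\mathcal K:=\operatorname{supp}\mathcal D(\eta_k)$ is compact. Let $S:H\times E\to H$ be a $C^2$-smooth map (in the sense of Fréchet) that is bounded on bounded sets together with its derivatives of first and second order, and let $X\subset H$ be a compact set with $S(X\times\mathcal K)\subset X$. Consider the system $u_k=S(u_{k-1},\eta_k)$, $k\ge1$, $u_0=v$. Assume that the following four conditions hold. ($\eta1$) If $\dim E<\infty$, then for every $\boldsymbol\xi\in\boldsymbol{\mathcal K}$ the measure $Q(\boldsymbol\xi;\cdot)$ has a density, $Q(\boldsymbol\xi;dx)=p_{\boldsymbol\xi}(x)\,dx$, where the function $(\boldsymbol\xi,x)\mapsto p_{\boldsymbol\xi}(x)$ from $\boldsymbol{\mathcal K}\times E$ to $\mathbb R$ is Lipschitz-continuous. If $E$ is a Hilbert space with orthonormal basis $\{f_l\}$, then $\eta_k=\sum_{l=1}^\infty r_l\eta_k^lf_l$, where $r_l>0$, $\sum_l r_l<\infty$, the processes $\{\eta_k^l,k\in\mathbb Z\}$, $l\ge1$, are independent real-valued stationary processes with $|\eta^l_k|\le1$, and the projection $Q^l(\boldsymbol\xi;\cdot)$ of $Q(\boldsymbol\xi;\cdot)$ to the span of $f_l$ has the form $Q^l(\boldsymbol\xi;dx)=p^l_{\boldsymbol\xi}(x)\,dx$ with a function $(\boldsymbol\xi,x)\mapsto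 p^l_{\boldsymbol\xi}(x)$ that is Lipschitz-continuous; moreover, $\lim_{\boldsymbol\xi'\to\boldsymbol\xi}\sum_{l=1}^\infty\|p^l_{\boldsymbol\xi'}-p^l_{\boldsymbol\xi}\|_{L^1}=0$. ($\eta2$) For any $n\in\mathbb N$ and $\delta>0$ there exist $s\in\mathbb N$ and $\varepsilon>0$ such that $\mathbb P\{\|\eta_j(\boldsymbol\xi)\|<\delta,\ j=s+1,\dots,s+n\}\ge\varepsilon$ for every $\boldsymbol\xi\in\boldsymbol{\mathcal K}$. (S1) There are $k\ge1$ and $a\in(0,1)$ such that, for every $v\in H$, the trajectory of $u_j=S(u_{j-1},0)$, $j\ge1$, $u_0=v$, satisfies $\|u_k\|\le a\|v\|$. (S2) There exist a Hilbert space $V$, compactly and densely embedded into $H$, and an open set $O\subset H\times E$ containing $X\times\mathcal K$ such that $S$ defines a $C^1$-smooth map from $H\times E$ to $V$, and for any $(u,\eta)\in O$ the linear operator $D_\eta S(u,\eta):E\to H$ has dense image. Then there are a Borel probability measure $\mu$ on $H$ with $\operatorname{supp}\mu\subset X$ and positive constants $C,\gamma$ such that, for any initial condition $v$ which is a random variable in $X$ independent of $\{\eta_k,k\ge1\}$, the corresponding trajectory satisfies $$\|\mathcal D(u_k)-\mu\|_L^*\le Ce^{-\gamma k},\qquad k\ge0,$$ where $C$ and $\gamma$ do not depend on $v$.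
   Context: $\mathcal D(\cdot)$ denotes the law of a random variable. $\mathbb Z_-=\{0,-1,-2,\dots\}$. The set $\boldsymbol{\mathcal K}:=\mathcal K^{\mathbb Z_-}$ is endowed with the distance $\mathrm d(\boldsymbol\xi,\boldsymbol\xi')=\sum_{k=-\infty}^0\iota^k\|\xi_k-\xi_k'\|_E$, where $\iota>1$ is an arbitrary fixed number. For $l\in\mathbb Z$ put $\boldsymbol\eta_l=(\dots,\eta_{l-1},\eta_l)$. For $\boldsymbol\xi\in\boldsymbol{\mathcal K}$, $Q(\boldsymbol\xi;\cdot)=\mathbb P\{\eta_1\in\cdot\,|\,\boldsymbol\eta_0=\boldsymbol\xi\}$ is the conditional distribution of $\eta_1$ given the past; it is a probability measure on $E$ supported by $\mathcal K$ (the conditions are understood for a suitable version of it). For $m\ge1$, $$Q_m(\boldsymbol\xi;dy_1,\dots,dy_m)=Q(\boldsymbol\xi;dy_1)\,Q((\boldsymbol\xi,y_1);dy_2)\cdots Q((\boldsymbol\xi,y_1,\dots,y_{m-1});dy_m)$$ is the conditional law of $(\eta_1,\dots,\eta_m)$ given $\boldsymbol\eta_0=\boldsymbol\xi$, where $(\boldsymbol\xi,y_1,\dots,y_l)$ denotes concatenation. For $\boldsymbol\xi\in\boldsymbol{\mathcal K}$, $\{\eta_j(\boldsymbol\xi),j\ge1\}$ is a process in $\mathcal K$ such that $\mathcal D(\eta_1(\boldsymbol\xi),\dots,\eta_m(\boldsymbol\xi))=Q_m(\boldsymbol\xi;\cdot)$ for all $m\ge1$. The dual-Lipschitz distance between Borel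 probability measures is $\|\mu-\nu\|_L^*=\sup_f|\langle f,\mu\rangle-\langle f,\nu\rangle|$, the supremum being over all Lipschitz functions $f$ on $X$ with $|f|\le1$ and $\operatorname{Lip}(f)\le1$. *)

theory Defs
  imports "HOL-Probability.Probability"
begin

definition msupport :: "'a::topological_space measure \<Rightarrow> 'a set" where
  "msupport \<mu> = {x. \<forall>U. open U \<longrightarrow> x \<in> U \<longrightarrow> emeasure \<mu> U > 0}"

text \<open>The test functions live on the whole type; the real supremum is over a nonempty
  set, bounded by 2 when \<open>\<mu>\<close> and \<open>\<nu>\<close> are Borel probability measures.\<close>

definition dual_lip_dist :: "'a::metric_space measure \<Rightarrow> 'a measure \<Rightarrow> real" where
  "dual_lip_dist \<mu> \<nu> =
     (SUP f\<in>{f::'a \<Rightarrow> real. 1-lipschitz_on UNIV f \<and> (\<forall>x. \<bar>f x\<bar> \<le> 1)}.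
        \<bar>(\<integral>x. f x \<partial>\<mu>) - (\<integral>x. f x \<partial>\<nu>)\<bar>)"

definition is_finite_basis :: "'a::real_vector set \<Rightarrow> bool" where
  "is_finite_basis B \<longleftrightarrow> finite B \<and> independent B \<and> span B = UNIV"

text \<open>Lebesgue measure on a finite-dimensional normed space, transported from the
  coordinates in a basis \<open>B\<close>. Another basis changes it by a positive constant factor only.\<close>

definition basis_lebesgue :: "'a::real_normed_vector set \<Rightarrow> 'a measure" where
  "basis_lebesgue B =
     distr (Pi\<^sub>M B (\<lambda>_. lborel :: real measure)) borel (\<lambda>c. \<Sum>b\<in>B. c b *\<^sub>R b)"

text \<open>The type is only assumed to be a normed space: \<open>ip\<close> is an inner product inducing
  the given norm (completeness is provided by the type class in use) and \<open>f\<close> is an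
  orthonormal basis, indexed from 0.\<close>

definition hilbert_with_onb ::
    "('a::real_normed_vector \<Rightarrow> 'a \<Rightarrow> real) \<Rightarrow> (nat \<Rightarrow> 'a) \<Rightarrow> bool" where
  "hilbert_with_onb ip f \<longleftrightarrow>
     bilinear ip \<and> (\<forall>x y. ip x y = ip y x) \<and> (\<forall>x. ip x x = (norm x)\<^sup>2) \<and>
     (\<forall>i j. ip (f i) (f j) = (if i = j then 1 else 0)) \<and>
     closure (span (range f)) = UNIV"

definition C1_map :: "('a::real_normed_vector \<Rightarrow> 'b::real_normed_vector) \<Rightarrow> bool" where
  "C1_map f \<longleftrightarrow>
     (\<exists>D :: 'a \<Rightarrow> 'a \<Rightarrow>\<^sub>L 'b.
        (\<forall>z. (f has_derivative blinfun_apply (D z)) (at z)) \<and> continuous_on UNIV D)"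

definition bounded_on_bounded :: "('a::metric_space \<Rightarrow> 'b::metric_space) \<Rightarrow> bool" where
  "bounded_on_bounded f \<longleftrightarrow> (\<forall>A. bounded A \<longrightarrow> bounded (f ` A))"

definition C2_map_bounded :: "('a::real_normed_vector \<Rightarrow> 'b::real_normed_vector) \<Rightarrow> bool" where
  "C2_map_bounded f \<longleftrightarrow>
     (\<exists>(D :: 'a \<Rightarrow> 'a \<Rightarrow>\<^sub>L 'b) (D2 :: 'a \<Rightarrow> 'a \<Rightarrow>\<^sub>L 'a \<Rightarrow>\<^sub>L 'b).
        (\<forall>z. (f has_derivative blinfun_apply (D z)) (at z)) \<and>
        (\<forall>z. (D has_derivative blinfun_apply (D2 z)) (at z)) \<and>
        continuous_on UNIV D2 \<and>
        bounded_on_bounded f \<and> bounded_on_bounded D \<and> bounded_on_bounded D2)"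

definition compact_dense_embedding ::
    "('v::real_normed_vector \<Rightarrow> 'h::real_normed_vector) \<Rightarrow> bool" where
  "compact_dense_embedding J \<longleftrightarrow>
     bounded_linear J \<and> inj J \<and> (\<forall>A. bounded A \<longrightarrow> compact (closure (J ` A))) \<and>
     closure (range J) = UNIV"

definition stationary_process ::
    "'w measure \<Rightarrow> (int \<Rightarrow> 'w \<Rightarrow> 'a::topological_space) \<Rightarrow> bool" where
  "stationary_process M \<eta> \<longleftrightarrow>
     (\<forall>k. \<eta> k \<in> borel_measurable M) \<and>
     (\<forall>h. distr M (Pi\<^sub>M UNIV (\<lambda>_. borel)) (\<lambda>\<omega> k. \<eta> (k + h) \<omega>) =
          distr M (Pi\<^sub>M UNIV (\<lambda>_. borel)) (\<lambda>\<omega> k. \<eta> k \<omega>))"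

text \<open>Sequences indexed by the non-positive integers are encoded as functions
  \<open>\<xi>\<close> on \<open>nat\<close>, where \<open>\<xi> n\<close> stands for the entry with index \<open>-n\<close>.\<close>

definition past :: "(int \<Rightarrow> 'w \<Rightarrow> 'a) \<Rightarrow> 'w \<Rightarrow> nat \<Rightarrow> 'a" where
  "past \<eta> \<omega> n = \<eta> (- int n) \<omega>"

definition past_seqs :: "'a set \<Rightarrow> (nat \<Rightarrow> 'a) set" where
  "past_seqs K = {\<xi>. \<forall>n. \<xi> n \<in> K}"

definition past_dist ::
    "real \<Rightarrow> (nat \<Rightarrow> 'a::real_normed_vector) \<Rightarrow> (nat \<Rightarrow> 'a) \<Rightarrow> real" where
  "past_dist \<iota> \<xi> \<xi>' = (\<Sum>n. norm (\<xi> n - \<xi>' n) / \<iota> ^ n)"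

text \<open>\<open>Q\<close> is a version of the conditional distribution of \<open>\<eta> 1\<close> given the past. Only its
  values on \<open>past_seqs K\<close> matter; it is a kernel on all sequences because a kernel on the
  measurable set \<open>past_seqs K\<close> can be extended by a constant.\<close>

definition cond_law_version ::
    "'w measure \<Rightarrow> (int \<Rightarrow> 'w \<Rightarrow> 'a::topological_space) \<Rightarrow> 'a set \<Rightarrow>
     ((nat \<Rightarrow> 'a) \<Rightarrow> 'a measure) \<Rightarrow> bool" where
  "cond_law_version M \<eta> K Q \<longleftrightarrow>
     Q \<in> measurable (Pi\<^sub>M UNIV (\<lambda>_. borel)) (prob_algebra borel) \<and>
     (\<forall>\<xi>\<in>past_seqs K. emeasure (Q \<xi>) K = 1) \<and>
     (\<forall>C\<in>sets (Pi\<^sub>M UNIV (\<lambda>_. borel)). \<forall>A\<in>sets borel.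
        emeasure M {\<omega>\<in>space M. past \<eta> \<omega> \<in> C \<and> \<eta> 1 \<omega> \<in> A} =
        (\<integral>\<^sup>+\<omega>. indicator C (past \<eta> \<omega>) * emeasure (Q (past \<eta> \<omega>)) A \<partial>M))"

text \<open>Concatenation \<open>(\<xi>, y 1, \<dots>, y m)\<close>, re-indexed so that \<open>y m\<close> is the entry with index 0.\<close>

definition append_past :: "(nat \<Rightarrow> 'a) \<Rightarrow> nat \<Rightarrow> (nat \<Rightarrow> 'a) \<Rightarrow> nat \<Rightarrow> 'a" where
  "append_past \<xi> m y n = (if n < m then y (m - n) else \<xi> (n - m))"

primrec cond_law ::
    "((nat \<Rightarrow> 'a::topological_space) \<Rightarrow> 'a measure) \<Rightarrow> (nat \<Rightarrow> 'a) \<Rightarrow> nat \<Rightarrow> (nat \<Rightarrow> 'a) measure" where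
  "cond_law Q \<xi> 0 = return (Pi\<^sub>M {1..0} (\<lambda>_. borel)) (\<lambda>_. undefined)"
| "cond_law Q \<xi> (Suc m) =
     bind (cond_law Q \<xi> m)
       (\<lambda>y. distr (Q (append_past \<xi> m y)) (Pi\<^sub>M {1..Suc m} (\<lambda>_. borel)) (\<lambda>x. y(Suc m := x)))"

definition conditioned_process ::
    "((nat \<Rightarrow> 'a::topological_space) \<Rightarrow> 'a measure) \<Rightarrow> 'a set \<Rightarrow> (nat \<Rightarrow> 'a) \<Rightarrow>
     'n measure \<Rightarrow> (nat \<Rightarrow> 'n \<Rightarrow> 'a) \<Rightarrow> bool" where
  "conditioned_process Q K \<xi> N \<zeta> \<longleftrightarrow>
     prob_space N \<and>
     (\<forall>j\<ge>1. \<zeta> j \<in> borel_measurable N \<and> (AE \<omega> in N. \<zeta> j \<omega> \<in> K)) \<and>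
     (\<forall>m\<ge>1. distr N (Pi\<^sub>M {1..m} (\<lambda>_. borel)) (\<lambda>\<omega>. \<lambda>j\<in>{1..m}. \<zeta> j \<omega>) = cond_law Q \<xi> m)"

definition lipschitz_density ::
    "real \<Rightarrow> 'a::real_normed_vector set \<Rightarrow> ((nat \<Rightarrow> 'a) \<Rightarrow> 'b::real_normed_vector \<Rightarrow> real) \<Rightarrow> bool" where
  "lipschitz_density \<iota> K p \<longleftrightarrow>
     (\<exists>L. \<forall>\<xi>\<in>past_seqs K. \<forall>\<xi>'\<in>past_seqs K. \<forall>x x'.
        \<bar>p \<xi> x - p \<xi>' x'\<bar> \<le> L * (past_dist \<iota> \<xi> \<xi>' + norm (x - x')))"

definition density_cond_finite_dim ::
    "real \<Rightarrow> 'e::real_normed_vector set \<Rightarrow> ((nat \<Rightarrow> 'e) \<Rightarrow> 'e measure) \<Rightarrow> 'e set \<Rightarrow> bool" where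
  "density_cond_finite_dim \<iota> K Q B \<longleftrightarrow>
     (\<exists>p :: (nat \<Rightarrow> 'e) \<Rightarrow> 'e \<Rightarrow> real.
        (\<forall>\<xi>\<in>past_seqs K. (\<forall>x. 0 \<le> p \<xi> x) \<and>
           Q \<xi> = density (basis_lebesgue B) (\<lambda>x. ennreal (p \<xi> x))) \<and>
        lipschitz_density \<iota> K p)"

text \<open>The span of \<open>f l\<close> is identified with the real line by the coordinate \<open>ip x (f l)\<close>.
  The limit is taken in \<open>ennreal\<close>, so that a divergent sum counts as infinite.\<close>

definition density_cond_hilbert ::
    "'w measure \<Rightarrow> (int \<Rightarrow> 'w \<Rightarrow> 'e::real_normed_vector) \<Rightarrow> real \<Rightarrow> 'e set \<Rightarrow>
     ((nat \<Rightarrow> 'e) \<Rightarrow> 'e measure) \<Rightarrow> ('e \<Rightarrow> 'e \<Rightarrow> real) \<Rightarrow> (nat \<Rightarrow> 'e) \<Rightarrow> bool" where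
  "density_cond_hilbert M \<eta> \<iota> K Q ip f \<longleftrightarrow>
     (\<exists>(r :: nat \<Rightarrow> real) (\<eta>c :: nat \<Rightarrow> int \<Rightarrow> 'w \<Rightarrow> real).
        (\<forall>l. 0 < r l) \<and> summable r \<and>
        (\<forall>l. stationary_process M (\<eta>c l)) \<and>
        prob_space.indep_vars M (\<lambda>_. Pi\<^sub>M UNIV (\<lambda>_. borel)) (\<lambda>l \<omega> k. \<eta>c l k \<omega>) UNIV \<and>
        (\<forall>l k. AE \<omega> in M. \<bar>\<eta>c l k \<omega>\<bar> \<le> 1) \<and>
        (\<forall>k. AE \<omega> in M. (\<lambda>l. (r l * \<eta>c l k \<omega>) *\<^sub>R f l) sums \<eta> k \<omega>)) \<and>
     (\<exists>p :: nat \<Rightarrow> (nat \<Rightarrow> 'e) \<Rightarrow> real \<Rightarrow> real.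
        (\<forall>l. \<forall>\<xi>\<in>past_seqs K. (\<forall>x. 0 \<le> p l \<xi> x) \<and>
           distr (Q \<xi>) borel (\<lambda>x. ip x (f l)) = density lborel (\<lambda>x. ennreal (p l \<xi> x))) \<and>
        (\<forall>l. lipschitz_density \<iota> K (p l)) \<and>
        (\<forall>\<xi>\<in>past_seqs K. \<forall>\<epsilon>>0. \<exists>\<delta>>0. \<forall>\<xi>'\<in>past_seqs K.
           past_dist \<iota> \<xi>' \<xi> < \<delta> \<longrightarrow>
           (\<Sum>l. \<integral>\<^sup>+x. ennreal \<bar>p l \<xi>' x - p l \<xi> x\<bar> \<partial>lborel) < ennreal \<epsilon>))"

primrec traj ::
    "('h \<times> 'e \<Rightarrow> 'h) \<Rightarrow> (int \<Rightarrow> 'w \<Rightarrow> 'e) \<Rightarrow> ('w \<Rightarrow> 'h) \<Rightarrow> nat \<Rightarrow> 'w \<Rightarrow> 'h" where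
  "traj S \<eta> v 0 \<omega> = v \<omega>"
| "traj S \<eta> v (Suc k) \<omega> = S (traj S \<eta> v k \<omega>, \<eta> (int (Suc k)) \<omega>)"

text \<open>The library's \<open>indep_var\<close> forces both variables to have the same value type, hence
  the formulation by the generated \<open>\<sigma>\<close>-algebras.\<close>

definition indep_of_future ::
    "'w measure \<Rightarrow> (int \<Rightarrow> 'w \<Rightarrow> 'e::topological_space) \<Rightarrow> ('w \<Rightarrow> 'h::topological_space) \<Rightarrow> bool" where
  "indep_of_future M \<eta> v \<longleftrightarrow>
     prob_space.indep_set M
       (sets (vimage_algebra (space M) v borel))
       (sets (vimage_algebra (space M) (\<lambda>\<omega>. \<lambda>k\<in>{1..}. \<eta> k \<omega>) (Pi\<^sub>M {1..} (\<lambda>_. borel))))"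

end

theory Submission
  imports Defs
begin

text \<open>Consider the Markov operator of the pair (state, past). Two pasts are compared only when they
  differ by elements of a finite-dimensional space, spanned by \<open>B\<close>. The one-step law of the noise is
  the convolution of a law on \<open>span B\<close> with a Lipschitz density and a law that is the same for both
  pasts. Since the \<open>\<eta>\<close>-derivative of \<open>S\<close> has dense image and takes values in a compactly embedded space,
  finitely many directions in \<open>span B\<close> suffice to shift the noise of one of two nearby trajectories such that
  they approach each other by a fixed factor. Such a shift costs a total variation of the order of
  the distance, so that the operator contracts a truncated Lipschitz seminorm at small distances.
  By (\<open>\<eta>2\<close>) and (S1) two trajectories come close with a probability bounded from below, which yields the
  contraction at all distances. The couplings are never constructed as joint laws: all estimates
  concern the operator applied to test functions.

  In the Hilbert space case \<open>B\<close> consists of the first \<open>n\<close> basis vectors, and the convolution structure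
  follows from the independence of the coordinate processes by disintegration.
  Finally, stationarity turns the contraction for equal pasts into convergence of the laws.\<close>

section \<open>Separability\<close>

text \<open>The noise has memory, so contraction is sought for pairs of a state and a past, and
  arbitrary pasts would differ in infinitely many coordinates. Both trajectories start from the same
  past, however, and controls only move coordinates in \<open>span B\<close>; the pasts never differ
  elsewhere, and the law of the remaining component is shared exactly. A control stays in the past
  after it has acted. Therefore the past carries a small weight \<open>A\<close> in the distance,
  while its older entries fade by \<open>1 / \<iota>\<close> per step. Steering leaves a quarter of
  the state difference, the weighted control adds at most another quarter, and the loss in total
  variation, proportional to the distance, is small in units of \<open>\<delta>\<close>. A far pair
  comes within \<open>\<delta> / 2\<close> with probability at least \<open>\<epsilon>^3\<close>:
  one factor for the shared component, one for each of the two components in \<open>span B\<close>.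
  The convolution structure holds for almost every past, whereas operator estimates are pointwise
  and iterated; hence all is done on a set \<open>G\<close> of pasts of full measure in which almost
  every continuation remains.\<close>

text \<open>The types of states and noises are separable by the hypotheses only. A predicate
  replaces the class of second countable spaces, on which the library's results on measurability
  of sums and continuous functions of two variables rely.\<close>

definition second_countable_type :: "'a::topological_space itself \<Rightarrow> bool" where
  "second_countable_type _ \<longleftrightarrow> (\<exists>B::'a set set. countable B \<and> topological_basis B)"

lemma second_countable_typeI_dense:
  fixes D :: "'a::metric_space set"
  assumes "countable D" "closure D = UNIV"
  shows "second_countable_type TYPE('a)"
proof -
  let ?B = "(\<lambda>(x, n). ball x (inverse (real (Suc n)))) ` (D \<times> UNIV)"
  have "countable ?B"
    using assms(1) by auto
  moreover have "topological_basis ?B"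
  proof (rule topological_basisI)
    fix O' and x :: 'a assume "open O'" "x \<in> O'"
    then obtain e where e: "e > 0" "ball x e \<subseteq> O'"
      by (auto simp: open_contains_ball)
    then obtain n where n: "inverse (real (Suc n)) < e / 2"
      using reals_Archimedean[of "e/2"] by auto
    obtain d where d: "d \<in> D" "dist d x < inverse (real (Suc n))"
      using assms(2) closure_approachable[of x D]
      by (metis UNIV_I inverse_positive_iff_positive of_nat_0_less_iff zero_less_Suc)
    have "ball d (inverse (real (Suc n))) \<subseteq> O'"
    proof
      fix y assume "y \<in> ball d (inverse (real (Suc n)))"
      then have "dist x y < e"
        using d n dist_triangle[of x y d] by (simp add: dist_commute)
      then show "y \<in> O'" using e by auto
    qed
    then show "\<exists>B'\<in>?B. x \<in> B' \<and> B' \<subseteq> O'"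
      using d by (intro bexI[of _ "ball d (inverse (real (Suc n)))"]) auto
  qed auto
  ultimately show ?thesis
    unfolding second_countable_type_def by blast
qed

text \<open>Rectangles over two countable bases form a countable basis of the product, hence
  generate its Borel sigma-algebra; componentwise measurability then suffices.\<close>

lemma borel_measurable_continuous_Pair':
  fixes f :: "'a \<Rightarrow> 'b::topological_space" and g :: "'a \<Rightarrow> 'c::topological_space"
    and H :: "'b \<times> 'c \<Rightarrow> 'd::topological_space"
  assumes sc: "second_countable_type TYPE('b)" "second_countable_type TYPE('c)"
  assumes f [measurable]: "f \<in> borel_measurable M" and g [measurable]: "g \<in> borel_measurable M"
  assumes H: "continuous_on UNIV H"
  shows "(\<lambda>x. H (f x, g x)) \<in> borel_measurable M"
proof -
  obtain B :: "'b set set" where B: "countable B" "topological_basis B"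
    using sc(1) unfolding second_countable_type_def by auto
  obtain C :: "'c set set" where C: "countable C" "topological_basis C"
    using sc(2) unfolding second_countable_type_def by auto
  let ?P = "(\<lambda>(b, c). b \<times> c) ` (B \<times> C)"
  have borel: "borel = sigma UNIV ?P"
    by (rule borel_eq_countable_basis) (use B C in \<open>auto intro!: topological_basis_prod\<close>)
  have "(\<lambda>x. (f x, g x)) \<in> measurable M borel"
    unfolding borel
  proof (rule measurable_measure_of)
    fix S assume "S \<in> ?P"
    then obtain b c where "b \<in> B" "c \<in> C" and S: "S = b \<times> c" by auto
    then have "open b" "open c"
      using B C by (auto intro: topological_basis_open)
    then have [measurable]: "b \<in> sets borel" "c \<in> sets borel" by auto
    have "{x\<in>space M. f x \<in> b \<and> g x \<in> c} \<in> sets M" by measurable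
    also have "{x\<in>space M. f x \<in> b \<and> g x \<in> c} = (\<lambda>x. (f x, g x)) -` S \<inter> space M"
      by (auto simp: S)
    finally show "(\<lambda>x. (f x, g x)) -` S \<inter> space M \<in> sets M" .
  qed auto
  from measurable_compose[OF this borel_measurable_continuous_onI[OF H]] show ?thesis .
qed

text \<open>Finite intersections of basis sets. Countability is the point: identities of two laws
  that hold almost surely for each set of the generator then hold almost surely for all of them at
  once.\<close>

lemma countable_Int_stable_generator_borel:
  assumes "second_countable_type TYPE('a)"
  obtains G :: "'a::topological_space set set" where "countable G" "Int_stable G" "UNIV \<in> G"
    "sets (borel :: 'a measure) = sigma_sets UNIV G"
proof -
  obtain B :: "'a set set" where B: "countable B" "topological_basis B"
    using assms unfolding second_countable_type_def by auto
  let ?G = "(\<lambda>F. \<Inter>F) ` {F. finite F \<and> F \<subseteq> B}"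
  have "countable ?G"
    using B(1) by (auto intro: countable_Collect_finite_subset)
  moreover have "Int_stable ?G"
  proof (rule Int_stableI)
    fix a b assume "a \<in> ?G" "b \<in> ?G"
    then obtain F1 F2 where "a = \<Inter>F1" "b = \<Inter>F2" "finite F1" "finite F2" "F1 \<subseteq> B" "F2 \<subseteq> B"
      by auto
    then show "a \<inter> b \<in> ?G"
      by (intro image_eqI[of _ _ "F1 \<union> F2"]) auto
  qed
  moreover have "UNIV \<in> ?G"
    by (rule image_eqI[of _ _ "{}"]) auto
  moreover have "sets (borel :: 'a measure) = sigma_sets UNIV ?G"
  proof -
    have 1: "sets (borel::'a measure) = sigma_sets UNIV B"
      by (simp add: borel_eq_countable_basis[OF B])
    show ?thesis
      unfolding 1
    proof (rule sigma_sets_eqI)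
      fix a assume "a \<in> B"
      then show "a \<in> sigma_sets UNIV ?G"
        by (intro sigma_sets.Basic image_eqI[of _ _ "{a}"]) auto
    next
      fix b assume "b \<in> ?G"
      then obtain F where F: "b = \<Inter>F" "finite F" "F \<subseteq> B" by auto
      have "\<Inter>F \<in> sets borel"
        using F B by (intro borel_open open_Inter) (auto intro: topological_basis_open)
      then show "b \<in> sigma_sets UNIV B" using F 1 by simp
    qed
  qed
  ultimately show ?thesis using that by blast
qed

text \<open>The complement of the support is the union of the basis sets of measure zero, and these
  are countably many.\<close>

lemma msupport_full_measure:
  fixes \<mu> :: "'a::topological_space measure"
  assumes "second_countable_type TYPE('a)" "sets \<mu> = sets borel"
  shows "closed (msupport \<mu>)" "AE x in \<mu>. x \<in> msupport \<mu>"
proof -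
  obtain B :: "'a set set" where B: "countable B" "topological_basis B"
    using assms unfolding second_countable_type_def by auto
  let ?N = "\<Union>{U\<in>B. emeasure \<mu> U = 0}"
  have N: "- msupport \<mu> = ?N"
  proof (intro equalityI subsetI)
    fix x assume "x \<in> - msupport \<mu>"
    then obtain U where U: "open U" "x \<in> U" "emeasure \<mu> U = 0"
      unfolding msupport_def by auto
    then obtain V where V: "V \<in> B" "x \<in> V" "V \<subseteq> U"
      using B(2) topological_basisE by metis
    then have "emeasure \<mu> V \<le> emeasure \<mu> U"
      using U assms(2) by (intro emeasure_mono) auto
    then show "x \<in> ?N" using U V by auto
  next
    fix x assume "x \<in> ?N"
    then obtain U where U: "U \<in> B" "x \<in> U" "emeasure \<mu> U = 0" by auto
    then show "x \<in> - msupport \<mu>"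
      using topological_basis_open[OF B(2)] unfolding msupport_def by auto
  qed
  have "open ?N"
    using topological_basis_open[OF B(2)] by auto
  then show "closed (msupport \<mu>)"
    by (simp add: closed_def N)
  have "?N \<in> null_sets \<mu>"
    using B topological_basis_open[OF B(2)] assms(2)
    by (intro null_sets_UN'[of _ id, simplified]) (auto intro: countable_subset[OF _ B(1)])
  then show "AE x in \<mu>. x \<in> msupport \<mu>"
    by (rule AE_I') (use N in auto)
qed

text \<open>Meant for finite linear combinations of a fixed sequence, which depend continuously on
  their coefficients: the coefficient space \<open>nat \<Rightarrow> real\<close> has a countable
  dense set, whose image is dense in the range.\<close>

lemma countable_dense_image_PiE:
  fixes g :: "(nat \<Rightarrow> real) \<Rightarrow> 'a::metric_space"
  assumes "continuous_on UNIV g"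
  obtains D where "countable D" "D \<subseteq> range g" "range g \<subseteq> closure D"
proof -
  obtain D0 :: "(nat \<Rightarrow> real) set" where D0: "countable D0" "closure D0 = UNIV"
  proof -
    obtain D0 :: "(nat \<Rightarrow> real) set"
      where D0: "countable D0" "\<And>X. open X \<Longrightarrow> X \<noteq> {} \<Longrightarrow> \<exists>d\<in>D0. d \<in> X"
      by (rule countable_dense_setE) blast
    have "x \<in> closure D0" for x
      unfolding closure_iff_nhds_not_empty using D0(2) by blast
    then show ?thesis using D0(1) that by blast
  qed
  have "g ` closure D0 \<subseteq> closure (g ` D0)"
    by (rule image_closure_subset) (use D0 assms in \<open>auto intro: closure_subset[THEN subsetD]\<close>)
  then show ?thesis
    using D0 by (intro that[of "g ` D0"]) auto
qed

text \<open>The algebraic span is exhausted by the combinations of the first \<open>n\<close>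
  vectors, each family being a continuous image of the coefficient space.\<close>

lemma second_countable_type_onb:
  fixes f :: "nat \<Rightarrow> 'a::real_normed_vector"
  assumes "closure (span (range f)) = UNIV"
  shows "second_countable_type TYPE('a)"
proof -
  define g where "g n c = (\<Sum>i<n. c i *\<^sub>R f i)" for n and c :: "nat \<Rightarrow> real"
  have "continuous_on UNIV (g n)" for n
    unfolding g_def by (intro continuous_intros continuous_on_product_coordinates)
  then have "\<exists>D. countable D \<and> range (g n) \<subseteq> closure D" for n
    by (metis countable_dense_image_PiE)
  then obtain D where D: "\<And>n. countable (D n)" "\<And>n. range (g n) \<subseteq> closure (D n)"
    by metis
  have "span (range f) \<subseteq> (\<Union>n. range (g n))"
  proof
    fix x assume "x \<in> span (range f)"
    then obtain t r where t: "finite t" "t \<subseteq> range f" "x = (\<Sum>a\<in>t. r a *\<^sub>R a)"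
      unfolding span_explicit by auto
    then obtain T where T: "t = f ` T" "inj_on f T"
      unfolding subset_image_inj by auto
    have "finite T"
      using t(1) T finite_imageD by blast
    then obtain n where n: "T \<subseteq> {..<n}"
      using finite_nat_bounded by metis
    have "x = (\<Sum>i\<in>T. r (f i) *\<^sub>R f i)"
      using T t by (simp add: sum.reindex)
    also have "\<dots> = g n (\<lambda>i. if i \<in> T then r (f i) else 0)"
      unfolding g_def using n \<open>finite T\<close> by (intro sum.mono_neutral_cong_left) auto
    finally show "x \<in> (\<Union>n. range (g n))" by auto
  qed
  also have "\<dots> \<subseteq> closure (\<Union>n. D n)"
    using D(2) closure_mono[of "D _" "\<Union>n. D n"] by blast
  finally have "closure (\<Union>n. D n) = UNIV"
    using assms by (metis closure_closure closure_mono top.extremum_uniqueI)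
  then show ?thesis
    using D(1) by (intro second_countable_typeI_dense[of "\<Union>n. D n"]) auto
qed

lemma second_countable_type_finite_basis:
  fixes B :: "'a::real_normed_vector set"
  assumes "is_finite_basis B"
  shows "second_countable_type TYPE('a)"
proof (cases "B = {}")
  case True
  then have "closure {0::'a} = UNIV" using assms by (simp add: is_finite_basis_def)
  then show ?thesis by (rule second_countable_typeI_dense[rotated]) simp
next
  case False
  \<comment> \<open>The finite set is enumerated with repetitions, which reduces the claim to that
    of a sequence with dense span.\<close>
  have "countable B"
    using assms by (auto simp: is_finite_basis_def intro: countable_finite)
  with False have "B = range (from_nat_into B)"
    by (simp add: range_from_nat_into)
  then show ?thesis
    using assms second_countable_type_onb[of "from_nat_into B"] by (simp add: is_finite_basis_def)
qed

text \<open>Separability of the state space comes from the smoothing hypothesis: images of balls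
  under a compact embedding are totally bounded, their finite nets form a countable set, and
  countably many balls exhaust the dense range.\<close>

lemma second_countable_type_compact_dense_embedding:
  fixes J :: "'v::real_normed_vector \<Rightarrow> 'h::real_normed_vector"
  assumes "compact_dense_embedding J"
  shows "second_countable_type TYPE('h)"
proof -
  have "\<exists>D. countable D \<and> J ` ball 0 (real n) \<subseteq> closure D" for n
  proof -
    have c: "compact (closure (J ` ball 0 (real n)))"
      using assms unfolding compact_dense_embedding_def by blast
    have "\<exists>k. finite k \<and> closure (J ` ball 0 (real n)) \<subseteq> (\<Union>x\<in>k. ball x (inverse (real (Suc m))))" for m
      using c[unfolded compact_eq_totally_bounded] by simp
    then obtain k where k: "\<And>m. finite (k m)"
      "\<And>m. closure (J ` ball 0 (real n)) \<subseteq> (\<Union>x\<in>k m. ball x (inverse (real (Suc m))))"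
      by metis
    have "J ` ball 0 (real n) \<subseteq> closure (\<Union>m. k m)"
    proof
      fix x assume "x \<in> J ` ball 0 (real n)"
      then have x: "x \<in> closure (J ` ball 0 (real n))" by (rule closure_subset[THEN subsetD])
      show "x \<in> closure (\<Union>m. k m)"
        unfolding closure_approachable
      proof (intro allI impI)
        fix e :: real assume "e > 0"
        then obtain m where m: "inverse (real (Suc m)) < e" using reals_Archimedean by blast
        obtain y where "y \<in> k m" "dist y x < inverse (real (Suc m))"
          using k(2)[of m] x by (auto simp: subset_eq)
        then show "\<exists>y\<in>\<Union>m. k m. dist y x < e" using m by force
      qed
    qed
    moreover have "countable (\<Union>m. k m)"
      by (rule countable_UN) (use k(1) in \<open>simp_all add: countable_finite\<close>)
    ultimately show ?thesis by blast
  qed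
  then have "\<forall>n::nat. \<exists>D. countable D \<and> J ` ball 0 (real n) \<subseteq> closure D" by (rule allI)
  from choice[OF this] obtain D
    where D': "\<forall>n::nat. countable (D n) \<and> J ` ball 0 (real n) \<subseteq> closure (D n)" ..
  then have D: "countable (D n)" "J ` ball 0 (real n) \<subseteq> closure (D n)" for n
    by simp_all
  have "range J \<subseteq> closure (\<Union>n. D n)"
  proof
    fix y assume "y \<in> range J"
    then obtain x where x: "y = J x" by blast
    obtain n where "norm x < real n" using reals_Archimedean2 by metis
    then have "y \<in> J ` ball 0 (real n)" using x by simp
    then have "y \<in> closure (D n)" by (rule D(2)[THEN subsetD])
    moreover have "closure (D n) \<subseteq> closure (\<Union>n. D n)"
      by (rule closure_mono) auto
    ultimately show "y \<in> closure (\<Union>n. D n)" by (rule subsetD[rotated])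
  qed
  then have "closure (\<Union>n. D n) = UNIV"
    using assms unfolding compact_dense_embedding_def
    by (metis closure_closure closure_mono top.extremum_uniqueI)
  then show ?thesis
    using D(1) by (intro second_countable_typeI_dense[of "\<Union>n. D n"]) auto
qed

section \<open>Weak compactness\<close>

text \<open>Memberships in the sets \<open>U i\<close> become the digits 0 and 1 of a ternary
  expansion, so that the values lie in a scaled Cantor set. Base 3 leaves gaps: all digits after
  position \<open>k\<close> together weigh at most half of the digit at \<open>k\<close>.\<close>

definition ternary_code :: "(nat \<Rightarrow> 'a set) \<Rightarrow> 'a \<Rightarrow> real" where
  "ternary_code U x = (\<Sum>i. indicator (U i) x * (1/3)^i)"

lemma ternary_code_summable: "summable (\<lambda>i. indicator (U i) x * (1/3::real)^i)"
  by (rule summable_comparison_test'[of "\<lambda>i. (1/3::real)^i" 0])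
    (auto simp: indicator_def summable_geometric)

lemma ternary_code_bounds: "0 \<le> ternary_code U x" "ternary_code U x \<le> 3/2"
proof -
  show "0 \<le> ternary_code U x"
    unfolding ternary_code_def by (rule suminf_nonneg[OF ternary_code_summable]) auto
  have "ternary_code U x \<le> (\<Sum>i. (1/3::real)^i)"
    unfolding ternary_code_def
    by (rule suminf_le[OF _ ternary_code_summable summable_geometric]) (auto simp: indicator_def)
  also have "\<dots> = 3/2" by (simp add: suminf_geometric)
  finally show "ternary_code U x \<le> 3/2" .
qed

text \<open>At the first index \<open>k\<close> where the memberships differ the digit contributes
  its full weight \<open>(1/3)^k\<close>, and the tail can cancel at most half of it. Codes closer
  than \<open>(1/3)^n / 2\<close> therefore agree in all digits up to \<open>n\<close>.\<close>

lemma ternary_code_separates: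
  assumes "x \<in> U n" "\<bar>ternary_code U x - ternary_code U y\<bar> < (1/3)^n / 2"
  shows "y \<in> U n"
proof -
  have "\<forall>i\<le>n. x \<in> U i \<longleftrightarrow> y \<in> U i"
  proof (rule ccontr)
    assume "\<not> ?thesis"
    then obtain j where j: "j \<le> n" "(x \<in> U j) \<noteq> (y \<in> U j)" by auto
    define k where "k = (LEAST k. (x \<in> U k) \<noteq> (y \<in> U k))"
    have k: "(x \<in> U k) \<noteq> (y \<in> U k)" unfolding k_def by (rule LeastI[of _ j]) (rule j)
    have kj: "k \<le> j" unfolding k_def by (rule Least_le) (rule j)
    have lt: "(x \<in> U i) = (y \<in> U i)" if "i < k" for i
      using not_less_Least[of i "\<lambda>k. (x \<in> U k) \<noteq> (y \<in> U k)"] that unfolding k_def by blast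
    define d where "d i = (indicator (U i) x - indicator (U i) y) * (1/3::real)^i" for i
    have sd: "summable d"
      unfolding d_def left_diff_distrib by (intro summable_diff ternary_code_summable)
    have "ternary_code U x - ternary_code U y = suminf d"
      unfolding ternary_code_def d_def left_diff_distrib
      by (rule suminf_diff[OF ternary_code_summable ternary_code_summable])
    also have "\<dots> = (\<Sum>i. d (i + Suc k)) + sum d {..<Suc k}"
      by (rule suminf_split_initial_segment[OF sd])
    also have "sum d {..<Suc k} = d k"
      using lt by (auto simp: d_def indicator_def intro!: sum.neutral)
    finally have eq: "ternary_code U x - ternary_code U y = (\<Sum>i. d (i + Suc k)) + d k" .
    have "\<bar>\<Sum>i. d (i + Suc k)\<bar> \<le> (\<Sum>i. (1/3::real)^(i + Suc k))"
    proof (rule order_trans[OF summable_rabs])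
      have le: "\<bar>d (i + Suc k)\<bar> \<le> (1/3)^(i + Suc k)" for i
        by (auto simp: d_def indicator_def)
      have sg: "summable (\<lambda>i. (1/3::real)^(i + Suc k))"
        by (subst summable_iff_shift) (simp add: summable_geometric)
      show sm: "summable (\<lambda>i. \<bar>d (i + Suc k)\<bar>)"
        by (rule summable_comparison_test'[OF sg, of 0]) (use le in auto)
      show "(\<Sum>i. \<bar>d (i + Suc k)\<bar>) \<le> (\<Sum>i. (1/3::real)^(i + Suc k))"
        by (rule suminf_le[OF le sm sg])
    qed
    also have "\<dots> = (\<Sum>i. (1/3::real)^Suc k * (1/3)^i)"
      by (simp only: power_add mult.commute)
    also have "\<dots> = (1/3)^Suc k * (\<Sum>i. (1/3::real)^i)"
      by (rule suminf_mult) (simp add: summable_geometric)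
    also have "\<dots> = (1/3)^k / 2"
      by (simp add: suminf_geometric)
    finally have A: "\<bar>\<Sum>i. d (i + Suc k)\<bar> \<le> (1/3)^k / 2" .
    have "\<bar>d k\<bar> = (1/3)^k" using k by (auto simp: d_def indicator_def)
    then have "\<bar>ternary_code U x - ternary_code U y\<bar> \<ge> (1/3)^k / 2"
      using A eq by linarith
    moreover have "(1/3::real)^n \<le> (1/3)^k"
      using kj j by (intro power_decreasing) auto
    ultimately show False using assms(2) by linarith
  qed
  then show ?thesis using assms(1) by simp
qed

lemma ternary_code_measurable:
  assumes [measurable]: "\<And>i. U i \<in> sets M"
  shows "ternary_code U \<in> borel_measurable M"
proof -
  have "(\<lambda>x. \<Sum>i<n. indicator (U i) x * (1/3::real)^i) \<in> borel_measurable M" for n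
    by measurable
  then show ?thesis
    by (rule borel_measurable_LIMSEQ_real[rotated])
      (use summable_LIMSEQ[OF ternary_code_summable] in \<open>simp add: ternary_code_def\<close>)
qed

text \<open>A compact metric space is coded by reals such that decoding is uniformly continuous; this
  reduces weak compactness on it to Helly's theorem on the line.\<close>

lemma compact_ternary_code:
  fixes X :: "'a::metric_space set"
  assumes X: "compact X" "X \<noteq> {}"
  obtains s :: "'a \<Rightarrow> real" where "s \<in> borel_measurable borel" "\<And>x. 0 \<le> s x" "\<And>x. s x \<le> 3/2"
    "\<And>e. e > 0 \<Longrightarrow> \<exists>d>0. \<forall>x\<in>X. \<forall>y\<in>X. \<bar>s x - s y\<bar> < d \<longrightarrow> dist x y < e"
proof -
  have "\<exists>k. finite k \<and> X \<subseteq> (\<Union>x\<in>k. ball x (inverse (real (Suc m))))" for m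
    using X(1)[unfolded compact_eq_totally_bounded] by simp
  then obtain k where k: "\<And>m. finite (k m)"
    "\<And>m. X \<subseteq> (\<Union>x\<in>k m. ball x (inverse (real (Suc m))))"
    by metis
  \<comment> \<open>All balls of all nets, enumerated below as \<open>U\<close>; the radius tends to
    0 with \<open>m\<close>, so that agreement of long initial strings of digits forces
    closeness.\<close>
  define UU where "UU = (\<lambda>(m, x). ball x (inverse (real (Suc m)))) ` (SIGMA m:UNIV. k m)"
  have "k 0 \<noteq> {}" using k(2)[of 0] X(2) by auto
  then have "UU \<noteq> {}" unfolding UU_def by auto
  have "countable UU"
    unfolding UU_def by (rule countable_image, rule countable_SIGMA) (use k in \<open>simp_all add: countable_finite\<close>)
  define U where "U = from_nat_into UU"
  have rU: "range U = UU"
    unfolding U_def by (rule range_from_nat_into) fact+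
  show thesis
  proof (rule that[of "ternary_code U"])
    have "U i \<in> UU" for i using rU by auto
    moreover have "open u" if "u \<in> UU" for u
      using that unfolding UU_def by auto
    ultimately have "open (U i)" for i by blast
    then show "ternary_code U \<in> borel_measurable borel"
      by (intro ternary_code_measurable) auto
    show "0 \<le> ternary_code U x" "ternary_code U x \<le> 3/2" for x
      by (rule ternary_code_bounds)+
    fix e :: real assume "e > 0"
    then obtain m where m: "inverse (real (Suc m)) < e / 2"
      using reals_Archimedean[of "e/2"] by auto
    have "\<forall>p\<in>k m. \<exists>i. U i = ball p (inverse (real (Suc m)))"
    proof
      fix p assume "p \<in> k m"
      then have "ball p (inverse (real (Suc m))) \<in> UU"
        unfolding UU_def by (intro image_eqI[of _ _ "(m, p)"]) auto
      then show "\<exists>i. U i = ball p (inverse (real (Suc m)))"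
        unfolding rU[symmetric] by auto
    qed
    then obtain i where i: "\<And>p. p \<in> k m \<Longrightarrow> U (i p) = ball p (inverse (real (Suc m)))"
      by metis
    \<comment> \<open>The finitely many balls of the \<open>m\<close>-th net have indices at most
      \<open>n\<close>. If the codes are within \<open>(1/3)^n / 2\<close>, then \<open>y\<close>
      lies in the ball of that net which contains \<open>x\<close>, and the diameter of this ball is
      less than \<open>e\<close>.\<close>
    define n where "n = Max (insert 0 (i ` k m))"
    have n: "i p \<le> n" if "p \<in> k m" for p
      unfolding n_def using that k(1) by (intro Max_ge) auto
    show "\<exists>d>0. \<forall>x\<in>X. \<forall>y\<in>X. \<bar>ternary_code U x - ternary_code U y\<bar> < d \<longrightarrow> dist x y < e"
    proof (intro exI[of _ "(1/3)^n / 2"] conjI ballI impI)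
      fix x y assume xy: "x \<in> X" "y \<in> X" "\<bar>ternary_code U x - ternary_code U y\<bar> < (1/3)^n / 2"
      obtain p where p: "p \<in> k m" "x \<in> ball p (inverse (real (Suc m)))"
        using k(2)[of m] xy(1) by auto
      have "(1/3::real)^n \<le> (1/3)^i p"
        using n[OF p(1)] by (intro power_decreasing) auto
      then have "\<bar>ternary_code U x - ternary_code U y\<bar> < (1/3)^i p / 2"
        using xy(3) by linarith
      then have "y \<in> U (i p)"
        using p i by (intro ternary_code_separates[of x U "i p" y]) auto
      then have "dist p y < e / 2" "dist p x < e / 2"
        using i p m by auto
      then show "dist x y < e"
        using dist_triangle[of x y p] by (simp add: dist_commute)
    qed simp
  qed
qed

text \<open>The code is only measurable, but decoding is uniformly continuous. Hence the laws are
  pushed to the line, a weak limit is taken there, and a test function \<open>f\<close> is tested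
  there after composition with the decoding map. Completeness extends the decoding to the closure
  \<open>C\<close> of the codes, on which the limit is concentrated.\<close>

lemma compact_weakly_convergent_subsequence:
  fixes X :: "'a::complete_space set" and \<mu> :: "nat \<Rightarrow> 'a measure"
  assumes X: "compact X"
    and prob: "\<And>k. prob_space (\<mu> k)" and sets: "\<And>k. sets (\<mu> k) = sets borel"
    and AE_X: "\<And>k. AE x in \<mu> k. x \<in> X"
  obtains \<nu> r where "prob_space \<nu>" "sets \<nu> = sets borel" "AE x in \<nu>. x \<in> X" "strict_mono r"
    "\<And>f :: 'a \<Rightarrow> real. \<And>b. continuous_on UNIV f \<Longrightarrow> (\<And>x. \<bar>f x\<bar> \<le> b) \<Longrightarrow>
       (\<lambda>k. \<integral>x. f x \<partial>\<mu> (r k)) \<longlonglongrightarrow> (\<integral>x. f x \<partial>\<nu>)"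
proof -
  interpret \<mu>: prob_space "\<mu> k" for k by (rule prob)
  note sets[measurable_cong]
  have "X \<noteq> {}"
    using AE_X[of 0] \<mu>.not_empty[of 0] \<mu>.AE_False[of 0] by auto
  then obtain x0 where x0: "x0 \<in> X" by auto
  obtain s :: "'a \<Rightarrow> real" where s [measurable]: "s \<in> borel_measurable borel"
    and sb: "\<And>x. 0 \<le> s x" "\<And>x. s x \<le> 3/2"
    and sc: "\<And>e. e > 0 \<Longrightarrow> \<exists>d>0. \<forall>x\<in>X. \<forall>y\<in>X. \<bar>s x - s y\<bar> < d \<longrightarrow> dist x y < e"
    using compact_ternary_code[OF X \<open>X \<noteq> {}\<close>] by metis
  have inj: "inj_on s X"
  proof (rule inj_onI, rule ccontr)
    fix x y assume "x \<in> X" "y \<in> X" "s x = s y" "x \<noteq> y"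
    then show False using sc[of "dist x y"] by fastforce
  qed
  define h where "h = inv_into X s"
  have hs: "h (s x) = x" if "x \<in> X" for x
    unfolding h_def using inj that by simp
  have "uniformly_continuous_on (s ` X) h"
    unfolding uniformly_continuous_on_def
  proof (intro allI impI)
    fix e :: real assume "e > 0"
    then obtain d where "d > 0" "\<forall>x\<in>X. \<forall>y\<in>X. \<bar>s x - s y\<bar> < d \<longrightarrow> dist x y < e"
      using sc by blast
    then show "\<exists>d>0. \<forall>x\<in>s ` X. \<forall>x'\<in>s ` X. dist x' x < d \<longrightarrow> dist (h x') (h x) < e"
      by (intro exI[of _ d]) (auto simp: hs dist_real_def)
  qed
  then obtain g where g: "uniformly_continuous_on (closure (s ` X)) g"
    and gh: "\<And>x. x \<in> s ` X \<Longrightarrow> h x = g x"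
    using uniformly_continuous_on_extension_on_closure by metis
  define C where "C = closure (s ` X)"
  have C: "closed C" "C \<noteq> {}" and sC: "s x \<in> C" if "x \<in> X" for x
    using \<open>X \<noteq> {}\<close> that closure_subset[of "s ` X"] by (auto simp: C_def)
  have gC: "continuous_on C g"
    unfolding C_def by (rule uniformly_continuous_imp_continuous[OF g])
  have gX: "g ` C \<subseteq> X"
    unfolding C_def
    by (rule image_closure_subset[OF gC[unfolded C_def]])
      (use compact_imp_closed[OF X] hs gh in force)+
  have gs: "g (s x) = x" if "x \<in> X" for x
    using gh[of "s x"] hs that by auto
  have C_ne: "C \<noteq> {}" using sC x0 by auto
  have Ccl: "closed C" unfolding C_def by simp
  define \<nu>0 where "\<nu>0 k = distr (\<mu> k) borel s" for k
  have rd: "real_distribution (\<nu>0 k)" for k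
    unfolding \<nu>0_def by (intro \<mu>.real_distribution_distr) simp
  have "measure (\<nu>0 n) {-1<..2} = 1" for n
  proof -
    have "measure (\<nu>0 n) {-1<..2} = measure (\<mu> n) (s -` {-1<..2} \<inter> space (\<mu> n))"
      unfolding \<nu>0_def by (rule measure_distr) auto
    also have "s -` {-1<..2} \<inter> space (\<mu> n) = space (\<mu> n)"
    proof -
      have "s x \<in> {-1<..2}" for x using sb[of x] by simp
      then show ?thesis by auto
    qed
    finally show ?thesis
      by (simp add: \<mu>.prob_space)
  qed
  \<comment> \<open>All codes lie in one bounded interval, so tightness is immediate.\<close>
  then have "\<exists>a b::real. a < b \<and> (\<forall>n. measure (\<nu>0 n) {a<..b} > 1 - e)" if "e > 0" for e :: real
    using that by (intro exI[of _ "-1"] exI[of _ 2]) simp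
  then have "tight \<nu>0"
    unfolding tight_def using rd by blast
  then obtain r M where r: "strict_mono r" and M: "real_distribution M"
    and weak: "weak_conv_m (\<nu>0 \<circ> r) M"
    using tight_imp_convergent_subsubsequence[of \<nu>0 "\<lambda>x. x"]
    by (auto simp: strict_mono_def comp_def)
  interpret M: real_distribution M by (rule M)
  have conv: "(\<lambda>k. \<integral>x. F (s x) \<partial>\<mu> (r k)) \<longlonglongrightarrow> (\<integral>x. F x \<partial>M)"
    if F: "continuous_on UNIV F" "\<And>x. \<bar>F x\<bar> \<le> b" for F :: "real \<Rightarrow> real" and b
  proof -
    have [measurable]: "F \<in> borel_measurable borel"
      by (rule borel_measurable_continuous_onI[OF F(1)])
    have "(\<lambda>k. integral\<^sup>L ((\<nu>0 \<circ> r) k) F) \<longlonglongrightarrow> integral\<^sup>L M F"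
      by (rule weak_conv_imp_integral_bdd_continuous_conv[of _ _ _ b])
        (use rd weak M F in \<open>auto simp: continuous_on_eq_continuous_at comp_def\<close>)
    moreover have "integral\<^sup>L ((\<nu>0 \<circ> r) k) F = (\<integral>x. F (s x) \<partial>\<mu> (r k))" for k
      unfolding \<nu>0_def by (simp add: integral_distr)
    ultimately show ?thesis by simp
  qed
  have AE_C: "AE x in M. x \<in> C"
  proof -
    \<comment> \<open>A bounded continuous function that vanishes exactly on the closed set
      \<open>C\<close>: its integrals along the sequence are 0, so its integral under the limit is 0
      as well.\<close>
    let ?F = "\<lambda>x. min 1 (infdist x C)"
    have cF: "continuous_on UNIV ?F" by (intro continuous_intros)
    have F01: "\<bar>?F x\<bar> \<le> 1" for x by (simp add: infdist_nonneg)
    have [measurable]: "?F \<in> borel_measurable borel"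
      by (rule borel_measurable_continuous_onI[OF cF])
    have "(\<integral>x. ?F (s x) \<partial>\<mu> k) = 0" for k
    proof -
      have "(\<integral>x. ?F (s x) \<partial>\<mu> k) = (\<integral>x. 0 \<partial>\<mu> k)"
        by (rule integral_cong_AE) (use AE_X[of k] sC in \<open>auto simp: infdist_zero\<close>)
      then show ?thesis by simp
    qed
    then have "(\<integral>x. ?F x \<partial>M) = 0"
      using conv[OF cF F01] by (simp add: LIMSEQ_const_iff)
    moreover have "integrable M ?F"
      by (rule M.integrable_const_bound[of _ 1]) (use F01 in auto)
    ultimately have "AE x in M. ?F x = 0"
      by (subst (asm) integral_nonneg_eq_0_iff_AE) (auto simp: infdist_nonneg)
    then show ?thesis
      by eventually_elim (use Ccl C_ne in \<open>auto simp: in_closed_iff_infdist_zero min_def split: if_splits\<close>)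
  qed
  define G where "G x = (if x \<in> C then g x else x0)" for x
  have [measurable]: "G \<in> borel_measurable borel"
    unfolding G_def by (rule borel_measurable_continuous_on_if) (use Ccl gC in auto)
  show thesis
  proof (rule that[of "distr M borel G" r])
    show "prob_space (distr M borel G)"
      by (rule M.prob_space_distr) simp
    show "AE x in distr M borel G. x \<in> X"
      using compact_imp_closed[OF X] gX x0
      by (subst AE_distr_iff) (auto simp: G_def intro!: AE_I2)
    fix f :: "'a \<Rightarrow> real" and b assume f: "continuous_on UNIV f" "\<And>x. \<bar>f x\<bar> \<le> b"
    have "b \<ge> 0" using f(2)[of undefined] by simp
    have [measurable]: "f \<in> borel_measurable borel"
      by (rule borel_measurable_continuous_onI[OF f(1)])
    have "continuous_on C (\<lambda>x. f (g x))"
      by (rule continuous_on_compose2[OF f(1) gC]) auto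
    \<comment> \<open>Weak convergence asks for a bounded continuous function on the whole line;
      Tietze's theorem extends \<open>f\<close> after decoding, with the same bound
      \<open>b\<close>. The values off \<open>C\<close> do not matter for the limit.\<close>
    then obtain F where F: "continuous_on UNIV F" "\<And>x. x \<in> C \<Longrightarrow> F x = f (g x)"
      "\<And>x. norm (F x) \<le> b"
      using Tietze[of C "\<lambda>x. f (g x)" UNIV b] Ccl f(2) \<open>b \<ge> 0\<close> by auto
    have [measurable]: "F \<in> borel_measurable borel"
      by (rule borel_measurable_continuous_onI[OF F(1)])
    have "(\<integral>x. F (s x) \<partial>\<mu> k) = (\<integral>x. f x \<partial>\<mu> k)" for k
      by (rule integral_cong_AE) (use AE_X[of k] F(2) gs sC in auto)
    moreover have "(\<integral>x. F x \<partial>M) = (\<integral>x. f x \<partial>distr M borel G)"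
    proof (subst integral_distr)
      show "(\<integral>x. F x \<partial>M) = (\<integral>x. f (G x) \<partial>M)"
      proof (rule integral_cong_AE)
        show "AE x in M. F x = f (G x)"
          using AE_C by eventually_elim (simp add: F(2) G_def)
      qed measurable
    qed measurable
    ultimately show "(\<lambda>k. \<integral>x. f x \<partial>\<mu> (r k)) \<longlonglongrightarrow> (\<integral>x. f x \<partial>distr M borel G)"
      using conv[OF F(1), of b] F(3) by simp
  qed (use r in auto)
qed

section \<open>Approximate controllability\<close>

lemma C2_map_bounded_Lipschitz:
  fixes S :: "'a::real_normed_vector \<Rightarrow> 'b::real_normed_vector"
  assumes "C2_map_bounded S"
  obtains L where "L \<ge> 0" "\<And>z z'. norm z \<le> R \<Longrightarrow> norm z' \<le> R \<Longrightarrow> norm (S z - S z') \<le> L * norm (z - z')"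
proof -
  obtain D where D: "\<And>z. (S has_derivative blinfun_apply (D z)) (at z)" "bounded_on_bounded D"
    using assms unfolding C2_map_bounded_def by metis
  have "bounded (D ` cball 0 R)"
    using D(2) unfolding bounded_on_bounded_def by simp
  then obtain L where L: "L > 0" "\<And>z. norm z \<le> R \<Longrightarrow> norm (D z) \<le> L"
    unfolding bounded_pos by auto
  show thesis
  proof (rule that[of L])
    fix z z' :: 'a assume z: "norm z \<le> R" "norm z' \<le> R"
    show "norm (S z - S z') \<le> L * norm (z - z')"
    proof (rule differentiable_bound[of "cball 0 R" S "\<lambda>z. blinfun_apply (D z)"])
      show "(S has_derivative blinfun_apply (D z)) (at z within cball 0 R)" for z
        by (rule has_derivative_at_withinI[OF D(1)])
      show "onorm (blinfun_apply (D z)) \<le> L" if "z \<in> cball 0 R" for z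
        using L that by (simp add: norm_blinfun.rep_eq[symmetric])
    qed (use z in auto)
  qed (use L in auto)
qed

lemma C2_map_bounded_Taylor:
  fixes S :: "'a::real_normed_vector \<Rightarrow> 'b::real_normed_vector"
  assumes "C2_map_bounded S"
  obtains D :: "'a \<Rightarrow> 'a \<Rightarrow>\<^sub>L 'b" and M where "M \<ge> 0"
    "\<And>z. (S has_derivative blinfun_apply (D z)) (at z)"
    "\<And>z z'. norm z \<le> R \<Longrightarrow> norm z' \<le> R \<Longrightarrow> norm (D z - D z') \<le> M * norm (z - z')"
    "\<And>z k. norm z \<le> R \<Longrightarrow> norm (z + k) \<le> R \<Longrightarrow> norm (S (z + k) - S z - D z k) \<le> M * (norm k)\<^sup>2"
proof -
  obtain D :: "'a \<Rightarrow> 'a \<Rightarrow>\<^sub>L 'b" and D2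
    where D: "\<And>z. (S has_derivative blinfun_apply (D z)) (at z)"
    "\<And>z. (D has_derivative blinfun_apply (D2 z)) (at z)" "bounded_on_bounded D2"
    using assms unfolding C2_map_bounded_def by metis
  have "bounded (D2 ` cball 0 R)"
    using D(3) unfolding bounded_on_bounded_def by simp
  then obtain M where M: "M > 0" "\<And>z. norm z \<le> R \<Longrightarrow> norm (D2 z) \<le> M"
    unfolding bounded_pos by auto
  have Dlip: "norm (D z - D z') \<le> M * norm (z - z')" if "norm z \<le> R" "norm z' \<le> R" for z z'
  proof (rule differentiable_bound[of "cball 0 R" D "\<lambda>z. blinfun_apply (D2 z)"])
    show "(D has_derivative blinfun_apply (D2 z)) (at z within cball 0 R)" for z
      by (rule has_derivative_at_withinI[OF D(2)])
    show "onorm (blinfun_apply (D2 z)) \<le> M" if "z \<in> cball 0 R" for z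
      using M that by (simp add: norm_blinfun.rep_eq[symmetric])
  qed (use that in auto)
  show thesis
  proof (rule that[of M D])
    fix z k :: 'a assume z: "norm z \<le> R" "norm (z + k) \<le> R"
    \<comment> \<open>A set that contains the segment from \<open>z\<close> to \<open>z + k\<close>
      and on which the derivative stays within \<open>M * norm k\<close> of its value at
      \<open>z\<close>; linearisation on it turns this into the quadratic remainder.\<close>
    define A where "A = cball 0 R \<inter> cball z (norm k)"
    have "norm (S (z + k) - S z - D z (z + k - z)) \<le> norm (z + k - z) * (M * norm k)"
    proof (rule differentiable_bound_linearization[of z "z + k" A S "\<lambda>z. blinfun_apply (D z)"])
      fix t :: real assume t: "t \<in> {0..1}"
      have "z + t *\<^sub>R k = (1 - t) *\<^sub>R z + t *\<^sub>R (z + k)" by (simp add: algebra_simps)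
      also have "\<dots> \<in> cball 0 R"
        by (rule convexD_alt) (use z t in auto)
      finally have "z + t *\<^sub>R k \<in> cball 0 R" .
      moreover have "norm (t *\<^sub>R k) \<le> norm k"
        using t by (auto intro: mult_left_le_one_le)
      ultimately show "z + t *\<^sub>R (z + k - z) \<in> A"
        by (simp add: A_def dist_norm)
    next
      show "(S has_derivative blinfun_apply (D z)) (at z within A)" for z
        by (rule has_derivative_at_withinI[OF D(1)])
      fix z' assume "z' \<in> A"
      then have "norm (D z' - D z) \<le> M * norm (z' - z)" "norm (z' - z) \<le> norm k"
        using Dlip z by (auto simp: A_def dist_norm norm_minus_commute)
      then have "norm (D z' - D z) \<le> M * norm k"
        using M(1) by (meson dual_order.trans mult_left_mono less_imp_le)
      then show "onorm (blinfun_apply (D z') - blinfun_apply (D z)) \<le> M * norm k"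
        by (simp add: norm_blinfun.rep_eq minus_blinfun.rep_eq fun_diff_def)
    next
      show "z \<in> A" using z by (simp add: A_def)
    qed
    then show "norm (S (z + k) - S z - D z k) \<le> M * (norm k)\<^sup>2"
      by (simp add: power2_eq_square mult.assoc mult.commute mult.left_commute)
  qed (use M Dlip D in auto)
qed

text \<open>The linearised control problem is solved approximately by controls from a finite set: compactness of
  the embedding makes the right-hand sides precompact, and compactness of \<open>X \<times> K\<close> makes the choice uniform.\<close>

lemma approximate_controls:
  fixes S :: "'h::real_normed_vector \<times> 'e::real_normed_vector \<Rightarrow> 'h"
    and J :: "'v::real_normed_vector \<Rightarrow> 'h" and D :: "'h \<times> 'e \<Rightarrow> ('h \<times> 'e) \<Rightarrow>\<^sub>L 'h"
  assumes D: "\<And>z. (S has_derivative blinfun_apply (D z)) (at z)"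
    and Dcont: "continuous_on UNIV D"
    and XK: "compact X" "compact K"
    and J: "compact_dense_embedding J"
    and T: "C1_map T" "\<And>z. S z = J (T z)"
    and dense: "\<And>u y. u \<in> X \<Longrightarrow> y \<in> K \<Longrightarrow>
      closure (range (frechet_derivative (\<lambda>y'. S (u, y')) (at y))) = UNIV"
    and F: "closure F = (UNIV :: 'e set)"
    and "\<sigma> > 0"
  obtains W r where "finite W" "W \<subseteq> F" "r > 0"
    "\<And>u y0 h. u \<in> X \<Longrightarrow> y0 \<in> K \<Longrightarrow> \<exists>w\<in>W. \<forall>y\<in>K. norm (y - y0) < r \<longrightarrow>
       norm (D (u, y) (h, norm h *\<^sub>R w)) \<le> \<sigma> * norm h"
proof -
  have local: "\<exists>W r. finite W \<and> W \<subseteq> F \<and> W \<noteq> {} \<and> r > 0 \<and> (\<forall>h. norm h = 1 \<longrightarrow> (\<exists>w\<in>W. \<forall>z\<in>ball z0 r.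
       norm (D z (h, w)) \<le> \<sigma>))" if z0: "z0 \<in> X \<times> K" for z0
  proof -
    obtain DT :: "'h \<times> 'e \<Rightarrow> ('h \<times> 'e) \<Rightarrow>\<^sub>L 'v"
      where DT: "\<And>z. (T has_derivative blinfun_apply (DT z)) (at z)"
      using T(1) unfolding C1_map_def by auto
    have JL: "bounded_linear J" and Jc: "\<And>A. bounded A \<Longrightarrow> compact (closure (J ` A))"
      using J unfolding compact_dense_embedding_def by auto
    \<comment> \<open>The derivative inherits the factorisation through the compact embedding, so
      the vectors \<open>D z0 (h, 0)\<close> with \<open>norm h \<le> 1\<close> form a precompact
      set and have a finite net.\<close>
    have DJ: "D z k = J (DT z k)" for z k
    proof -
      have "((\<lambda>z. J (T z)) has_derivative (\<lambda>k. J (DT z k))) (at z)"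
        by (rule bounded_linear.has_derivative[OF JL DT])
      moreover have "S = (\<lambda>z. J (T z))" using T(2) by auto
      ultimately show ?thesis
        using has_derivative_unique[OF D[of z]] by (metis (no_types, lifting))
    qed
    have "bounded ((\<lambda>h. DT z0 (h, 0)) ` cball 0 1)"
    proof (rule bounded_linear_image)
      show "bounded_linear (\<lambda>h. blinfun_apply (DT z0) (h, 0))"
        by (intro bounded_linear_intros)
    qed simp
    then have "compact (closure (J ` (\<lambda>h. DT z0 (h, 0)) ` cball 0 1))" by (rule Jc)
    then have "\<exists>P. finite P \<and> closure (J ` (\<lambda>h. DT z0 (h, 0)) ` cball 0 1) \<subseteq> (\<Union>p\<in>P. ball p (\<sigma>/4))"
      using \<open>\<sigma> > 0\<close> by (simp add: compact_eq_totally_bounded)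
    then obtain P where P: "finite P"
      "closure (J ` (\<lambda>h. DT z0 (h, 0)) ` cball 0 1) \<subseteq> (\<Union>p\<in>P. ball p (\<sigma>/4))"
      by auto
    obtain u0 y0 where uy: "z0 = (u0, y0)" "u0 \<in> X" "y0 \<in> K" using z0 by auto
    have fd: "frechet_derivative (\<lambda>y'. S (u0, y')) (at y0) = (\<lambda>k. D z0 (0, k))"
    proof (rule frechet_derivative_at[symmetric])
      have "((\<lambda>y'. (u0, y')) has_derivative (\<lambda>k. (0, k))) (at y0)"
        by (auto intro!: derivative_eq_intros)
      from has_derivative_compose[OF this, of S "blinfun_apply (D z0)"]
      show "((\<lambda>y'. S (u0, y')) has_derivative (\<lambda>k. D z0 (0, k))) (at y0)"
        using D[of z0] uy by simp
    qed
    \<comment> \<open>Each net point is cancelled approximately by a control: first by some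
      direction, since the image is dense, then by one from \<open>F\<close>, since the derivative
      is continuous in the control.\<close>
    have "\<exists>w\<in>F. norm (p + D z0 (0, w)) < \<sigma>/4" for p
    proof -
      have "- p \<in> closure (range (\<lambda>k. D z0 (0, k)))"
        using dense[OF uy(2,3)] fd by simp
      then obtain k where k: "dist (D z0 (0, k)) (- p) < \<sigma>/8"
        unfolding closure_approachable using \<open>\<sigma> > 0\<close> by (metis (no_types, lifting) rangeE zero_less_divide_iff zero_less_numeral)
      have "continuous (at k) (\<lambda>w. D z0 (0, w))"
        by (intro continuous_intros)
      then obtain d where d: "d > 0" "\<And>w. dist w k < d \<Longrightarrow> dist (D z0 (0, w)) (D z0 (0, k)) < \<sigma>/8"
        unfolding continuous_at_eps_delta using \<open>\<sigma> > 0\<close> by (metis zero_less_divide_iff zero_less_numeral)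
      obtain w where w: "w \<in> F" "dist w k < d"
        using F d(1) by (metis UNIV_I closure_approachable)
      have "dist (D z0 (0, w)) (- p) < \<sigma>/4"
        using d(2)[OF w(2)] k dist_triangle[of "D z0 (0, w)" "- p" "D z0 (0, k)"] by simp
      then show ?thesis using w(1) by (auto simp: dist_norm add.commute)
    qed
    then obtain wf where wf: "\<And>p. wf p \<in> F" "\<And>p. norm (p + D z0 (0, wf p)) < \<sigma>/4"
      by metis
    define W where "W = wf ` P"
    have "finite W" using P by (simp add: W_def)
    have "J (DT z0 (0, 0)) \<in> closure (J ` (\<lambda>h. DT z0 (h, 0)) ` cball 0 1)"
      by (rule closure_subset[THEN subsetD]) (auto intro!: image_eqI[of _ _ 0])
    then have "P \<noteq> {}" using P(2) by auto
    \<comment> \<open>\<open>c\<close> bounds the norm of \<open>(h, w)\<close> for unit vectors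
      \<open>h\<close>, so that a change of the derivative by \<open>\<sigma> / (2 * c)\<close>
      costs at most half of \<open>\<sigma>\<close>; the other half is spent on the net and on the
      cancellation.\<close>
    define c where "c = 1 + Max (norm ` W)"
    have c: "1 + norm w \<le> c" if "w \<in> W" for w
      using that \<open>finite W\<close> by (auto simp: c_def)
    have "c > 0" using c \<open>P \<noteq> {}\<close> norm_ge_zero unfolding W_def
      by (smt (verit) ex_in_conv image_eqI)
    have "continuous (at z0) D" using Dcont continuous_on_eq_continuous_at[OF open_UNIV, of D] by blast
    then obtain r where r: "r > 0" "\<And>z. dist z z0 < r \<Longrightarrow> dist (D z) (D z0) < \<sigma> / (2 * c)"
      unfolding continuous_at_eps_delta using \<open>\<sigma> > 0\<close> \<open>c > 0\<close>
      by (metis zero_less_divide_iff zero_less_mult_iff zero_less_numeral)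
    have "\<exists>w\<in>W. \<forall>z\<in>ball z0 r. norm (D z (h, w)) \<le> \<sigma>" if "norm h = 1" for h
    proof -
      have "J (DT z0 (h, 0)) \<in> closure (J ` (\<lambda>h. DT z0 (h, 0)) ` cball 0 1)"
        by (rule closure_subset[THEN subsetD]) (use that in \<open>auto intro!: image_eqI[of _ _ h]\<close>)
      then obtain p where p: "p \<in> P" "dist p (D z0 (h, 0)) < \<sigma>/4"
        using P(2) DJ by auto
      show ?thesis
      proof (intro bexI[of _ "wf p"] ballI)
        fix z assume "z \<in> ball z0 r"
        then have "norm (D z - D z0) \<le> \<sigma> / (2 * c)"
          using r(2)[of z] by (simp add: dist_commute dist_norm norm_minus_commute)
        moreover have "norm (h, wf p) \<le> c"
          using norm_Pair_le[of h "wf p"] that c[of "wf p"] p(1) by (simp add: W_def)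
        ultimately have "norm (D z - D z0) * norm (h, wf p) \<le> \<sigma> / (2 * c) * c"
          using \<open>\<sigma> > 0\<close> \<open>c > 0\<close> by (intro mult_mono) auto
        then have 1: "norm ((D z - D z0) (h, wf p)) \<le> \<sigma> / 2"
          using norm_blinfun[of "D z - D z0" "(h, wf p)"] \<open>c > 0\<close> by simp
        have "D z0 (h, wf p) = D z0 (h, 0) + D z0 (0, wf p)"
          by (simp add: blinfun.add_right[symmetric])
        also have "\<dots> = (D z0 (h, 0) - p) + (p + D z0 (0, wf p))" by simp
        finally have "norm (D z0 (h, wf p)) \<le> norm (D z0 (h, 0) - p) + norm (p + D z0 (0, wf p))"
          by (metis norm_triangle_ineq)
        also have "\<dots> \<le> \<sigma> / 2"
          using p(2) wf(2)[of p] by (simp add: dist_norm norm_minus_commute)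
        finally have 2: "norm (D z0 (h, wf p)) \<le> \<sigma> / 2" .
        have "D z (h, wf p) = (D z - D z0) (h, wf p) + D z0 (h, wf p)"
          by (simp add: blinfun.diff_left)
        then show "norm (D z (h, wf p)) \<le> \<sigma>"
          using 1 2 norm_triangle_ineq[of "(D z - D z0) (h, wf p)" "D z0 (h, wf p)"] by simp
      qed (use p in \<open>simp add: W_def\<close>)
    qed
    then show ?thesis
      using \<open>finite W\<close> r(1) wf(1) \<open>P \<noteq> {}\<close> by (intro exI[of _ W] exI[of _ r]) (auto simp: W_def)
  qed
  then have "\<forall>z0\<in>X \<times> K. \<exists>W r. finite W \<and> W \<subseteq> F \<and> W \<noteq> {} \<and> r > 0 \<and>
      (\<forall>h. norm h = 1 \<longrightarrow> (\<exists>w\<in>W. \<forall>z\<in>ball z0 r. norm (D z (h, w)) \<le> \<sigma>))"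
    by (rule ballI)
  from bchoice[OF this] obtain W where
    W: "\<forall>z0\<in>X \<times> K. \<exists>r. finite (W z0) \<and> W z0 \<subseteq> F \<and> W z0 \<noteq> {} \<and> r > 0 \<and>
      (\<forall>h. norm h = 1 \<longrightarrow> (\<exists>w\<in>W z0. \<forall>z\<in>ball z0 r. norm (D z (h, w)) \<le> \<sigma>))" ..
  from bchoice[OF this] obtain r where
    r: "\<forall>z0\<in>X \<times> K. finite (W z0) \<and> W z0 \<subseteq> F \<and> W z0 \<noteq> {} \<and> r z0 > 0 \<and>
      (\<forall>h. norm h = 1 \<longrightarrow> (\<exists>w\<in>W z0. \<forall>z\<in>ball z0 (r z0). norm (D z (h, w)) \<le> \<sigma>))" ..
  have Wr: "\<And>z. z \<in> X \<times> K \<Longrightarrow> finite (W z)" "\<And>z. z \<in> X \<times> K \<Longrightarrow> W z \<subseteq> F"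
    "\<And>z. z \<in> X \<times> K \<Longrightarrow> W z \<noteq> {}" "\<And>z. z \<in> X \<times> K \<Longrightarrow> r z > (0::real)"
    "\<And>z h. z \<in> X \<times> K \<Longrightarrow> norm h = 1 \<Longrightarrow> \<exists>w\<in>W z. \<forall>z'\<in>ball z (r z). norm (D z' (h, w)) \<le> \<sigma>"
    using r by blast+
  have "compact (X \<times> K)" using XK by (rule compact_Times)
  \<comment> \<open>Half radii leave room in the covering: a base point in
    \<open>ball z (r z / 2)\<close>, with its noise changed by less than \<open>r'\<close>, remains
    in \<open>ball z (r z)\<close>, where one control serves all points.\<close>
  then obtain Z where Z: "Z \<subseteq> X \<times> K" "finite Z" "X \<times> K \<subseteq> (\<Union>z\<in>Z. ball z (r z / 2))"
    using compactE_image[of "X \<times> K" "X \<times> K" "\<lambda>z. ball z (r z / 2)"] Wr(4)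
    by (metis (no_types, lifting) UN_I centre_in_ball half_gt_zero open_ball subsetI)
  \<comment> \<open>\<open>w0\<close> keeps the set of controls nonempty; for \<open>h = 0\<close>
    any control will do, since it is multiplied by \<open>norm h\<close>.\<close>
  obtain w0 where w0: "w0 \<in> F" using F by (metis UNIV_I closure_empty empty_iff equals0I)
  define W' where "W' = insert w0 (\<Union>z\<in>Z. W z)"
  define r' where "r' = Min (insert 1 ((\<lambda>z. r z / 2) ` Z))"
  have r'0: "r' > 0" unfolding r'_def using Z Wr(4) by (subst Min_gr_iff) auto
  have r': "r' \<le> r z / 2" if "z \<in> Z" for z
    unfolding r'_def using Z that by (intro Min_le) auto
  show thesis
  proof (rule that[of W' r'])
    have "finite (W z)" "W z \<subseteq> F" if "z \<in> Z" for z using that Z(1) Wr(1,2) by blast+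
    then show "finite W'" "W' \<subseteq> F" unfolding W'_def using Z(2) w0 by blast+
    fix u y0 and h :: 'h assume uy: "u \<in> X" "y0 \<in> K"
    show "\<exists>w\<in>W'. \<forall>y\<in>K. norm (y - y0) < r' \<longrightarrow> norm (D (u, y) (h, norm h *\<^sub>R w)) \<le> \<sigma> * norm h"
    proof (cases "h = 0")
      case True
      then show ?thesis by (auto simp: W'_def zero_prod_def[symmetric])
    next
      case False
      have "(u, y0) \<in> (\<Union>z\<in>Z. ball z (r z / 2))" using Z(3) uy by blast
      then obtain z where z: "z \<in> Z" "dist z (u, y0) < r z / 2" unfolding UN_iff mem_ball by blast
      have "norm (h /\<^sub>R norm h) = 1" using False by simp
      then obtain w where w: "w \<in> W z" "\<And>z'. z' \<in> ball z (r z) \<Longrightarrow> norm (D z' (h /\<^sub>R norm h, w)) \<le> \<sigma>"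
        using Wr(5)[of z "h /\<^sub>R norm h"] z(1) Z(1) by blast
      show ?thesis
      proof (intro bexI[of _ w] ballI impI)
        fix y assume y: "y \<in> K" "norm (y - y0) < r'"
        have "dist (u, y0) (u, y) < r z / 2"
          using r'[OF z(1)] y(2) by (simp add: dist_Pair_Pair dist_norm norm_minus_commute)
        then have "dist z (u, y) < r z"
          using dist_triangle[of z "(u, y)" "(u, y0)"] z(2) by simp
        then have "norm (D (u, y) (h /\<^sub>R norm h, w)) \<le> \<sigma>" using w(2) by simp
        then have "norm (norm h *\<^sub>R D (u, y) (h /\<^sub>R norm h, w)) \<le> \<sigma> * norm h"
          by (simp add: mult.commute[of \<sigma>] mult_left_mono)
        also have "norm h *\<^sub>R D (u, y) (h /\<^sub>R norm h, w) = D (u, y) (norm h *\<^sub>R (h /\<^sub>R norm h, w))"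
          by (rule blinfun.scaleR_right[symmetric])
        also have "norm h *\<^sub>R (h /\<^sub>R norm h, w) = (h, norm h *\<^sub>R w)" using False by simp
        finally show "norm (D (u, y) (h, norm h *\<^sub>R w)) \<le> \<sigma> * norm h" .
      qed (use w z in \<open>auto simp: W'_def\<close>)
    qed
  qed (rule r'0)
qed

text \<open>Half of \<open>\<sigma>\<close> pays for the linearised control problem and half for the
  Taylor remainder, which is quadratic in \<open>norm (u' - u)\<close> because the control is scaled
  by this norm. One control serves all noises near \<open>y0\<close>, so that it can act as a
  constant shift on a piece of the noise law.\<close>

lemma approximate_steering:
  fixes S :: "'h::real_normed_vector \<times> 'e::real_normed_vector \<Rightarrow> 'h"
    and J :: "'v::real_normed_vector \<Rightarrow> 'h"
  assumes S: "C2_map_bounded S"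
    and XK: "compact X" "compact K"
    and J: "compact_dense_embedding J"
    and T: "C1_map T" "\<And>z. S z = J (T z)"
    and dense: "\<And>u y. u \<in> X \<Longrightarrow> y \<in> K \<Longrightarrow>
      closure (range (frechet_derivative (\<lambda>y'. S (u, y')) (at y))) = UNIV"
    and F: "closure F = (UNIV :: 'e set)"
    and "\<sigma> > 0"
  obtains W r \<delta> where "finite W" "W \<subseteq> F" "r > 0" "\<delta> > 0"
    "\<And>u u' y0. u \<in> X \<Longrightarrow> u' \<in> X \<Longrightarrow> norm (u' - u) < \<delta> \<Longrightarrow> y0 \<in> K \<Longrightarrow> \<exists>w\<in>W. \<forall>y\<in>K. norm (y - y0) < r \<longrightarrow>
       norm (S (u', y + norm (u' - u) *\<^sub>R w) - S (u, y)) \<le> \<sigma> * norm (u' - u)"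
proof -
  obtain D0 D2 where
    "\<And>z. (S has_derivative blinfun_apply (D0 z)) (at z)"
    "\<And>z. (D0 has_derivative blinfun_apply (D2 z)) (at z)"
    using S unfolding C2_map_bounded_def by metis
  note D0 = this
  have D0c: "continuous_on UNIV D0"
    using D0(2) by (meson has_derivative_continuous_on has_derivative_at_withinI)
  have "\<sigma> / 2 > 0" using \<open>\<sigma> > 0\<close> by simp
  then obtain W r where W: "finite W" "W \<subseteq> F" "r > 0"
    "\<And>u y0 h. u \<in> X \<Longrightarrow> y0 \<in> K \<Longrightarrow> \<exists>w\<in>W. \<forall>y\<in>K. norm (y - y0) < r \<longrightarrow>
       norm (D0 (u, y) (h, norm h *\<^sub>R w)) \<le> (\<sigma> / 2) * norm h"
    using approximate_controls[OF D0(1) D0c XK J T dense F, of "\<sigma>/2"] by blast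
  obtain c where c: "c > 0" "\<And>w. w \<in> W \<Longrightarrow> norm w \<le> c"
    using finite_imp_bounded[OF W(1)] unfolding bounded_pos by auto
  have "bounded (X \<times> K)" using XK by (intro bounded_Times compact_imp_bounded)
  then obtain R where R: "R > 0" "\<And>z. z \<in> X \<times> K \<Longrightarrow> norm z \<le> R"
    unfolding bounded_pos by auto
  obtain D M where M: "M \<ge> 0" and DS: "\<And>z. (S has_derivative blinfun_apply (D z)) (at z)"
    and Taylor: "\<And>z k. norm z \<le> R + (1 + c) \<Longrightarrow> norm (z + k) \<le> R + (1 + c) \<Longrightarrow>
      norm (S (z + k) - S z - D z k) \<le> M * (norm k)\<^sup>2"
    using C2_map_bounded_Taylor[OF S] by metis
  have DD: "D z = D0 z" for z
    using has_derivative_unique[OF DS D0(1)] by (simp add: blinfun_apply_inject)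
  \<comment> \<open>The bound 1 keeps \<open>norm k \<le> 1 + c\<close>, hence the points inside the
    ball on which the Taylor estimate was taken; the second bound makes
    \<open>M * (1 + c)^2 * norm h\<close> at most \<open>\<sigma> / 2\<close>.\<close>
  define \<delta> where "\<delta> = min 1 (\<sigma> / (2 * (M + 1) * (1 + c)\<^sup>2))"
  have "2 * (M + 1) * (1 + c)\<^sup>2 > 0" using M c by (simp add: power2_eq_square)
  then have "\<delta> > 0" using \<open>\<sigma> > 0\<close> by (simp add: \<delta>_def)
  show thesis
  proof (rule that[OF W(1-3) \<open>\<delta> > 0\<close>])
    fix u u' y0 assume A: "u \<in> X" "u' \<in> X" "norm (u' - u) < \<delta>" "y0 \<in> K"
    define h where "h = u' - u"
    obtain w where w: "w \<in> W" "\<And>y. y \<in> K \<Longrightarrow> norm (y - y0) < r \<Longrightarrow>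
       norm (D0 (u, y) (h, norm h *\<^sub>R w)) \<le> (\<sigma> / 2) * norm h"
      using W(4)[OF A(1,4)] by blast
    show "\<exists>w\<in>W. \<forall>y\<in>K. norm (y - y0) < r \<longrightarrow>
       norm (S (u', y + norm (u' - u) *\<^sub>R w) - S (u, y)) \<le> \<sigma> * norm (u' - u)"
    proof (intro bexI[OF _ w(1)] ballI impI)
      fix y assume y: "y \<in> K" "norm (y - y0) < r"
      define k where "k = (h, norm h *\<^sub>R w)"
      have hd: "norm h < \<delta>" "norm h \<le> 1" using A(3) by (auto simp: h_def \<delta>_def)
      have nk: "norm k \<le> norm h * (1 + c)"
        using norm_Pair_le[of h "norm h *\<^sub>R w"] mult_left_mono[OF c(2)[OF w(1)], of "norm h"]
        by (simp add: k_def algebra_simps)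
      also have "\<dots> \<le> 1 * (1 + c)" using hd c by (intro mult_right_mono) auto
      finally have nk1: "norm k \<le> 1 + c" by simp
      have nz: "norm (u, y) \<le> R" using R(2)[of "(u, y)"] A y by simp
      have "norm (S ((u, y) + k) - S (u, y) - D (u, y) k) \<le> M * (norm k)\<^sup>2"
        using nz nk1 c norm_triangle_ineq[of "(u, y)" k] by (intro Taylor) auto
      also have "\<dots> \<le> M * (norm h * (1 + c))\<^sup>2"
        using nk M by (intro mult_left_mono power_mono) auto
      also have "\<dots> = (M * (1 + c)\<^sup>2 * norm h) * norm h"
        by (simp add: power2_eq_square algebra_simps)
      also have "\<dots> \<le> (\<sigma> / 2) * norm h"
      proof (rule mult_right_mono)
        have "norm h \<le> \<sigma> / (2 * (M + 1) * (1 + c)\<^sup>2)" using hd by (simp add: \<delta>_def)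
        then have "norm h * (2 * (M + 1) * (1 + c)\<^sup>2) \<le> \<sigma>"
          using \<open>2 * (M + 1) * (1 + c)\<^sup>2 > 0\<close> by (simp add: pos_le_divide_eq)
        moreover have "M * (1 + c)\<^sup>2 * norm h \<le> (M + 1) * (1 + c)\<^sup>2 * norm h"
          by (intro mult_right_mono) auto
        moreover have "norm h * (2 * (M + 1) * (1 + c)\<^sup>2) = 2 * ((M + 1) * (1 + c)\<^sup>2 * norm h)"
          by (simp add: mult_ac)
        ultimately show "M * (1 + c)\<^sup>2 * norm h \<le> \<sigma> / 2" by linarith
      qed simp
      finally have 1: "norm (S ((u, y) + k) - S (u, y) - D (u, y) k) \<le> (\<sigma> / 2) * norm h" .
      have 2: "norm (D (u, y) k) \<le> (\<sigma> / 2) * norm h"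
        using w(2)[OF y] by (simp add: DD k_def)
      have "norm (S ((u, y) + k) - S (u, y)) \<le> \<sigma> * norm h"
        using norm_triangle_ineq[of "S ((u, y) + k) - S (u, y) - D (u, y) k" "D (u, y) k"] 1 2 by simp
      then show "norm (S (u', y + norm (u' - u) *\<^sub>R w) - S (u, y)) \<le> \<sigma> * norm (u' - u)"
        by (simp add: k_def h_def)
    qed
  qed
qed

section \<open>Shifts of densities\<close>

text \<open>Pointwise form of a maximal coupling: the common mass \<open>min a a'\<close> is charged
  with \<open>e\<close>, the excess with \<open>c\<close>. The larger of the two weights is split
  into the smaller one and the excess.\<close>

lemma min_coupling_pointwise:
  fixes x x' a a' c e :: real
  assumes "0 \<le> a" "0 \<le> a'" "0 \<le> c" "0 \<le> e"
    and "a > 0 \<Longrightarrow> \<bar>x\<bar> \<le> c" "a' > 0 \<Longrightarrow> \<bar>x'\<bar> \<le> c" "a > 0 \<Longrightarrow> a' > 0 \<Longrightarrow> \<bar>x - x'\<bar> \<le> e"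
  shows "\<bar>x * a - x' * a'\<bar> \<le> e * min a a' + c * \<bar>a - a'\<bar>"
proof (cases "a \<le> a'")
  case True
  have "\<bar>(x - x') * a\<bar> \<le> e * a"
    using assms True by (cases "a > 0") (auto simp: abs_mult intro: mult_right_mono)
  moreover have "\<bar>x' * (a' - a)\<bar> \<le> c * (a' - a)"
  proof (cases "a' > 0")
    case True
    then show ?thesis using assms(6) \<open>a \<le> a'\<close> by (auto simp: abs_mult intro: mult_right_mono)
  next
    case False
    then have "a' = 0" "a = 0" using assms \<open>a \<le> a'\<close> by auto
    then show ?thesis by simp
  qed
  moreover have "x * a - x' * a' = (x - x') * a - x' * (a' - a)" by (simp add: algebra_simps)
  ultimately show ?thesis using True by (simp add: min_def abs_minus_commute)
next
  case False
  have "\<bar>(x - x') * a'\<bar> \<le> e * a'"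
    using assms False by (cases "a' > 0") (auto simp: abs_mult intro: mult_right_mono)
  moreover have "\<bar>x * (a - a')\<bar> \<le> c * (a - a')"
    using assms False by (cases "a > 0") (auto simp: abs_mult intro: mult_right_mono)
  moreover have "x * a - x' * a' = (x - x') * a' + x * (a - a')" by (simp add: algebra_simps)
  ultimately show ?thesis using False by (simp add: min_def)
qed

text \<open>A coupling of two densities in disguise: the \<open>j\<close>-th pieces are matched after a shift by
  \<open>t j\<close> as far as they overlap, and the rest costs their \<open>L\<^sup>1\<close>-distance. Integrating the
  pointwise bound avoids constructing any joint law.\<close>

lemma shift_coupling_bound:
  fixes \<Lambda> :: "'e::real_normed_vector measure" and \<alpha> \<alpha>' :: "'j \<Rightarrow> 'e \<Rightarrow> real"
  assumes fin: "finite I"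
    and sets[measurable_cong]: "sets \<Lambda> = sets borel"
    and shift: "\<And>j. j \<in> I \<Longrightarrow> distr \<Lambda> borel (\<lambda>a. a + t j) = \<Lambda>"
    and int: "\<And>j. j \<in> I \<Longrightarrow> integrable \<Lambda> (\<alpha> j)" "\<And>j. j \<in> I \<Longrightarrow> integrable \<Lambda> (\<alpha>' j)"
    and nonneg: "\<And>j a. j \<in> I \<Longrightarrow> 0 \<le> \<alpha> j a" "\<And>j a. j \<in> I \<Longrightarrow> 0 \<le> \<alpha>' j a"
    and mass: "(\<Sum>j\<in>I. \<integral>a. \<alpha> j a \<partial>\<Lambda>) = 1" "(\<Sum>j\<in>I. \<integral>a. \<alpha>' j a \<partial>\<Lambda>) = 1"
    and g[measurable]: "g \<in> borel_measurable borel" "g' \<in> borel_measurable borel"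
    and gb: "\<And>a. \<bar>g a\<bar> \<le> b" "\<And>a. \<bar>g' a\<bar> \<le> b"
    and ce: "0 \<le> c" "0 \<le> e"
    and AE1: "\<And>j. j \<in> I \<Longrightarrow> AE a in \<Lambda>. \<alpha> j a > 0 \<longrightarrow> \<bar>g a - m\<bar> \<le> c"
    and AE2: "\<And>j. j \<in> I \<Longrightarrow> AE a in \<Lambda>. \<alpha>' j a > 0 \<longrightarrow> \<bar>g' a - m\<bar> \<le> c"
    and AE3: "\<And>j. j \<in> I \<Longrightarrow> AE a in \<Lambda>. \<alpha> j a > 0 \<longrightarrow> \<alpha>' j (a + t j) > 0 \<longrightarrow> \<bar>g a - g' (a + t j)\<bar> \<le> e"
  shows "\<bar>(\<Sum>j\<in>I. \<integral>a. g a * \<alpha> j a \<partial>\<Lambda>) - (\<Sum>j\<in>I. \<integral>a. g' a * \<alpha>' j a \<partial>\<Lambda>)\<bar>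
    \<le> e + c * (\<Sum>j\<in>I. \<integral>a. \<bar>\<alpha> j a - \<alpha>' j (a + t j)\<bar> \<partial>\<Lambda>)"
proof -
  have plus[measurable]: "(\<lambda>a. a + t j) \<in> borel_measurable borel" for j
    by (intro borel_measurable_continuous_onI continuous_intros)
  have shift_int: "(\<integral>a. F (a + t j) \<partial>\<Lambda>) = (\<integral>a. F a \<partial>\<Lambda>)"
    if "j \<in> I" "F \<in> borel_measurable borel" for j and F :: "'e \<Rightarrow> real"
  proof -
    have "(\<integral>a. F a \<partial>distr \<Lambda> borel (\<lambda>a. a + t j)) = (\<integral>a. F (a + t j) \<partial>\<Lambda>)"
      using that by (intro integral_distr) measurable
    then show ?thesis using shift[OF that(1)] by simp
  qed
  have shift_integrable: "integrable \<Lambda> (\<lambda>a. F (a + t j))"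
    if "j \<in> I" "integrable \<Lambda> F" for j and F :: "'e \<Rightarrow> real"
    using that shift[OF that(1)] by (intro integrable_distr[of "\<lambda>a. a + t j" \<Lambda> borel]) auto
  have bm: "integrable \<Lambda> (\<lambda>a. h a * F a)"
    if "integrable \<Lambda> F" "h \<in> borel_measurable borel" "\<And>a. \<bar>h a\<bar> \<le> b'"
    for h F :: "'e \<Rightarrow> real" and b'
  proof (rule Bochner_Integration.integrable_bound[where f="\<lambda>a. b' * F a"])
    show "integrable \<Lambda> (\<lambda>a. b' * F a)" using that by simp
    show "(\<lambda>a. h a * F a) \<in> borel_measurable \<Lambda>" using that by measurable
    have "\<bar>h a * F a\<bar> \<le> \<bar>b' * F a\<bar>" for a
      using that(3)[of a] by (auto simp: abs_mult intro: mult_right_mono)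
    then show "AE a in \<Lambda>. norm (h a * F a) \<le> norm (b' * F a)" by auto
  qed
  \<comment> \<open>Both families of densities have total mass 1, so the constant \<open>m\<close>
    may be subtracted; on the supports the values are then at most \<open>c\<close> in modulus, and
    unmatched mass costs \<open>c\<close> instead of the crude bound \<open>b\<close>.\<close>
  have gm: "(\<lambda>a. g a - m) \<in> borel_measurable borel" "(\<lambda>a. g' a - m) \<in> borel_measurable borel"
    by measurable
  have gmb: "\<bar>g a - m\<bar> \<le> b + \<bar>m\<bar>" "\<bar>g' a - m\<bar> \<le> b + \<bar>m\<bar>" for a
    using gb(1)[of a] gb(2)[of a] by linarith+
  have piece: "\<bar>(\<integral>a. (g a - m) * \<alpha> j a \<partial>\<Lambda>) - (\<integral>a. (g' a - m) * \<alpha>' j a \<partial>\<Lambda>)\<bar>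
      \<le> e * (\<integral>a. \<alpha> j a \<partial>\<Lambda>) + c * (\<integral>a. \<bar>\<alpha> j a - \<alpha>' j (a + t j)\<bar> \<partial>\<Lambda>)" if j: "j \<in> I" for j
  proof -
    have [measurable]: "\<alpha> j \<in> borel_measurable borel" "\<alpha>' j \<in> borel_measurable borel"
      using int[OF j] borel_measurable_integrable sets measurable_cong_sets by blast+
    have i1: "integrable \<Lambda> (\<lambda>a. (g a - m) * \<alpha> j a)"
      by (rule bm[OF int(1)[OF j] gm(1) gmb(1)])
    have i2: "integrable \<Lambda> (\<lambda>a. (g' (a + t j) - m) * \<alpha>' j (a + t j))"
      by (rule shift_integrable[OF j bm[OF int(2)[OF j] gm(2) gmb(2)]])
    have i3: "integrable \<Lambda> (\<lambda>a. \<alpha>' j (a + t j))" by (rule shift_integrable[OF j int(2)[OF j]])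
    have s: "(\<integral>a. (g' a - m) * \<alpha>' j a \<partial>\<Lambda>) = (\<integral>a. (g' (a + t j) - m) * \<alpha>' j (a + t j) \<partial>\<Lambda>)"
      by (rule shift_int[OF j, symmetric]) measurable
    have i4: "integrable \<Lambda> (\<lambda>a. min (\<alpha> j a) (\<alpha>' j (a + t j)))"
      using int(1)[OF j] i3 by (rule integrable_min)
    have i5: "integrable \<Lambda> (\<lambda>a. \<bar>\<alpha> j a - \<alpha>' j (a + t j)\<bar>)"
      using int(1)[OF j] i3 by (intro integrable_abs Bochner_Integration.integrable_diff)
    \<comment> \<open>Invariance of the measure under the shift carries exceptional null sets
      along.\<close>
    have AE2': "AE a in \<Lambda>. \<alpha>' j (a + t j) > 0 \<longrightarrow> \<bar>g' (a + t j) - m\<bar> \<le> c"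
    proof -
      have "AE a in distr \<Lambda> borel (\<lambda>a. a + t j). \<alpha>' j a > 0 \<longrightarrow> \<bar>g' a - m\<bar> \<le> c"
        unfolding shift[OF j] by (rule AE2[OF j])
      then show ?thesis
        by (subst (asm) AE_distr_iff) measurable
    qed
    have "\<bar>(\<integral>a. (g a - m) * \<alpha> j a \<partial>\<Lambda>) - (\<integral>a. (g' a - m) * \<alpha>' j a \<partial>\<Lambda>)\<bar>
      = \<bar>\<integral>a. (g a - m) * \<alpha> j a - (g' (a + t j) - m) * \<alpha>' j (a + t j) \<partial>\<Lambda>\<bar>"
      using i1 i2 s by simp
    also have "\<dots> \<le> (\<integral>a. \<bar>(g a - m) * \<alpha> j a - (g' (a + t j) - m) * \<alpha>' j (a + t j)\<bar> \<partial>\<Lambda>)"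
      by (rule integral_abs_bound)
    also have "\<dots> \<le> (\<integral>a. e * min (\<alpha> j a) (\<alpha>' j (a + t j)) + c * \<bar>\<alpha> j a - \<alpha>' j (a + t j)\<bar> \<partial>\<Lambda>)"
    proof (rule integral_mono_AE)
      show "integrable \<Lambda> (\<lambda>a. \<bar>(g a - m) * \<alpha> j a - (g' (a + t j) - m) * \<alpha>' j (a + t j)\<bar>)"
        using i1 i2 by (intro integrable_abs Bochner_Integration.integrable_diff)
      show "integrable \<Lambda> (\<lambda>a. e * min (\<alpha> j a) (\<alpha>' j (a + t j)) + c * \<bar>\<alpha> j a - \<alpha>' j (a + t j)\<bar>)"
        using i4 i5 by simp
      show "AE a in \<Lambda>. \<bar>(g a - m) * \<alpha> j a - (g' (a + t j) - m) * \<alpha>' j (a + t j)\<bar> \<le>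
          e * min (\<alpha> j a) (\<alpha>' j (a + t j)) + c * \<bar>\<alpha> j a - \<alpha>' j (a + t j)\<bar>"
        using AE1[OF j] AE2' AE3[OF j]
        by eventually_elim (rule min_coupling_pointwise, use nonneg[OF j] ce in auto)
    qed
    also have "\<dots> = e * (\<integral>a. min (\<alpha> j a) (\<alpha>' j (a + t j)) \<partial>\<Lambda>) + c * (\<integral>a. \<bar>\<alpha> j a - \<alpha>' j (a + t j)\<bar> \<partial>\<Lambda>)"
      using i4 i5 by simp
    \<comment> \<open>The matched mass is at most the mass of the \<open>j\<close>-th piece; summed
      over \<open>j\<close> this gives 1, whence the single \<open>e\<close> in the result.\<close>
    also have "(\<integral>a. min (\<alpha> j a) (\<alpha>' j (a + t j)) \<partial>\<Lambda>) \<le> (\<integral>a. \<alpha> j a \<partial>\<Lambda>)"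
      using i4 int(1)[OF j] by (intro integral_mono) auto
    finally show ?thesis using ce by (simp add: mult_left_mono)
  qed
  have split: "(\<Sum>j\<in>I. \<integral>a. (G a - m) * A j a \<partial>\<Lambda>) = (\<Sum>j\<in>I. \<integral>a. G a * A j a \<partial>\<Lambda>) - m"
    if "\<And>j. j \<in> I \<Longrightarrow> integrable \<Lambda> (A j)" "(\<Sum>j\<in>I. \<integral>a. A j a \<partial>\<Lambda>) = 1" "G \<in> borel_measurable borel"
      "\<And>a. \<bar>G a\<bar> \<le> b" for G and A :: "'j \<Rightarrow> 'e \<Rightarrow> real"
  proof -
    have "(\<integral>a. (G a - m) * A j a \<partial>\<Lambda>) = (\<integral>a. G a * A j a \<partial>\<Lambda>) - m * (\<integral>a. A j a \<partial>\<Lambda>)" if "j \<in> I" for j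
      using bm[OF \<open>\<And>j. j \<in> I \<Longrightarrow> integrable \<Lambda> (A j)\<close>[OF that] \<open>G \<in> _\<close> \<open>\<And>a. \<bar>G a\<bar> \<le> b\<close>]
        \<open>\<And>j. j \<in> I \<Longrightarrow> integrable \<Lambda> (A j)\<close>[OF that]
      by (simp add: left_diff_distrib)
    then show ?thesis
      using that(2) by (simp add: sum_subtractf sum_distrib_left[symmetric])
  qed
  have "\<bar>(\<Sum>j\<in>I. \<integral>a. g a * \<alpha> j a \<partial>\<Lambda>) - (\<Sum>j\<in>I. \<integral>a. g' a * \<alpha>' j a \<partial>\<Lambda>)\<bar>
    = \<bar>\<Sum>j\<in>I. (\<integral>a. (g a - m) * \<alpha> j a \<partial>\<Lambda>) - (\<integral>a. (g' a - m) * \<alpha>' j a \<partial>\<Lambda>)\<bar>"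
    using split[OF int(1) mass(1) g(1) gb(1)] split[OF int(2) mass(2) g(2) gb(2)]
    by (simp add: sum_subtractf)
  also have "\<dots> \<le> (\<Sum>j\<in>I. \<bar>(\<integral>a. (g a - m) * \<alpha> j a \<partial>\<Lambda>) - (\<integral>a. (g' a - m) * \<alpha>' j a \<partial>\<Lambda>)\<bar>)"
    by (rule sum_abs)
  also have "\<dots> \<le> (\<Sum>j\<in>I. e * (\<integral>a. \<alpha> j a \<partial>\<Lambda>) + c * (\<integral>a. \<bar>\<alpha> j a - \<alpha>' j (a + t j)\<bar> \<partial>\<Lambda>))"
    by (rule sum_mono) (rule piece)
  also have "\<dots> = e + c * (\<Sum>j\<in>I. \<integral>a. \<bar>\<alpha> j a - \<alpha>' j (a + t j)\<bar> \<partial>\<Lambda>)"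
    using mass(1) by (simp add: sum.distrib sum_distrib_left[symmetric])
  finally show ?thesis .
qed

lemma Lipschitz_partition_of_unity:
  fixes K :: "'a::metric_space set"
  assumes "compact K" "r > 0"
  obtains Y \<phi> L where "finite Y" "Y \<subseteq> K" "L \<ge> 0"
    "\<And>j y. 0 \<le> \<phi> j y" "\<And>j y. \<phi> j y > 0 \<Longrightarrow> dist y j < r" "\<And>j y. j \<in> Y \<Longrightarrow> \<phi> j y \<le> 1"
    "\<And>y. y \<in> K \<Longrightarrow> (\<Sum>j\<in>Y. \<phi> j y) = 1"
    "\<And>j y y'. \<bar>\<phi> j y - \<phi> j y'\<bar> \<le> L * dist y y'"
    "\<And>j. continuous_on UNIV (\<phi> j)"
proof -
  obtain Y where Y: "Y \<subseteq> K" "finite Y" "K \<subseteq> (\<Union>x\<in>Y. ball x (r/2))"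
    using compactE_image[OF assms(1), of K "\<lambda>x. ball x (r/2)"] assms(2)
    by (metis (no_types, lifting) UN_I centre_in_ball half_gt_zero open_ball subsetI)
  define \<psi> where "\<psi> j y = max 0 (r - dist y j)" for j y :: 'a
  \<comment> \<open>Truncation from below makes the division Lipschitz on the whole space. On
    \<open>K\<close> it is inactive, since a centre at distance less than \<open>r/2\<close> alone
    contributes more than \<open>r/2\<close>; hence the quotients sum to 1 there.\<close>
  define A where "A y = max (r/2) (\<Sum>j\<in>Y. \<psi> j y)" for y
  have \<psi>0: "0 \<le> \<psi> j y" for j y by (simp add: \<psi>_def)
  have A0: "A y \<ge> r/2" for y by (simp add: A_def)
  have A0': "A y > 0" for y using A0[of y] assms(2) by linarith
  have \<psi>L: "\<bar>\<psi> j y - \<psi> j y'\<bar> \<le> dist y y'" for j y y'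
    using dist_triangle[of y j y'] dist_triangle[of y' j y] by (auto simp: \<psi>_def dist_commute)
  have AL: "\<bar>A y - A y'\<bar> \<le> real (card Y) * dist y y'" for y y'
  proof -
    have "\<bar>A y - A y'\<bar> \<le> \<bar>(\<Sum>j\<in>Y. \<psi> j y) - (\<Sum>j\<in>Y. \<psi> j y')\<bar>"
      by (auto simp: A_def)
    also have "\<dots> \<le> (\<Sum>j\<in>Y. \<bar>\<psi> j y - \<psi> j y'\<bar>)"
      by (simp add: sum_subtractf[symmetric] sum_abs)
    also have "\<dots> \<le> (\<Sum>j\<in>Y. dist y y')" by (rule sum_mono) (rule \<psi>L)
    finally show ?thesis by simp
  qed
  define \<phi> where "\<phi> j y = (if j \<in> Y then \<psi> j y / A y else 0)" for j y
  have \<psi>A: "\<psi> j y \<le> A y" if "j \<in> Y" for j y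
    unfolding A_def using Y(2) \<psi>0 that by (intro max.coboundedI2 member_le_sum) auto
  define L where "L = (1 + real (card Y)) / (r/2)"
  have \<phi>L: "\<bar>\<phi> j y - \<phi> j y'\<bar> \<le> L * dist y y'" for j y y'
  proof (cases "j \<in> Y")
    case True
    have "\<psi> j y / A y - \<psi> j y' / A y' = ((\<psi> j y - \<psi> j y') + (\<psi> j y' / A y') * (A y' - A y)) / A y"
      using A0'[of y] A0'[of y'] by (simp add: field_simps)
    also have "\<bar>\<dots>\<bar> \<le> (dist y y' + 1 * (real (card Y) * dist y y')) / A y"
    proof -
      have "\<bar>(\<psi> j y' / A y') * (A y' - A y)\<bar> \<le> 1 * (real (card Y) * dist y y')"
        unfolding abs_mult
        by (rule mult_mono) (use \<psi>A[OF True, of y'] \<psi>0[of j y'] A0'[of y'] AL[of y' y] in \<open>auto simp: dist_commute\<close>)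
      then have "\<bar>(\<psi> j y - \<psi> j y') + (\<psi> j y' / A y') * (A y' - A y)\<bar> \<le> dist y y' + 1 * (real (card Y) * dist y y')"
        using \<psi>L[of j y y'] by linarith
      then show ?thesis
        using A0'[of y] by (simp add: divide_right_mono)
    qed
    also have "\<dots> \<le> (dist y y' + 1 * (real (card Y) * dist y y')) / (r/2)"
      using A0[of y] assms(2) by (intro divide_left_mono) (auto intro: mult_pos_pos A0')
    also have "\<dots> = L * dist y y'" by (simp add: L_def algebra_simps add_divide_distrib)
    finally show ?thesis using True by (simp add: \<phi>_def)
  qed (use assms in \<open>simp add: \<phi>_def L_def\<close>)
  show thesis
  proof (rule that[OF Y(2,1)])
    show "L \<ge> 0" using assms by (simp add: L_def)
    show "0 \<le> \<phi> j y" for j y using \<psi>0[of j y] A0'[of y] by (simp add: \<phi>_def)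
    show "dist y j < r" if "\<phi> j y > 0" for j y
      using that A0'[of y] by (auto simp: \<phi>_def \<psi>_def zero_less_divide_iff split: if_splits)
    show "\<phi> j y \<le> 1" for j y using \<psi>A[of j y] A0'[of y] by (simp add: \<phi>_def)
    show "(\<Sum>j\<in>Y. \<phi> j y) = 1" if "y \<in> K" for y
    proof -
      obtain j where j: "j \<in> Y" "dist j y < r/2" using subsetD[OF Y(3) \<open>y \<in> K\<close>] by auto
      then have "r / 2 \<le> \<psi> j y" by (simp add: \<psi>_def dist_commute max_def)
      also have "\<dots> \<le> (\<Sum>j\<in>Y. \<psi> j y)" using Y(2) j \<psi>0 by (intro member_le_sum) auto
      finally have "A y = (\<Sum>j\<in>Y. \<psi> j y)" by (simp add: A_def)
      then show ?thesis using A0'[of y] by (simp add: \<phi>_def sum_divide_distrib[symmetric])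
    qed
    show "continuous_on UNIV (\<phi> j)" for j
    proof (cases "j \<in> Y")
      case True
      have "\<forall>y\<in>UNIV. A y \<noteq> 0" using A0' by (metis less_irrefl)
      then show ?thesis unfolding \<phi>_def \<psi>_def A_def using True
        by (simp, intro continuous_intros) auto
    qed (simp add: \<phi>_def)
  qed (rule \<phi>L)
qed

section \<open>Lebesgue measure of a basis\<close>

lemma borel_measurable_add':
  fixes f g :: "'a \<Rightarrow> 'e::real_normed_vector"
  assumes "second_countable_type TYPE('e)" "f \<in> borel_measurable M" "g \<in> borel_measurable M"
  shows "(\<lambda>x. f x + g x) \<in> borel_measurable M"
proof -
  have "(\<lambda>x. (\<lambda>z. fst z + snd z) (f x, g x)) \<in> borel_measurable M"
    using assms by (intro borel_measurable_continuous_Pair') (auto intro!: continuous_intros)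
  then show ?thesis by simp
qed

lemma borel_measurable_sum':
  fixes f :: "'i \<Rightarrow> 'a \<Rightarrow> 'e::real_normed_vector"
  assumes "second_countable_type TYPE('e)" "\<And>i. i \<in> I \<Longrightarrow> f i \<in> borel_measurable M"
  shows "(\<lambda>x. \<Sum>i\<in>I. f i x) \<in> borel_measurable M"
  using assms(2)
  by (induction I rule: infinite_finite_induct) (auto intro!: borel_measurable_add'[OF assms(1)])

lemma borel_measurable_scaleR_const:
  fixes e :: "'e::real_normed_vector"
  assumes "f \<in> borel_measurable M"
  shows "(\<lambda>x. f x *\<^sub>R e) \<in> borel_measurable M"
  using assms by (rule measurable_compose) (intro borel_measurable_continuous_onI continuous_intros)

lemma borel_measurable_linear_combination:
  fixes B :: "'e::real_normed_vector set"
  assumes "second_countable_type TYPE('e)"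
  shows "(\<lambda>c. \<Sum>b\<in>B. c b *\<^sub>R b) \<in> borel_measurable (Pi\<^sub>M B (\<lambda>_. lborel))"
proof (rule borel_measurable_sum'[OF assms])
  fix b assume "b \<in> B"
  then have "(\<lambda>c. c b) \<in> measurable (Pi\<^sub>M B (\<lambda>_. lborel)) (lborel :: real measure)"
    by (rule measurable_component_singleton)
  then show "(\<lambda>c. c b *\<^sub>R b) \<in> borel_measurable (Pi\<^sub>M B (\<lambda>_. lborel :: real measure))"
    by (intro borel_measurable_scaleR_const) simp
qed

text \<open>On the compact sup-norm sphere of coefficients the norm of the combination attains its
  minimum, which is positive by independence; homogeneity gives the rest.\<close>

lemma independent_coordinates_bounded:
  fixes B :: "'e::real_normed_vector set"
  assumes "finite B" "independent B"
  obtains C where "C > 0" "\<And>c b. b \<in> B \<Longrightarrow> \<bar>c b\<bar> \<le> C * norm (\<Sum>b\<in>B. c b *\<^sub>R b)"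
proof (cases "B = {}")
  case True
  then show ?thesis by (intro that[of 1]) auto
next
  case False
  define g where "g c = (\<Sum>b\<in>B. c b *\<^sub>R b)" for c :: "'e \<Rightarrow> real"
  have gc: "continuous_on UNIV g"
    unfolding g_def by (intro continuous_intros continuous_on_product_coordinates)
  \<comment> \<open>Coefficients are functions on the whole type; setting them to 0 off
    \<open>B\<close> makes the cube a product of compact sets, to which Tychonoff's theorem
    applies.\<close>
  define Q where "Q = PiE UNIV (\<lambda>b. if b \<in> B then {-1..1} else {0::real})"
  have "compactin (product_topology (\<lambda>_::'e. euclidean :: real topology) UNIV) Q"
    unfolding Q_def by (subst compactin_PiE) (auto simp: compactin_euclidean_iff)
  then have Qc: "compact Q"
    by (simp add: euclidean_product_topology compactin_euclidean_iff)
  define S where "S = (\<Union>b\<in>B. {c. \<bar>c b\<bar> = (1::real)} \<inter> Q)"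
  have "compact ({c. \<bar>c b\<bar> = (1::real)} \<inter> Q)" for b
    by (intro closed_Int_compact Qc closed_Collect_eq continuous_intros continuous_on_product_coordinates)
  then have Sc: "compact S"
    unfolding S_def using assms(1) by (intro compact_UN) auto
  obtain b0 where "b0 \<in> B" using False by auto
  then have "(\<lambda>b. if b = b0 then 1 else 0) \<in> S"
    by (auto simp: S_def Q_def intro!: bexI[of _ b0])
  then have "S \<noteq> {}" by blast
  have "continuous_on S (\<lambda>c. norm (g c))"
    by (intro continuous_intros continuous_on_subset[OF gc]) auto
  then obtain c0 where c0: "c0 \<in> S" "\<And>c. c \<in> S \<Longrightarrow> norm (g c0) \<le> norm (g c)"
    using continuous_attains_inf[OF Sc \<open>S \<noteq> {}\<close>] by metis
  have "g c0 \<noteq> 0"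
  proof
    assume "g c0 = 0"
    then have "\<forall>b\<in>B. c0 b = 0"
      using assms unfolding g_def independent_explicit_finite_subsets by blast
    then show False using c0(1) by (auto simp: S_def)
  qed
  then have n0: "norm (g c0) > 0" by simp
  show thesis
  proof (rule that[of "1 / norm (g c0)"])
    fix c :: "'e \<Rightarrow> real" and b assume b: "b \<in> B"
    define m where "m = Max ((\<lambda>b. \<bar>c b\<bar>) ` B)"
    have bm: "\<bar>c b\<bar> \<le> m" if "b \<in> B" for b
      unfolding m_def using assms(1) that by (intro Max_ge) auto
    obtain b1 where b1: "b1 \<in> B" "\<bar>c b1\<bar> = m"
    proof -
      have "m \<in> (\<lambda>b. \<bar>c b\<bar>) ` B" unfolding m_def using assms(1) False by (intro Max_in) auto
      then show ?thesis using that by auto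
    qed
    show "\<bar>c b\<bar> \<le> 1 / norm (g c0) * norm (\<Sum>b\<in>B. c b *\<^sub>R b)"
    proof (cases "m = 0")
      case True
      then show ?thesis using bm[OF b] by simp
    next
      case False
      then have m: "m > 0" using b1 by auto
      define d where "d b = (if b \<in> B then c b / m else 0)" for b
      have "d \<in> S"
        unfolding S_def
      proof (rule UN_I[OF b1(1)])
        have "- 1 \<le> c b / m \<and> c b / m \<le> 1" if "b \<in> B" for b
          using bm[OF that] m by (simp add: abs_le_iff field_simps)
        then show "d \<in> {c. \<bar>c b1\<bar> = 1} \<inter> Q"
          using b1 m by (auto simp: d_def Q_def abs_divide)
      qed
      then have "norm (g c0) \<le> norm (g d)" by (rule c0(2))
      also have "g d = (1/m) *\<^sub>R g c"
        unfolding g_def scaleR_sum_right by (intro sum.cong) (auto simp: d_def)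
      finally have "m * norm (g c0) \<le> norm (g c)" using m by (simp add: field_simps)
      then have "m \<le> norm (g c) / norm (g c0)" using n0 by (simp add: pos_le_divide_eq)
      then show ?thesis using bm[OF b] by (simp add: g_def)
    qed
  qed (use n0 in simp)
qed

lemma sets_basis_lebesgue [simp, measurable_cong]: "sets (basis_lebesgue B) = sets borel"
  and space_basis_lebesgue [simp]: "space (basis_lebesgue B) = UNIV"
  by (simp_all add: basis_lebesgue_def)

lemma PiM_lborel_translate:
  assumes "finite I"
  shows "distr (Pi\<^sub>M I (\<lambda>_. lborel :: real measure)) (Pi\<^sub>M I (\<lambda>_. lborel)) (\<lambda>c. \<lambda>i\<in>I. c i + s i) =
    Pi\<^sub>M I (\<lambda>_. lborel)"
proof -
  interpret product_sigma_finite "\<lambda>_. lborel :: real measure" ..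
  have meas: "(\<lambda>c. \<lambda>i\<in>I. c i + s i) \<in> measurable (Pi\<^sub>M I (\<lambda>_. lborel :: real measure)) (Pi\<^sub>M I (\<lambda>_. lborel :: real measure))"
    by (intro measurable_restrict) (auto intro!: borel_measurable_add simp: measurable_lborel2)
  show ?thesis
  proof (rule PiM_eqI[OF assms])
    fix A :: "_ \<Rightarrow> real set" assume A: "\<And>i. i \<in> I \<Longrightarrow> A i \<in> sets lborel"
    have "emeasure (distr (Pi\<^sub>M I (\<lambda>_. lborel)) (Pi\<^sub>M I (\<lambda>_. lborel)) (\<lambda>c. \<lambda>i\<in>I. c i + s i)) (Pi\<^sub>E I A)
      = emeasure (Pi\<^sub>M I (\<lambda>_. lborel)) ((\<lambda>c. \<lambda>i\<in>I. c i + s i) -` (Pi\<^sub>E I A) \<inter> space (Pi\<^sub>M I (\<lambda>_. lborel)))"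
      by (rule emeasure_distr[OF meas]) (use A assms in \<open>auto intro!: sets_PiM_I_finite\<close>)
    also have "(\<lambda>c. \<lambda>i\<in>I. c i + s i) -` (Pi\<^sub>E I A) \<inter> space (Pi\<^sub>M I (\<lambda>_. lborel))
      = (\<Pi>\<^sub>E i\<in>I. (\<lambda>x. x + s i) -` A i)"
      by (auto simp: space_PiM PiE_iff extensional_def)
    also have "emeasure (Pi\<^sub>M I (\<lambda>_. lborel)) \<dots> = (\<Prod>i\<in>I. emeasure lborel ((\<lambda>x. x + s i) -` A i))"
      using A by (intro emeasure_PiM assms) (auto intro!: measurable_sets_borel[of _ borel])
    also have "\<dots> = (\<Prod>i\<in>I. emeasure lborel (A i))"
    proof (rule prod.cong[OF refl])
      fix i assume "i \<in> I"
      have "emeasure lborel (A i) = emeasure (distr lborel borel ((+) (s i))) (A i)"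
        by (simp add: lborel_distr_plus)
      also have "\<dots> = emeasure lborel ((+) (s i) -` A i)"
        using A[OF \<open>i \<in> I\<close>] by (subst emeasure_distr) auto
      also have "(+) (s i) -` A i = (\<lambda>x. x + s i) -` A i" by (auto simp: add.commute)
      finally show "emeasure lborel ((\<lambda>x. x + s i) -` A i) = emeasure lborel (A i)" by simp
    qed
    finally show "emeasure (distr (Pi\<^sub>M I (\<lambda>_. lborel)) (Pi\<^sub>M I (\<lambda>_. lborel)) (\<lambda>c. \<lambda>i\<in>I. c i + s i)) (Pi\<^sub>E I A)
      = (\<Prod>i\<in>I. emeasure lborel (A i))" .
  qed simp
qed

text \<open>If \<open>B\<close> does not span the whole space, the measure sits on
  \<open>span B\<close>, and translations within that span act as translations of the coordinates.
  This ties the admissible shifts of the noise to \<open>span B\<close>.\<close>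

lemma basis_lebesgue_translate:
  fixes B :: "'e::real_normed_vector set"
  assumes sc: "second_countable_type TYPE('e)" and B: "finite B" and t: "t \<in> span B"
  shows "distr (basis_lebesgue B) borel (\<lambda>a. a + t) = basis_lebesgue B"
proof -
  obtain s where s: "t = (\<Sum>b\<in>B. s b *\<^sub>R b)"
    using t B by (auto simp: span_finite)
  let ?P = "Pi\<^sub>M B (\<lambda>_. lborel :: real measure)" and ?g = "\<lambda>c. \<Sum>b\<in>B. c b *\<^sub>R b"
  have g: "?g \<in> borel_measurable ?P"
    by (rule borel_measurable_linear_combination[OF sc])
  have plus: "(\<lambda>a. a + t) \<in> borel_measurable borel"
    by (intro borel_measurable_continuous_onI continuous_intros)
  have meas: "(\<lambda>c. \<lambda>i\<in>B. c i + s i) \<in> measurable ?P ?P"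
    by (intro measurable_restrict) (auto intro!: borel_measurable_add simp: measurable_lborel2)
  have "distr (basis_lebesgue B) borel (\<lambda>a. a + t) = distr ?P borel (\<lambda>c. ?g c + t)"
    unfolding basis_lebesgue_def using distr_distr[OF plus g] by (simp add: comp_def)
  also have "(\<lambda>c. ?g c + t) = ?g \<circ> (\<lambda>c. \<lambda>i\<in>B. c i + s i)"
    by (simp add: fun_eq_iff s sum.distrib scaleR_left_distrib)
  also have "distr ?P borel \<dots> = distr (distr ?P ?P (\<lambda>c. \<lambda>i\<in>B. c i + s i)) borel ?g"
    by (rule distr_distr[OF g meas, symmetric])
  also have "\<dots> = basis_lebesgue B"
    unfolding PiM_lborel_translate[OF B] basis_lebesgue_def ..
  finally show ?thesis .
qed

text \<open>A norm ball corresponds to a bounded set of coordinates. Finiteness is what makes a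
  uniform bound on the difference of two densities integrable over a ball.\<close>

lemma basis_lebesgue_cball_finite:
  fixes B :: "'e::real_normed_vector set"
  assumes sc: "second_countable_type TYPE('e)" and B: "finite B" "independent B"
  shows "emeasure (basis_lebesgue B) (cball 0 R) < \<infinity>"
proof -
  interpret product_sigma_finite "\<lambda>_. lborel :: real measure" ..
  let ?P = "Pi\<^sub>M B (\<lambda>_. lborel :: real measure)" and ?g = "\<lambda>c. \<Sum>b\<in>B. c b *\<^sub>R b"
  obtain C where C: "C > 0" "\<And>c b. b \<in> B \<Longrightarrow> \<bar>c b\<bar> \<le> C * norm (?g c)"
    using independent_coordinates_bounded[OF B] by blast
  have "emeasure (basis_lebesgue B) (cball 0 R) = emeasure ?P (?g -` cball 0 R \<inter> space ?P)"
    unfolding basis_lebesgue_def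
    by (rule emeasure_distr[OF borel_measurable_linear_combination[OF sc]]) simp
  also have "\<dots> \<le> emeasure ?P (\<Pi>\<^sub>E b\<in>B. {- (C * R)..C * R})"
  proof (rule emeasure_mono)
    show "?g -` cball 0 R \<inter> space ?P \<subseteq> (\<Pi>\<^sub>E b\<in>B. {- (C * R)..C * R})"
    proof
      fix c assume c: "c \<in> ?g -` cball 0 R \<inter> space ?P"
      have "\<bar>c b\<bar> \<le> C * R" if "b \<in> B" for b
        using order_trans[OF C(2)[OF that, of c] mult_left_mono[of "norm (?g c)" R C]] C(1) c by auto
      then show "c \<in> (\<Pi>\<^sub>E b\<in>B. {- (C * R)..C * R})"
        using c by (auto simp: space_PiM PiE_iff abs_le_iff)
           (metis minus_le_iff)
    qed
  qed (use B in \<open>auto intro!: sets_PiM_I_finite\<close>)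
  also have "\<dots> = (\<Prod>b\<in>B. emeasure lborel {- (C * R)..C * R})"
    by (rule emeasure_PiM) (use B in auto)
  also have "\<dots> < \<infinity>"
    by (auto simp: less_top[symmetric] emeasure_lborel_Icc_eq power_eq_top_ennreal)
  finally show ?thesis .
qed

lemma AE_basis_lebesgue_closed:
  fixes B :: "'e::real_normed_vector set"
  assumes sc: "second_countable_type TYPE('e)" and A: "closed A" "span B \<subseteq> A"
  shows "AE a in basis_lebesgue B. a \<in> A"
proof -
  have "(\<Sum>b\<in>B. c b *\<^sub>R b) \<in> A" for c
    using A(2) by (meson span_base span_scale span_sum subsetD)
  then show ?thesis
    unfolding basis_lebesgue_def using A(1)
    by (subst AE_distr_iff[OF borel_measurable_linear_combination[OF sc]]) auto
qed

section \<open>Chains depending on the past\<close>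

lemma past_dist_summable:
  fixes \<xi> \<xi>' :: "nat \<Rightarrow> 'e::real_normed_vector"
  assumes "bounded K" "\<xi> \<in> past_seqs K" "\<xi>' \<in> past_seqs K" "\<iota> > 1"
  shows "summable (\<lambda>n. norm (\<xi> n - \<xi>' n) / \<iota> ^ n)"
proof -
  obtain R where R: "\<And>y. y \<in> K \<Longrightarrow> norm y \<le> R" using assms(1) unfolding bounded_iff by auto
  show ?thesis
  proof (rule summable_comparison_test'[of "\<lambda>n. (2 * R) * (1 / \<iota>) ^ n" 0])
    show "summable (\<lambda>n. (2 * R) * (1 / \<iota>) ^ n)"
      using assms(4) by (intro summable_mult summable_geometric) simp
    show "norm (norm (\<xi> n - \<xi>' n) / \<iota> ^ n) \<le> 2 * R * (1 / \<iota>) ^ n" for n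
    proof -
      have "norm (\<xi> n) \<le> R" "norm (\<xi>' n) \<le> R" using assms R by (auto simp: past_seqs_def)
      then have "norm (\<xi> n - \<xi>' n) \<le> 2 * R" using norm_triangle_ineq4[of "\<xi> n" "\<xi>' n"] by simp
      then show ?thesis using assms(4) by (simp add: power_divide divide_right_mono)
    qed
  qed
qed

lemma past_dist_nonneg:
  fixes \<xi> \<xi>' :: "nat \<Rightarrow> 'e::real_normed_vector"
  assumes "bounded K" "\<xi> \<in> past_seqs K" "\<xi>' \<in> past_seqs K" "\<iota> > 1"
  shows "0 \<le> past_dist \<iota> \<xi> \<xi>'"
  unfolding past_dist_def using past_dist_summable[OF assms] assms(4) by (intro suminf_nonneg) auto

lemma past_dist_self [simp]: "past_dist \<iota> \<xi> \<xi> = 0"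
  by (simp add: past_dist_def)

text \<open>Splitting off the head of the series. The factor \<open>1 / \<iota>\<close> is the
  source of all contraction in the past variable: old differences can only fade, never be steered
  away.\<close>

lemma past_dist_case_nat:
  fixes \<xi> \<xi>' :: "nat \<Rightarrow> 'e::real_normed_vector"
  assumes "bounded K" "\<xi> \<in> past_seqs K" "\<xi>' \<in> past_seqs K" "\<iota> > 1" "y \<in> K" "y' \<in> K"
  shows "past_dist \<iota> (case_nat y \<xi>) (case_nat y' \<xi>') = norm (y - y') + past_dist \<iota> \<xi> \<xi>' / \<iota>"
proof -
  let ?f = "\<lambda>n. norm (case_nat y \<xi> n - case_nat y' \<xi>' n) / \<iota> ^ n"
  have "case_nat y \<xi> \<in> past_seqs K" "case_nat y' \<xi>' \<in> past_seqs K"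
    using assms by (auto simp: past_seqs_def split: nat.split)
  then have "summable ?f" using assms by (intro past_dist_summable)
  from suminf_split_head[OF this]
  have "past_dist \<iota> (case_nat y \<xi>) (case_nat y' \<xi>') = norm (y - y') + (\<Sum>n. norm (\<xi> n - \<xi>' n) / \<iota> ^ n / \<iota>)"
    by (simp add: past_dist_def mult.commute)
  also have "(\<Sum>n. norm (\<xi> n - \<xi>' n) / \<iota> ^ n / \<iota>) = past_dist \<iota> \<xi> \<xi>' / \<iota>"
    unfolding past_dist_def by (rule suminf_divide[OF past_dist_summable[OF assms(1-4)]])
  finally show ?thesis .
qed

text \<open>Recent entries are small by assumption, and the older ones, bounded by \<open>R\<close>
  only, are damped by \<open>\<iota> ^ n\<close>; the factor \<open>\<iota> / (\<iota> - 1)\<close>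
  is the sum of the geometric series.\<close>

lemma past_dist_le:
  fixes \<xi> \<xi>' :: "nat \<Rightarrow> 'e::real_normed_vector"
  assumes "bounded K" "\<xi> \<in> past_seqs K" "\<xi>' \<in> past_seqs K" "\<iota> > 1"
    and R: "\<And>y. y \<in> K \<Longrightarrow> norm y \<le> R"
    and small: "\<And>i. i < n \<Longrightarrow> norm (\<xi> i) < \<delta>" "\<And>i. i < n \<Longrightarrow> norm (\<xi>' i) < \<delta>" and "\<delta> > 0"
  shows "past_dist \<iota> \<xi> \<xi>' \<le> (2 * \<delta> + 2 * R / \<iota> ^ n) * (\<iota> / (\<iota> - 1))"
proof -
  have i: "1 / \<iota> < 1" "0 < \<iota>" "0 \<le> 1/\<iota>" using assms(4) by auto
  have geo: "(\<Sum>k. (1 / \<iota>) ^ k) = \<iota> / (\<iota> - 1)"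
    using assms(4) by (subst suminf_geometric) (auto simp: field_simps)
  have R0: "0 \<le> R" using R assms(2) norm_ge_zero order_trans unfolding past_seqs_def by blast
  have sh: "summable (\<lambda>k. if k < n then 2 * \<delta> * (1 / \<iota>) ^ k else 2 * R * (1 / \<iota>) ^ k)"
  proof (rule summable_comparison_test'[of "\<lambda>k. (2 * \<delta> + 2 * R) * (1 / \<iota>) ^ k" 0])
    show "summable (\<lambda>k. (2 * \<delta> + 2 * R) * (1 / \<iota>) ^ k)"
      using i by (intro summable_mult summable_geometric) simp
    show "norm (if k < n then 2 * \<delta> * (1 / \<iota>) ^ k else 2 * R * (1 / \<iota>) ^ k)
        \<le> (2 * \<delta> + 2 * R) * (1 / \<iota>) ^ k" for k
      using i R0 \<open>\<delta> > 0\<close> by (auto simp: abs_mult intro!: mult_right_mono)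
  qed
  have sh': "summable (\<lambda>k. if k < n then 2 * \<delta> * (1 / \<iota>) ^ k else 0)"
    by (rule summable_finite[of "{..<n}"]) auto
  have ng: "summable (\<lambda>k. 2 * \<delta> * (1 / \<iota>) ^ k)" using i by (intro summable_mult summable_geometric) simp
  have "past_dist \<iota> \<xi> \<xi>' \<le> (\<Sum>k. if k < n then 2 * \<delta> * (1 / \<iota>) ^ k else 2 * R * (1 / \<iota>) ^ k)"
    unfolding past_dist_def
  proof (rule suminf_le[OF _ past_dist_summable[OF assms(1-4)] sh])
    fix k
    have "norm (\<xi> k - \<xi>' k) \<le> (if k < n then 2 * \<delta> else 2 * R)"
      using norm_triangle_ineq4[of "\<xi> k" "\<xi>' k"] small[of k] R[of "\<xi> k"] R[of "\<xi>' k"] assms(2,3)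
      by (auto simp: past_seqs_def)
    then show "norm (\<xi> k - \<xi>' k) / \<iota> ^ k \<le> (if k < n then 2 * \<delta> * (1 / \<iota>) ^ k else 2 * R * (1 / \<iota>) ^ k)"
      using i by (auto simp: power_divide divide_right_mono split: if_splits)
  qed
  also have "\<dots> = (\<Sum>k. if k + n < n then 2 * \<delta> * (1 / \<iota>) ^ (k + n) else 2 * R * (1 / \<iota>) ^ (k + n))
     + (\<Sum>k<n. if k < n then 2 * \<delta> * (1 / \<iota>) ^ k else 2 * R * (1 / \<iota>) ^ k)"
    by (rule suminf_split_initial_segment[OF sh])
  also have "(\<Sum>k. if k + n < n then 2 * \<delta> * (1 / \<iota>) ^ (k + n) else 2 * R * (1 / \<iota>) ^ (k + n))
    = (\<Sum>k. (2 * R / \<iota> ^ n) * (1 / \<iota>) ^ k)"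
    by (simp add: power_add power_divide mult.commute)
  also have "\<dots> = (2 * R / \<iota> ^ n) * (\<iota> / (\<iota> - 1))"
    unfolding geo[symmetric] using i by (intro suminf_mult summable_geometric) simp
  also have "(\<Sum>k<n. if k < n then 2 * \<delta> * (1 / \<iota>) ^ k else 2 * R * (1 / \<iota>) ^ k) = (\<Sum>k<n. 2 * \<delta> * (1 / \<iota>) ^ k)"
    by (rule sum.cong) auto
  also have "\<dots> \<le> (\<Sum>k. 2 * \<delta> * (1 / \<iota>) ^ k)"
    using \<open>\<delta> > 0\<close> i by (intro sum_le_suminf ng) auto
  also have "\<dots> = 2 * \<delta> * (\<iota> / (\<iota> - 1))"
    unfolding geo[symmetric] using i by (intro suminf_mult summable_geometric) simp
  finally show ?thesis by (simp add: algebra_simps add_divide_distrib)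
qed

text \<open>The independent coupling without a joint law: integrating over one variable and then
  over the other replaces \<open>h a\<close> and \<open>h' a'\<close> by their means, since the
  product separates the variables.\<close>

lemma product_coupling_bound:
  fixes F :: "'a \<Rightarrow> real" and F' :: "'b \<Rightarrow> real"
  assumes "prob_space P" "prob_space P'"
    and meas[measurable]: "F \<in> borel_measurable P" "F' \<in> borel_measurable P'"
      "h \<in> borel_measurable P" "h' \<in> borel_measurable P'"
    and bd: "\<And>a. \<bar>F a\<bar> \<le> b" "\<And>a. \<bar>F' a\<bar> \<le> b" "\<And>a. \<bar>h a\<bar> \<le> 1" "\<And>a. \<bar>h' a\<bar> \<le> 1"
    and AE: "AE a' in P'. AE a in P. \<bar>F a - F' a'\<bar> \<le> c * (1 - s * h a * h' a')"
  shows "\<bar>(\<integral>a. F a \<partial>P) - (\<integral>a. F' a \<partial>P')\<bar> \<le> c * (1 - s * (\<integral>a. h a \<partial>P) * (\<integral>a. h' a \<partial>P'))"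
proof -
  interpret P: prob_space P by fact
  interpret P': prob_space P' by fact
  have i: "integrable P F" "integrable P h" "integrable P' F'" "integrable P' h'"
    using bd by (simp_all add: P.integrable_const_bound[where B=b] P.integrable_const_bound[where B=1]
        P'.integrable_const_bound[where B=b] P'.integrable_const_bound[where B=1])
  have 1: "AE a' in P'. \<bar>(\<integral>a. F a \<partial>P) - F' a'\<bar> \<le> c * (1 - s * (\<integral>a. h a \<partial>P) * h' a')"
    using AE
  proof eventually_elim
    case (elim a')
    have "\<bar>(\<integral>a. F a \<partial>P) - F' a'\<bar> = \<bar>\<integral>a. F a - F' a' \<partial>P\<bar>"
      using i by (simp add: P.prob_space)
    also have "\<dots> \<le> (\<integral>a. \<bar>F a - F' a'\<bar> \<partial>P)" by (rule integral_abs_bound)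
    also have "\<dots> \<le> (\<integral>a. c * (1 - s * h a * h' a') \<partial>P)"
      using i elim by (intro integral_mono_AE) auto
    also have "\<dots> = c * (1 - s * (\<integral>a. h a \<partial>P) * h' a')"
      using i by (simp add: P.prob_space)
    finally show ?case .
  qed
  have "\<bar>(\<integral>a. F a \<partial>P) - (\<integral>a. F' a \<partial>P')\<bar> = \<bar>\<integral>a'. (\<integral>a. F a \<partial>P) - F' a' \<partial>P'\<bar>"
    using i by (simp add: P'.prob_space)
  also have "\<dots> \<le> (\<integral>a'. \<bar>(\<integral>a. F a \<partial>P) - F' a'\<bar> \<partial>P')" by (rule integral_abs_bound)
  also have "\<dots> \<le> (\<integral>a'. c * (1 - s * (\<integral>a. h a \<partial>P) * h' a') \<partial>P')"
    using i 1 by (intro integral_mono_AE) auto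
  also have "\<dots> = c * (1 - s * (\<integral>a. h a \<partial>P) * (\<integral>a. h' a \<partial>P'))"
    using i by (simp add: P'.prob_space)
  finally show ?thesis .
qed

section \<open>Hitting probabilities, runs and the one-step operator\<close>

abbreviation seq_space :: "(nat \<Rightarrow> 'e::topological_space) measure" where
  "seq_space \<equiv> Pi\<^sub>M UNIV (\<lambda>_. borel)"

text \<open>\<open>hit_prob \<kappa> A j \<xi>\<close> is the probability that the past-dependent chain with one-step law \<open>\<kappa>\<close>
  and initial past \<open>\<xi>\<close> has its past in \<open>A\<close> after \<open>j\<close> steps.\<close>

primrec hit_prob :: "((nat \<Rightarrow> 'e) \<Rightarrow> 'e measure) \<Rightarrow> (nat \<Rightarrow> 'e) set \<Rightarrow> nat \<Rightarrow> (nat \<Rightarrow> 'e) \<Rightarrow> real" where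
  "hit_prob \<kappa> A 0 \<xi> = indicator A \<xi>"
| "hit_prob \<kappa> A (Suc j) \<xi> = (\<integral>y. hit_prob \<kappa> A j (case_nat y \<xi>) \<partial>\<kappa> \<xi>)"

text \<open>Pushing \<open>L x\<close> forward by \<open>y \<mapsto> (x, y)\<close> turns the
  parameter-dependent integrand into a fixed one, and integrals of a fixed function depend
  measurably on the measure.\<close>

lemma integral_kernel_measurable:
  fixes f :: "'a \<Rightarrow> 'b \<Rightarrow> real"
  assumes f[measurable]: "(\<lambda>(x, y). f x y) \<in> borel_measurable (M \<Otimes>\<^sub>M N)"
  assumes N: "L \<in> measurable M (prob_algebra N)"
  shows "(\<lambda>x. \<integral>y. f x y \<partial>L x) \<in> borel_measurable M"
proof -
  have N'[measurable]: "L \<in> measurable M (subprob_algebra N)"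
    using N by (rule measurable_prob_algebraD)
  note integral_measurable_subprob_algebra[measurable] measurable_distr2[measurable]
  have "(\<lambda>x. integral\<^sup>L (distr (L x) (M \<Otimes>\<^sub>M N) (\<lambda>y. (x, y))) (\<lambda>(x, y). f x y)) \<in> borel_measurable M"
    by measurable
  then show ?thesis
  proof (rule measurable_cong[THEN iffD1, rotated])
    fix x assume "x \<in> space M"
    then have [measurable_cong]: "sets (L x) = sets N"
      using N' by (rule subprob_measurableD(2)[rotated])
    show "integral\<^sup>L (distr (L x) (M \<Otimes>\<^sub>M N) (\<lambda>y. (x, y))) (\<lambda>(x, y). f x y) = (\<integral>y. f x y \<partial>L x)"
      using \<open>x \<in> space M\<close> by (subst integral_distr) simp_all
  qed
qed

lemma kernel_prob_algebraD:
  assumes "\<kappa> \<in> measurable seq_space (prob_algebra N)"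
  shows "prob_space (\<kappa> \<xi>)" "sets (\<kappa> \<xi>) = sets N"
proof -
  have "\<kappa> \<xi> \<in> space (prob_algebra N)"
    using measurable_space[OF assms, of \<xi>] by (simp add: space_PiM)
  then show "prob_space (\<kappa> \<xi>)" "sets (\<kappa> \<xi>) = sets N" by (simp_all add: space_prob_algebra)
qed

lemma case_nat_measurable1 [measurable]:
  "(\<lambda>y. case_nat y \<xi>) \<in> measurable borel (seq_space :: (nat \<Rightarrow> 'e::topological_space) measure)"
  by (rule measurable_case_nat') (simp_all add: space_PiM)

lemma hit_prob_measurable [measurable]:
  fixes A :: "(nat \<Rightarrow> 'e::topological_space) set"
  assumes \<kappa>[measurable]: "\<kappa> \<in> measurable seq_space (prob_algebra borel)" and A[measurable]: "A \<in> sets seq_space"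
  shows "hit_prob \<kappa> A j \<in> borel_measurable seq_space"
proof (induction j)
  case (Suc j)
  note Suc.IH[measurable]
  have "(\<lambda>\<xi>. \<integral>y. hit_prob \<kappa> A j (case_nat y \<xi>) \<partial>\<kappa> \<xi>) \<in> borel_measurable seq_space"
    by (rule integral_kernel_measurable[OF _ \<kappa>]) measurable
  then show ?case by simp
qed simp

lemma hit_prob_bounds:
  fixes A :: "(nat \<Rightarrow> 'e::topological_space) set"
  assumes \<kappa>[measurable]: "\<kappa> \<in> measurable seq_space (prob_algebra borel)" and A[measurable]: "A \<in> sets seq_space"
  shows "0 \<le> hit_prob \<kappa> A j \<xi>" "hit_prob \<kappa> A j \<xi> \<le> 1"
proof -
  have "0 \<le> hit_prob \<kappa> A j \<xi> \<and> hit_prob \<kappa> A j \<xi> \<le> 1" for \<xi>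
  proof (induction j arbitrary: \<xi>)
    case (Suc j)
    interpret prob_space "\<kappa> \<xi>" by (rule kernel_prob_algebraD[OF \<kappa>])
    note kernel_prob_algebraD(2)[OF \<kappa>, measurable_cong]
    have "integrable (\<kappa> \<xi>) (\<lambda>y. hit_prob \<kappa> A j (case_nat y \<xi>))"
      using Suc.IH by (intro integrable_const_bound[of _ 1]) (auto intro!: AE_I2)
    then have "(\<integral>y. hit_prob \<kappa> A j (case_nat y \<xi>) \<partial>\<kappa> \<xi>) \<le> (\<integral>y. 1 \<partial>\<kappa> \<xi>)"
      using Suc.IH by (intro integral_mono) auto
    then show ?case using Suc.IH by (auto simp: prob_space intro!: integral_nonneg_AE)
  qed (simp add: indicator_def)
  then show "0 \<le> hit_prob \<kappa> A j \<xi>" "hit_prob \<kappa> A j \<xi> \<le> 1" by auto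
qed

text \<open>The newest noise has index 0 and acts last, so the recursion unfolds from the outside.
  Appending a step to the past by \<open>case_nat\<close> is then one more application of
  \<open>S\<close>, as in \<open>run_case_nat\<close>.\<close>

primrec run :: "('h \<times> 'e \<Rightarrow> 'h) \<Rightarrow> nat \<Rightarrow> 'h \<Rightarrow> (nat \<Rightarrow> 'e) \<Rightarrow> 'h" where
  "run S 0 x \<xi> = x"
| "run S (Suc n) x \<xi> = S (run S n x (\<lambda>i. \<xi> (Suc i)), \<xi> 0)"

lemma run_add: "run S (n + k) x \<xi> = run S n (run S k x (\<lambda>i. \<xi> (i + n))) \<xi>"
  by (induction n arbitrary: \<xi>) simp_all

lemma run_case_nat: "run S (Suc n) x (case_nat y \<xi>) = S (run S n x \<xi>, y)"
  by simp

lemma run_in: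
  assumes "\<And>u y. u \<in> X \<Longrightarrow> y \<in> K \<Longrightarrow> S (u, y) \<in> X" "x \<in> X" "\<xi> \<in> past_seqs K"
  shows "run S n x \<xi> \<in> X"
  using assms(3)
proof (induction n arbitrary: \<xi>)
  case (Suc n)
  then have "(\<lambda>i. \<xi> (Suc i)) \<in> past_seqs K" "\<xi> 0 \<in> K" by (auto simp: past_seqs_def)
  then show ?case using Suc.IH assms(1) by simp
qed (use assms in simp)

definition step_op :: "('h \<times> 'e \<Rightarrow> 'h) \<Rightarrow> ((nat \<Rightarrow> 'e) \<Rightarrow> 'e measure) \<Rightarrow> ('h \<times> (nat \<Rightarrow> 'e) \<Rightarrow> real) \<Rightarrow>
    'h \<times> (nat \<Rightarrow> 'e) \<Rightarrow> real" where
  "step_op S Q f = (\<lambda>(u, \<xi>). \<integral>y. f (S (u, y), case_nat y \<xi>) \<partial>Q \<xi>)"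

lemma step_op_measurable:
  fixes S :: "'h::topological_space \<times> 'e::topological_space \<Rightarrow> 'h"
  assumes S[measurable]: "S \<in> measurable (borel \<Otimes>\<^sub>M borel) borel"
    and Q[measurable]: "Q \<in> measurable seq_space (prob_algebra borel)"
    and f[measurable]: "f \<in> borel_measurable (borel \<Otimes>\<^sub>M seq_space)"
  shows "step_op S Q f \<in> borel_measurable (borel \<Otimes>\<^sub>M seq_space)"
proof -
  have "(\<lambda>z. \<integral>y. f (S (fst z, y), case_nat y (snd z)) \<partial>Q (snd z))
      \<in> borel_measurable (borel \<Otimes>\<^sub>M seq_space :: ('h \<times> (nat \<Rightarrow> 'e)) measure)"
    by (rule integral_kernel_measurable[where N=borel]) measurable
  then show ?thesis by (simp add: step_op_def split_beta')
qed

lemma step_op_bounded: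
  fixes S :: "'h::topological_space \<times> 'e::topological_space \<Rightarrow> 'h"
  assumes S[measurable]: "S \<in> measurable (borel \<Otimes>\<^sub>M borel) borel"
    and Q: "Q \<in> measurable seq_space (prob_algebra borel)"
    and f[measurable]: "f \<in> borel_measurable (borel \<Otimes>\<^sub>M seq_space)"
    and b: "\<And>z. \<bar>f z\<bar> \<le> b"
  shows "\<bar>step_op S Q f z\<bar> \<le> b"
proof -
  obtain u \<xi> where z: "z = (u, \<xi>)" by force
  interpret prob_space "Q \<xi>" by (rule kernel_prob_algebraD[OF Q])
  note kernel_prob_algebraD(2)[OF Q, measurable_cong]
  have i: "integrable (Q \<xi>) (\<lambda>y. f (S (u, y), case_nat y \<xi>))"
    using b by (intro integrable_const_bound[of _ b]) (auto intro!: AE_I2)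
  have "\<bar>step_op S Q f z\<bar> \<le> (\<integral>y. \<bar>f (S (u, y), case_nat y \<xi>)\<bar> \<partial>Q \<xi>)"
    unfolding z step_op_def by (simp add: integral_abs_bound)
  also have "\<dots> \<le> (\<integral>y. b \<partial>Q \<xi>)"
    using i b by (intro integral_mono) auto
  finally show ?thesis by (simp add: prob_space)
qed

section \<open>Contraction of the Markov operator\<close>

text \<open>\<open>QA\<close> is the law of the component of the noise in \<open>span B\<close>, \<open>QB\<close> that of the complementary component
  \<open>\<pi> y\<close>. Each depends on the corresponding component of the past only.\<close>

locale split_kernel =
  fixes S :: "'h::real_normed_vector \<times> 'e::real_normed_vector \<Rightarrow> 'h"
    and X :: "'h set" and K :: "'e set" and G :: "(nat \<Rightarrow> 'e) set" and \<iota> :: real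
    and Q QA QB :: "(nat \<Rightarrow> 'e) \<Rightarrow> 'e measure" and q :: "(nat \<Rightarrow> 'e) \<Rightarrow> 'e \<Rightarrow> real"
    and B :: "'e set" and \<pi> :: "'e \<Rightarrow> 'e" and L R :: real
  assumes scH: "second_countable_type TYPE('h)" and scE: "second_countable_type TYPE('e)"
    and S_cont: "continuous_on UNIV S"
    and X_inv: "\<And>u y. u \<in> X \<Longrightarrow> y \<in> K \<Longrightarrow> S (u, y) \<in> X"
    and K_compact: "compact K" and iota: "\<iota> > 1"
    and Q_ker: "Q \<in> measurable seq_space (prob_algebra borel)"
    and QA_ker: "QA \<in> measurable seq_space (prob_algebra borel)"
    and QB_ker: "QB \<in> measurable seq_space (prob_algebra borel)"
    and G_sets [measurable]: "G \<in> sets seq_space" and G_K: "G \<subseteq> past_seqs K"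
    and G_inv: "\<And>\<xi>. \<xi> \<in> G \<Longrightarrow> AE y in Q \<xi>. y \<in> K \<and> case_nat y \<xi> \<in> G"
    and Q_split: "\<And>\<xi>. \<xi> \<in> G \<Longrightarrow> Q \<xi> = distr (QB \<xi> \<Otimes>\<^sub>M QA \<xi>) borel (\<lambda>(b, a). a + b)"
    and QA_density: "\<And>\<xi>. \<xi> \<in> G \<Longrightarrow> QA \<xi> = density (basis_lebesgue B) (\<lambda>a. ennreal (q \<xi> a))"
    and q_nonneg: "\<And>\<xi> a. \<xi> \<in> G \<Longrightarrow> 0 \<le> q \<xi> a"
    and q_lip: "\<And>\<xi> \<xi>' a a'. \<xi> \<in> G \<Longrightarrow> \<xi>' \<in> G \<Longrightarrow>
      \<bar>q \<xi> a - q \<xi>' a'\<bar> \<le> L * (past_dist \<iota> \<xi> \<xi>' + norm (a - a'))"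
    and L_nonneg: "0 \<le> L"
    and q_supp: "\<And>\<xi>. \<xi> \<in> G \<Longrightarrow> AE a in basis_lebesgue B. norm a > R \<longrightarrow> q \<xi> a = 0"
    and B_fin: "finite B" and B_indep: "independent B"
    and pi_lin: "bounded_linear \<pi>" and pi_B: "\<And>b. b \<in> B \<Longrightarrow> \<pi> b = 0"
    and QA_cong: "\<And>\<xi> \<xi>'. (\<And>n. \<xi> n - \<pi> (\<xi> n) = \<xi>' n - \<pi> (\<xi>' n)) \<Longrightarrow> QA \<xi> = QA \<xi>'"
    and QB_cong: "\<And>\<xi> \<xi>'. (\<And>n. \<pi> (\<xi> n) = \<pi> (\<xi>' n)) \<Longrightarrow> QB \<xi> = QB \<xi>'"
    and QB_supp: "\<And>\<xi>. \<xi> \<in> G \<Longrightarrow> AE b in QB \<xi>. \<pi> b = b"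
begin

sublocale QA: prob_space "QA \<xi>" for \<xi> by (rule kernel_prob_algebraD[OF QA_ker])
sublocale QB: prob_space "QB \<xi>" for \<xi> by (rule kernel_prob_algebraD[OF QB_ker])
sublocale Q: prob_space "Q \<xi>" for \<xi> by (rule kernel_prob_algebraD[OF Q_ker])

lemmas kernel_measurable [measurable] = Q_ker QA_ker QB_ker
lemmas kernel_sets [measurable_cong, simp] =
  kernel_prob_algebraD(2)[OF Q_ker] kernel_prob_algebraD(2)[OF QA_ker] kernel_prob_algebraD(2)[OF QB_ker]

lemma S_measurable [measurable]: "S \<in> measurable (borel \<Otimes>\<^sub>M borel) borel"
  using borel_measurable_continuous_Pair'[OF scH scE measurable_fst measurable_snd S_cont] by simp

lemma plus_measurable [measurable]:
  "(\<lambda>(b, a). a + b) \<in> measurable (borel \<Otimes>\<^sub>M borel) (borel :: 'e measure)"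
  unfolding split_beta by (rule borel_measurable_add'[OF scE]) measurable

lemma pi_cont: "continuous_on UNIV \<pi>"
  using pi_lin by (rule linear_continuous_on)

lemma pi_measurable [measurable]: "\<pi> \<in> measurable borel borel"
  by (rule borel_measurable_continuous_onI[OF pi_cont])

lemma K_closed: "closed K" and K_bounded: "bounded K"
  using K_compact compact_imp_closed compact_imp_bounded by auto

lemma K_sets [measurable]: "K \<in> sets borel"
  using K_closed by simp

lemma G_past: "\<xi> \<in> G \<Longrightarrow> \<xi> \<in> past_seqs K"
  using G_K by auto

lemma pi_add: "\<pi> (a + b) = \<pi> a + \<pi> b"
  using pi_lin by (simp add: linear_simps)

lemma pi_span: "a \<in> span B \<Longrightarrow> \<pi> a = 0"
proof (induction rule: span_induct_alt)
  case base
  then show ?case using pi_lin by (simp add: linear_simps)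
next
  case (step c x y)
  then show ?case using pi_lin pi_B by (simp add: linear_simps)
qed

lemma q_measurable: "\<xi> \<in> G \<Longrightarrow> q \<xi> \<in> borel_measurable borel"
proof -
  assume \<xi>: "\<xi> \<in> G"
  have "L-lipschitz_on UNIV (q \<xi>)"
    using q_lip[OF \<xi> \<xi>] L_nonneg by (intro lipschitz_onI) (auto simp: dist_norm)
  then show ?thesis
    by (intro borel_measurable_continuous_onI lipschitz_on_continuous_on)
qed

lemma q_integral:
  assumes \<xi>: "\<xi> \<in> G"
  shows "integrable (basis_lebesgue B) (q \<xi>)" "(\<integral>a. q \<xi> a \<partial>basis_lebesgue B) = 1"
proof -
  note q_measurable[OF \<xi>, measurable]
  have "(\<integral>\<^sup>+a. ennreal (q \<xi> a) \<partial>basis_lebesgue B) = emeasure (QA \<xi>) UNIV"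
    unfolding QA_density[OF \<xi>] by (subst emeasure_density) auto
  also have "\<dots> = 1"
    using QA.emeasure_space_1[of \<xi>] sets_eq_imp_space_eq[OF kernel_prob_algebraD(2)[OF QA_ker, of \<xi>]] by simp
  finally have *: "(\<integral>\<^sup>+a. ennreal (q \<xi> a) \<partial>basis_lebesgue B) = 1" .
  show "integrable (basis_lebesgue B) (q \<xi>)"
    by (rule integrableI_nonneg) (use * q_nonneg[OF \<xi>] in auto)
  then show "(\<integral>a. q \<xi> a \<partial>basis_lebesgue B) = 1"
    using * q_nonneg[OF \<xi>] by (subst integral_eq_nn_integral) auto
qed

lemma QA_integral:
  fixes g :: "'e \<Rightarrow> real"
  assumes \<xi>: "\<xi> \<in> G" and [measurable]: "g \<in> borel_measurable borel"
  shows "(\<integral>a. g a \<partial>QA \<xi>) = (\<integral>a. g a * q \<xi> a \<partial>basis_lebesgue B)"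
proof -
  note q_measurable[OF \<xi>, measurable]
  show ?thesis
    unfolding QA_density[OF \<xi>] using q_nonneg[OF \<xi>]
    by (subst integral_density) (auto simp: mult.commute)
qed

lemma pi_QA: "\<xi> \<in> G \<Longrightarrow> AE a in QA \<xi>. \<pi> a = 0"
proof -
  assume "\<xi> \<in> G"
  have "AE a in basis_lebesgue B. a \<in> {a. \<pi> a = 0}"
    using pi_span by (intro AE_basis_lebesgue_closed[OF scE] closed_Collect_eq pi_cont continuous_intros) auto
  then show ?thesis
    unfolding QA_density[OF \<open>\<xi> \<in> G\<close>] using q_measurable[OF \<open>\<xi> \<in> G\<close>] by (subst AE_density) auto
qed

text \<open>The invariance of \<open>G\<close> is needed slicewise, because the estimates below fix
  the shared component \<open>b\<close> and vary only \<open>a\<close>.\<close>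

lemma AE_good:
  assumes \<xi>: "\<xi> \<in> G"
  shows "AE b in QB \<xi>. \<pi> b = b \<and> (AE a in QA \<xi>. \<pi> a = 0 \<and> a + b \<in> K \<and> case_nat (a + b) \<xi> \<in> G)"
proof -
  interpret P: pair_prob_space "QB \<xi>" "QA \<xi>" ..
  have "AE y in distr (QB \<xi> \<Otimes>\<^sub>M QA \<xi>) borel (\<lambda>(b, a). a + b). y \<in> K \<and> case_nat y \<xi> \<in> G"
    using G_inv[OF \<xi>] unfolding Q_split[OF \<xi>] .
  then have "AE z in QB \<xi> \<Otimes>\<^sub>M QA \<xi>. snd z + fst z \<in> K \<and> case_nat (snd z + fst z) \<xi> \<in> G"
    by (subst (asm) AE_distr_iff) (auto simp: split_beta)
  from P.AE_pair[OF this]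
  have "AE b in QB \<xi>. AE a in QA \<xi>. a + b \<in> K \<and> case_nat (a + b) \<xi> \<in> G" by simp
  with QB_supp[OF \<xi>] show ?thesis
  proof eventually_elim
    case (elim b)
    from elim(2) pi_QA[OF \<xi>] elim(1) show ?case by auto
  qed
qed

lemma step_split:
  fixes f :: "'h \<times> (nat \<Rightarrow> 'e) \<Rightarrow> real"
  assumes \<xi>: "\<xi> \<in> G" and [measurable]: "f \<in> borel_measurable (borel \<Otimes>\<^sub>M seq_space)"
    and b: "\<And>z. \<bar>f z\<bar> \<le> 1"
  shows "step_op S Q f (u, \<xi>) = (\<integral>b. (\<integral>a. f (S (u, a + b), case_nat (a + b) \<xi>) \<partial>QA \<xi>) \<partial>QB \<xi>)"
proof -
  interpret P: pair_prob_space "QB \<xi>" "QA \<xi>" ..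
  have "step_op S Q f (u, \<xi>) = (\<integral>y. f (S (u, y), case_nat y \<xi>) \<partial>distr (QB \<xi> \<Otimes>\<^sub>M QA \<xi>) borel (\<lambda>(b, a). a + b))"
    by (simp add: step_op_def Q_split[OF \<xi>, symmetric])
  also have "\<dots> = (\<integral>z. f (S (u, snd z + fst z), case_nat (snd z + fst z) \<xi>) \<partial>(QB \<xi> \<Otimes>\<^sub>M QA \<xi>))"
    by (subst integral_distr) (auto simp: split_beta)
  also have "\<dots> = (\<integral>b. (\<integral>a. f (S (u, a + b), case_nat (a + b) \<xi>) \<partial>QA \<xi>) \<partial>QB \<xi>)"
  proof -
    have "integrable (QB \<xi> \<Otimes>\<^sub>M QA \<xi>) (\<lambda>z. f (S (u, snd z + fst z), case_nat (snd z + fst z) \<xi>))"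
      by (rule P.integrable_const_bound[of _ 1]) (use b in auto)
    from P.integral_fst'[OF this] show ?thesis by simp
  qed
  finally show ?thesis .
qed

section \<open>Equivalent pasts and the truncated Lipschitz seminorm\<close>

definition eqv :: "(nat \<Rightarrow> 'e) \<Rightarrow> (nat \<Rightarrow> 'e) \<Rightarrow> bool" where
  "eqv \<xi> \<xi>' \<longleftrightarrow> \<xi> \<in> G \<and> \<xi>' \<in> G \<and> (\<forall>n. \<pi> (\<xi> n) = \<pi> (\<xi>' n))"

text \<open>A control applied to the noise stays in the past, so it also has a price there. A small
  weight \<open>A\<close> makes this price a fraction of the gain in the state; its value is fixed
  in \<open>step_contraction_near\<close>.\<close>

definition pdist :: "real \<Rightarrow> 'h \<Rightarrow> 'h \<Rightarrow> (nat \<Rightarrow> 'e) \<Rightarrow> (nat \<Rightarrow> 'e) \<Rightarrow> real" where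
  "pdist A u u' \<xi> \<xi>' = norm (u' - u) + A * past_dist \<iota> \<xi> \<xi>'"

text \<open>A Lipschitz bound for the truncated distance. Below \<open>\<delta>\<close> it improves
  because distances contract; beyond \<open>\<delta>\<close> it merely limits the oscillation, and
  there the improvement comes from pairs that get within \<open>\<delta> / 2\<close>.\<close>

definition osc :: "real \<Rightarrow> real \<Rightarrow> real \<Rightarrow> ('h \<times> (nat \<Rightarrow> 'e) \<Rightarrow> real) \<Rightarrow> bool" where
  "osc A \<delta> c f \<longleftrightarrow> (\<forall>u\<in>X. \<forall>u'\<in>X. \<forall>\<xi> \<xi>'. eqv \<xi> \<xi>' \<longrightarrow>
     \<bar>f (u, \<xi>) - f (u', \<xi>')\<bar> \<le> c * min 1 (pdist A u u' \<xi> \<xi>' / \<delta>))"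

lemma eqv_refl: "\<xi> \<in> G \<Longrightarrow> eqv \<xi> \<xi>" by (simp add: eqv_def)

lemma eqv_QB: "eqv \<xi> \<xi>' \<Longrightarrow> QB \<xi> = QB \<xi>'"
  by (rule QB_cong) (simp add: eqv_def)

lemma eqv_case_nat:
  assumes "eqv \<xi> \<xi>'" "case_nat (a + b) \<xi> \<in> G" "case_nat (a' + b) \<xi>' \<in> G" "\<pi> a = 0" "\<pi> a' = 0"
  shows "eqv (case_nat (a + b) \<xi>) (case_nat (a' + b) \<xi>')"
  using assms by (auto simp: eqv_def pi_add split: nat.split)

lemma past_dist_G_nonneg: "eqv \<xi> \<xi>' \<Longrightarrow> 0 \<le> past_dist \<iota> \<xi> \<xi>'"
  using past_dist_nonneg[OF K_bounded _ _ iota] G_past by (simp add: eqv_def)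

lemma past_dist_G_case_nat:
  "eqv \<xi> \<xi>' \<Longrightarrow> y \<in> K \<Longrightarrow> y' \<in> K \<Longrightarrow>
    past_dist \<iota> (case_nat y \<xi>) (case_nat y' \<xi>') = norm (y - y') + past_dist \<iota> \<xi> \<xi>' / \<iota>"
  using past_dist_case_nat[OF K_bounded _ _ iota] G_past by (simp add: eqv_def)

lemma osc_le: "osc A \<delta> c f \<Longrightarrow> 0 \<le> c \<Longrightarrow> u \<in> X \<Longrightarrow> u' \<in> X \<Longrightarrow> eqv \<xi> \<xi>' \<Longrightarrow> \<bar>f (u, \<xi>) - f (u', \<xi>')\<bar> \<le> c"
  unfolding osc_def by (meson dual_order.trans min.cobounded1 mult_left_le)

section \<open>Small noise, component by component\<close>

abbreviation "smallA n \<delta> \<equiv> {\<xi>. \<forall>i<n. norm (\<xi> i - \<pi> (\<xi> i)) < \<delta>}"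
abbreviation "smallB n \<delta> \<equiv> {\<xi>. \<forall>i<n. norm (\<pi> (\<xi> i)) < \<delta>}"

lemma small_sets [measurable]:
  "smallA n \<delta> \<in> sets seq_space" "smallB n \<delta> \<in> sets seq_space"
  "{\<xi> :: nat \<Rightarrow> 'e. \<forall>i<n. norm (\<xi> i) < \<delta>} \<in> sets seq_space"
proof -
  have [measurable]: "{a. norm (a - \<pi> a) < \<delta>} \<in> sets borel" "{a. norm (\<pi> a) < \<delta>} \<in> sets borel"
    "{a :: 'e. norm a < \<delta>} \<in> sets borel"
    by (intro borel_open open_Collect_less continuous_intros pi_cont)+
  have "{\<xi>\<in>space seq_space. \<forall>i<n. \<xi> i \<in> {a. norm (a - \<pi> a) < \<delta>}} \<in> sets seq_space"
    "{\<xi>\<in>space seq_space. \<forall>i<n. \<xi> i \<in> {a. norm (\<pi> a) < \<delta>}} \<in> sets seq_space"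
    "{\<xi>\<in>space seq_space. \<forall>i<n. \<xi> i \<in> {a :: 'e. norm a < \<delta>}} \<in> sets seq_space"
    by measurable
  then show "smallA n \<delta> \<in> sets seq_space" "smallB n \<delta> \<in> sets seq_space"
    "{\<xi> :: nat \<Rightarrow> 'e. \<forall>i<n. norm (\<xi> i) < \<delta>} \<in> sets seq_space"
    by (simp_all add: space_PiM)
qed

lemma hit_probA_cong:
  assumes "\<And>n. \<xi> n - \<pi> (\<xi> n) = \<xi>' n - \<pi> (\<xi>' n)"
  shows "hit_prob QA (smallA n \<delta>) j \<xi> = hit_prob QA (smallA n \<delta>) j \<xi>'"
  using assms
proof (induction j arbitrary: \<xi> \<xi>')
  case (Suc j)
  have "hit_prob QA (smallA n \<delta>) j (case_nat a \<xi>) = hit_prob QA (smallA n \<delta>) j (case_nat a \<xi>')" for a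
    by (rule Suc.IH) (use Suc.prems in \<open>auto split: nat.split\<close>)
  then show ?case using QA_cong[OF Suc.prems] by simp
qed (simp add: indicator_def)

lemma hit_probB_cong:
  assumes "\<And>n. \<pi> (\<xi> n) = \<pi> (\<xi>' n)"
  shows "hit_prob QB (smallB n \<delta>) j \<xi> = hit_prob QB (smallB n \<delta>) j \<xi>'"
  using assms
proof (induction j arbitrary: \<xi> \<xi>')
  case (Suc j)
  have "hit_prob QB (smallB n \<delta>) j (case_nat b \<xi>) = hit_prob QB (smallB n \<delta>) j (case_nat b \<xi>')" for b
    by (rule Suc.IH) (use Suc.prems in \<open>auto split: nat.split\<close>)
  then show ?case using QB_cong[OF Suc.prems] by simp
qed (simp add: indicator_def)

lemma hit_probA_plus:
  assumes "\<pi> b = b"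
  shows "hit_prob QA (smallA n \<delta>) j (case_nat (a + b) \<xi>) = hit_prob QA (smallA n \<delta>) j (case_nat a \<xi>)"
  by (rule hit_probA_cong) (use assms in \<open>auto simp: pi_add split: nat.split\<close>)

lemma hit_probB_plus:
  assumes "\<pi> a = 0"
  shows "hit_prob QB (smallB n \<delta>) j (case_nat (a + b) \<xi>) = hit_prob QB (smallB n \<delta>) j (case_nat b \<xi>)"
  by (rule hit_probB_cong) (use assms in \<open>auto simp: pi_add split: nat.split\<close>)

lemma hit_prob_integral:
  assumes \<xi>: "\<xi> \<in> G" and A[measurable]: "A \<in> sets seq_space"
  shows "hit_prob Q A (Suc j) \<xi> = (\<integral>b. (\<integral>a. hit_prob Q A j (case_nat (a + b) \<xi>) \<partial>QA \<xi>) \<partial>QB \<xi>)"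
  using step_split[OF \<xi>, of "\<lambda>z. hit_prob Q A j (snd z)"] hit_prob_bounds[OF Q_ker A, of j]
  by (simp add: step_op_def)

text \<open>Smallness of the whole noise forces smallness of either component, whose probability only
  depends on the corresponding component of the past.\<close>

lemma hit_prob_le_components:
  assumes \<delta>: "\<And>y. norm y < \<delta>' \<Longrightarrow> norm (y - \<pi> y) < \<delta> \<and> norm (\<pi> y) < \<delta>"
    and \<xi>: "\<xi> \<in> G"
  shows "hit_prob Q {\<xi>. \<forall>i<n. norm (\<xi> i) < \<delta>'} j \<xi> \<le> hit_prob QA (smallA n \<delta>) j \<xi> \<and>
    hit_prob Q {\<xi>. \<forall>i<n. norm (\<xi> i) < \<delta>'} j \<xi> \<le> hit_prob QB (smallB n \<delta>) j \<xi>"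
  using \<xi>
proof (induction j arbitrary: \<xi>)
  case 0
  then show ?case using \<delta> by (auto simp: indicator_def)
next
  case (Suc j)
  let ?S = "{\<xi>. \<forall>i<n. norm (\<xi> i :: 'e) < \<delta>'}"
  note bq = hit_prob_bounds[OF Q_ker small_sets(3)]
  note ba = hit_prob_bounds[OF QA_ker small_sets(1)]
  note bb = hit_prob_bounds[OF QB_ker small_sets(2)]
  have iq: "integrable (QA \<xi>) (\<lambda>a. hit_prob Q ?S j (case_nat (a + b) \<xi>))" for b
    by (rule QA.integrable_const_bound[of _ 1]) (use bq in \<open>auto simp: abs_le_iff\<close>, measurable)
  have ia: "integrable (QA \<xi>) (\<lambda>a. hit_prob QA (smallA n \<delta>) j (case_nat a \<xi>))"
    by (rule QA.integrable_const_bound[of _ 1]) (use ba in \<open>auto\<close>, measurable)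
  have ib: "integrable (QB \<xi>) (\<lambda>b. hit_prob QB (smallB n \<delta>) j (case_nat b \<xi>))"
    by (rule QB.integrable_const_bound[of _ 1]) (use bb in \<open>auto\<close>, measurable)
  have m: "(\<lambda>b. \<integral>a. hit_prob Q ?S j (case_nat (a + b) \<xi>) \<partial>QA \<xi>) \<in> borel_measurable (QB \<xi>)"
    by (rule QA.borel_measurable_lebesgue_integral) measurable
  have i1: "\<bar>\<integral>a. hit_prob Q ?S j (case_nat (a + b) \<xi>) \<partial>QA \<xi>\<bar> \<le> 1" for b
  proof -
    have "\<bar>\<integral>a. hit_prob Q ?S j (case_nat (a + b) \<xi>) \<partial>QA \<xi>\<bar> \<le> (\<integral>a. \<bar>hit_prob Q ?S j (case_nat (a + b) \<xi>)\<bar> \<partial>QA \<xi>)"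
      by (rule integral_abs_bound)
    also have "\<dots> \<le> (\<integral>a. 1 \<partial>QA \<xi>)"
      using iq bq by (intro integral_mono) auto
    finally show ?thesis by (simp add: QA.prob_space)
  qed
  have iq2: "integrable (QB \<xi>) (\<lambda>b. \<integral>a. hit_prob Q ?S j (case_nat (a + b) \<xi>) \<partial>QA \<xi>)"
    by (rule QB.integrable_const_bound[of _ 1]) (use i1 m in auto)
  have "(\<integral>b. (\<integral>a. hit_prob Q ?S j (case_nat (a + b) \<xi>) \<partial>QA \<xi>) \<partial>QB \<xi>)
    \<le> (\<integral>b. (\<integral>a. hit_prob QA (smallA n \<delta>) j (case_nat a \<xi>) \<partial>QA \<xi>) \<partial>QB \<xi>)"
  proof (rule integral_mono_AE[OF iq2])
    show "AE b in QB \<xi>. (\<integral>a. hit_prob Q ?S j (case_nat (a + b) \<xi>) \<partial>QA \<xi>)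
        \<le> (\<integral>a. hit_prob QA (smallA n \<delta>) j (case_nat a \<xi>) \<partial>QA \<xi>)"
      using AE_good[OF Suc.prems]
    proof eventually_elim
      case (elim b)
      have "AE a in QA \<xi>. hit_prob Q ?S j (case_nat (a + b) \<xi>) \<le> hit_prob QA (smallA n \<delta>) j (case_nat a \<xi>)"
        using elim[THEN conjunct2]
      proof eventually_elim
        case a: (elim a)
        then show ?case
          using Suc.IH[of "case_nat (a + b) \<xi>"] hit_probA_plus[of b n \<delta> j a \<xi>] elim[THEN conjunct1] by simp
      qed
      then show ?case by (intro integral_mono_AE iq ia)
    qed
  qed simp
  moreover have "(\<integral>b. (\<integral>a. hit_prob Q ?S j (case_nat (a + b) \<xi>) \<partial>QA \<xi>) \<partial>QB \<xi>)
    \<le> (\<integral>b. hit_prob QB (smallB n \<delta>) j (case_nat b \<xi>) \<partial>QB \<xi>)"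
  proof (rule integral_mono_AE[OF iq2 ib])
    show "AE b in QB \<xi>. (\<integral>a. hit_prob Q ?S j (case_nat (a + b) \<xi>) \<partial>QA \<xi>)
        \<le> hit_prob QB (smallB n \<delta>) j (case_nat b \<xi>)"
      using AE_good[OF Suc.prems]
    proof eventually_elim
      case (elim b)
      have "AE a in QA \<xi>. hit_prob Q ?S j (case_nat (a + b) \<xi>) \<le> hit_prob QB (smallB n \<delta>) j (case_nat b \<xi>)"
        using elim[THEN conjunct2]
      proof eventually_elim
        case a: (elim a)
        then show ?case
          using Suc.IH[of "case_nat (a + b) \<xi>"] hit_probB_plus[of a n \<delta> j b \<xi>] by simp
      qed
      then have "(\<integral>a. hit_prob Q ?S j (case_nat (a + b) \<xi>) \<partial>QA \<xi>)
          \<le> (\<integral>a. hit_prob QB (smallB n \<delta>) j (case_nat b \<xi>) \<partial>QA \<xi>)"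
        by (intro integral_mono_AE iq) simp_all
      then show ?case by (simp add: QA.prob_space)
    qed
  qed
  ultimately show ?case
    using hit_prob_integral[OF Suc.prems small_sets(3), of n \<delta>' j]
    by (simp add: QB.prob_space)
qed

section \<open>Far pairs: the gain from simultaneously small noise\<close>

lemma step_pow_measurable:
  assumes "f \<in> borel_measurable (borel \<Otimes>\<^sub>M seq_space)"
  shows "(step_op S Q ^^ j) f \<in> borel_measurable (borel \<Otimes>\<^sub>M seq_space)"
  by (induction j) (use assms in \<open>simp_all add: step_op_measurable[OF S_measurable Q_ker]\<close>)

lemma step_pow_bounded:
  assumes "f \<in> borel_measurable (borel \<Otimes>\<^sub>M seq_space)" "\<And>z. \<bar>f z\<bar> \<le> b"
  shows "\<bar>(step_op S Q ^^ j) f z\<bar> \<le> b"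
  using assms
  by (induction j arbitrary: z)
    (simp_all add: step_op_bounded[OF S_measurable Q_ker] step_pow_measurable)

lemma inner_integral:
  fixes f :: "'h \<times> (nat \<Rightarrow> 'e) \<Rightarrow> real"
  assumes [measurable]: "f \<in> borel_measurable (borel \<Otimes>\<^sub>M seq_space)" and b: "\<And>z. \<bar>f z\<bar> \<le> 1"
  shows "integrable (QB \<xi>') (\<lambda>b. \<integral>a. f (S (u, a + b), case_nat (a + b) \<xi>) \<partial>QA \<xi>)"
proof (rule QB.integrable_const_bound[of _ 1])
  show "(\<lambda>b. \<integral>a. f (S (u, a + b), case_nat (a + b) \<xi>) \<partial>QA \<xi>) \<in> borel_measurable (QB \<xi>')"
    by (rule QA.borel_measurable_lebesgue_integral) measurable
  have "\<bar>\<integral>a. f (S (u, a + b), case_nat (a + b) \<xi>) \<partial>QA \<xi>\<bar> \<le> 1" for b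
  proof -
    have "integrable (QA \<xi>) (\<lambda>a. f (S (u, a + b), case_nat (a + b) \<xi>))"
      by (rule QA.integrable_const_bound[of _ 1]) (use assms(2) in auto)
    then have "(\<integral>a. \<bar>f (S (u, a + b), case_nat (a + b) \<xi>)\<bar> \<partial>QA \<xi>) \<le> (\<integral>a. 1 \<partial>QA \<xi>)"
      using assms(2) by (intro integral_mono) auto
    then show ?thesis
      using order_trans[OF integral_abs_bound[of "QA \<xi>" "\<lambda>a. f (S (u, a + b), case_nat (a + b) \<xi>)"]]
      by (simp add: QA.prob_space)
  qed
  then show "AE b in QB \<xi>'. norm (\<integral>a. f (S (u, a + b), case_nat (a + b) \<xi>) \<partial>QA \<xi>) \<le> 1"
    by simp
qed

text \<open>The two chains share the \<open>QB\<close>-component of the noise and have independent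
  \<open>QA\<close>-components, so the probability that both noises are small at the end factorises.\<close>

lemma step_pow_difference:
  fixes f :: "'h \<times> (nat \<Rightarrow> 'e) \<Rightarrow> real"
  assumes f[measurable]: "f \<in> borel_measurable (borel \<Otimes>\<^sub>M seq_space)" and b: "\<And>z. \<bar>f z\<bar> \<le> 1"
    and osc: "osc A \<delta> c f" and c: "0 \<le> c" and \<delta>: "\<delta> > 0"
    and near: "\<And>x x' \<xi> \<xi>'. x \<in> X \<Longrightarrow> x' \<in> X \<Longrightarrow> eqv \<xi> \<xi>' \<Longrightarrow> \<xi> \<in> smallA n d \<inter> smallB n d \<Longrightarrow>
      \<xi>' \<in> smallA n d \<inter> smallB n d \<Longrightarrow> pdist A (run S m x \<xi>) (run S m x' \<xi>') \<xi> \<xi>' \<le> \<delta> / 2"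
    and x: "x \<in> X" "x' \<in> X" and eqv: "eqv \<xi> \<xi>'" and ij: "i + j = m"
  shows "\<bar>(step_op S Q ^^ j) f (run S i x \<xi>, \<xi>) - (step_op S Q ^^ j) f (run S i x' \<xi>', \<xi>')\<bar> \<le>
    c * (1 - 1/2 * hit_prob QB (smallB n d) j \<xi> * hit_prob QA (smallA n d) j \<xi> * hit_prob QA (smallA n d) j \<xi>')"
  using eqv ij
\<comment> \<open>\<open>j\<close> steps are still to be averaged over and \<open>i\<close> have
  been made. The state is written as a run along the very past it is paired with, so that
  \<open>near\<close> is called only at the final time \<open>m\<close>.\<close>
proof (induction j arbitrary: i \<xi> \<xi>')
  case 0
  have G: "\<xi> \<in> past_seqs K" "\<xi>' \<in> past_seqs K" using 0(1) G_past by (auto simp: eqv_def)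
  have rX: "run S m x \<xi> \<in> X" "run S m x' \<xi>' \<in> X"
    by (rule run_in[of X K S, OF X_inv]; use x G in simp)+
  have o: "\<bar>f (run S m x \<xi>, \<xi>) - f (run S m x' \<xi>', \<xi>')\<bar>
      \<le> c * min 1 (pdist A (run S m x \<xi>) (run S m x' \<xi>') \<xi> \<xi>' / \<delta>)"
    using osc rX 0(1) unfolding osc_def by blast
  \<comment> \<open>For the second past \<open>smallB\<close> need not be tested: equivalent pasts
    have the same complementary component. If all three indicators are 1, the distance is at most
    \<open>\<delta> / 2\<close> and the bound is \<open>c / 2\<close>; otherwise the product
    vanishes and only the trivial bound \<open>c\<close> is claimed.\<close>
  show ?case
  proof (cases "\<xi> \<in> smallA n d \<inter> smallB n d \<and> \<xi>' \<in> smallA n d")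
    case True
    then have "\<xi>' \<in> smallA n d \<inter> smallB n d" using 0(1) by (simp add: eqv_def)
    then have "pdist A (run S m x \<xi>) (run S m x' \<xi>') \<xi> \<xi>' \<le> \<delta> / 2" using True near x 0(1) by blast
    then have "min 1 (pdist A (run S m x \<xi>) (run S m x' \<xi>') \<xi> \<xi>' / \<delta>) \<le> 1/2"
      using \<delta> by (simp add: min_le_iff_disj pos_divide_le_eq)
    then have "c * min 1 (pdist A (run S m x \<xi>) (run S m x' \<xi>') \<xi> \<xi>' / \<delta>) \<le> c * (1/2)"
      using c by (intro mult_left_mono)
    then show ?thesis using o True 0(2) by (simp add: indicator_def)
  next
    case False
    have "c * min 1 (pdist A (run S m x \<xi>) (run S m x' \<xi>') \<xi> \<xi>' / \<delta>) \<le> c * 1"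
      using c by (intro mult_left_mono) auto
    then show ?thesis using o False 0(2) by (auto simp: indicator_def)
  qed
next
  case (Suc j)
  define g where "g = (step_op S Q ^^ j) f"
  have g[measurable]: "g \<in> borel_measurable (borel \<Otimes>\<^sub>M seq_space)"
    unfolding g_def by (rule step_pow_measurable[OF f])
  have gb: "\<bar>g z\<bar> \<le> 1" for z unfolding g_def by (rule step_pow_bounded[OF f b])
  let ?u = "run S i x \<xi>" and ?u' = "run S i x' \<xi>'"
  let ?I = "\<lambda>b. \<integral>a. g (S (?u, a + b), case_nat (a + b) \<xi>) \<partial>QA \<xi>"
  let ?I' = "\<lambda>b. \<integral>a. g (S (?u', a + b), case_nat (a + b) \<xi>') \<partial>QA \<xi>'"
  let ?p = "hit_prob QA (smallA n d) (Suc j) \<xi>" and ?p' = "hit_prob QA (smallA n d) (Suc j) \<xi>'"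
  let ?r = "\<lambda>b. hit_prob QB (smallB n d) j (case_nat b \<xi>)"
  have \<xi>: "\<xi> \<in> G" "\<xi>' \<in> G" using Suc.prems(1) by (auto simp: eqv_def)
  have QBeq: "QB \<xi>' = QB \<xi>" using eqv_QB[OF Suc.prems(1)] by simp
  note ba = hit_prob_bounds[OF QA_ker small_sets(1)]
  note bb = hit_prob_bounds[OF QB_ker small_sets(2)]
  have ir: "integrable (QB \<xi>) ?r"
    by (rule QB.integrable_const_bound[of _ 1]) (use bb in \<open>auto\<close>, measurable)
  have "AE b in QB \<xi>. \<pi> b = b \<and> (AE a in QA \<xi>'. \<pi> a = 0 \<and> a + b \<in> K \<and> case_nat (a + b) \<xi>' \<in> G)"
    using AE_good[OF \<xi>(2)] unfolding QBeq .
  with AE_good[OF \<xi>(1)]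
  have key: "AE b in QB \<xi>. \<bar>?I b - ?I' b\<bar> \<le> c * (1 - 1/2 * ?r b * ?p * ?p')"
  proof eventually_elim
    case (elim b)
    \<comment> \<open>With \<open>b\<close> fixed, \<open>?r b\<close> is a common constant, and the
      two \<open>QA\<close>-components are averaged independently.\<close>
    have "\<bar>?I b - ?I' b\<bar> \<le> c * (1 - (1/2 * ?r b) * (\<integral>a. hit_prob QA (smallA n d) j (case_nat a \<xi>) \<partial>QA \<xi>)
        * (\<integral>a. hit_prob QA (smallA n d) j (case_nat a \<xi>') \<partial>QA \<xi>'))"
    proof (rule product_coupling_bound[OF QA.prob_space_axioms QA.prob_space_axioms])
      show "AE a' in QA \<xi>'. AE a in QA \<xi>. \<bar>g (S (?u, a + b), case_nat (a + b) \<xi>) - g (S (?u', a' + b), case_nat (a' + b) \<xi>')\<bar>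
          \<le> c * (1 - 1 / 2 * ?r b * hit_prob QA (smallA n d) j (case_nat a \<xi>) *
            hit_prob QA (smallA n d) j (case_nat a' \<xi>'))"
        using elim(2)[THEN conjunct2]
      proof eventually_elim
        case a': (elim a')
        from elim(1)[THEN conjunct2] show ?case
        proof eventually_elim
          case a: (elim a)
          have e: "eqv (case_nat (a + b) \<xi>) (case_nat (a' + b) \<xi>')"
            using eqv_case_nat[OF Suc.prems(1)] a a' by blast
          have "Suc i + j = m" using Suc.prems by simp
          from Suc.IH[OF e this]
          show ?case
            using elim a a' by (simp add: g_def hit_probA_plus hit_probB_plus)
        qed
      qed
    qed (use gb ba in auto)
    then show ?case by simp
  qed
  have "(step_op S Q ^^ Suc j) f (?u, \<xi>) - (step_op S Q ^^ Suc j) f (?u', \<xi>') = (\<integral>b. ?I b \<partial>QB \<xi>) - (\<integral>b. ?I' b \<partial>QB \<xi>)"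
    using step_split[OF \<xi>(1) g gb] step_split[OF \<xi>(2) g gb] by (simp add: g_def QBeq)
  also have "\<dots> = (\<integral>b. ?I b - ?I' b \<partial>QB \<xi>)"
    by (rule Bochner_Integration.integral_diff[symmetric]; rule inner_integral[OF g gb])
  finally have "\<bar>(step_op S Q ^^ Suc j) f (?u, \<xi>) - (step_op S Q ^^ Suc j) f (?u', \<xi>')\<bar> \<le> (\<integral>b. \<bar>?I b - ?I' b\<bar> \<partial>QB \<xi>)"
    by (simp add: integral_abs_bound)
  also have "\<dots> \<le> (\<integral>b. c * (1 - 1/2 * ?r b * ?p * ?p') \<partial>QB \<xi>)"
    using ir by (intro integral_mono_AE key integrable_abs Bochner_Integration.integrable_diff inner_integral[OF g gb]) auto
  also have "\<dots> = c * (1 - 1/2 * hit_prob QB (smallB n d) (Suc j) \<xi> * ?p * ?p')"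
    using ir by (simp add: QB.prob_space)
  finally show ?case .
qed

section \<open>Near pairs: shifting the noise law along the controls\<close>

lemma density_shift_L1:
  assumes \<xi>: "\<xi> \<in> G" "\<xi>' \<in> G" and t: "t \<in> span B" "norm t \<le> T"
    and \<phi>[measurable]: "\<phi> \<in> borel_measurable borel" and \<phi>01: "\<And>a. 0 \<le> \<phi> a" "\<And>a. \<phi> a \<le> (1::real)"
    and \<phi>L: "\<And>a a'. \<bar>\<phi> a - \<phi> a'\<bar> \<le> M * norm (a - a')"
  shows "(\<integral>a. \<bar>\<phi> a * q \<xi> a - \<phi> (a + t) * q \<xi>' (a + t)\<bar> \<partial>basis_lebesgue B) \<le>
    M * norm t + L * (past_dist \<iota> \<xi> \<xi>' + norm t) * measure (basis_lebesgue B) (cball 0 (R + T))"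
proof -
  let ?\<Lambda> = "basis_lebesgue B" and ?C = "cball (0::'e) (R + T)"
  let ?d = "past_dist \<iota> \<xi> \<xi>' + norm t"
  note q_measurable[OF \<xi>(1), measurable] q_measurable[OF \<xi>(2), measurable]
  have fin: "emeasure ?\<Lambda> ?C < \<infinity>"
    by (rule basis_lebesgue_cball_finite[OF scE B_fin B_indep])
  have i1: "integrable ?\<Lambda> (\<lambda>a. M * norm t * q \<xi> a)"
    using q_integral(1)[OF \<xi>(1)] by simp
  have i2: "integrable ?\<Lambda> (\<lambda>a. L * ?d * indicator ?C a)"
    using fin by (intro integrable_mult_right integrable_real_indicator) auto
  have i3: "integrable ?\<Lambda> (\<lambda>a. M * norm t * q \<xi> a + L * ?d * indicator ?C a)"
    using i1 i2 by simp
  have "AE a in distr ?\<Lambda> borel (\<lambda>a. a + t). norm a > R \<longrightarrow> q \<xi>' a = 0"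
    unfolding basis_lebesgue_translate[OF scE B_fin t(1)] by (rule q_supp[OF \<xi>(2)])
  then have s': "AE a in ?\<Lambda>. norm (a + t) > R \<longrightarrow> q \<xi>' (a + t) = 0"
    by (subst (asm) AE_distr_iff) auto
  \<comment> \<open>Product rule for the weighted density: moving the cut-off costs
    \<open>M * norm t\<close> times a density of mass 1, moving the density costs its Lipschitz
    bound on a ball outside of which both densities vanish.\<close>
  have le: "AE a in ?\<Lambda>. \<bar>\<phi> a * q \<xi> a - \<phi> (a + t) * q \<xi>' (a + t)\<bar> \<le> M * norm t * q \<xi> a + L * ?d * indicator ?C a"
    using q_supp[OF \<xi>(1)] s'
  proof eventually_elim
    case (elim a)
    have 1: "\<bar>(\<phi> a - \<phi> (a + t)) * q \<xi> a\<bar> \<le> M * norm t * q \<xi> a"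
      using \<phi>L[of a "a + t"] q_nonneg[OF \<xi>(1), of a] by (simp add: abs_mult mult_right_mono)
    have 2: "\<bar>\<phi> (a + t) * (q \<xi> a - q \<xi>' (a + t))\<bar> \<le> L * ?d * indicator ?C a"
    proof (cases "a \<in> ?C")
      case True
      have "\<bar>\<phi> (a + t) * (q \<xi> a - q \<xi>' (a + t))\<bar> \<le> 1 * (L * ?d)"
        unfolding abs_mult using q_lip[OF \<xi>, of a "a + t"] \<phi>01[of "a + t"]
        by (intro mult_mono) auto
      then show ?thesis using True by simp
    next
      case False
      \<comment> \<open>Outside the ball of radius \<open>R + T\<close> both \<open>a\<close> and
        \<open>a + t\<close> have norm above \<open>R\<close>.\<close>
      then have "norm a > R + T" by simp
      moreover have "norm a \<le> norm (a + t) + norm t" using norm_triangle_ineq4[of "a + t" t] by simp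
      ultimately have "norm a > R" "norm (a + t) > R"
        using t(2) norm_ge_zero[of t] by linarith+
      then show ?thesis using elim False by simp
    qed
    have "\<phi> a * q \<xi> a - \<phi> (a + t) * q \<xi>' (a + t) = (\<phi> a - \<phi> (a + t)) * q \<xi> a + \<phi> (a + t) * (q \<xi> a - q \<xi>' (a + t))"
      by (simp add: algebra_simps)
    then show ?case using 1 2 by linarith
  qed
  have "(\<integral>a. \<bar>\<phi> a * q \<xi> a - \<phi> (a + t) * q \<xi>' (a + t)\<bar> \<partial>?\<Lambda>) \<le> (\<integral>a. M * norm t * q \<xi> a + L * ?d * indicator ?C a \<partial>?\<Lambda>)"
  proof (rule integral_mono_AE[OF _ i3 le])
    show "integrable ?\<Lambda> (\<lambda>a. \<bar>\<phi> a * q \<xi> a - \<phi> (a + t) * q \<xi>' (a + t)\<bar>)"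
    proof (rule Bochner_Integration.integrable_bound[OF i3])
      show "AE a in ?\<Lambda>. norm \<bar>\<phi> a * q \<xi> a - \<phi> (a + t) * q \<xi>' (a + t)\<bar> \<le> norm (M * norm t * q \<xi> a + L * ?d * indicator ?C a)"
        using le by eventually_elim simp
    qed measurable
  qed
  also have "\<dots> = M * norm t + L * ?d * measure ?\<Lambda> ?C"
    using i1 i2 q_integral(2)[OF \<xi>(1)] fin by simp
  finally show ?thesis .
qed

text \<open>One value \<open>b\<close> of the shared component is fixed. The partition of unity cuts
  the law of \<open>a + b\<close> into pieces, each with its own control \<open>t j\<close>, and the
  pieces are matched after these shifts. The first term of the bound is the cost of the matched
  mass, the second that of the mass left over because shift and past change the densities.\<close>

lemma inner_contraction:
  fixes f :: "'h \<times> (nat \<Rightarrow> 'e) \<Rightarrow> real" and t :: "'j \<Rightarrow> 'e" and \<phi> :: "'j \<Rightarrow> 'e \<Rightarrow> real"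
  assumes f[measurable]: "f \<in> borel_measurable (borel \<Otimes>\<^sub>M seq_space)" and fb: "\<And>z. \<bar>f z\<bar> \<le> 1"
    and osc: "osc A \<delta> c f" and c: "0 \<le> c" and e: "0 \<le> e"
    and u: "u \<in> X" "u' \<in> X" and eqv: "eqv \<xi> \<xi>'"
    and I: "finite I" and \<phi>c: "\<And>j. continuous_on UNIV (\<phi> j)" and \<phi>0: "\<And>j y. 0 \<le> \<phi> j y"
    and \<phi>1: "\<And>y. y \<in> K \<Longrightarrow> (\<Sum>j\<in>I. \<phi> j y) = 1" and \<phi>le: "\<And>j y. j \<in> I \<Longrightarrow> \<phi> j y \<le> 1"
    and \<phi>L: "\<And>j y y'. \<bar>\<phi> j y - \<phi> j y'\<bar> \<le> M * dist y y'"
    and t: "\<And>j. j \<in> I \<Longrightarrow> t j \<in> span B" "\<And>j. j \<in> I \<Longrightarrow> norm (t j) \<le> T"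
    and steer: "\<And>j y. j \<in> I \<Longrightarrow> y \<in> K \<Longrightarrow> y + t j \<in> K \<Longrightarrow> \<phi> j y > 0 \<Longrightarrow>
      pdist A (S (u, y)) (S (u', y + t j)) (case_nat y \<xi>) (case_nat (y + t j) \<xi>') / \<delta> \<le> e"
    and b: "AE a in QA \<xi>. \<pi> a = 0 \<and> a + b \<in> K \<and> case_nat (a + b) \<xi> \<in> G"
      "AE a in QA \<xi>'. \<pi> a = 0 \<and> a + b \<in> K \<and> case_nat (a + b) \<xi>' \<in> G"
  shows "\<bar>(\<integral>a. f (S (u, a + b), case_nat (a + b) \<xi>) \<partial>QA \<xi>) - (\<integral>a. f (S (u', a + b), case_nat (a + b) \<xi>') \<partial>QA \<xi>')\<bar>
    \<le> c * e + c * (\<Sum>j\<in>I. M * norm (t j) + L * (past_dist \<iota> \<xi> \<xi>' + norm (t j)) * measure (basis_lebesgue B) (cball 0 (R + T)))"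
proof -
  let ?\<Lambda> = "basis_lebesgue B"
  have \<xi>: "\<xi> \<in> G" "\<xi>' \<in> G" using eqv by (auto simp: eqv_def)
  note qm[measurable] = q_measurable[OF \<xi>(1)] q_measurable[OF \<xi>(2)]
  define g where "g a = f (S (u, a + b), case_nat (a + b) \<xi>)" for a
  define g' where "g' a = f (S (u', a + b), case_nat (a + b) \<xi>')" for a
  have gm[measurable]: "g \<in> borel_measurable borel" "g' \<in> borel_measurable borel"
    unfolding g_def g'_def by measurable
  have gb: "\<bar>g a\<bar> \<le> 1" "\<bar>g' a\<bar> \<le> 1" for a unfolding g_def g'_def by (rule fb)+
  have \<phi>m[measurable]: "\<phi> j \<in> borel_measurable borel" for j
    by (rule borel_measurable_continuous_onI[OF \<phi>c])
  define \<alpha> where "\<alpha> j a = \<phi> j (a + b) * q \<xi> a" for j a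
  define \<alpha>' where "\<alpha>' j a = \<phi> j (a + b) * q \<xi>' a" for j a
  have \<phi>i: "integrable ?\<Lambda> (\<lambda>a. \<phi> j (a + b) * q \<xi>0 a)" if "j \<in> I" "\<xi>0 \<in> G" for j \<xi>0
  proof (rule Bochner_Integration.integrable_bound[OF q_integral(1)[OF that(2)]])
    note q_measurable[OF that(2), measurable]
    show "(\<lambda>a. \<phi> j (a + b) * q \<xi>0 a) \<in> borel_measurable ?\<Lambda>" by measurable
    have "\<phi> j (a + b) * q \<xi>0 a \<le> q \<xi>0 a" for a
      using \<phi>le[OF that(1), of "a + b"] \<phi>0[of j "a + b"] q_nonneg[OF that(2), of a]
      by (intro mult_left_le_one_le)
    then show "AE a in ?\<Lambda>. norm (\<phi> j (a + b) * q \<xi>0 a) \<le> norm (q \<xi>0 a)"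
      using \<phi>0 q_nonneg[OF that(2)] by (auto simp: abs_mult)
  qed
  have good: "AE a in ?\<Lambda>. 0 < q \<xi>0 a \<longrightarrow> \<pi> a = 0 \<and> a + b \<in> K \<and> case_nat (a + b) \<xi>0 \<in> G"
    if "\<xi>0 \<in> G" "AE a in QA \<xi>0. \<pi> a = 0 \<and> a + b \<in> K \<and> case_nat (a + b) \<xi>0 \<in> G" for \<xi>0
    using that(2) q_measurable[OF that(1)] unfolding QA_density[OF that(1)]
    by (subst (asm) AE_density) (auto simp: ennreal_eq_0_iff)
  note good1 = good[OF \<xi>(1) b(1)] and good2 = good[OF \<xi>(2) b(2)]
  have sums: "(\<integral>a. h a \<partial>QA \<xi>0) = (\<Sum>j\<in>I. \<integral>a. h a * (\<phi> j (a + b) * q \<xi>0 a) \<partial>?\<Lambda>)"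
    if "\<xi>0 \<in> G" "AE a in QA \<xi>0. \<pi> a = 0 \<and> a + b \<in> K \<and> case_nat (a + b) \<xi>0 \<in> G"
      and hm[measurable]: "h \<in> borel_measurable borel" and hb: "\<And>a. \<bar>h a\<bar> \<le> 1" for h :: "'e \<Rightarrow> real" and \<xi>0
  proof -
    note q_measurable[OF that(1), measurable]
    have i: "integrable ?\<Lambda> (\<lambda>a. h a * (\<phi> j (a + b) * q \<xi>0 a))" if "j \<in> I" for j
    proof (rule Bochner_Integration.integrable_bound[OF \<phi>i[OF that \<open>\<xi>0 \<in> G\<close>]])
      have "\<bar>h a\<bar> * x \<le> x" if "0 \<le> x" for a x using hb[of a] that by (intro mult_left_le_one_le) auto
      then show "AE a in ?\<Lambda>. norm (h a * (\<phi> j (a + b) * q \<xi>0 a)) \<le> norm (\<phi> j (a + b) * q \<xi>0 a)"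
        by (auto simp: abs_mult[of "h _"])
    qed measurable
    have "(\<integral>a. h a \<partial>QA \<xi>0) = (\<integral>a. h a * q \<xi>0 a \<partial>?\<Lambda>)"
      by (rule QA_integral[OF that(1)]) measurable
    also have "\<dots> = (\<integral>a. (\<Sum>j\<in>I. h a * (\<phi> j (a + b) * q \<xi>0 a)) \<partial>?\<Lambda>)"
    proof (rule integral_cong_AE)
      show "AE a in ?\<Lambda>. h a * q \<xi>0 a = (\<Sum>j\<in>I. h a * (\<phi> j (a + b) * q \<xi>0 a))"
        using good[OF that(1,2)]
      proof eventually_elim
        case (elim a)
        have "(\<Sum>j\<in>I. h a * (\<phi> j (a + b) * q \<xi>0 a)) = h a * q \<xi>0 a * (\<Sum>j\<in>I. \<phi> j (a + b))"
          by (simp add: sum_distrib_left mult_ac)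
        then show ?case using elim \<phi>1 q_nonneg[OF that(1), of a] by (cases "q \<xi>0 a = 0") auto
      qed
    qed measurable
    also have "\<dots> = (\<Sum>j\<in>I. \<integral>a. h a * (\<phi> j (a + b) * q \<xi>0 a) \<partial>?\<Lambda>)"
      by (rule Bochner_Integration.integral_sum) (rule i)
    finally show ?thesis .
  qed
  have mass: "(\<Sum>j\<in>I. \<integral>a. \<phi> j (a + b) * q \<xi>0 a \<partial>?\<Lambda>) = 1"
    if "\<xi>0 \<in> G" "AE a in QA \<xi>0. \<pi> a = 0 \<and> a + b \<in> K \<and> case_nat (a + b) \<xi>0 \<in> G" for \<xi>0
    using sums[OF that, of "\<lambda>_. 1"] by (simp add: QA.prob_space)
  \<comment> \<open>A reference point outside the exceptional sets. Its value \<open>m\<close> is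
    within \<open>c\<close> of almost all values of both functions, as the oscillation between
    equivalent pasts is at most \<open>c\<close>.\<close>
  have "\<exists>a0. \<pi> a0 = 0 \<and> a0 + b \<in> K \<and> case_nat (a0 + b) \<xi>' \<in> G"
  proof (rule ccontr)
    assume "\<not> ?thesis"
    then have "AE a in QA \<xi>'. False" by (intro eventually_mono[OF b(2)]) blast
    then show False by simp
  qed
  then obtain a0 where a0: "\<pi> a0 = 0" "a0 + b \<in> K" "case_nat (a0 + b) \<xi>' \<in> G" by blast
  define m where "m = g' a0"
  have SX: "S (u, y) \<in> X" "S (u', y) \<in> X" if "y \<in> K" for y using X_inv u that by auto
  have eqv': "eqv \<xi>' \<xi>'" by (rule eqv_refl[OF \<xi>(2)])
  have B1: "\<bar>g a - m\<bar> \<le> c" if "\<pi> a = 0" "a + b \<in> K" "case_nat (a + b) \<xi> \<in> G" for a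
    unfolding g_def g'_def m_def
    by (rule osc_le[OF osc c]) (use that a0 SX eqv eqv_case_nat in auto)
  have B2: "\<bar>g' a - m\<bar> \<le> c" if "\<pi> a = 0" "a + b \<in> K" "case_nat (a + b) \<xi>' \<in> G" for a
    unfolding g'_def m_def
    by (rule osc_le[OF osc c]) (use that a0 SX eqv' eqv_case_nat in auto)
  have B3: "\<bar>g a - g' (a + t j)\<bar> \<le> c * e"
    if j: "j \<in> I" and a: "\<pi> a = 0" "a + b \<in> K" "case_nat (a + b) \<xi> \<in> G" "\<phi> j (a + b) > 0"
      and a': "\<pi> (a + t j) = 0" "(a + t j) + b \<in> K" "case_nat ((a + t j) + b) \<xi>' \<in> G" for a j
  proof -
    have eq: "a + t j + b = (a + b) + t j" by simp
    have "\<bar>g a - g' (a + t j)\<bar> \<le> c * min 1 (pdist A (S (u, a + b)) (S (u', a + t j + b)) (case_nat (a + b) \<xi>) (case_nat (a + t j + b) \<xi>') / \<delta>)"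
      unfolding g_def g'_def using osc eqv_case_nat[OF eqv a(3) a'(3) a(1) a'(1)] SX a a'
      unfolding osc_def by blast
    also have "\<dots> \<le> c * e"
      using steer[OF j a(2) _ a(4)] a'(2) c unfolding eq by (intro mult_left_mono) (auto simp: min_le_iff_disj)
    finally show ?thesis .
  qed
  have "\<bar>(\<Sum>j\<in>I. \<integral>a. g a * \<alpha> j a \<partial>?\<Lambda>) - (\<Sum>j\<in>I. \<integral>a. g' a * \<alpha>' j a \<partial>?\<Lambda>)\<bar>
    \<le> c * e + c * (\<Sum>j\<in>I. \<integral>a. \<bar>\<alpha> j a - \<alpha>' j (a + t j)\<bar> \<partial>?\<Lambda>)"
  proof (rule shift_coupling_bound[OF I _ _ _ _ _ _ _ _ gm gb c])
    show "distr ?\<Lambda> borel (\<lambda>a. a + t j) = ?\<Lambda>" if "j \<in> I" for j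
      by (rule basis_lebesgue_translate[OF scE B_fin t(1)[OF that]])
    show "integrable ?\<Lambda> (\<alpha> j)" "integrable ?\<Lambda> (\<alpha>' j)" if "j \<in> I" for j
      unfolding \<alpha>_def \<alpha>'_def using \<phi>i[OF that] \<xi> by blast+
    show "0 \<le> \<alpha> j a" "0 \<le> \<alpha>' j a" for j a
      unfolding \<alpha>_def \<alpha>'_def using \<phi>0 q_nonneg \<xi> by auto
    show "(\<Sum>j\<in>I. \<integral>a. \<alpha> j a \<partial>?\<Lambda>) = 1" "(\<Sum>j\<in>I. \<integral>a. \<alpha>' j a \<partial>?\<Lambda>) = 1"
      unfolding \<alpha>_def \<alpha>'_def by (rule mass[OF \<xi>(1) b(1)] mass[OF \<xi>(2) b(2)])+
    show "0 \<le> c * e" using c e by simp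
    have pos: "0 < q \<xi>0 a \<and> 0 < \<phi> j (a + b)" if "0 < \<phi> j (a + b) * q \<xi>0 a" "\<xi>0 \<in> G" for \<xi>0 j a
      using that \<phi>0[of j "a + b"] q_nonneg[OF that(2), of a] by (auto simp: zero_less_mult_iff)
    show "AE a in ?\<Lambda>. 0 < \<alpha> j a \<longrightarrow> \<bar>g a - m\<bar> \<le> c" if "j \<in> I" for j
      using good1 by eventually_elim (use pos \<xi> B1 in \<open>auto simp: \<alpha>_def\<close>)
    show "AE a in ?\<Lambda>. 0 < \<alpha>' j a \<longrightarrow> \<bar>g' a - m\<bar> \<le> c" if "j \<in> I" for j
      using good2 by eventually_elim (use pos \<xi> B2 in \<open>auto simp: \<alpha>'_def\<close>)
    show "AE a in ?\<Lambda>. 0 < \<alpha> j a \<longrightarrow> 0 < \<alpha>' j (a + t j) \<longrightarrow> \<bar>g a - g' (a + t j)\<bar> \<le> c * e" if j: "j \<in> I" for j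
    proof -
      have "AE a in distr ?\<Lambda> borel (\<lambda>a. a + t j). 0 < q \<xi>' a \<longrightarrow> \<pi> a = 0 \<and> a + b \<in> K \<and> case_nat (a + b) \<xi>' \<in> G"
        unfolding basis_lebesgue_translate[OF scE B_fin t(1)[OF j]] by (rule good2)
      then have "AE a in ?\<Lambda>. 0 < q \<xi>' (a + t j) \<longrightarrow> \<pi> (a + t j) = 0 \<and> (a + t j) + b \<in> K \<and> case_nat ((a + t j) + b) \<xi>' \<in> G"
        by (subst (asm) AE_distr_iff) auto
      with good1 show ?thesis
      proof eventually_elim
        case (elim a)
        show ?case
        proof (intro impI)
          assume p: "0 < \<alpha> j a" "0 < \<alpha>' j (a + t j)"
          then have "0 < q \<xi> a \<and> 0 < \<phi> j (a + b)" "0 < q \<xi>' (a + t j)"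
            using pos[of j a \<xi>] pos[of j "a + t j" \<xi>'] \<xi> by (auto simp: \<alpha>_def \<alpha>'_def)
          then show "\<bar>g a - g' (a + t j)\<bar> \<le> c * e" using elim j by (intro B3) auto
        qed
      qed
    qed
  qed simp
  also have "(\<Sum>j\<in>I. \<integral>a. g a * \<alpha> j a \<partial>?\<Lambda>) = (\<integral>a. g a \<partial>QA \<xi>)"
    unfolding \<alpha>_def by (rule sums[OF \<xi>(1) b(1) gm(1) gb(1), symmetric])
  also have "(\<Sum>j\<in>I. \<integral>a. g' a * \<alpha>' j a \<partial>?\<Lambda>) = (\<integral>a. g' a \<partial>QA \<xi>')"
    unfolding \<alpha>'_def by (rule sums[OF \<xi>(2) b(2) gm(2) gb(2), symmetric])
  finally have 1: "\<bar>(\<integral>a. g a \<partial>QA \<xi>) - (\<integral>a. g' a \<partial>QA \<xi>')\<bar> \<le> c * e + c * (\<Sum>j\<in>I. \<integral>a. \<bar>\<alpha> j a - \<alpha>' j (a + t j)\<bar> \<partial>?\<Lambda>)" .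
  have "(\<integral>a. \<bar>\<alpha> j a - \<alpha>' j (a + t j)\<bar> \<partial>?\<Lambda>) \<le>
      M * norm (t j) + L * (past_dist \<iota> \<xi> \<xi>' + norm (t j)) * measure ?\<Lambda> (cball 0 (R + T))" if j: "j \<in> I" for j
    unfolding \<alpha>_def \<alpha>'_def
    by (rule density_shift_L1[OF \<xi> t[OF j]])
      (use \<phi>0 \<phi>le[OF j] \<phi>L[of j "_ + b" "_ + b"] in \<open>auto simp: dist_norm\<close>)
  then have "(\<Sum>j\<in>I. \<integral>a. \<bar>\<alpha> j a - \<alpha>' j (a + t j)\<bar> \<partial>?\<Lambda>) \<le>
      (\<Sum>j\<in>I. M * norm (t j) + L * (past_dist \<iota> \<xi> \<xi>' + norm (t j)) * measure ?\<Lambda> (cball 0 (R + T)))"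
    by (rule sum_mono)
  then have "c * (\<Sum>j\<in>I. \<integral>a. \<bar>\<alpha> j a - \<alpha>' j (a + t j)\<bar> \<partial>?\<Lambda>) \<le>
      c * (\<Sum>j\<in>I. M * norm (t j) + L * (past_dist \<iota> \<xi> \<xi>' + norm (t j)) * measure ?\<Lambda> (cball 0 (R + T)))"
    using c by (rule mult_left_mono)
  with 1 show ?thesis unfolding g_def g'_def by linarith
qed

text \<open>One step multiplies the distance by at most \<open>\<kappa>1\<close>, apart from a loss
  of at most \<open>C\<close> times the distance in total variation. In units of
  \<open>\<delta>\<close> this loss carries the factor \<open>C * \<delta>\<close>, which a small
  \<open>\<delta>\<close> pushes below half of the gap \<open>1 - \<kappa>1\<close>.\<close>

lemma step_contraction_near:
  assumes W: "finite W" "W \<subseteq> span B" and r: "r > 0" and \<delta>0: "\<delta>0 > 0"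
    and steer: "\<And>u u' y0. u \<in> X \<Longrightarrow> u' \<in> X \<Longrightarrow> norm (u' - u) < \<delta>0 \<Longrightarrow> y0 \<in> K \<Longrightarrow>
      \<exists>w\<in>W. \<forall>y\<in>K. norm (y - y0) < r \<longrightarrow>
        norm (S (u', y + norm (u' - u) *\<^sub>R w) - S (u, y)) \<le> (1/4) * norm (u' - u)"
  obtains A \<delta> \<kappa> where "0 < A" "A \<le> 1" "0 < \<delta>" "\<delta> \<le> 1" "0 < \<kappa>" "\<kappa> < 1"
    "\<And>f c u u' \<xi> \<xi>'. f \<in> borel_measurable (borel \<Otimes>\<^sub>M seq_space) \<Longrightarrow> (\<And>z. \<bar>f z\<bar> \<le> 1) \<Longrightarrow>
      osc A \<delta> c f \<Longrightarrow> 0 \<le> c \<Longrightarrow> u \<in> X \<Longrightarrow> u' \<in> X \<Longrightarrow> eqv \<xi> \<xi>' \<Longrightarrow> pdist A u u' \<xi> \<xi>' < \<delta> \<Longrightarrow>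
      \<bar>step_op S Q f (u, \<xi>) - step_op S Q f (u', \<xi>')\<bar> \<le> c * \<kappa> * (pdist A u u' \<xi> \<xi>' / \<delta>)"
proof -
  obtain w0 where w0: "w0 \<ge> 0" "\<And>w. w \<in> W \<Longrightarrow> norm w \<le> w0"
    using finite_imp_bounded[OF W(1)] unfolding bounded_iff
    by (metis abs_ge_self abs_ge_zero dual_order.trans)
  obtain I \<phi> M where I: "finite I" "I \<subseteq> K" and M: "M \<ge> 0"
    and \<phi>: "\<And>j y. 0 \<le> \<phi> j y" "\<And>j y. \<phi> j y > 0 \<Longrightarrow> dist y j < r" "\<And>j y. j \<in> I \<Longrightarrow> \<phi> j y \<le> 1"
      "\<And>y. y \<in> K \<Longrightarrow> (\<Sum>j\<in>I. \<phi> j y) = 1"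
      "\<And>j y y'. \<bar>\<phi> j y - \<phi> j y'\<bar> \<le> M * dist y y'" "\<And>j. continuous_on UNIV (\<phi> j)"
    using Lipschitz_partition_of_unity[OF K_compact r] by metis
  \<comment> \<open>Chosen for \<open>A * w0 \<le> 1/4\<close>: the control remembered in the new
    past costs at most a quarter of \<open>h\<close>, beside the quarter left over by
    steering.\<close>
  define A where "A = min 1 (1 / (4 * (w0 + 1)))"
  have A: "0 < A" "A \<le> 1" using w0 by (auto simp: A_def)
  have Aw: "A * w0 \<le> 1/4"
  proof -
    have "A * w0 \<le> 1 / (4 * (w0 + 1)) * w0" using w0 by (intro mult_right_mono) (auto simp: A_def)
    also have "\<dots> \<le> 1/4" using w0 by (simp add: field_simps)
    finally show ?thesis .
  qed
  \<comment> \<open>The state part keeps at most 1/2 of its distance, the past part at most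
    \<open>1 / \<iota>\<close>.\<close>
  define \<kappa>1 where "\<kappa>1 = max (1/2) (1/\<iota>)"
  have \<kappa>1: "1/2 \<le> \<kappa>1" "1/\<iota> \<le> \<kappa>1" "\<kappa>1 < 1" using iota by (auto simp: \<kappa>1_def)
  define V where "V = measure (basis_lebesgue B) (cball 0 (R + w0))"
  have V: "V \<ge> 0" by (simp add: V_def)
  \<comment> \<open>The loss is proportional to \<open>h + p\<close>; dividing by \<open>A\<close>
    expresses it through \<open>D\<close>, since \<open>A * (h + p) \<le> D\<close>.\<close>
  define C where "C = real (card I) * (M * w0 + L * (1 + w0) * V) / A"
  have C: "C \<ge> 0" using M w0 L_nonneg V A by (simp add: C_def)
  define \<delta> where "\<delta> = min (min 1 \<delta>0) ((1 - \<kappa>1) / (2 * (C + 1)))"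
  have \<delta>: "0 < \<delta>" "\<delta> \<le> 1" "\<delta> \<le> \<delta>0" using \<delta>0 \<kappa>1 C by (auto simp: \<delta>_def)
  have C\<delta>: "C * \<delta> \<le> (1 - \<kappa>1) / 2"
  proof -
    have "C * \<delta> \<le> (C + 1) * ((1 - \<kappa>1) / (2 * (C + 1)))"
      using C \<delta> by (intro mult_mono) (auto simp: \<delta>_def)
    also have "\<dots> = (1 - \<kappa>1) / 2" using C by (simp add: field_simps)
    finally show ?thesis .
  qed
  define \<kappa> where "\<kappa> = (1 + \<kappa>1) / 2"
  have \<kappa>: "0 < \<kappa>" "\<kappa> < 1" using \<kappa>1 by (auto simp: \<kappa>_def)
  show thesis
  proof (rule that[OF A \<delta>(1,2) \<kappa>])
    fix f :: "'h \<times> (nat \<Rightarrow> 'e) \<Rightarrow> real" and c u u' \<xi> \<xi>'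
    assume f: "f \<in> borel_measurable (borel \<Otimes>\<^sub>M seq_space)" and fb: "\<And>z. \<bar>f z\<bar> \<le> 1"
      and osc: "osc A \<delta> c f" and c: "0 \<le> c" and u: "u \<in> X" "u' \<in> X" and eqv: "eqv \<xi> \<xi>'"
      and d: "pdist A u u' \<xi> \<xi>' < \<delta>"
    define h where "h = norm (u' - u)"
    define p where "p = past_dist \<iota> \<xi> \<xi>'"
    define D where "D = pdist A u u' \<xi> \<xi>'"
    have p0: "0 \<le> p" unfolding p_def by (rule past_dist_G_nonneg[OF eqv])
    have h0: "0 \<le> h" by (simp add: h_def)
    have Deq: "D = h + A * p" by (simp add: D_def pdist_def h_def p_def)
    have hD: "h \<le> D" "0 \<le> D" "A * (h + p) \<le> D"
      using A p0 h0 mult_left_le_one_le[of h A] by (auto simp: Deq distrib_left)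
    have h1: "h < \<delta>0" "h \<le> 1" using hD d \<delta> by (auto simp: D_def)
    have "\<forall>j\<in>I. \<exists>w\<in>W. \<forall>y\<in>K. norm (y - j) < r \<longrightarrow> norm (S (u', y + h *\<^sub>R w) - S (u, y)) \<le> (1/4) * h"
      using steer[OF u] h1 I(2) by (auto simp: h_def)
    then obtain w where w: "\<And>j. j \<in> I \<Longrightarrow> w j \<in> W"
      "\<And>j y. j \<in> I \<Longrightarrow> y \<in> K \<Longrightarrow> norm (y - j) < r \<Longrightarrow> norm (S (u', y + h *\<^sub>R w j) - S (u, y)) \<le> (1/4) * h"
      by metis
    define t where "t j = h *\<^sub>R w j" for j
    have tB: "t j \<in> span B" if "j \<in> I" for j
      using w(1)[OF that] W(2) by (auto simp: t_def intro: span_scale)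
    have nt: "norm (t j) \<le> h * w0" if "j \<in> I" for j
      using w0(2)[OF w(1)[OF that]] h0 by (simp add: t_def mult_left_mono)
    have nt': "norm (t j) \<le> w0" if "j \<in> I" for j
      using nt[OF that] mult_right_mono[OF h1(2) w0(1)] by simp
    define e where "e = \<kappa>1 * (D / \<delta>)"
    have e: "0 \<le> e" using hD \<delta> \<kappa>1 by (simp add: e_def)
    have steer': "pdist A (S (u, y)) (S (u', y + t j)) (case_nat y \<xi>) (case_nat (y + t j) \<xi>') / \<delta> \<le> e"
      if j: "j \<in> I" and y: "y \<in> K" "y + t j \<in> K" "\<phi> j y > 0" for j y
    proof -
      have "norm (y - j) < r" using \<phi>(2)[OF y(3)] by (simp add: dist_norm)
      then have 1: "norm (S (u', y + t j) - S (u, y)) \<le> (1/4) * h" using w(2)[OF j y(1)] by (simp add: t_def)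
      have "pdist A (S (u, y)) (S (u', y + t j)) (case_nat y \<xi>) (case_nat (y + t j) \<xi>')
          = norm (S (u', y + t j) - S (u, y)) + A * (norm (t j) + p / \<iota>)"
        unfolding pdist_def past_dist_G_case_nat[OF eqv y(1,2)] p_def by (simp add: norm_minus_commute)
      also have "\<dots> \<le> (1/4) * h + A * (h * w0 + p / \<iota>)"
        using 1 nt[OF j] A by (intro add_mono mult_left_mono) auto
      also have "\<dots> = (1/4 + A * w0) * h + (1/\<iota>) * (A * p)" by (simp add: algebra_simps)
      also have "\<dots> \<le> \<kappa>1 * h + \<kappa>1 * (A * p)"
        using Aw \<kappa>1 h0 p0 A by (intro add_mono mult_right_mono) auto
      also have "\<dots> = \<kappa>1 * D" by (simp add: Deq algebra_simps)
      finally show ?thesis using \<delta> by (simp add: e_def divide_right_mono)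
    qed
    have sumle: "(\<Sum>j\<in>I. M * norm (t j) + L * (p + norm (t j)) * V) \<le> C * D"
    proof -
      have "(\<Sum>j\<in>I. M * norm (t j) + L * (p + norm (t j)) * V) \<le> (\<Sum>j\<in>I. (M * w0 + L * (1 + w0) * V) * (h + p))"
      proof (rule sum_mono)
        fix j assume j: "j \<in> I"
        have 1: "norm (t j) \<le> w0 * (h + p)"
          using nt[OF j] mult_left_mono[of h "h + p" w0] w0 p0 by (simp add: mult.commute)
        have 2: "p + norm (t j) \<le> (1 + w0) * (h + p)"
          using 1 h0 by (simp add: algebra_simps)
        have "M * norm (t j) \<le> M * (w0 * (h + p))" using 1 M by (rule mult_left_mono)
        moreover have "L * (p + norm (t j)) * V \<le> L * ((1 + w0) * (h + p)) * V"
          using 2 L_nonneg V by (intro mult_right_mono mult_left_mono)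
        ultimately show "M * norm (t j) + L * (p + norm (t j)) * V \<le> (M * w0 + L * (1 + w0) * V) * (h + p)"
          by (simp add: algebra_simps)
      qed
      also have "\<dots> = C * (A * (h + p))" using A by (simp add: C_def)
      also have "\<dots> \<le> C * D" using hD C by (intro mult_left_mono)
      finally show ?thesis .
    qed
    have \<xi>: "\<xi> \<in> G" "\<xi>' \<in> G" using eqv by (auto simp: eqv_def)
    have QBeq: "QB \<xi>' = QB \<xi>" using eqv_QB[OF eqv] by simp
    let ?I = "\<lambda>b. \<integral>a. f (S (u, a + b), case_nat (a + b) \<xi>) \<partial>QA \<xi>"
    let ?I' = "\<lambda>b. \<integral>a. f (S (u', a + b), case_nat (a + b) \<xi>') \<partial>QA \<xi>'"
    have "AE b in QB \<xi>. \<pi> b = b \<and> (AE a in QA \<xi>'. \<pi> a = 0 \<and> a + b \<in> K \<and> case_nat (a + b) \<xi>' \<in> G)"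
      using AE_good[OF \<xi>(2)] unfolding QBeq .
    with AE_good[OF \<xi>(1)]
    have key: "AE b in QB \<xi>. \<bar>?I b - ?I' b\<bar> \<le> c * e + c * (C * D)"
    proof eventually_elim
      case (elim b)
      have "\<bar>?I b - ?I' b\<bar> \<le> c * e + c * (\<Sum>j\<in>I. M * norm (t j) + L * (past_dist \<iota> \<xi> \<xi>' + norm (t j)) * measure (basis_lebesgue B) (cball 0 (R + w0)))"
        by (rule inner_contraction[OF f fb osc c e u eqv I(1) \<phi>(6,1,4,3,5) tB nt' steer'])
          (use elim in blast)+
      also have "\<dots> \<le> c * e + c * (C * D)"
        using sumle c unfolding p_def V_def by (intro add_left_mono mult_left_mono)
      finally show ?case .
    qed
    have "step_op S Q f (u, \<xi>) - step_op S Q f (u', \<xi>') = (\<integral>b. ?I b \<partial>QB \<xi>) - (\<integral>b. ?I' b \<partial>QB \<xi>)"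
      using step_split[OF \<xi>(1) f fb] step_split[OF \<xi>(2) f fb] by (simp add: QBeq)
    also have "\<dots> = (\<integral>b. ?I b - ?I' b \<partial>QB \<xi>)"
      by (rule Bochner_Integration.integral_diff[symmetric]; rule inner_integral[OF f fb])
    finally have "\<bar>step_op S Q f (u, \<xi>) - step_op S Q f (u', \<xi>')\<bar> \<le> (\<integral>b. \<bar>?I b - ?I' b\<bar> \<partial>QB \<xi>)"
      by (simp add: integral_abs_bound)
    also have "\<dots> \<le> (\<integral>b. c * e + c * (C * D) \<partial>QB \<xi>)"
      by (intro integral_mono_AE key integrable_abs Bochner_Integration.integrable_diff inner_integral[OF f fb]) auto
    also have "\<dots> = c * (e + C * D)" by (simp add: QB.prob_space distrib_left)
    also have "\<dots> \<le> c * (\<kappa> * (D / \<delta>))"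
    proof (rule mult_left_mono[OF _ c])
      have "C * D = (C * \<delta>) * (D / \<delta>)" using \<delta> by simp
      also have "\<dots> \<le> ((1 - \<kappa>1) / 2) * (D / \<delta>)" using C\<delta> hD \<delta> by (intro mult_right_mono) auto
      finally have "C * D \<le> ((1 - \<kappa>1) / 2) * (D / \<delta>)" .
      moreover have "\<kappa> * (D / \<delta>) = \<kappa>1 * (D / \<delta>) + ((1 - \<kappa>1) / 2) * (D / \<delta>)"
        unfolding \<kappa>_def by (simp add: algebra_simps add_divide_distrib diff_divide_distrib)
      ultimately show "e + C * D \<le> \<kappa> * (D / \<delta>)" unfolding e_def by (metis add_left_mono)
    qed
    finally show "\<bar>step_op S Q f (u, \<xi>) - step_op S Q f (u', \<xi>')\<bar> \<le> c * \<kappa> * (pdist A u u' \<xi> \<xi>' / \<delta>)"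
      by (simp add: D_def mult.assoc)
  qed
qed

text \<open>The states at time \<open>m - n\<close> are arbitrary points of \<open>X\<close>.
  Dissipation erases them within \<open>n\<close> steps of small noise, and the same
  \<open>n\<close> recent entries make the two pasts close. Hence one \<open>n\<close> works for
  every \<open>m \<ge> n\<close>.\<close>

lemma near_after_small_noise:
  assumes dissip: "\<And>\<epsilon> n0. \<epsilon> > 0 \<Longrightarrow> \<exists>n\<ge>n0. \<exists>d>0. \<forall>x\<in>X. \<forall>\<xi>\<in>past_seqs K. (\<forall>i<n. norm (\<xi> i) < d) \<longrightarrow> norm (run S n x \<xi>) < \<epsilon>"
    and A: "0 < A" "A \<le> 1" and \<delta>: "0 < \<delta>"
  obtains n d where "d > 0" "n \<ge> 1"
    "\<And>m x x' \<xi> \<xi>'. m \<ge> n \<Longrightarrow> x \<in> X \<Longrightarrow> x' \<in> X \<Longrightarrow> eqv \<xi> \<xi>' \<Longrightarrow> \<xi> \<in> smallA n d \<inter> smallB n d \<Longrightarrow>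
      \<xi>' \<in> smallA n d \<inter> smallB n d \<Longrightarrow> pdist A (run S m x \<xi>) (run S m x' \<xi>') \<xi> \<xi>' \<le> \<delta> / 2"
proof -
  obtain RK where RK: "RK > 0" "\<And>y. y \<in> K \<Longrightarrow> norm y \<le> RK"
    using K_bounded unfolding bounded_pos by auto
  define g where "g = \<iota> / (\<iota> - 1)"
  have g: "g > 0" using iota by (simp add: g_def)
  \<comment> \<open>The constants share out \<open>\<delta> / 2\<close>: a quarter of
    \<open>\<delta>\<close> for the two runs together and a quarter for the pasts, the latter
    divided equally between recent and old entries.\<close>
  have "(\<lambda>n. (1 / \<iota>) ^ n) \<longlonglongrightarrow> 0" using iota by (intro LIMSEQ_power_zero) simp
  then have "\<forall>\<^sub>F n in sequentially. (1 / \<iota>) ^ n < \<delta> / (16 * RK * g)"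
    using \<delta> RK g by (intro order_tendstoD) auto
  then obtain n0 where n0: "\<And>n. n \<ge> n0 \<Longrightarrow> (1 / \<iota>) ^ n < \<delta> / (16 * RK * g)"
    by (auto simp: eventually_sequentially)
  obtain n d where n: "n \<ge> Suc n0" and d: "d > 0"
    and run: "\<And>x \<xi>. x \<in> X \<Longrightarrow> \<xi> \<in> past_seqs K \<Longrightarrow> (\<forall>i<n. norm (\<xi> i) < d) \<Longrightarrow> norm (run S n x \<xi>) < \<delta> / 8"
    using dissip[of "\<delta>/8" "Suc n0"] \<delta> by auto
  define d1 where "d1 = min d (\<delta> / (16 * g))"
  have d1: "d1 > 0" using d \<delta> g by (simp add: d1_def)
  show thesis
  \<comment> \<open>Halved because the noise is the sum of its two components.\<close>
  proof (rule that[of "d1 / 2" n])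
    show "d1 / 2 > 0" using d1 by simp
    show "n \<ge> 1" using n by simp
    fix m x x' \<xi> \<xi>'
    assume m: "m \<ge> n" and x: "x \<in> X" "x' \<in> X" and eqv: "eqv \<xi> \<xi>'"
      and s: "\<xi> \<in> smallA n (d1/2) \<inter> smallB n (d1/2)" "\<xi>' \<in> smallA n (d1/2) \<inter> smallB n (d1/2)"
    have past: "\<xi> \<in> past_seqs K" "\<xi>' \<in> past_seqs K" using eqv G_past by (auto simp: eqv_def)
    have small: "norm (\<zeta> i) < d1" if "\<zeta> \<in> smallA n (d1/2) \<inter> smallB n (d1/2)" "i < n" for \<zeta> :: "nat \<Rightarrow> 'e" and i
    proof -
      have "norm (\<zeta> i - \<pi> (\<zeta> i)) < d1/2" "norm (\<pi> (\<zeta> i)) < d1/2" using that by auto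
      then show ?thesis using norm_triangle_ineq[of "\<zeta> i - \<pi> (\<zeta> i)" "\<pi> (\<zeta> i)"] by simp
    qed
    have runs: "norm (run S m x0 \<zeta>) < \<delta> / 8"
      if "x0 \<in> X" "\<zeta> \<in> past_seqs K" "\<zeta> \<in> smallA n (d1/2) \<inter> smallB n (d1/2)" for x0 \<zeta>
    proof -
      have "run S m x0 \<zeta> = run S n (run S (m - n) x0 (\<lambda>i. \<zeta> (i + n))) \<zeta>"
        using run_add[of S n "m - n"] m by simp
      moreover have "run S (m - n) x0 (\<lambda>i. \<zeta> (i + n)) \<in> X"
        by (rule run_in[of X K S, OF X_inv]) (use that in \<open>auto simp: past_seqs_def\<close>)
      moreover have "\<forall>i<n. norm (\<zeta> i) < d" using small[OF that(3)] by (auto simp: d1_def)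
      ultimately show ?thesis using run that(2) by simp
    qed
    have "norm (run S m x' \<xi>' - run S m x \<xi>) \<le> \<delta> / 4"
      using norm_triangle_ineq4[of "run S m x' \<xi>'" "run S m x \<xi>"] runs[OF x(1) past(1) s(1)] runs[OF x(2) past(2) s(2)]
      by simp
    moreover have "A * past_dist \<iota> \<xi> \<xi>' \<le> \<delta> / 4"
    proof -
      have "past_dist \<iota> \<xi> \<xi>' \<le> (2 * d1 + 2 * RK / \<iota> ^ n) * g"
        unfolding g_def
        by (rule past_dist_le[OF K_bounded past iota RK(2) _ _ d1]) (use small s in auto)
      also have "\<dots> = 2 * d1 * g + 2 * RK * g * (1 / \<iota>) ^ n"
        by (simp add: algebra_simps power_divide)
      also have "2 * d1 * g \<le> 2 * (\<delta> / (16 * g)) * g" using g by (intro mult_right_mono) (auto simp: d1_def)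
      also have "2 * (\<delta> / (16 * g)) * g = \<delta> / 8" using g by simp
      also have "2 * RK * g * (1 / \<iota>) ^ n \<le> 2 * RK * g * (\<delta> / (16 * RK * g))"
        using n0[of n] n RK g by (intro mult_left_mono) auto
      also have "2 * RK * g * (\<delta> / (16 * RK * g)) = \<delta> / 8" using RK g by simp
      finally have "past_dist \<iota> \<xi> \<xi>' \<le> \<delta> / 4" by simp
      moreover have "A * past_dist \<iota> \<xi> \<xi>' \<le> past_dist \<iota> \<xi> \<xi>'"
        using A past_dist_G_nonneg[OF eqv] by (intro mult_left_le_one_le) auto
      ultimately show ?thesis by simp
    qed
    ultimately show "pdist A (run S m x \<xi>) (run S m x' \<xi>') \<xi> \<xi>' \<le> \<delta> / 2"
      by (simp add: pdist_def)
  qed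
qed

text \<open>In a block of \<open>m\<close> steps a near pair gains in its first step, the others
  being non-expansive, and a far pair gains from the chance that the noise is small at the end of
  the block. Both gains lower the same seminorm, so blocks can be iterated.\<close>

theorem geometric_contraction:
  assumes W: "finite W" "W \<subseteq> span B" and r: "r > 0" and \<delta>0: "\<delta>0 > 0"
    and steer: "\<And>u u' y0. u \<in> X \<Longrightarrow> u' \<in> X \<Longrightarrow> norm (u' - u) < \<delta>0 \<Longrightarrow> y0 \<in> K \<Longrightarrow>
      \<exists>w\<in>W. \<forall>y\<in>K. norm (y - y0) < r \<longrightarrow>
        norm (S (u', y + norm (u' - u) *\<^sub>R w) - S (u, y)) \<le> (1/4) * norm (u' - u)"
    and dissip: "\<And>\<epsilon> n0. \<epsilon> > 0 \<Longrightarrow> \<exists>n\<ge>n0. \<exists>d>0. \<forall>x\<in>X. \<forall>\<xi>\<in>past_seqs K. (\<forall>i<n. norm (\<xi> i) < d) \<longrightarrow> norm (run S n x \<xi>) < \<epsilon>"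
    and recur: "\<And>n d. n \<ge> 1 \<Longrightarrow> d > 0 \<Longrightarrow> \<exists>s. \<exists>\<epsilon>>0. \<forall>\<xi>\<in>G. hit_prob Q {\<xi>. \<forall>i<n. norm (\<xi> i) < d} (s + n) \<xi> \<ge> \<epsilon>"
  obtains C \<gamma> where "0 < C" "0 < \<gamma>"
    "\<And>f u u' \<xi> k. 1-lipschitz_on UNIV f \<Longrightarrow> (\<And>x. \<bar>f x\<bar> \<le> 1) \<Longrightarrow> u \<in> X \<Longrightarrow> u' \<in> X \<Longrightarrow> \<xi> \<in> G \<Longrightarrow>
      \<bar>(step_op S Q ^^ k) (\<lambda>z. f (fst z)) (u, \<xi>) - (step_op S Q ^^ k) (\<lambda>z. f (fst z)) (u', \<xi>)\<bar> \<le> C * exp (- \<gamma> * real k)"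
proof -
  obtain A \<delta> \<kappa> where A: "0 < A" "A \<le> 1" and \<delta>: "0 < \<delta>" "\<delta> \<le> 1" and \<kappa>: "0 < \<kappa>" "\<kappa> < 1"
    and near: "\<And>f c u u' \<xi> \<xi>'. f \<in> borel_measurable (borel \<Otimes>\<^sub>M seq_space) \<Longrightarrow> (\<And>z. \<bar>f z\<bar> \<le> 1) \<Longrightarrow>
      osc A \<delta> c f \<Longrightarrow> 0 \<le> c \<Longrightarrow> u \<in> X \<Longrightarrow> u' \<in> X \<Longrightarrow> eqv \<xi> \<xi>' \<Longrightarrow> pdist A u u' \<xi> \<xi>' < \<delta> \<Longrightarrow>
      \<bar>step_op S Q f (u, \<xi>) - step_op S Q f (u', \<xi>')\<bar> \<le> c * \<kappa> * (pdist A u u' \<xi> \<xi>' / \<delta>)"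
    using step_contraction_near[OF W r \<delta>0 steer] by blast
  obtain n d where d: "d > 0" and n: "n \<ge> 1"
    and small: "\<And>m x x' \<xi> \<xi>'. m \<ge> n \<Longrightarrow> x \<in> X \<Longrightarrow> x' \<in> X \<Longrightarrow> eqv \<xi> \<xi>' \<Longrightarrow> \<xi> \<in> smallA n d \<inter> smallB n d \<Longrightarrow>
      \<xi>' \<in> smallA n d \<inter> smallB n d \<Longrightarrow> pdist A (run S m x \<xi>) (run S m x' \<xi>') \<xi> \<xi>' \<le> \<delta> / 2"
    by (rule near_after_small_noise[OF dissip A \<delta>(1)]) (assumption, rule that, assumption+)
  obtain b where b: "b > 0" "\<And>y. norm (\<pi> y) \<le> norm y * b"
    using bounded_linear.pos_bounded[OF pi_lin] by blast
  define d' where "d' = d / (1 + b)"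
  have d': "d' > 0" using d b by (simp add: d'_def)
  have dd: "norm (y - \<pi> y) < d \<and> norm (\<pi> y) < d" if "norm y < d'" for y
  proof -
    have "norm y * (1 + b) < d" using that b by (simp add: d'_def pos_less_divide_eq)
    then have "norm y + norm y * b < d" by (simp add: distrib_left)
    then show ?thesis using b(2)[of y] norm_triangle_ineq4[of y "\<pi> y"] norm_ge_zero[of y] by linarith
  qed
  obtain s \<epsilon> where \<epsilon>: "\<epsilon> > 0"
    and hit: "\<And>\<xi>. \<xi> \<in> G \<Longrightarrow> hit_prob Q {\<xi>. \<forall>i<n. norm (\<xi> i) < d'} (s + n) \<xi> \<ge> \<epsilon>"
    using recur[OF n d'] by blast
  define m where "m = s + n"
  have m: "m \<ge> n" "m \<ge> 1" using n by (auto simp: m_def)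
  have hitA: "\<epsilon> \<le> hit_prob QA (smallA n d) m \<xi>" and hitB: "\<epsilon> \<le> hit_prob QB (smallB n d) m \<xi>" if "\<xi> \<in> G" for \<xi>
    using hit_prob_le_components[where \<delta>' = d' and \<delta> = d and n = n and j = m, OF dd that] hit[OF that]
    unfolding m_def by linarith+
  \<comment> \<open>One factor \<open>\<epsilon>\<close> for the shared component and one for each
    of the two components in \<open>span B\<close>; the factor 1/2 is the gain at distance
    \<open>\<delta> / 2\<close>.\<close>
  define \<kappa>' where "\<kappa>' = max \<kappa> (1 - \<epsilon>^3 / 2)"
  have \<kappa>': "0 < \<kappa>'" "\<kappa>' < 1" using \<kappa> \<epsilon> by (auto simp: \<kappa>'_def)
  have diff: "\<bar>(step_op S Q ^^ j) f (u, \<xi>) - (step_op S Q ^^ j) f (u', \<xi>')\<bar> \<le>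
      c * (1 - 1/2 * hit_prob QB (smallB n d) j \<xi> * hit_prob QA (smallA n d) j \<xi> * hit_prob QA (smallA n d) j \<xi>')"
    if f: "f \<in> borel_measurable (borel \<Otimes>\<^sub>M seq_space)" "\<And>z. \<bar>f z\<bar> \<le> 1" "osc A \<delta> c f" "0 \<le> c"
      and u: "u \<in> X" "u' \<in> X" and e: "eqv \<xi> \<xi>'" and j: "j = m" for f c u u' \<xi> \<xi>' j
  proof -
    have "\<bar>(step_op S Q ^^ j) f (run S 0 u \<xi>, \<xi>) - (step_op S Q ^^ j) f (run S 0 u' \<xi>', \<xi>')\<bar> \<le>
      c * (1 - 1/2 * hit_prob QB (smallB n d) j \<xi> * hit_prob QA (smallA n d) j \<xi> * hit_prob QA (smallA n d) j \<xi>')"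
    proof (rule step_pow_difference[where m = m, OF f \<delta>(1) _ u e])
      show "0 + j = m" using j by simp
    qed (rule small[OF m(1)])
    then show ?thesis by simp
  qed
  have one: "osc A \<delta> c (step_op S Q f)"
    if f: "f \<in> borel_measurable (borel \<Otimes>\<^sub>M seq_space)" "\<And>z. \<bar>f z\<bar> \<le> 1" "osc A \<delta> c f" and c: "0 \<le> c" for f c
    unfolding osc_def
  proof (intro ballI allI impI)
    fix u u' \<xi> \<xi>' assume u: "u \<in> X" "u' \<in> X" and e: "eqv \<xi> \<xi>'"
    let ?D = "pdist A u u' \<xi> \<xi>'"
    have D0: "0 \<le> ?D" using past_dist_G_nonneg[OF e] A by (simp add: pdist_def)
    show "\<bar>step_op S Q f (u, \<xi>) - step_op S Q f (u', \<xi>')\<bar> \<le> c * min 1 (?D / \<delta>)"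
    proof (cases "?D < \<delta>")
      case True
      have "\<bar>step_op S Q f (u, \<xi>) - step_op S Q f (u', \<xi>')\<bar> \<le> c * \<kappa> * (?D / \<delta>)"
        by (rule near[OF f c u e True])
      also have "\<dots> \<le> c * 1 * (?D / \<delta>)"
        using \<kappa> c D0 \<delta> by (intro mult_right_mono mult_left_mono) auto
      finally show ?thesis using True \<delta> by (simp add: min_def)
    next
      case False
      \<comment> \<open>With threshold 0 the smallness events are empty, so the closeness condition
        of \<open>step_pow_difference\<close> holds vacuously and its estimate reduces to
        non-expansion.\<close>
      have far: "pdist A (run S 1 x \<xi>) (run S 1 x' \<xi>') \<xi> \<xi>' \<le> \<delta> / 2"
        if "\<xi> \<in> smallA 1 0 \<inter> smallB 1 0" for x x' \<xi> \<xi>'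
      proof -
        from that have "\<forall>i<1. norm (\<xi> i - \<pi> (\<xi> i)) < 0" by blast
        then have "norm (\<xi> 0 - \<pi> (\<xi> 0)) < 0" by (rule allE[of _ 0]) simp
        then show ?thesis by simp
      qed
      have "\<bar>(step_op S Q ^^ 1) f (run S 0 u \<xi>, \<xi>) - (step_op S Q ^^ 1) f (run S 0 u' \<xi>', \<xi>')\<bar> \<le>
        c * (1 - 1/2 * hit_prob QB (smallB 1 0) 1 \<xi> * hit_prob QA (smallA 1 0) 1 \<xi> * hit_prob QA (smallA 1 0) 1 \<xi>')"
        by (rule step_pow_difference[OF f c \<delta>(1) far u e]) auto
      also have "\<dots> \<le> c * 1"
      proof (rule mult_left_mono[OF _ c])
        have "0 \<le> hit_prob QB (smallB 1 0) 1 \<xi> * hit_prob QA (smallA 1 0) 1 \<xi> * hit_prob QA (smallA 1 0) 1 \<xi>'"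
          by (intro mult_nonneg_nonneg hit_prob_bounds(1)[OF QA_ker small_sets(1)] hit_prob_bounds(1)[OF QB_ker small_sets(2)])
        then show "1 - 1/2 * hit_prob QB (smallB 1 0) 1 \<xi> * hit_prob QA (smallA 1 0) 1 \<xi> * hit_prob QA (smallA 1 0) 1 \<xi>' \<le> 1"
          by (simp add: mult.assoc)
      qed
      finally show ?thesis using False \<delta> by (simp add: min_def pos_less_divide_eq)
    qed
  qed
  have powosc: "osc A \<delta> c ((step_op S Q ^^ j) f)"
    if f: "f \<in> borel_measurable (borel \<Otimes>\<^sub>M seq_space)" "\<And>z. \<bar>f z\<bar> \<le> 1" "osc A \<delta> c f" and c: "0 \<le> c" for f c j
    by (induction j) (use f c one step_pow_measurable[OF f(1)] step_pow_bounded[OF f(1,2)] in simp_all)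
  have block: "osc A \<delta> (c * \<kappa>') ((step_op S Q ^^ m) f)"
    if f: "f \<in> borel_measurable (borel \<Otimes>\<^sub>M seq_space)" "\<And>z. \<bar>f z\<bar> \<le> 1" "osc A \<delta> c f" and c: "0 \<le> c" for f c
    unfolding osc_def
  proof (intro ballI allI impI)
    fix u u' \<xi> \<xi>' assume u: "u \<in> X" "u' \<in> X" and e: "eqv \<xi> \<xi>'"
    let ?D = "pdist A u u' \<xi> \<xi>'"
    have D0: "0 \<le> ?D" using past_dist_G_nonneg[OF e] A by (simp add: pdist_def)
    have G: "\<xi> \<in> G" "\<xi>' \<in> G" using e by (auto simp: eqv_def)
    show "\<bar>(step_op S Q ^^ m) f (u, \<xi>) - (step_op S Q ^^ m) f (u', \<xi>')\<bar> \<le> c * \<kappa>' * min 1 (?D / \<delta>)"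
    proof (cases "?D < \<delta>")
      case True
      have "\<bar>step_op S Q ((step_op S Q ^^ (m - 1)) f) (u, \<xi>) - step_op S Q ((step_op S Q ^^ (m - 1)) f) (u', \<xi>')\<bar> \<le> c * \<kappa> * (?D / \<delta>)"
        by (rule near[OF step_pow_measurable[OF f(1)] step_pow_bounded[OF f(1,2)] powosc[OF f c] c u e True])
      moreover have "step_op S Q ((step_op S Q ^^ (m - 1)) f) = (step_op S Q ^^ m) f"
        using m(2) by (cases m) auto
      moreover have "c * \<kappa> * (?D / \<delta>) \<le> c * \<kappa>' * (?D / \<delta>)"
        using c D0 \<delta> by (intro mult_right_mono mult_left_mono) (auto simp: \<kappa>'_def)
      ultimately show ?thesis using True \<delta> by (simp add: min_def)
    next
      case False
      have "\<bar>(step_op S Q ^^ m) f (u, \<xi>) - (step_op S Q ^^ m) f (u', \<xi>')\<bar> \<le>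
        c * (1 - 1/2 * hit_prob QB (smallB n d) m \<xi> * hit_prob QA (smallA n d) m \<xi> * hit_prob QA (smallA n d) m \<xi>')"
        by (rule diff[OF f c u e refl])
      also have "\<dots> \<le> c * \<kappa>'"
      proof (rule mult_left_mono[OF _ c])
        have "\<epsilon> * \<epsilon> * \<epsilon> \<le> hit_prob QB (smallB n d) m \<xi> * hit_prob QA (smallA n d) m \<xi> * hit_prob QA (smallA n d) m \<xi>'"
          using \<epsilon> hitA hitB G
          by (intro mult_mono mult_nonneg_nonneg hit_prob_bounds(1)[OF QA_ker small_sets(1)] hit_prob_bounds(1)[OF QB_ker small_sets(2)]) auto
        then have "1 - 1/2 * hit_prob QB (smallB n d) m \<xi> * hit_prob QA (smallA n d) m \<xi> * hit_prob QA (smallA n d) m \<xi>' \<le> 1 - \<epsilon>^3 / 2"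
          by (simp add: power3_eq_cube mult.assoc)
        then show "1 - 1/2 * hit_prob QB (smallB n d) m \<xi> * hit_prob QA (smallA n d) m \<xi> * hit_prob QA (smallA n d) m \<xi>' \<le> \<kappa>'"
          by (simp add: \<kappa>'_def)
      qed
      finally show ?thesis using False \<delta> by (simp add: min_def pos_less_divide_eq)
    qed
  qed
  define \<gamma> where "\<gamma> = - ln \<kappa>' / real m"
  have "ln \<kappa>' < 0" using \<kappa>' by simp
  then have \<gamma>: "\<gamma> > 0" unfolding \<gamma>_def using m by (intro divide_pos_pos) auto
  \<comment> \<open>2 bounds the initial seminorm, and \<open>1 / \<kappa>'\<close> makes up for the
    incomplete last block.\<close>
  define C where "C = 2 / \<kappa>'"
  show thesis
  proof (rule that[of C \<gamma>])
    show "C > 0" using \<kappa>' by (simp add: C_def)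
    show "\<gamma> > 0" by (rule \<gamma>)
    fix f :: "'h \<Rightarrow> real" and u u' \<xi> k
    assume f: "1-lipschitz_on UNIV f" "\<And>x. \<bar>f x\<bar> \<le> 1" and u: "u \<in> X" "u' \<in> X" and \<xi>: "\<xi> \<in> G"
    let ?f = "\<lambda>z::'h \<times> (nat \<Rightarrow> 'e). f (fst z)"
    have [measurable]: "f \<in> borel_measurable borel"
      using f(1) by (intro borel_measurable_continuous_onI lipschitz_on_continuous_on)
    have fm: "?f \<in> borel_measurable (borel \<Otimes>\<^sub>M seq_space)" by measurable
    have fb: "\<bar>?f z\<bar> \<le> 1" for z using f(2) by simp
    \<comment> \<open>Values of \<open>f\<close> differ by at most 2 and by at most the distance of
      the states; \<open>\<delta> \<le> 1\<close> turns both bounds into twice the truncated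
      distance.\<close>
    have fo: "osc A \<delta> 2 ?f"
      unfolding osc_def
    proof (intro ballI allI impI)
      fix v v' \<zeta> \<zeta>' assume e: "eqv \<zeta> \<zeta>'"
      have p0: "0 \<le> past_dist \<iota> \<zeta> \<zeta>'" by (rule past_dist_G_nonneg[OF e])
      have "\<bar>f v - f v'\<bar> \<le> 2" using f(2)[of v] f(2)[of v'] by linarith
      moreover have "\<bar>f v - f v'\<bar> \<le> 2 * (pdist A v v' \<zeta> \<zeta>' / \<delta>)"
      proof -
        have "\<bar>f v - f v'\<bar> \<le> norm (v' - v)"
          using lipschitz_onD[OF f(1), of v v'] by (simp add: dist_norm norm_minus_commute)
        also have "\<dots> \<le> pdist A v v' \<zeta> \<zeta>'" using p0 A by (simp add: pdist_def)
        also have "\<dots> \<le> 2 * (pdist A v v' \<zeta> \<zeta>' / \<delta>)"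
        proof -
          have "0 \<le> pdist A v v' \<zeta> \<zeta>'" using p0 A by (simp add: pdist_def)
          then have "pdist A v v' \<zeta> \<zeta>' * \<delta> \<le> 2 * pdist A v v' \<zeta> \<zeta>'"
            using \<delta> mult_left_mono[of \<delta> 2 "pdist A v v' \<zeta> \<zeta>'"] by (simp add: mult.commute)
          then show ?thesis using \<delta> by (simp add: pos_le_divide_eq)
        qed
        finally show ?thesis .
      qed
      ultimately show "\<bar>?f (v, \<zeta>) - ?f (v', \<zeta>')\<bar> \<le> 2 * min 1 (pdist A v v' \<zeta> \<zeta>' / \<delta>)"
        by (simp add: min_def)
    qed
    have blocks: "osc A \<delta> (2 * \<kappa>' ^ i) ((step_op S Q ^^ (m * i)) ?f)" for i
    proof (induction i)
      case (Suc i)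
      have "osc A \<delta> (2 * \<kappa>' ^ i * \<kappa>') ((step_op S Q ^^ m) ((step_op S Q ^^ (m * i)) ?f))"
        using \<kappa>' by (intro block Suc.IH step_pow_measurable step_pow_bounded fm fb) auto
      moreover have "(step_op S Q ^^ m) ((step_op S Q ^^ (m * i)) ?f) = (step_op S Q ^^ (m * Suc i)) ?f"
        by (simp add: funpow_add)
      ultimately show ?case by (simp add: mult_ac)
    qed (use fo in simp)
    have k: "k = k mod m + m * (k div m)" by simp
    have "osc A \<delta> (2 * \<kappa>' ^ (k div m)) ((step_op S Q ^^ (k mod m)) ((step_op S Q ^^ (m * (k div m))) ?f))"
      using \<kappa>' by (intro powosc step_pow_measurable step_pow_bounded blocks fm fb) auto
    also have "(step_op S Q ^^ (k mod m)) ((step_op S Q ^^ (m * (k div m))) ?f) = (step_op S Q ^^ (k mod m + m * (k div m))) ?f"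
      unfolding funpow_add by simp
    finally have "osc A \<delta> (2 * \<kappa>' ^ (k div m)) ((step_op S Q ^^ k) ?f)"
      by simp
    then have "\<bar>(step_op S Q ^^ k) ?f (u, \<xi>) - (step_op S Q ^^ k) ?f (u', \<xi>)\<bar> \<le> 2 * \<kappa>' ^ (k div m)"
      by (rule osc_le) (use \<kappa>' u eqv_refl[OF \<xi>] in auto)
    also have "\<kappa>' ^ (k div m) \<le> exp (- \<gamma> * real k) / \<kappa>'"
    proof -
      have "real k \<le> real m * (real (k div m) + 1)"
      proof -
        have "k mod m \<le> m" using m(2) by (simp add: less_imp_le)
        then have "k \<le> m * (k div m + 1)" using k by (metis add.commute add_le_mono1 mult.commute mult_Suc Suc_eq_plus1)
        then have "real k \<le> real (m * (k div m + 1))" by (rule of_nat_mono)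
        then show ?thesis by (simp add: algebra_simps)
      qed
      then have "ln \<kappa>' * (real m * (real (k div m) + 1)) \<le> ln \<kappa>' * real k"
        using \<kappa>' by (intro mult_left_mono_neg) auto
      then have "ln \<kappa>' * (real (k div m) + 1) \<le> - \<gamma> * real k"
        using m(2) by (simp add: \<gamma>_def field_simps)
      then have "exp (ln \<kappa>' * (real (k div m) + 1)) \<le> exp (- \<gamma> * real k)" by simp
      also have "exp (ln \<kappa>' * (real (k div m) + 1)) = \<kappa>' ^ (k div m) * \<kappa>'"
        using \<kappa>' by (simp add: distrib_left exp_add exp_of_nat2_mult mult.commute[of "ln \<kappa>'"] exp_of_nat_mult)
      finally show ?thesis using \<kappa>' by (simp add: pos_le_divide_eq)
    qed
    finally show "\<bar>(step_op S Q ^^ k) ?f (u, \<xi>) - (step_op S Q ^^ k) ?f (u', \<xi>)\<bar> \<le> C * exp (- \<gamma> * real k)"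
      by (simp add: C_def)
  qed
qed

end

section \<open>Stationary noise\<close>

lemma bind_pair_integral:
  fixes g :: "'a \<Rightarrow> 'b \<Rightarrow> real"
  assumes F: "prob_space F" "sets F = sets A" and Q: "Q \<in> measurable A (prob_algebra B)"
    and g[measurable]: "(\<lambda>(x, y). g x y) \<in> borel_measurable (A \<Otimes>\<^sub>M B)" and b: "\<And>x y. \<bar>g x y\<bar> \<le> b"
  shows "(\<integral>z. g (fst z) (snd z) \<partial>bind F (\<lambda>x. distr (Q x) (A \<Otimes>\<^sub>M B) (\<lambda>y. (x, y)))) = (\<integral>x. \<integral>y. g x y \<partial>Q x \<partial>F)"
proof -
  interpret F: prob_space F by fact
  note F(2)[measurable_cong] Q[measurable]
  have Q': "Q \<in> measurable F (prob_algebra B)" by measurable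
  have N: "(\<lambda>x. distr (Q x) (A \<Otimes>\<^sub>M B) (\<lambda>y. (x, y))) \<in> measurable F (prob_algebra (A \<Otimes>\<^sub>M B))"
    by measurable
  have gm: "(\<lambda>z. g (fst z) (snd z)) \<in> borel_measurable (A \<Otimes>\<^sub>M B)" using g by (simp add: split_beta')
  have "(\<integral>z. g (fst z) (snd z) \<partial>bind F (\<lambda>x. distr (Q x) (A \<Otimes>\<^sub>M B) (\<lambda>y. (x, y))))
    = (\<integral>x. (\<integral>z. g (fst z) (snd z) \<partial>distr (Q x) (A \<Otimes>\<^sub>M B) (\<lambda>y. (x, y))) \<partial>F)"
  proof (rule integral_bind[where B=b and B'=1])
    show "(\<lambda>z. g (fst z) (snd z)) \<in> borel_measurable (A \<Otimes>\<^sub>M B)" by (rule gm)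
    show "(\<lambda>x. distr (Q x) (A \<Otimes>\<^sub>M B) (\<lambda>y. (x, y))) \<in> measurable F (subprob_algebra (A \<Otimes>\<^sub>M B))"
      using N by (rule measurable_prob_algebraD)
    show "AE x in F. emeasure (distr (Q x) (A \<Otimes>\<^sub>M B) (\<lambda>y. (x, y))) (space (distr (Q x) (A \<Otimes>\<^sub>M B) (\<lambda>y. (x, y)))) \<le> ennreal 1"
    proof (rule AE_I2)
      fix x assume "x \<in> space F"
      then have "prob_space (distr (Q x) (A \<Otimes>\<^sub>M B) (\<lambda>y. (x, y)))"
        using measurable_space[OF N] by (simp add: space_prob_algebra)
      then show "emeasure (distr (Q x) (A \<Otimes>\<^sub>M B) (\<lambda>y. (x, y))) (space (distr (Q x) (A \<Otimes>\<^sub>M B) (\<lambda>y. (x, y)))) \<le> ennreal 1"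
        using prob_space.emeasure_space_1 by (metis ennreal_1 order_refl)
    qed
  qed (use b F.finite_measure_axioms in auto)
  also have "\<dots> = (\<integral>x. \<integral>y. g x y \<partial>Q x \<partial>F)"
  proof (rule Bochner_Integration.integral_cong[OF refl])
    fix x assume x: "x \<in> space F"
    then have "Q x \<in> space (prob_algebra B)" using Q' by (rule measurable_space[rotated])
    then have [measurable_cong]: "sets (Q x) = sets B" by (simp add: space_prob_algebra)
    have [measurable]: "(\<lambda>y. (x, y)) \<in> measurable (Q x) (A \<Otimes>\<^sub>M B)"
      using x sets_eq_imp_space_eq[OF F(2)] by simp
    show "(\<integral>z. g (fst z) (snd z) \<partial>distr (Q x) (A \<Otimes>\<^sub>M B) (\<lambda>y. (x, y))) = (\<integral>y. g x y \<partial>Q x)"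
      by (subst integral_distr) (use gm in auto)
  qed
  finally show ?thesis .
qed

lemma bind_pair_emeasure:
  assumes F: "prob_space F" "sets F = sets A" and Q: "Q \<in> measurable A (prob_algebra B)"
    and D: "D \<in> sets (A \<Otimes>\<^sub>M B)"
  shows "emeasure (bind F (\<lambda>x. distr (Q x) (A \<Otimes>\<^sub>M B) (\<lambda>y. (x, y)))) D = (\<integral>\<^sup>+x. emeasure (Q x) (Pair x -` D) \<partial>F)"
proof -
  interpret F: prob_space F by fact
  note F(2)[measurable_cong] Q[measurable]
  have Q': "Q \<in> measurable F (prob_algebra B)" by measurable
  have N: "(\<lambda>x. distr (Q x) (A \<Otimes>\<^sub>M B) (\<lambda>y. (x, y))) \<in> measurable F (prob_algebra (A \<Otimes>\<^sub>M B))"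
    by measurable
  have "emeasure (bind F (\<lambda>x. distr (Q x) (A \<Otimes>\<^sub>M B) (\<lambda>y. (x, y)))) D
    = (\<integral>\<^sup>+x. emeasure (distr (Q x) (A \<Otimes>\<^sub>M B) (\<lambda>y. (x, y))) D \<partial>F)"
    by (rule emeasure_bind[OF F.not_empty measurable_prob_algebraD[OF N]]) (use D in auto)
  also have "\<dots> = (\<integral>\<^sup>+x. emeasure (Q x) (Pair x -` D) \<partial>F)"
  proof (rule nn_integral_cong)
    fix x assume x: "x \<in> space F"
    then have "Q x \<in> space (prob_algebra B)" using Q' by (rule measurable_space[rotated])
    then have s[measurable_cong]: "sets (Q x) = sets B" by (simp add: space_prob_algebra)
    have m: "Pair x \<in> measurable (Q x) (A \<Otimes>\<^sub>M B)"
      using x sets_eq_imp_space_eq[OF F(2)] by simp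
    have "Pair x -` D \<inter> space (Q x) = Pair x -` D"
      using sets.sets_into_space[OF D] sets_eq_imp_space_eq[OF s] by (auto simp: space_pair_measure)
    then show "emeasure (distr (Q x) (A \<Otimes>\<^sub>M B) (Pair x)) D = emeasure (Q x) (Pair x -` D)"
      using emeasure_distr[OF m D] by simp
  qed
  finally show ?thesis .
qed

lemma bind_pair_emeasure_Times:
  assumes F: "prob_space F" "sets F = sets A" and Q: "Q \<in> measurable A (prob_algebra B)"
    and C: "C \<in> sets A" "D \<in> sets B"
  shows "emeasure (bind F (\<lambda>x. distr (Q x) (A \<Otimes>\<^sub>M B) (\<lambda>y. (x, y)))) (C \<times> D) =
    (\<integral>\<^sup>+x. indicator C x * emeasure (Q x) D \<partial>F)"
proof -
  have "Pair x -` (C \<times> D) = (if x \<in> C then D else {})" for x by auto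
  then show ?thesis
    using bind_pair_emeasure[OF F Q pair_measureI[OF C]] by (auto simp: indicator_def intro!: nn_integral_cong)
qed

lemma finite_pair_measure_eqI:
  assumes "finite_measure P" "sets P = sets (A \<Otimes>\<^sub>M B)" "sets P' = sets (A \<Otimes>\<^sub>M B)"
    and eq: "\<And>C D. C \<in> sets A \<Longrightarrow> D \<in> sets B \<Longrightarrow> emeasure P (C \<times> D) = emeasure P' (C \<times> D)"
  shows "P = P'"
proof -
  interpret finite_measure P by fact
  show ?thesis
  proof (rule measure_eqI_generator_eq[OF Int_stable_pair_measure_generator pair_measure_closed, of A B])
    show "sets P = sigma_sets (space A \<times> space B) {a \<times> b |a b. a \<in> sets A \<and> b \<in> sets B}"
      "sets P' = sigma_sets (space A \<times> space B) {a \<times> b |a b. a \<in> sets A \<and> b \<in> sets B}"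
      using assms by (simp_all add: sets_pair_measure)
    show "range (\<lambda>_::nat. space A \<times> space B) \<subseteq> {a \<times> b |a b. a \<in> sets A \<and> b \<in> sets B}" by auto
    show "emeasure P (space A \<times> space B) \<noteq> \<infinity>" by simp
  qed (use eq in auto)
qed

section \<open>The law of the past and its invariance\<close>

definition past_at :: "(int \<Rightarrow> 'w \<Rightarrow> 'a) \<Rightarrow> nat \<Rightarrow> 'w \<Rightarrow> nat \<Rightarrow> 'a" where
  "past_at \<eta> k \<omega> n = \<eta> (int k - int n) \<omega>"

lemma past_at_0: "past_at \<eta> 0 = past \<eta>"
  by (simp add: past_at_def past_def fun_eq_iff)

lemma past_at_Suc: "past_at \<eta> (Suc k) \<omega> = case_nat (\<eta> (int (Suc k)) \<omega>) (past_at \<eta> k \<omega>)"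
  by (auto simp: past_at_def fun_eq_iff split: nat.split)

lemma traj_eq_run: "traj S \<eta> v k \<omega> = run S k (v \<omega>) (past_at \<eta> k \<omega>)"
proof (induction k)
  case (Suc k)
  then show ?case unfolding past_at_Suc run_case_nat by simp
qed simp

lemma run_cong: "(\<And>i. i < k \<Longrightarrow> \<xi> i = \<xi>' i) \<Longrightarrow> run S k x \<xi> = run S k x \<xi>'"
proof (induction k arbitrary: \<xi> \<xi>')
  case (Suc k)
  have "run S k x (\<lambda>i. \<xi> (Suc i)) = run S k x (\<lambda>i. \<xi>' (Suc i))"
    by (rule Suc.IH) (use Suc.prems in auto)
  then show ?case using Suc.prems[of 0] by simp
qed simp

locale stationary_noise = prob_space M for M :: "'w measure" +
  fixes \<eta> :: "int \<Rightarrow> 'w \<Rightarrow> 'e::real_normed_vector" and K :: "'e set" and Q :: "(nat \<Rightarrow> 'e) \<Rightarrow> 'e measure"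
  assumes stat: "stationary_process M \<eta>" and scE': "second_countable_type TYPE('e)"
    and Kdef: "K = msupport (distr M borel (\<eta> 0))"
    and cond: "cond_law_version M \<eta> K Q"
begin

lemma eta_measurable [measurable]: "\<eta> k \<in> borel_measurable M"
  using stat by (simp add: stationary_process_def)

lemma past_at_measurable [measurable]: "past_at \<eta> k \<in> measurable M seq_space"
  by (rule measurable_PiM_single') (auto simp: past_at_def)

lemma past_measurable [measurable]: "past \<eta> \<in> measurable M seq_space"
  unfolding past_at_0[symmetric] by simp

definition past_law :: "(nat \<Rightarrow> 'e) measure" where
  "past_law = distr M seq_space (past \<eta>)"

lemma prob_space_past_law: "prob_space past_law"
  unfolding past_law_def by (rule prob_space_distr) simp

lemma sets_past_law [measurable_cong, simp]: "sets past_law = sets seq_space"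
  by (simp add: past_law_def)

lemma space_past_law [simp]: "space past_law = UNIV"
  by (simp add: past_law_def space_PiM)

lemma past_at_law: "distr M seq_space (past_at \<eta> k) = past_law"
proof -
  let ?P = "Pi\<^sub>M UNIV (\<lambda>_::int. borel :: 'e measure)"
  define g where "g w = (\<lambda>n. w (- int n))" for w :: "int \<Rightarrow> 'e"
  have g[measurable]: "g \<in> measurable ?P seq_space"
    unfolding g_def by (rule measurable_PiM_single') (auto simp: space_PiM)
  have m[measurable]: "(\<lambda>\<omega> j. \<eta> (j + h) \<omega>) \<in> measurable M ?P" for h
    by (rule measurable_PiM_single') auto
  have "distr M seq_space (past_at \<eta> k) = distr (distr M ?P (\<lambda>\<omega> j. \<eta> (j + int k) \<omega>)) seq_space g"
    by (subst distr_distr) (auto simp: g_def past_at_def[abs_def] comp_def algebra_simps)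
  also have "\<dots> = distr (distr M ?P (\<lambda>\<omega> j. \<eta> (j + 0) \<omega>)) seq_space g"
    using stat by (simp add: stationary_process_def)
  also have "\<dots> = past_law"
    using m[of 0] by (subst distr_distr) (auto simp: g_def past_law_def past_def[abs_def] comp_def)
  finally show ?thesis .
qed

lemma Q_kernel [measurable]: "Q \<in> measurable seq_space (prob_algebra borel)"
  using cond by (simp add: cond_law_version_def)

text \<open>The defining identity of a conditional law concerns rectangles, and these determine a
  finite measure on the product.\<close>

lemma joint_law: "distr M (seq_space \<Otimes>\<^sub>M borel) (\<lambda>\<omega>. (past \<eta> \<omega>, \<eta> 1 \<omega>)) =
    bind past_law (\<lambda>\<xi>. distr (Q \<xi>) (seq_space \<Otimes>\<^sub>M borel) (\<lambda>y. (\<xi>, y)))"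
proof (rule finite_pair_measure_eqI)
  show "finite_measure (distr M (seq_space \<Otimes>\<^sub>M borel) (\<lambda>\<omega>. (past \<eta> \<omega>, \<eta> 1 \<omega>)))"
    by (rule finite_measure_distr) measurable
  show "sets (bind past_law (\<lambda>\<xi>. distr (Q \<xi>) (seq_space \<Otimes>\<^sub>M borel) (\<lambda>y. (\<xi>, y)))) = sets (seq_space \<Otimes>\<^sub>M borel)"
    by (rule sets_bind) auto
  fix C :: "(nat \<Rightarrow> 'e) set" and D :: "'e set" assume [measurable]: "C \<in> sets seq_space" "D \<in> sets borel"
  have "emeasure (distr M (seq_space \<Otimes>\<^sub>M borel) (\<lambda>\<omega>. (past \<eta> \<omega>, \<eta> 1 \<omega>))) (C \<times> D)
    = emeasure M {\<omega>\<in>space M. past \<eta> \<omega> \<in> C \<and> \<eta> 1 \<omega> \<in> D}"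
    by (subst emeasure_distr) (auto intro!: arg_cong[where f="emeasure M"])
  also have "\<dots> = (\<integral>\<^sup>+\<omega>. indicator C (past \<eta> \<omega>) * emeasure (Q (past \<eta> \<omega>)) D \<partial>M)"
    using cond by (simp add: cond_law_version_def)
  also have "\<dots> = (\<integral>\<^sup>+\<xi>. indicator C \<xi> * emeasure (Q \<xi>) D \<partial>past_law)"
    unfolding past_law_def
    by (subst nn_integral_distr)
      (auto intro!: borel_measurable_times_ennreal borel_measurable_indicator
        measurable_compose[OF measurable_prob_algebraD[OF Q_kernel] measurable_emeasure_subprob_algebra])
  also have "\<dots> = emeasure (bind past_law (\<lambda>\<xi>. distr (Q \<xi>) (seq_space \<Otimes>\<^sub>M borel) (\<lambda>y. (\<xi>, y)))) (C \<times> D)"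
    by (rule bind_pair_emeasure_Times[symmetric]) (use prob_space_past_law in auto)
  finally show "emeasure (distr M (seq_space \<Otimes>\<^sub>M borel) (\<lambda>\<omega>. (past \<eta> \<omega>, \<eta> 1 \<omega>))) (C \<times> D) =
      emeasure (bind past_law (\<lambda>\<xi>. distr (Q \<xi>) (seq_space \<Otimes>\<^sub>M borel) (\<lambda>y. (\<xi>, y)))) (C \<times> D)" .
qed simp

lemma joint_integral:
  fixes g :: "(nat \<Rightarrow> 'e) \<Rightarrow> 'e \<Rightarrow> real"
  assumes g[measurable]: "(\<lambda>(\<xi>, y). g \<xi> y) \<in> borel_measurable (seq_space \<Otimes>\<^sub>M borel)" and b: "\<And>\<xi> y. \<bar>g \<xi> y\<bar> \<le> b"
  shows "(\<integral>\<omega>. g (past \<eta> \<omega>) (\<eta> 1 \<omega>) \<partial>M) = (\<integral>\<xi>. \<integral>y. g \<xi> y \<partial>Q \<xi> \<partial>past_law)"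
proof -
  have "(\<integral>\<omega>. g (past \<eta> \<omega>) (\<eta> 1 \<omega>) \<partial>M) = (\<integral>z. g (fst z) (snd z) \<partial>distr M (seq_space \<Otimes>\<^sub>M borel) (\<lambda>\<omega>. (past \<eta> \<omega>, \<eta> 1 \<omega>)))"
    by (subst integral_distr) auto
  also have "\<dots> = (\<integral>\<xi>. \<integral>y. g \<xi> y \<partial>Q \<xi> \<partial>past_law)"
    unfolding joint_law by (rule bind_pair_integral[OF prob_space_past_law _ _ g b]) auto
  finally show ?thesis .
qed

text \<open>Appending \<open>\<eta> 1\<close> to the past at time 0 yields the past at time 1, whose
  law is the same by stationarity.\<close>

lemma past_law_invariant:
  fixes g :: "(nat \<Rightarrow> 'e) \<Rightarrow> real"
  assumes [measurable]: "g \<in> borel_measurable seq_space" and b: "\<And>\<xi>. \<bar>g \<xi>\<bar> \<le> b"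
  shows "(\<integral>\<xi>. g \<xi> \<partial>past_law) = (\<integral>\<xi>. \<integral>y. g (case_nat y \<xi>) \<partial>Q \<xi> \<partial>past_law)"
proof -
  have "(\<integral>\<xi>. g \<xi> \<partial>past_law) = (\<integral>\<omega>. g (past_at \<eta> 1 \<omega>) \<partial>M)"
    unfolding past_at_law[of 1, symmetric] by (subst integral_distr) auto
  also have "\<dots> = (\<integral>\<omega>. g (case_nat (\<eta> 1 \<omega>) (past \<eta> \<omega>)) \<partial>M)"
    using past_at_Suc[of \<eta> 0] by (simp add: past_at_0)
  also have "\<dots> = (\<integral>\<xi>. \<integral>y. g (case_nat y \<xi>) \<partial>Q \<xi> \<partial>past_law)"
    by (rule joint_integral[where b=b]) (use b in auto)
  finally show ?thesis .
qed

lemma Q_measure_eq_integral: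
  assumes "A \<in> sets seq_space"
  shows "measure (Q \<xi>) {y. case_nat y \<xi> \<in> A} = (\<integral>y. indicator A (case_nat y \<xi>) \<partial>Q \<xi>)"
    and "{y. case_nat y \<xi> \<in> A} \<in> sets (Q \<xi>)"
proof -
  have "(\<integral>y. indicator A (case_nat y \<xi>) \<partial>Q \<xi>) = (\<integral>y. indicator {y. case_nat y \<xi> \<in> A} y \<partial>Q \<xi> :: real)"
    by (simp add: indicator_def)
  also have "\<dots> = measure (Q \<xi>) ({y. case_nat y \<xi> \<in> A} \<inter> space (Q \<xi>))"
    by (rule Bochner_Integration.integral_indicator)
  also have "{y. case_nat y \<xi> \<in> A} \<inter> space (Q \<xi>) = {y. case_nat y \<xi> \<in> A}"
    using sets_eq_imp_space_eq[OF kernel_prob_algebraD(2)[OF Q_kernel, of \<xi>]] by simp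
  finally show "measure (Q \<xi>) {y. case_nat y \<xi> \<in> A} = (\<integral>y. indicator A (case_nat y \<xi>) \<partial>Q \<xi>)" ..
  show "{y. case_nat y \<xi> \<in> A} \<in> sets (Q \<xi>)"
    using measurable_sets[OF case_nat_measurable1 assms, of \<xi>] kernel_prob_algebraD(2)[OF Q_kernel, of \<xi>]
    by (simp add: vimage_def)
qed

lemma Q_measure_measurable:
  assumes [measurable]: "A \<in> sets seq_space"
  shows "(\<lambda>\<xi>. measure (Q \<xi>) {y. case_nat y \<xi> \<in> A}) \<in> borel_measurable seq_space"
  unfolding Q_measure_eq_integral(1)[OF assms]
  by (rule integral_kernel_measurable[OF _ Q_kernel]) measurable

text \<open>By invariance the \<open>Q\<close>-probabilities of continuing into \<open>A\<close>
  have mean 1, and none of them exceeds 1.\<close>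

lemma AE_past_law_step:
  assumes [measurable]: "A \<in> sets seq_space" and A: "AE \<xi> in past_law. \<xi> \<in> A"
  shows "AE \<xi> in past_law. AE y in Q \<xi>. case_nat y \<xi> \<in> A"
proof -
  interpret F: prob_space past_law by (rule prob_space_past_law)
  have "(\<integral>\<xi>. measure (Q \<xi>) {y. case_nat y \<xi> \<in> A} \<partial>past_law) = (\<integral>\<xi>. \<integral>y. indicator A (case_nat y \<xi>) \<partial>Q \<xi> \<partial>past_law)"
    by (simp add: Q_measure_eq_integral)
  also have "\<dots> = (\<integral>\<xi>. indicator A \<xi> \<partial>past_law)"
    by (rule past_law_invariant[symmetric, where b=1]) (auto simp: indicator_def)
  also have "\<dots> = (\<integral>\<xi>. 1 \<partial>past_law)"
    by (rule integral_cong_AE) (use A in auto)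
  finally have eq: "(\<integral>\<xi>. measure (Q \<xi>) {y. case_nat y \<xi> \<in> A} \<partial>past_law) = 1" by (simp add: F.prob_space[unfolded space_past_law])
  have m: "(\<lambda>\<xi>. measure (Q \<xi>) {y. case_nat y \<xi> \<in> A}) \<in> borel_measurable past_law"
    using Q_measure_measurable by simp
  have le: "measure (Q \<xi>) {y. case_nat y \<xi> \<in> A} \<le> 1" for \<xi>
    using prob_space.prob_le_1[OF kernel_prob_algebraD(1)[OF Q_kernel]] .
  have i: "integrable past_law (\<lambda>\<xi>. measure (Q \<xi>) {y. case_nat y \<xi> \<in> A})"
    by (rule F.integrable_const_bound[of _ 1]) (use le m in auto)
  have "(\<integral>\<xi>. 1 - measure (Q \<xi>) {y. case_nat y \<xi> \<in> A} \<partial>past_law) = 0"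
    using i eq by (simp add: F.prob_space[unfolded space_past_law])
  then have "AE \<xi> in past_law. 1 - measure (Q \<xi>) {y. case_nat y \<xi> \<in> A} = 0"
    using i le by (subst (asm) integral_nonneg_eq_0_iff_AE) auto
  then show ?thesis
  proof eventually_elim
    case (elim \<xi>)
    interpret Q: prob_space "Q \<xi>" by (rule kernel_prob_algebraD[OF Q_kernel])
    have "AE y in Q \<xi>. y \<in> {y. case_nat y \<xi> \<in> A}"
      by (rule Q.AE_prob_1) (use elim in simp)
    then show ?case by simp
  qed
qed

lemma AE_past_K: "closed K" "AE \<xi> in past_law. \<xi> \<in> past_seqs K" "past_seqs K \<in> sets seq_space"
proof -
  have sets: "sets (distr M borel (\<eta> 0)) = sets borel" by simp
  show K: "closed K" unfolding Kdef by (rule msupport_full_measure(1)[OF scE' sets])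
  then have [measurable]: "K \<in> sets borel" by simp
  have "{\<xi>\<in>space seq_space. \<forall>n. \<xi> n \<in> K} \<in> sets seq_space" by measurable
  then show *: "past_seqs K \<in> sets seq_space" by (simp add: past_seqs_def space_PiM)
  have 0: "AE x in distr M borel (\<eta> 0). x \<in> K" unfolding Kdef by (rule msupport_full_measure(2)[OF scE' sets])
  have "AE \<omega> in M. \<eta> (- int n) \<omega> \<in> K" for n
  proof -
    let ?P = "Pi\<^sub>M UNIV (\<lambda>_::int. borel :: 'e measure)"
    have m[measurable]: "(\<lambda>\<omega> j. \<eta> (j + h) \<omega>) \<in> measurable M ?P" for h
      by (rule measurable_PiM_single') auto
    have c[measurable]: "(\<lambda>w. w 0) \<in> measurable ?P borel" by measurable
    have "distr M borel (\<eta> h) = distr (distr M ?P (\<lambda>\<omega> j. \<eta> (j + h) \<omega>)) borel (\<lambda>w. w 0)" for h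
      by (subst distr_distr[OF c m]) (simp add: comp_def)
    then have d0: "distr M borel (\<eta> (- int n)) = distr M borel (\<eta> 0)"
      using stat by (simp add: stationary_process_def)
    then have "AE x in distr M borel (\<eta> (- int n)). x \<in> K" unfolding d0 by (intro 0)
    then show ?thesis by (subst (asm) AE_distr_iff) auto
  qed
  then have "AE \<omega> in M. \<forall>n. \<eta> (- int n) \<omega> \<in> K" by (simp add: AE_all_countable)
  then show "AE \<xi> in past_law. \<xi> \<in> past_seqs K"
    unfolding past_law_def using * by (subst AE_distr_iff) (auto simp: past_seqs_def past_def)
qed

text \<open>What is known for almost every past must survive along the chain, as the operator is
  iterated pointwise. Pasts that leave the current set with positive probability are removed again
  and again; invariance of the law preserves full measure at each stage, and the countable
  intersection is closed under almost every continuation.\<close>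

lemma invariant_full_set:
  assumes G0: "AE \<xi> in past_law. P \<xi>"
  obtains G where "G \<in> sets seq_space" "AE \<xi> in past_law. \<xi> \<in> G" "\<And>\<xi>. \<xi> \<in> G \<Longrightarrow> P \<xi>"
    "\<And>\<xi>. \<xi> \<in> G \<Longrightarrow> AE y in Q \<xi>. case_nat y \<xi> \<in> G"
proof -
  obtain N where N: "N \<in> null_sets past_law" "\<And>\<xi>. \<xi> \<notin> N \<Longrightarrow> P \<xi>"
    using AE_E3[OF G0] by (metis DiffI UNIV_I space_past_law)
  define H where "H A = A \<inter> {\<xi>. measure (Q \<xi>) {y. case_nat y \<xi> \<in> A} = 1}" for A
  define g where "g = rec_nat (- N) (\<lambda>_. H)"
  have g: "g 0 = - N" "g (Suc n) = H (g n)" for n by (simp_all add: g_def)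
  have gs: "g n \<in> sets seq_space \<and> (AE \<xi> in past_law. \<xi> \<in> g n)" for n
  proof (induction n)
    case 0
    have "N \<in> sets seq_space" using N(1) by (auto simp: null_sets_def)
    then have "space seq_space - N \<in> sets seq_space" by auto
    moreover have "AE \<xi> in past_law. \<xi> \<notin> N" using N(1) by (rule AE_not_in)
    ultimately show ?case by (simp add: g space_PiM Compl_eq_Diff_UNIV)
  next
    case (Suc n)
    then have [measurable]: "g n \<in> sets seq_space" and A: "AE \<xi> in past_law. \<xi> \<in> g n" by auto
    note Q_measure_measurable[OF \<open>g n \<in> _\<close>, measurable]
    have "g n \<inter> {\<xi>\<in>space seq_space. measure (Q \<xi>) {y. case_nat y \<xi> \<in> g n} = 1} \<in> sets seq_space"
      by measurable
    moreover have "AE \<xi> in past_law. measure (Q \<xi>) {y. case_nat y \<xi> \<in> g n} = 1"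
      using AE_past_law_step[OF \<open>g n \<in> _\<close> A]
    proof eventually_elim
      case (elim \<xi>)
      interpret Q: prob_space "Q \<xi>" by (rule kernel_prob_algebraD[OF Q_kernel])
      show ?case
        using elim Q_measure_eq_integral(2)[OF \<open>g n \<in> _\<close>, of \<xi>] Q.prob_eq_1[of "{y. case_nat y \<xi> \<in> g n}"] by simp
    qed
    ultimately show ?case using A by (auto simp: g H_def space_PiM)
  qed
  show thesis
  proof (rule that[of "\<Inter>n. g n"])
    show "(\<Inter>n. g n) \<in> sets seq_space" using gs by auto
    show "AE \<xi> in past_law. \<xi> \<in> (\<Inter>n. g n)" using gs by (simp add: AE_all_countable)
    show "P \<xi>" if "\<xi> \<in> (\<Inter>n. g n)" for \<xi>
    proof -
      have "\<xi> \<in> g 0" using that by blast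
      then show ?thesis using N(2) by (auto simp: g)
    qed
    fix \<xi> assume \<xi>: "\<xi> \<in> (\<Inter>n. g n)"
    interpret Q: prob_space "Q \<xi>" by (rule kernel_prob_algebraD[OF Q_kernel])
    have "AE y in Q \<xi>. case_nat y \<xi> \<in> g n" for n
    proof -
      have "\<xi> \<in> g (Suc n)" using \<xi> by blast
      then have "measure (Q \<xi>) {y. case_nat y \<xi> \<in> g n} = 1" by (simp add: g H_def)
      then have "AE y in Q \<xi>. y \<in> {y. case_nat y \<xi> \<in> g n}" by (rule Q.AE_prob_1)
      then show ?thesis by simp
    qed
    then show "AE y in Q \<xi>. case_nat y \<xi> \<in> (\<Inter>n. g n)" by (simp add: AE_all_countable)
  qed
qed

end

section \<open>Conditional laws of several steps as iterated kernels\<close>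

lemma run_measurable:
  fixes S :: "'h::topological_space \<times> 'e::topological_space \<Rightarrow> 'h"
  assumes S[measurable]: "S \<in> measurable (borel \<Otimes>\<^sub>M borel) borel"
  shows "(\<lambda>z. run S k (fst z) (snd z)) \<in> measurable (borel \<Otimes>\<^sub>M seq_space) borel"
proof (induction k)
  case (Suc k)
  note Suc[measurable]
  have sh[measurable]: "(\<lambda>z. (\<lambda>i. snd z (Suc i))) \<in> measurable (borel \<Otimes>\<^sub>M seq_space :: ('h \<times> (nat \<Rightarrow> 'e)) measure) seq_space"
    by (rule measurable_PiM_single') (auto simp: space_PiM)
  have "(\<lambda>z. run S k (fst (fst z, \<lambda>i. snd z (Suc i))) (snd (fst z, \<lambda>i. snd z (Suc i))))
      \<in> measurable (borel \<Otimes>\<^sub>M seq_space :: ('h \<times> (nat \<Rightarrow> 'e)) measure) borel"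
    by (rule measurable_compose[OF _ Suc]) measurable
  then have [measurable]: "(\<lambda>z. run S k (fst z) (\<lambda>i. snd z (Suc i))) \<in> measurable (borel \<Otimes>\<^sub>M seq_space :: ('h \<times> (nat \<Rightarrow> 'e)) measure) borel"
    by simp
  show ?case by simp
qed simp

lemma run_const_measurable:
  fixes S :: "'h::topological_space \<times> 'e::topological_space \<Rightarrow> 'h"
  assumes S[measurable]: "S \<in> measurable (borel \<Otimes>\<^sub>M borel) borel"
  shows "run S k x \<in> measurable seq_space borel"
proof -
  have "(\<lambda>\<xi>. run S k (fst (x, \<xi>)) (snd (x, \<xi>))) \<in> measurable seq_space borel"
    by (rule measurable_compose[OF _ run_measurable[OF S]]) simp
  then show ?thesis by simp
qed

lemma append_past_measurable [measurable]:
  "append_past \<xi> m \<in> measurable (Pi\<^sub>M {1..m} (\<lambda>_. borel)) (seq_space :: (nat \<Rightarrow> 'e::topological_space) measure)"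
proof (rule measurable_PiM_single')
  fix i :: nat
  show "(\<lambda>y. append_past \<xi> m y i) \<in> borel_measurable (Pi\<^sub>M {1..m} (\<lambda>_. borel))"
  proof (cases "i < m")
    case True
    then have "m - i \<in> {1..m}" by auto
    then show ?thesis using True by (simp add: append_past_def measurable_component_singleton)
  qed (simp add: append_past_def)
qed (auto simp: space_PiM)

lemma append_past_Suc: "append_past \<xi> (Suc m) (y(Suc m := x)) = case_nat x (append_past \<xi> m y)"
proof
  fix n show "append_past \<xi> (Suc m) (y(Suc m := x)) n = case_nat x (append_past \<xi> m y) n"
    by (cases n) (auto simp: append_past_def Suc_diff_Suc)
qed

lemma cond_law_step_measurable:
  fixes Q :: "(nat \<Rightarrow> 'e::topological_space) \<Rightarrow> 'e measure"
  assumes Q[measurable]: "Q \<in> measurable seq_space (prob_algebra borel)"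
  shows "(\<lambda>y. distr (Q (append_past \<xi> m y)) (Pi\<^sub>M {1..Suc m} (\<lambda>_. borel)) (\<lambda>x. y(Suc m := x)))
    \<in> measurable (Pi\<^sub>M {1..m} (\<lambda>_. borel)) (prob_algebra (Pi\<^sub>M {1..Suc m} (\<lambda>_. borel)))"
proof (rule measurable_distr_prob_space2[where M=borel])
  show "(\<lambda>y. Q (append_past \<xi> m y)) \<in> measurable (Pi\<^sub>M {1..m} (\<lambda>_. borel)) (prob_algebra borel)"
    by measurable
  have "{1..Suc m} = insert (Suc m) {1..m}" by auto
  then show "(\<lambda>(y, x). y(Suc m := x)) \<in> measurable (Pi\<^sub>M {1..m} (\<lambda>_. borel) \<Otimes>\<^sub>M borel) (Pi\<^sub>M {1..Suc m} (\<lambda>_. borel))"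
    using measurable_add_dim[of "Suc m" "{1..m}" "\<lambda>_. borel :: 'e measure"] by simp
qed

lemma cond_law_prob:
  fixes Q :: "(nat \<Rightarrow> 'e::topological_space) \<Rightarrow> 'e measure"
  assumes Q: "Q \<in> measurable seq_space (prob_algebra borel)"
  shows "prob_space (cond_law Q \<xi> m) \<and> sets (cond_law Q \<xi> m) = sets (Pi\<^sub>M {1..m} (\<lambda>_. borel))"
proof (induction m)
  case 0
  show ?case by (auto intro!: prob_space_return simp: space_PiM)
next
  case (Suc m)
  then interpret prob_space "cond_law Q \<xi> m" by simp
  have s[measurable_cong]: "sets (cond_law Q \<xi> m) = sets (Pi\<^sub>M {1..m} (\<lambda>_. borel))" using Suc by simp
  have N: "(\<lambda>y. distr (Q (append_past \<xi> m y)) (Pi\<^sub>M {1..Suc m} (\<lambda>_. borel)) (\<lambda>x. y(Suc m := x)))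
    \<in> measurable (cond_law Q \<xi> m) (prob_algebra (Pi\<^sub>M {1..Suc m} (\<lambda>_. borel)))"
    using cond_law_step_measurable[OF Q] measurable_cong_sets[OF s refl] by blast
  have "prob_space (cond_law Q \<xi> m \<bind> (\<lambda>y. distr (Q (append_past \<xi> m y)) (Pi\<^sub>M {1..Suc m} (\<lambda>_. borel)) (\<lambda>x. y(Suc m := x))))"
    by (rule prob_space_bind[OF AE_I2 measurable_prob_algebraD[OF N]])
      (use measurable_space[OF N] in \<open>simp add: space_prob_algebra\<close>)
  moreover have "sets (cond_law Q \<xi> m \<bind> (\<lambda>y. distr (Q (append_past \<xi> m y)) (Pi\<^sub>M {1..Suc m} (\<lambda>_. borel)) (\<lambda>x. y(Suc m := x))))
      = sets (Pi\<^sub>M {1..Suc m} (\<lambda>_. borel))"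
    by (rule sets_bind[OF _ not_empty]) simp
  ultimately show ?case by simp
qed

text \<open>\<open>cond_law\<close> grows at its last coordinate whereas \<open>hit_prob\<close>
  unfolds the first step. The induction trades a step counted by \<open>m\<close> for one counted by
  \<open>j\<close>, which shows that both describe the same chain.\<close>

lemma cond_law_hit_prob:
  fixes Q :: "(nat \<Rightarrow> 'e::topological_space) \<Rightarrow> 'e measure"
  assumes Q: "Q \<in> measurable seq_space (prob_algebra borel)" and A[measurable]: "A \<in> sets seq_space"
  shows "(\<integral>y. hit_prob Q A j (append_past \<xi> m y) \<partial>cond_law Q \<xi> m) = hit_prob Q A (m + j) \<xi>"
proof (induction m arbitrary: j)
  case 0
  have "append_past \<xi> 0 y = \<xi>" for y by (simp add: append_past_def fun_eq_iff)
  then have "(\<integral>y. hit_prob Q A j (append_past \<xi> 0 y) \<partial>cond_law Q \<xi> 0) = (\<integral>y. hit_prob Q A j \<xi> \<partial>cond_law Q \<xi> 0)"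
    by (simp only:)
  also have "\<dots> = hit_prob Q A j \<xi>"
    using prob_space.prob_space[OF conjunct1[OF cond_law_prob[OF Q, of \<xi> 0]]]
    by (simp del: cond_law.simps)
  finally show ?case by simp
next
  case (Suc m)
  interpret prob_space "cond_law Q \<xi> m" using cond_law_prob[OF Q] by blast
  have s[measurable_cong]: "sets (cond_law Q \<xi> m) = sets (Pi\<^sub>M {1..m} (\<lambda>_. borel))" using cond_law_prob[OF Q] by blast
  let ?N = "\<lambda>y. distr (Q (append_past \<xi> m y)) (Pi\<^sub>M {1..Suc m} (\<lambda>_. borel)) (\<lambda>x. y(Suc m := x))"
  have N: "?N \<in> measurable (cond_law Q \<xi> m) (prob_algebra (Pi\<^sub>M {1..Suc m} (\<lambda>_. borel)))"
    using cond_law_step_measurable[OF Q] measurable_cong_sets[OF s refl] by blast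
  note hm = hit_prob_measurable[OF Q A]
  note hb = hit_prob_bounds[OF Q A]
  have am: "append_past \<xi> (Suc m) \<in> measurable (Pi\<^sub>M {1..Suc m} (\<lambda>_. borel)) seq_space" by measurable
  have hma: "(\<lambda>y. hit_prob Q A j (append_past \<xi> (Suc m) y)) \<in> borel_measurable (Pi\<^sub>M {1..Suc m} (\<lambda>_. borel))"
    by (rule measurable_compose[OF am hm])
  have "(\<integral>y. hit_prob Q A j (append_past \<xi> (Suc m) y) \<partial>cond_law Q \<xi> (Suc m))
    = (\<integral>y. (\<integral>z. hit_prob Q A j (append_past \<xi> (Suc m) z) \<partial>?N y) \<partial>cond_law Q \<xi> m)"
    unfolding cond_law.simps(2)
  proof (rule integral_bind[where B=1 and B'=1])
    show "?N \<in> measurable (cond_law Q \<xi> m) (subprob_algebra (Pi\<^sub>M {1..Suc m} (\<lambda>_. borel)))"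
      by (rule measurable_prob_algebraD[OF N])
    show "AE y in cond_law Q \<xi> m. emeasure (?N y) (space (?N y)) \<le> ennreal 1"
    proof (rule AE_I2)
      fix y assume "y \<in> space (cond_law Q \<xi> m)"
      then have "prob_space (?N y)" using measurable_space[OF N] by (simp add: space_prob_algebra)
      then show "emeasure (?N y) (space (?N y)) \<le> ennreal 1"
        using prob_space.emeasure_space_1 by (metis ennreal_1 order_refl)
    qed
  qed (use hb hma finite_measure_axioms in \<open>auto simp: abs_le_iff intro: order_trans[of _ 0]\<close>)
  also have "\<dots> = (\<integral>y. hit_prob Q A (Suc j) (append_past \<xi> m y) \<partial>cond_law Q \<xi> m)"
  proof (rule Bochner_Integration.integral_cong[OF refl])
    fix y assume "y \<in> space (cond_law Q \<xi> m)"
    then have y: "y \<in> space (Pi\<^sub>M {1..m} (\<lambda>_. borel :: 'e measure))" using sets_eq_imp_space_eq[OF s] by simp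
    note kernel_prob_algebraD(2)[OF Q, measurable_cong]
    have "{1..Suc m} = insert (Suc m) {1..m}" by auto
    then have "(\<lambda>x. y(Suc m := x)) \<in> measurable borel (Pi\<^sub>M {1..Suc m} (\<lambda>_. borel))"
      using measurable_compose[OF measurable_Pair1'[OF y] measurable_add_dim[of "Suc m" "{1..m}" "\<lambda>_. borel :: 'e measure"]]
      by simp
    then have "(\<lambda>x. y(Suc m := x)) \<in> measurable (Q (append_past \<xi> m y)) (Pi\<^sub>M {1..Suc m} (\<lambda>_. borel))"
      by measurable
    then have "(\<integral>z. hit_prob Q A j (append_past \<xi> (Suc m) z) \<partial>?N y) =
        (\<integral>x. hit_prob Q A j (append_past \<xi> (Suc m) (y(Suc m := x))) \<partial>Q (append_past \<xi> m y))"
      by (rule integral_distr) (rule hma)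
    then show "(\<integral>z. hit_prob Q A j (append_past \<xi> (Suc m) z) \<partial>?N y) = hit_prob Q A (Suc j) (append_past \<xi> m y)"
      by (simp add: append_past_Suc)
  qed
  also have "\<dots> = hit_prob Q A (m + Suc j) \<xi>" by (rule Suc.IH)
  finally show ?case by simp
qed

text \<open>Translates (\<eta>2) to the chain. The order is reversed: time \<open>j\<close> of the
  process has index \<open>s + n - j\<close> in the final past, so the times \<open>s+1\<close> to
  \<open>s+n\<close> occupy its first \<open>n\<close> entries.\<close>

lemma conditioned_process_hit_prob:
  fixes Q :: "(nat \<Rightarrow> 'e::real_normed_vector) \<Rightarrow> 'e measure"
  assumes Q: "Q \<in> measurable seq_space (prob_algebra borel)"
    and cp: "conditioned_process Q K \<xi> N \<zeta>" and "s + n \<ge> 1"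
  shows "measure N {\<omega>\<in>space N. \<forall>j\<in>{s+1..s+n}. norm (\<zeta> j \<omega>) < \<delta>} =
    hit_prob Q {\<xi>. \<forall>i<n. norm (\<xi> i) < \<delta>} (s + n) \<xi>"
proof -
  define m where "m = s + n"
  let ?P = "Pi\<^sub>M {1..m} (\<lambda>_. borel :: 'e measure)"
  let ?A = "{\<xi>. \<forall>i<n. norm (\<xi> i :: 'e) < \<delta>}"
  have ball[measurable]: "{a :: 'e. norm a < \<delta>} \<in> sets borel"
    by (intro borel_open open_Collect_less continuous_intros)
  have "{\<xi>\<in>space seq_space. \<forall>i<n. \<xi> i \<in> {a :: 'e. norm a < \<delta>}} \<in> sets seq_space" by measurable
  then have A[measurable]: "?A \<in> sets seq_space" by (simp add: space_PiM)
  have m1: "m \<ge> 1" using assms m_def by simp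
  have \<zeta>: "\<zeta> j \<in> borel_measurable N" if "j \<ge> 1" for j using cp that by (simp add: conditioned_process_def)
  have law: "distr N ?P (\<lambda>\<omega>. \<lambda>j\<in>{1..m}. \<zeta> j \<omega>) = cond_law Q \<xi> m"
    using cp m1 by (simp add: conditioned_process_def)
  have meas: "(\<lambda>\<omega>. \<lambda>j\<in>{1..m}. \<zeta> j \<omega>) \<in> measurable N ?P"
    by (rule measurable_restrict) (use \<zeta> in auto)
  have s: "sets (cond_law Q \<xi> m) = sets ?P" using cond_law_prob[OF Q] by blast
  have sp: "space (cond_law Q \<xi> m) = space ?P" by (rule sets_eq_imp_space_eq[OF s])
  let ?E = "append_past \<xi> m -` ?A \<inter> space ?P"
  have E: "?E \<in> sets ?P" by (rule measurable_sets[OF append_past_measurable A])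
  have eqv: "append_past \<xi> m y \<in> ?A \<longleftrightarrow> (\<forall>j\<in>{s+1..s+n}. norm (y j) < \<delta>)" for y
  proof
    assume *: "append_past \<xi> m y \<in> ?A"
    show "\<forall>j\<in>{s+1..s+n}. norm (y j) < \<delta>"
    proof
      fix j assume j: "j \<in> {s+1..s+n}"
      then have "m - j < n" "m - (m - j) = j" "m - j < m" by (auto simp: m_def)
      then show "norm (y j) < \<delta>" using * by (auto simp: append_past_def dest!: spec[of _ "m - j"])
    qed
  next
    assume *: "\<forall>j\<in>{s+1..s+n}. norm (y j) < \<delta>"
    have "norm (append_past \<xi> m y i) < \<delta>" if "i < n" for i
    proof -
      have "m - i \<in> {s+1..s+n}" "i < m" using that by (auto simp: m_def)
      then show ?thesis using * by (simp add: append_past_def)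
    qed
    then show "append_past \<xi> m y \<in> ?A" by simp
  qed
  have "{\<omega>\<in>space N. \<forall>j\<in>{s+1..s+n}. norm (\<zeta> j \<omega>) < \<delta>} = (\<lambda>\<omega>. \<lambda>j\<in>{1..m}. \<zeta> j \<omega>) -` ?E \<inter> space N"
    using measurable_space[OF meas] eqv by (auto simp: m_def)
  then have "measure N {\<omega>\<in>space N. \<forall>j\<in>{s+1..s+n}. norm (\<zeta> j \<omega>) < \<delta>} = measure (cond_law Q \<xi> m) ?E"
    unfolding law[symmetric] using measure_distr[OF meas E] by simp
  also have "?E = ?E \<inter> space (cond_law Q \<xi> m)"
    unfolding sp by blast
  also have "measure (cond_law Q \<xi> m) \<dots> = (\<integral>y. indicator ?E y \<partial>cond_law Q \<xi> m)"
    by (rule Bochner_Integration.integral_indicator[symmetric])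
  also have "\<dots> = (\<integral>y. hit_prob Q ?A 0 (append_past \<xi> m y) \<partial>cond_law Q \<xi> m)"
    by (rule Bochner_Integration.integral_cong[OF refl]) (use sp in \<open>auto simp: indicator_def\<close>)
  also have "\<dots> = hit_prob Q ?A (m + 0) \<xi>" by (rule cond_law_hit_prob[OF Q A])
  finally show ?thesis by (simp add: m_def)
qed

lemma msupport_subset:
  assumes "closed X" "sets \<mu> = sets borel" "AE x in \<mu>. x \<in> X"
  shows "msupport \<mu> \<subseteq> X"
proof
  fix x assume x: "x \<in> msupport \<mu>"
  show "x \<in> X"
  proof (rule ccontr)
    assume "x \<notin> X"
    have "- X \<in> sets \<mu>" using assms(1,2) by (simp add: open_Compl)
    moreover have "AE x in \<mu>. x \<notin> - X" using assms(3) by simp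
    ultimately have "- X \<in> null_sets \<mu>" using AE_iff_null_sets by blast
    then have "emeasure \<mu> (- X) = 0" by (rule null_setsD1)
    moreover have "open (- X)" using assms(1) by (simp add: open_Compl)
    ultimately show False using x \<open>x \<notin> X\<close> by (auto simp: msupport_def)
  qed
qed

section \<open>The limit law and the rate of convergence\<close>

context stationary_noise
begin

text \<open>Invariance of the law of the past lets the last noise of the run be drawn afresh from
  \<open>Q\<close>; after \<open>k\<close> repetitions the run along the past has become the
  operator at the deterministic start \<open>x\<close>.\<close>

lemma run_step_op_integral:
  fixes S :: "'h::topological_space \<times> 'e \<Rightarrow> 'h" and \<Phi> :: "'h \<times> (nat \<Rightarrow> 'e) \<Rightarrow> real"
  assumes S[measurable]: "S \<in> measurable (borel \<Otimes>\<^sub>M borel) borel"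
    and \<Phi>: "\<Phi> \<in> borel_measurable (borel \<Otimes>\<^sub>M seq_space)" "\<And>z. \<bar>\<Phi> z\<bar> \<le> b"
  shows "(\<integral>\<xi>. \<Phi> (run S k x \<xi>, \<xi>) \<partial>past_law) = (\<integral>\<xi>. (step_op S Q ^^ k) \<Phi> (x, \<xi>) \<partial>past_law)"
  using \<Phi>
proof (induction k arbitrary: \<Phi>)
  case (Suc k)
  note Suc.prems(1)[measurable]
  note rm[measurable] = run_const_measurable[OF S]
  have m: "step_op S Q \<Phi> \<in> borel_measurable (borel \<Otimes>\<^sub>M seq_space)" "\<bar>step_op S Q \<Phi> z\<bar> \<le> b" for z
    by (rule step_op_measurable[OF S Q_kernel Suc.prems(1)], rule step_op_bounded[OF S Q_kernel Suc.prems])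
  have "(\<integral>\<xi>. \<Phi> (run S (Suc k) x \<xi>, \<xi>) \<partial>past_law) =
      (\<integral>\<xi>. \<integral>y. \<Phi> (run S (Suc k) x (case_nat y \<xi>), case_nat y \<xi>) \<partial>Q \<xi> \<partial>past_law)"
  proof (rule past_law_invariant[where b=b])
    show "(\<lambda>\<xi>. \<Phi> (run S (Suc k) x \<xi>, \<xi>)) \<in> borel_measurable seq_space"
      using rm[of "Suc k" x] by measurable
  qed (use Suc.prems in auto)
  also have "\<dots> = (\<integral>\<xi>. step_op S Q \<Phi> (run S k x \<xi>, \<xi>) \<partial>past_law)"
    unfolding run_case_nat by (simp add: step_op_def)
  also have "\<dots> = (\<integral>\<xi>. (step_op S Q ^^ k) (step_op S Q \<Phi>) (x, \<xi>) \<partial>past_law)"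
    by (rule Suc.IH[OF m])
  finally show ?case by (simp add: funpow_swap1)
qed simp

text \<open>A trajectory started at time \<open>m\<close> with the state reached there and one restarted from \<open>x\<close> see the
  same past, so the contraction between equal pasts already makes the laws a Cauchy sequence.\<close>

lemma mixing_past_law:
  fixes S :: "'h::{real_normed_vector, complete_space} \<times> 'e \<Rightarrow> 'h"
  assumes S[measurable]: "S \<in> measurable (borel \<Otimes>\<^sub>M borel) borel"
    and X: "compact X" "X \<noteq> {}" and X_inv: "\<And>u y. u \<in> X \<Longrightarrow> y \<in> K \<Longrightarrow> S (u, y) \<in> X"
    and G: "AE \<xi> in past_law. \<xi> \<in> G" "G \<subseteq> past_seqs K"
    and contr: "\<And>f u u' \<xi> k. 1-lipschitz_on UNIV f \<Longrightarrow> (\<And>x. \<bar>f x\<bar> \<le> 1) \<Longrightarrow> u \<in> X \<Longrightarrow> u' \<in> X \<Longrightarrow> \<xi> \<in> G \<Longrightarrow>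
      \<bar>(step_op S Q ^^ k) (\<lambda>z. f (fst z)) (u, \<xi>) - (step_op S Q ^^ k) (\<lambda>z. f (fst z)) (u', \<xi>)\<bar> \<le> C * exp (- \<gamma> * real k)"
    and C: "0 < C" "0 < \<gamma>"
  obtains \<mu> where "prob_space \<mu>" "sets \<mu> = sets borel" "AE x in \<mu>. x \<in> X"
    "\<And>f x k. 1-lipschitz_on UNIV f \<Longrightarrow> (\<And>x. \<bar>f x\<bar> \<le> 1) \<Longrightarrow> x \<in> X \<Longrightarrow>
      \<bar>(\<integral>\<xi>. f (run S k x \<xi>) \<partial>past_law) - (\<integral>x. f x \<partial>\<mu>)\<bar> \<le> 2 * C * exp (- \<gamma> * real k)"
proof -
  interpret F: prob_space past_law by (rule prob_space_past_law)
  note rm[measurable] = run_const_measurable[OF S]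
  obtain x0 where x0: "x0 \<in> X" using X(2) by blast
  define E where "E f k x = (\<integral>\<xi>. f (run S k x \<xi>) \<partial>past_law)" for f :: "'h \<Rightarrow> real" and k x
  have GX: "run S k x \<xi> \<in> X" if "\<xi> \<in> G" "x \<in> X" for k x \<xi>
    by (rule run_in[of X K S, OF X_inv]) (use that G in auto)
  \<comment> \<open>Both sides are integrals of the same \<open>k\<close>-step function
    \<open>g\<close> over the same past, one from the state reached after \<open>m\<close> steps and
    one from \<open>x'\<close>. Only the states differ, so the contraction with equal pasts
    applies.\<close>
  have gen: "\<bar>E f (m + k) x - E f k x'\<bar> \<le> C * exp (- \<gamma> * real k)"
    if f: "1-lipschitz_on UNIV f" "\<And>x. \<bar>f x\<bar> \<le> 1" and x: "x \<in> X" "x' \<in> X" for f k m x x'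
  proof -
    let ?f = "\<lambda>z::'h \<times> (nat \<Rightarrow> 'e). f (fst z)"
    have [measurable]: "f \<in> borel_measurable borel"
      using f(1) by (intro borel_measurable_continuous_onI lipschitz_on_continuous_on)
    have fm: "?f \<in> borel_measurable (borel \<Otimes>\<^sub>M seq_space)" by measurable
    define g where "g = (step_op S Q ^^ k) ?f"
    have g[measurable]: "g \<in> borel_measurable (borel \<Otimes>\<^sub>M seq_space)"
      unfolding g_def by (induction k) (use fm step_op_measurable[OF S Q_kernel] in simp_all)
    have gb: "\<bar>g z\<bar> \<le> 1" for z
    proof -
      have "(step_op S Q ^^ k) ?f \<in> borel_measurable (borel \<Otimes>\<^sub>M seq_space) \<and> (\<forall>z. \<bar>(step_op S Q ^^ k) ?f z\<bar> \<le> 1)"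
      proof (induction k)
        case (Suc k)
        then have 1: "(step_op S Q ^^ k) ?f \<in> borel_measurable (borel \<Otimes>\<^sub>M seq_space)"
          and 2: "\<And>z. \<bar>(step_op S Q ^^ k) ?f z\<bar> \<le> 1" by blast+
        show ?case
          using step_op_measurable[OF S Q_kernel 1] step_op_bounded[OF S Q_kernel 1 2] by simp
      qed (use fm f(2) in simp)
      then show ?thesis unfolding g_def by blast
    qed
    have "E f (m + k) x = (\<integral>\<xi>. (step_op S Q ^^ (m + k)) ?f (x, \<xi>) \<partial>past_law)"
      unfolding E_def using run_step_op_integral[OF S fm, of 1 "m + k" x] f(2) by simp
    also have "(step_op S Q ^^ (m + k)) ?f = (step_op S Q ^^ m) g" by (simp add: funpow_add g_def)
    also have "(\<integral>\<xi>. (step_op S Q ^^ m) g (x, \<xi>) \<partial>past_law) = (\<integral>\<xi>. g (run S m x \<xi>, \<xi>) \<partial>past_law)"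
      by (rule run_step_op_integral[OF S g gb, symmetric])
    finally have e1: "E f (m + k) x = (\<integral>\<xi>. g (run S m x \<xi>, \<xi>) \<partial>past_law)" .
    have e2: "E f k x' = (\<integral>\<xi>. g (x', \<xi>) \<partial>past_law)"
      unfolding E_def g_def using run_step_op_integral[OF S fm, of 1 k x'] f(2) by simp
    have i: "integrable past_law (\<lambda>\<xi>. g (run S m x \<xi>, \<xi>))" "integrable past_law (\<lambda>\<xi>. g (x', \<xi>))"
      by (rule F.integrable_const_bound[of _ 1]; use gb in simp)+
    have "\<bar>E f (m + k) x - E f k x'\<bar> = \<bar>\<integral>\<xi>. g (run S m x \<xi>, \<xi>) - g (x', \<xi>) \<partial>past_law\<bar>"
      using i by (simp add: e1 e2)
    also have "\<dots> \<le> (\<integral>\<xi>. \<bar>g (run S m x \<xi>, \<xi>) - g (x', \<xi>)\<bar> \<partial>past_law)" by (rule integral_abs_bound)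
    also have "\<dots> \<le> (\<integral>\<xi>. C * exp (- \<gamma> * real k) \<partial>past_law)"
    proof (rule integral_mono_AE)
      show "AE \<xi> in past_law. \<bar>g (run S m x \<xi>, \<xi>) - g (x', \<xi>)\<bar> \<le> C * exp (- \<gamma> * real k)"
        using G(1) by eventually_elim (use contr[OF f] GX x in \<open>simp add: g_def\<close>)
    qed (use i in auto)
    finally show ?thesis by (simp add: F.prob_space[unfolded space_past_law])
  qed
  define \<mu>k where "\<mu>k k = distr past_law borel (run S k x0)" for k
  have pk: "prob_space (\<mu>k k)" for k unfolding \<mu>k_def by (rule F.prob_space_distr) simp
  have Xs: "X \<in> sets borel" using X(1) by (simp add: compact_imp_closed)
  have AEk: "AE x in \<mu>k k. x \<in> X" for k
  proof -
    have "AE \<xi> in past_law. run S k x0 \<xi> \<in> X"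
      using G(1) by eventually_elim (use GX x0 in blast)
    then show ?thesis unfolding \<mu>k_def using Xs by (subst AE_distr_iff) auto
  qed
  have sk: "sets (\<mu>k k) = sets borel" for k by (simp add: \<mu>k_def)
  obtain \<mu> r where \<mu>: "prob_space \<mu>" "sets \<mu> = sets borel" "AE x in \<mu>. x \<in> X" and r: "strict_mono r"
    and lim: "\<And>f :: 'h \<Rightarrow> real. \<And>b. continuous_on UNIV f \<Longrightarrow> (\<And>x. \<bar>f x\<bar> \<le> b) \<Longrightarrow>
       (\<lambda>k. \<integral>x. f x \<partial>\<mu>k (r k)) \<longlonglongrightarrow> (\<integral>x. f x \<partial>\<mu>)"
    using compact_weakly_convergent_subsequence[of X \<mu>k, OF X(1) pk sk AEk] by metis
  show thesis
  proof (rule that[OF \<mu>])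
    fix f :: "'h \<Rightarrow> real" and x k assume f: "1-lipschitz_on UNIV f" "\<And>x. \<bar>f x\<bar> \<le> 1" and x: "x \<in> X"
    have fc: "continuous_on UNIV f" using f(1) by (rule lipschitz_on_continuous_on)
    have [measurable]: "f \<in> borel_measurable borel" by (rule borel_measurable_continuous_onI[OF fc])
    have Ek: "(\<integral>x. f x \<partial>\<mu>k j) = E f j x0" for j
      unfolding \<mu>k_def E_def by (subst integral_distr) auto
    have "\<bar>E f k x - (\<integral>x. f x \<partial>\<mu>)\<bar> \<le> C * exp (- \<gamma> * real k)"
    \<comment> \<open>For \<open>j \<ge> k\<close> the index \<open>r j\<close> is at least
      \<open>k\<close>, so the estimate with \<open>r j - k\<close> extra steps applies and passes
      to the limit.\<close>
    proof (rule LIMSEQ_le_const2)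
      show "(\<lambda>j. \<bar>E f k x - E f (r j) x0\<bar>) \<longlonglongrightarrow> \<bar>E f k x - (\<integral>x. f x \<partial>\<mu>)\<bar>"
        using lim[OF fc f(2)] unfolding Ek by (intro tendsto_intros)
      show "\<exists>N. \<forall>j\<ge>N. \<bar>E f k x - E f (r j) x0\<bar> \<le> C * exp (- \<gamma> * real k)"
      proof (intro exI[of _ k] allI impI)
        fix j assume "k \<le> j"
        then have "k \<le> r j" using seq_suble[OF r, of j] by simp
        then have "r j = (r j - k) + k" by simp
        then have "\<bar>E f (r j) x0 - E f k x\<bar> \<le> C * exp (- \<gamma> * real k)" using gen[OF f x0 x, of "r j - k" k] by simp
        then show "\<bar>E f k x - E f (r j) x0\<bar> \<le> C * exp (- \<gamma> * real k)" by (simp add: abs_minus_commute)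
      qed
    qed
    also have "C * exp (- \<gamma> * real k) \<le> 2 * C * exp (- \<gamma> * real k)" using C by simp
    finally show "\<bar>(\<integral>\<xi>. f (run S k x \<xi>) \<partial>past_law) - (\<integral>x. f x \<partial>\<mu>)\<bar> \<le> 2 * C * exp (- \<gamma> * real k)"
      unfolding E_def .
  qed
qed

section \<open>Trajectories from an independent initial state\<close>

definition future :: "'w \<Rightarrow> int \<Rightarrow> 'e" where
  "future \<omega> = (\<lambda>k\<in>{1..}. \<eta> k \<omega>)"

text \<open>The future read backwards from time \<open>k\<close>. A run of length \<open>k\<close>
  reads only the first \<open>k\<close> entries; the default \<open>y 1\<close> elsewhere is a
  coordinate at hand that keeps the map measurable and dependent on the future alone.\<close>

definition rev_past :: "nat \<Rightarrow> (int \<Rightarrow> 'e) \<Rightarrow> nat \<Rightarrow> 'e" where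
  "rev_past k y i = (if i < k then y (int k - int i) else y 1)"

lemma future_measurable [measurable]: "future \<in> measurable M (Pi\<^sub>M {1..} (\<lambda>_. borel))"
  unfolding future_def by (rule measurable_restrict) simp

lemma rev_past_measurable [measurable]: "rev_past k \<in> measurable (Pi\<^sub>M {1..} (\<lambda>_. borel)) seq_space"
proof (rule measurable_PiM_single')
  fix i
  show "(\<lambda>y. rev_past k y i) \<in> borel_measurable (Pi\<^sub>M {1..} (\<lambda>_. borel))"
    unfolding rev_past_def by (cases "i < k") (auto intro!: measurable_component_singleton)
qed (auto simp: space_PiM)

lemma traj_eq_future: "traj S \<eta> v k \<omega> = run S k (v \<omega>) (rev_past k (future \<omega>))"
  unfolding traj_eq_run by (rule run_cong) (auto simp: past_at_def rev_past_def future_def)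

text \<open>The trajectory is a function of the start and the future, which are independent; by
  Fubini's theorem the start may be frozen at \<open>x\<close>. For a frozen start the driving
  noises are the recent entries of the past at time \<open>k\<close>, whose law is
  \<open>past_law\<close> by stationarity.\<close>

lemma indep_future_integral:
  fixes S :: "'h::topological_space \<times> 'e \<Rightarrow> 'h" and f :: "'h \<Rightarrow> real"
  assumes S[measurable]: "S \<in> measurable (borel \<Otimes>\<^sub>M borel) borel"
    and v[measurable]: "v \<in> borel_measurable M" and ind: "indep_of_future M \<eta> v"
    and f[measurable]: "f \<in> borel_measurable borel" and b: "\<And>x. \<bar>f x\<bar> \<le> b"
  shows "traj S \<eta> v k \<in> borel_measurable M"
    "(\<integral>\<omega>. f (traj S \<eta> v k \<omega>) \<partial>M) = (\<integral>x. (\<integral>\<xi>. f (run S k x \<xi>) \<partial>past_law) \<partial>distr M borel v)"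
proof -
  let ?P = "Pi\<^sub>M {1..} (\<lambda>_::int. borel :: 'e measure)"
  note rm[measurable] = run_measurable[OF S]
  have "(\<lambda>\<omega>. run S k (fst (v \<omega>, rev_past k (future \<omega>))) (snd (v \<omega>, rev_past k (future \<omega>)))) \<in> borel_measurable M"
    by (rule measurable_compose[OF _ rm]) measurable
  then show tm: "traj S \<eta> v k \<in> borel_measurable M"
    by (subst measurable_cong[where g = "\<lambda>\<omega>. run S k (v \<omega>) (rev_past k (future \<omega>))"]) (simp_all add: traj_eq_future)
  interpret V: prob_space "distr M borel v" by (rule prob_space_distr) simp
  interpret U: prob_space "distr M ?P future" by (rule prob_space_distr) simp
  interpret VU: pair_prob_space "distr M borel v" "distr M ?P future" ..
  have pair: "distr M borel v \<Otimes>\<^sub>M distr M ?P future = distr M (borel \<Otimes>\<^sub>M ?P) (\<lambda>\<omega>. (v \<omega>, future \<omega>))"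
  proof (rule pair_measure_eqI)
    show "sigma_finite_measure (distr M borel v)" "sigma_finite_measure (distr M ?P future)" by unfold_locales
    show "sets (distr M borel v \<Otimes>\<^sub>M distr M ?P future) = sets (distr M (borel \<Otimes>\<^sub>M ?P) (\<lambda>\<omega>. (v \<omega>, future \<omega>)))"
      by (simp cong: sets_pair_measure_cong)
    fix A B assume "A \<in> sets (distr M borel v)" "B \<in> sets (distr M ?P future)"
    then have A[measurable]: "A \<in> sets borel" and B[measurable]: "B \<in> sets ?P" by auto
    have a: "v -` A \<inter> space M \<in> sets (vimage_algebra (space M) v borel)" using A by (rule in_vimage_algebra)
    have f': "future = (\<lambda>\<omega>. \<lambda>k\<in>{1..}. \<eta> k \<omega>)" by (simp add: future_def fun_eq_iff)
    have b: "future -` B \<inter> space M \<in> sets (vimage_algebra (space M) (\<lambda>\<omega>. \<lambda>k\<in>{1..}. \<eta> k \<omega>) ?P)"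
      unfolding f' using B by (rule in_vimage_algebra)
    have "prob ((v -` A \<inter> space M) \<inter> (future -` B \<inter> space M)) = prob (v -` A \<inter> space M) * prob (future -` B \<inter> space M)"
      using ind a b unfolding indep_of_future_def by (rule indep_setD)
    then have "emeasure M (v -` A \<inter> space M) * emeasure M (future -` B \<inter> space M) = emeasure M ((v -` A \<inter> space M) \<inter> (future -` B \<inter> space M))"
      by (simp add: emeasure_eq_measure ennreal_mult'')
    also have "(v -` A \<inter> space M) \<inter> (future -` B \<inter> space M) = (\<lambda>\<omega>. (v \<omega>, future \<omega>)) -` (A \<times> B) \<inter> space M" by auto
    finally show "emeasure (distr M borel v) A * emeasure (distr M ?P future) B = emeasure (distr M (borel \<Otimes>\<^sub>M ?P) (\<lambda>\<omega>. (v \<omega>, future \<omega>))) (A \<times> B)"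
      by (simp add: emeasure_distr)
  qed
  define g where "g z = f (run S k (fst z) (rev_past k (snd z)))" for z :: "'h \<times> (int \<Rightarrow> 'e)"
  have g[measurable]: "g \<in> borel_measurable (borel \<Otimes>\<^sub>M ?P)"
  proof -
    have "(\<lambda>z. run S k (fst (fst z, rev_past k (snd z))) (snd (fst z, rev_past k (snd z)))) \<in> measurable (borel \<Otimes>\<^sub>M ?P) borel"
      by (rule measurable_compose[OF _ rm]) measurable
    then show ?thesis unfolding g_def by simp
  qed
  have "(\<integral>\<omega>. f (traj S \<eta> v k \<omega>) \<partial>M) = (\<integral>\<omega>. g (v \<omega>, future \<omega>) \<partial>M)"
    by (simp add: g_def traj_eq_future)
  also have "\<dots> = (\<integral>z. g z \<partial>(distr M borel v \<Otimes>\<^sub>M distr M ?P future))"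
    unfolding pair by (subst integral_distr) auto
  also have "\<dots> = (\<integral>x. (\<integral>y. g (x, y) \<partial>distr M ?P future) \<partial>distr M borel v)"
  proof (rule VU.integral_fst'[symmetric])
    show "integrable (distr M borel v \<Otimes>\<^sub>M distr M ?P future) g"
    proof (rule VU.integrable_const_bound[of _ b])
      show "g \<in> borel_measurable (distr M borel v \<Otimes>\<^sub>M distr M ?P future)"
        using g by (simp cong: measurable_cong_sets sets_pair_measure_cong)
    qed (use \<open>\<And>x. \<bar>f x\<bar> \<le> b\<close> in \<open>simp add: g_def\<close>)
  qed
  also have "\<dots> = (\<integral>x. (\<integral>\<xi>. f (run S k x \<xi>) \<partial>past_law) \<partial>distr M borel v)"
  proof (rule Bochner_Integration.integral_cong[OF refl])
    fix x
    have "(\<integral>y. g (x, y) \<partial>distr M ?P future) = (\<integral>\<omega>. g (x, future \<omega>) \<partial>M)"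
      by (subst integral_distr) auto
    also have "\<dots> = (\<integral>\<omega>. f (run S k x (past_at \<eta> k \<omega>)) \<partial>M)"
      using traj_eq_future[of S "\<lambda>_. x" k] traj_eq_run[of S \<eta> "\<lambda>_. x" k] by (simp add: g_def)
    also have "\<dots> = (\<integral>\<xi>. f (run S k x \<xi>) \<partial>past_law)"
      unfolding past_at_law[of k, symmetric] using run_const_measurable[OF S, of k x]
      by (subst integral_distr) auto
    finally show "(\<integral>y. g (x, y) \<partial>distr M ?P future) = (\<integral>\<xi>. f (run S k x \<xi>) \<partial>past_law)" .
  qed
  finally show "(\<integral>\<omega>. f (traj S \<eta> v k \<omega>) \<partial>M) = (\<integral>x. (\<integral>\<xi>. f (run S k x \<xi>) \<partial>past_law) \<partial>distr M borel v)" .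
qed

text \<open>The rate for deterministic starts is uniform over \<open>X\<close> and over the test
  functions, so it survives integration over the law of the start and the supremum in
  \<open>dual_lip_dist\<close>.\<close>

lemma exponential_mixing:
  fixes S :: "'h::{real_normed_vector, complete_space} \<times> 'e \<Rightarrow> 'h"
  assumes S[measurable]: "S \<in> measurable (borel \<Otimes>\<^sub>M borel) borel"
    and X: "compact X" "X \<noteq> {}" and X_inv: "\<And>u y. u \<in> X \<Longrightarrow> y \<in> K \<Longrightarrow> S (u, y) \<in> X"
    and G: "AE \<xi> in past_law. \<xi> \<in> G" "G \<subseteq> past_seqs K"
    and contr: "\<And>f u u' \<xi> k. 1-lipschitz_on UNIV f \<Longrightarrow> (\<And>x. \<bar>f x\<bar> \<le> 1) \<Longrightarrow> u \<in> X \<Longrightarrow> u' \<in> X \<Longrightarrow> \<xi> \<in> G \<Longrightarrow>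
      \<bar>(step_op S Q ^^ k) (\<lambda>z. f (fst z)) (u, \<xi>) - (step_op S Q ^^ k) (\<lambda>z. f (fst z)) (u', \<xi>)\<bar> \<le> C * exp (- \<gamma> * real k)"
    and C: "0 < C" "0 < \<gamma>"
  shows "\<exists>(\<mu> :: 'h measure) C \<gamma>.
           prob_space \<mu> \<and> sets \<mu> = sets borel \<and> msupport \<mu> \<subseteq> X \<and> C > 0 \<and> \<gamma> > 0 \<and>
           (\<forall>v. v \<in> borel_measurable M \<and> (AE \<omega> in M. v \<omega> \<in> X) \<and> indep_of_future M \<eta> v \<longrightarrow>
              (\<forall>k. dual_lip_dist (distr M borel (traj S \<eta> v k)) \<mu> \<le> C * exp (- \<gamma> * real k)))"
proof -
  obtain \<mu> :: "'h measure" where \<mu>: "prob_space \<mu>" "sets \<mu> = sets borel" "AE x in \<mu>. x \<in> X"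
    and rate: "\<And>f x k. 1-lipschitz_on UNIV f \<Longrightarrow> (\<And>x. \<bar>f x\<bar> \<le> 1) \<Longrightarrow> x \<in> X \<Longrightarrow>
      \<bar>(\<integral>\<xi>. f (run S k x \<xi>) \<partial>past_law) - (\<integral>x. f x \<partial>\<mu>)\<bar> \<le> 2 * C * exp (- \<gamma> * real k)"
    using mixing_past_law[OF S X X_inv G contr C] by blast
  have "dual_lip_dist (distr M borel (traj S \<eta> v k)) \<mu> \<le> (2 * C) * exp (- \<gamma> * real k)"
    if v: "v \<in> borel_measurable M" "AE \<omega> in M. v \<omega> \<in> X" "indep_of_future M \<eta> v" for v k
    unfolding dual_lip_dist_def
  proof (rule cSUP_least)
    show "{f :: 'h \<Rightarrow> real. 1-lipschitz_on UNIV f \<and> (\<forall>x. \<bar>f x\<bar> \<le> 1)} \<noteq> {}"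
      by (auto intro!: exI[of _ "\<lambda>_. 0"] lipschitz_onI)
    fix f :: "'h \<Rightarrow> real" assume "f \<in> {f. 1-lipschitz_on UNIV f \<and> (\<forall>x. \<bar>f x\<bar> \<le> 1)}"
    then have f: "1-lipschitz_on UNIV f" "\<And>x. \<bar>f x\<bar> \<le> 1" by auto
    have fm[measurable]: "f \<in> borel_measurable borel"
      using f(1) by (intro borel_measurable_continuous_onI lipschitz_on_continuous_on)
    interpret V: prob_space "distr M borel v" by (rule prob_space_distr) (rule v)
    interpret F: prob_space past_law by (rule prob_space_past_law)
    note tr = indep_future_integral[OF S v(1,3) fm f(2), of k]
    let ?e = "\<lambda>x. \<integral>\<xi>. f (run S k x \<xi>) \<partial>past_law"
    have em: "?e \<in> borel_measurable (distr M borel v)"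
    proof -
      have rm': "(\<lambda>z. run S k (fst z) (snd z)) \<in> measurable (borel \<Otimes>\<^sub>M past_law) borel"
        using run_measurable[OF S, of k] by (simp cong: measurable_cong_sets sets_pair_measure_cong)
      have "(\<lambda>(x, \<xi>). f (run S k x \<xi>)) \<in> borel_measurable (borel \<Otimes>\<^sub>M past_law)"
        using measurable_compose[OF rm' fm] by (simp add: split_beta')
      from F.borel_measurable_lebesgue_integral[OF this] show ?thesis by simp
    qed
    have eb: "\<bar>?e x\<bar> \<le> 1" for x
    proof -
      have "integrable past_law (\<lambda>\<xi>. f (run S k x \<xi>))"
        using run_const_measurable[OF S, of k x] f(2) by (intro F.integrable_const_bound[of _ 1]) auto
      then have "(\<integral>\<xi>. \<bar>f (run S k x \<xi>)\<bar> \<partial>past_law) \<le> (\<integral>\<xi>. 1 \<partial>past_law)"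
        using f(2) by (intro integral_mono) auto
      then show ?thesis
        using order_trans[OF integral_abs_bound[of past_law "\<lambda>\<xi>. f (run S k x \<xi>)"]]
        by (simp add: F.prob_space[unfolded space_past_law])
    qed
    have i: "integrable (distr M borel v) ?e"
      by (rule V.integrable_const_bound[of _ 1]) (use em eb in auto)
    have AEX: "AE x in distr M borel v. x \<in> X"
      using v X(1) by (subst AE_distr_iff) (auto simp: compact_imp_closed)
    have "(\<integral>x. f x \<partial>distr M borel (traj S \<eta> v k)) = (\<integral>\<omega>. f (traj S \<eta> v k \<omega>) \<partial>M)"
      by (rule integral_distr[OF tr(1) fm])
    also have "\<dots> = (\<integral>x. ?e x \<partial>distr M borel v)" by (rule tr(2))
    finally have "\<bar>(\<integral>x. f x \<partial>distr M borel (traj S \<eta> v k)) - (\<integral>x. f x \<partial>\<mu>)\<bar>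
        = \<bar>\<integral>x. ?e x - (\<integral>x. f x \<partial>\<mu>) \<partial>distr M borel v\<bar>"
      using i V.prob_space by simp
    also have "\<dots> \<le> (\<integral>x. \<bar>?e x - (\<integral>x. f x \<partial>\<mu>)\<bar> \<partial>distr M borel v)" by (rule integral_abs_bound)
    also have "\<dots> \<le> (\<integral>x. (2 * C) * exp (- \<gamma> * real k) \<partial>distr M borel v)"
    proof (rule integral_mono_AE)
      show "AE x in distr M borel v. \<bar>?e x - (\<integral>x. f x \<partial>\<mu>)\<bar> \<le> (2 * C) * exp (- \<gamma> * real k)"
        using AEX by eventually_elim (rule rate[OF f])
    qed (use i in auto)
    finally show "\<bar>(\<integral>x. f x \<partial>distr M borel (traj S \<eta> v k)) - (\<integral>x. f x \<partial>\<mu>)\<bar> \<le> (2 * C) * exp (- \<gamma> * real k)"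
      using V.prob_space by simp
  qed
  then show ?thesis
    using \<mu> C msupport_subset[OF compact_imp_closed[OF X(1)] \<mu>(2,3)]
    by (intro exI[of _ \<mu>] exI[of _ "2 * C"] exI[of _ \<gamma>]) auto
qed

end

section \<open>Disintegration of the conditional law\<close>

lemma emeasure_kernel_section_measurable:
  assumes "Q \<in> measurable A (prob_algebra B)" "D \<in> sets (A \<Otimes>\<^sub>M B)"
  shows "(\<lambda>x. emeasure (Q x) (Pair x -` D)) \<in> borel_measurable A"
proof (rule emeasure_measurable_subprob_algebra2[OF _ measurable_prob_algebraD[OF assms(1)]])
  have "(SIGMA x:space A. Pair x -` D) = D" using sets.sets_into_space[OF assms(2)] by (auto simp: space_pair_measure)
  then show "(SIGMA x:space A. Pair x -` D) \<in> sets (A \<Otimes>\<^sub>M B)" using assms(2) by simp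
qed

text \<open>For each fixed set the two kernels agree almost surely by uniqueness of densities; a
  countable intersection-stable generator collects the exceptional null sets into one.\<close>

lemma kernel_AE_unique:
  fixes \<kappa> \<kappa>' :: "'a \<Rightarrow> 'e::topological_space measure"
  assumes F: "prob_space F" and sc: "second_countable_type TYPE('e)"
    and \<kappa>: "\<kappa> \<in> measurable F (prob_algebra borel)" "\<kappa>' \<in> measurable F (prob_algebra borel)"
    and eq: "\<And>D A. D \<in> sets F \<Longrightarrow> A \<in> sets borel \<Longrightarrow>
      (\<integral>\<^sup>+x. indicator D x * emeasure (\<kappa> x) A \<partial>F) = (\<integral>\<^sup>+x. indicator D x * emeasure (\<kappa>' x) A \<partial>F)"
  shows "AE x in F. \<kappa> x = \<kappa>' x"
proof -
  interpret F: prob_space F by fact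
  obtain G :: "'e set set" where G: "countable G" "Int_stable G" "UNIV \<in> G" "sets (borel :: 'e measure) = sigma_sets UNIV G"
    using countable_Int_stable_generator_borel[OF sc] by blast
  have m: "(\<lambda>x. emeasure (k x) A) \<in> borel_measurable F"
    if "k \<in> measurable F (prob_algebra borel)" "A \<in> sets borel" for k and A :: "'e set"
    using measurable_compose[OF measurable_prob_algebraD[OF that(1)] measurable_emeasure_subprob_algebra[OF that(2)]] .
  have one: "AE x in F. emeasure (\<kappa> x) A = emeasure (\<kappa>' x) A" if A: "A \<in> sets borel" for A
  proof (rule F.density_unique[OF m[OF \<kappa>(1) A] m[OF \<kappa>(2) A]])
    show "density F (\<lambda>x. emeasure (\<kappa> x) A) = density F (\<lambda>x. emeasure (\<kappa>' x) A)"
      by (rule measure_eqI)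
        (use eq[OF _ A] m[OF \<kappa>(1) A] m[OF \<kappa>(2) A] in \<open>auto simp: emeasure_density mult.commute\<close>)
  qed
  have "AE x in F. \<forall>A\<in>G. emeasure (\<kappa> x) A = emeasure (\<kappa>' x) A"
    using one G by (subst AE_ball_countable) (auto intro: sigma_sets.Basic)
  then show ?thesis
  proof (rule AE_mp, intro AE_I2 impI)
    fix x assume x: "x \<in> space F" and e: "\<forall>A\<in>G. emeasure (\<kappa> x) A = emeasure (\<kappa>' x) A"
    have p: "prob_space (\<kappa> x)" "sets (\<kappa> x) = sets borel" "sets (\<kappa>' x) = sets borel"
      using measurable_space[OF \<kappa>(1) x] measurable_space[OF \<kappa>(2) x] by (auto simp: space_prob_algebra)
    interpret p: prob_space "\<kappa> x" by fact
    show "\<kappa> x = \<kappa>' x"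
    proof (rule measure_eqI_generator_eq[OF G(2), of UNIV])
      show "range (\<lambda>_::nat. UNIV) \<subseteq> G" using G(3) by auto
    qed (use e p G(4) in auto)
  qed
qed

context stationary_noise
begin

text \<open>The \<open>r\<close>-component of the past is replaced by that of an independent copy and integrated out, so
  that the kernel depends on the \<open>p\<close>-component of every past, and not only of almost every one.\<close>

definition block_kernel :: "('e \<Rightarrow> 'e) \<Rightarrow> ('e \<Rightarrow> 'e) \<Rightarrow> (nat \<Rightarrow> 'e) \<Rightarrow> 'e measure" where
  "block_kernel p r \<xi> = bind past_law (\<lambda>\<xi>'. distr (Q (\<lambda>n. p (\<xi> n) + r (\<xi>' n))) borel p)"

lemma block_kernel_cong: "(\<And>n. p (\<xi> n) = p (\<xi>' n)) \<Longrightarrow> block_kernel p r \<xi> = block_kernel p r \<xi>'"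
  by (simp add: block_kernel_def)

lemma map_seq_measurable:
  assumes [measurable]: "p \<in> measurable borel (borel :: 'e measure)"
  shows "(\<lambda>\<xi> n. p (\<xi> n)) \<in> measurable seq_space seq_space"
  by (rule measurable_PiM_single') (auto simp: space_PiM)

lemma add_seq_measurable:
  assumes [measurable]: "p \<in> measurable borel (borel :: 'e measure)" "r \<in> measurable borel (borel :: 'e measure)"
  shows "(\<lambda>z n. p (fst z n) + r (snd z n)) \<in> measurable (seq_space \<Otimes>\<^sub>M seq_space) seq_space"
  by (rule measurable_PiM_single') (auto simp: space_PiM intro!: borel_measurable_add'[OF scE'])

lemma block_kernel_inner:
  assumes p[measurable]: "p \<in> measurable borel (borel :: 'e measure)" and r[measurable]: "r \<in> measurable borel (borel :: 'e measure)"
  shows "(\<lambda>z. distr (Q (\<lambda>n. p (fst z n) + r (snd z n))) borel p) \<in> measurable (seq_space \<Otimes>\<^sub>M seq_space) (prob_algebra borel)"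
  by (rule measurable_distr_prob_space2[where M=borel, OF measurable_compose[OF add_seq_measurable Q_kernel]]) measurable

lemma past_law_in_prob_algebra: "past_law \<in> space (prob_algebra seq_space)"
  using prob_space_past_law by (simp add: space_prob_algebra)

lemma block_kernel_measurable:
  assumes p: "p \<in> measurable borel (borel :: 'e measure)" and r: "r \<in> measurable borel (borel :: 'e measure)"
  shows "block_kernel p r \<in> measurable seq_space (prob_algebra borel)"
proof -
  have "(\<lambda>\<xi>. bind past_law (\<lambda>\<xi>'. distr (Q (\<lambda>n. p (\<xi> n) + r (\<xi>' n))) borel p)) \<in> measurable seq_space (prob_algebra borel)"
    by (rule measurable_bind_prob_space2[where N=seq_space])
      (use past_law_in_prob_algebra block_kernel_inner[OF p r] in \<open>auto simp: split_beta'\<close>)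
  then show ?thesis by (simp add: block_kernel_def[abs_def])
qed

lemma block_kernel_emeasure:
  assumes p[measurable]: "p \<in> measurable borel (borel :: 'e measure)" and r[measurable]: "r \<in> measurable borel (borel :: 'e measure)"
    and A[measurable]: "A \<in> sets borel"
  shows "emeasure (block_kernel p r \<xi>) A = (\<integral>\<^sup>+\<xi>'. emeasure (Q (\<lambda>n. p (\<xi> n) + r (\<xi>' n))) (p -` A) \<partial>past_law)"
proof -
  interpret F: prob_space past_law by (rule prob_space_past_law)
  have "(\<lambda>\<xi>'. (\<lambda>z. distr (Q (\<lambda>n. p (fst z n) + r (snd z n))) borel p) (\<xi>, \<xi>')) \<in> measurable past_law (prob_algebra borel)"
    by (rule measurable_compose[OF _ block_kernel_inner[OF p r]]) (simp add: space_PiM)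
  then have N: "(\<lambda>\<xi>'. distr (Q (\<lambda>n. p (\<xi> n) + r (\<xi>' n))) borel p) \<in> measurable past_law (prob_algebra borel)"
    by simp
  have "emeasure (block_kernel p r \<xi>) A = (\<integral>\<^sup>+\<xi>'. emeasure (distr (Q (\<lambda>n. p (\<xi> n) + r (\<xi>' n))) borel p) A \<partial>past_law)"
    unfolding block_kernel_def by (rule emeasure_bind[OF F.not_empty measurable_prob_algebraD[OF N] A])
  also have "\<dots> = (\<integral>\<^sup>+\<xi>'. emeasure (Q (\<lambda>n. p (\<xi> n) + r (\<xi>' n))) (p -` A) \<partial>past_law)"
  proof (rule nn_integral_cong)
    fix \<xi>'
    note s = kernel_prob_algebraD(2)[OF Q_kernel]
    have "p \<in> measurable (Q (\<lambda>n. p (\<xi> n) + r (\<xi>' n))) borel" using p measurable_cong_sets[OF s refl] by blast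
    from emeasure_distr[OF this A]
    show "emeasure (distr (Q (\<lambda>n. p (\<xi> n) + r (\<xi>' n))) borel p) A = emeasure (Q (\<lambda>n. p (\<xi> n) + r (\<xi>' n))) (p -` A)"
      using sets_eq_imp_space_eq[OF s] by simp
  qed
  finally show ?thesis .
qed

text \<open>Independence of the entire component pasts, not only at one time. By stationarity it can
  be applied to sequences whose newest entry is the next noise.\<close>

definition indep_blocks :: "('e \<Rightarrow> 'e) \<Rightarrow> ('e \<Rightarrow> 'e) \<Rightarrow> bool" where
  "indep_blocks p r \<longleftrightarrow> (\<forall>C\<in>sets seq_space. \<forall>D\<in>sets seq_space.
     emeasure past_law {\<xi>. (\<lambda>n. p (\<xi> n)) \<in> C \<and> (\<lambda>n. r (\<xi> n)) \<in> D} =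
     emeasure past_law {\<xi>. (\<lambda>n. p (\<xi> n)) \<in> C} * emeasure past_law {\<xi>. (\<lambda>n. r (\<xi> n)) \<in> D})"

lemma indep_blocks_sym: "indep_blocks p r \<Longrightarrow> indep_blocks r p"
  unfolding indep_blocks_def by (auto simp: conj_commute mult.commute)

lemma indep_blocks_pair:
  assumes p: "p \<in> measurable borel (borel :: 'e measure)" and r: "r \<in> measurable borel (borel :: 'e measure)"
    and ind: "indep_blocks p r"
  shows "distr past_law (seq_space \<Otimes>\<^sub>M seq_space) (\<lambda>\<xi>. (\<lambda>n. p (\<xi> n), \<lambda>n. r (\<xi> n))) =
    distr past_law seq_space (\<lambda>\<xi> n. p (\<xi> n)) \<Otimes>\<^sub>M distr past_law seq_space (\<lambda>\<xi> n. r (\<xi> n))"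
proof -
  interpret F: prob_space past_law by (rule prob_space_past_law)
  note pm[measurable] = map_seq_measurable[OF p] and rm[measurable] = map_seq_measurable[OF r]
  interpret P: prob_space "distr past_law seq_space (\<lambda>\<xi> n. p (\<xi> n))" by (rule F.prob_space_distr) simp
  interpret R: prob_space "distr past_law seq_space (\<lambda>\<xi> n. r (\<xi> n))" by (rule F.prob_space_distr) simp
  show ?thesis
  proof (rule pair_measure_eqI[symmetric])
    show "sigma_finite_measure (distr past_law seq_space (\<lambda>\<xi> n. p (\<xi> n)))"
      "sigma_finite_measure (distr past_law seq_space (\<lambda>\<xi> n. r (\<xi> n)))" by unfold_locales
    fix C D assume "C \<in> sets (distr past_law seq_space (\<lambda>\<xi> n. p (\<xi> n)))" "D \<in> sets (distr past_law seq_space (\<lambda>\<xi> n. r (\<xi> n)))"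
    then have [measurable]: "C \<in> sets seq_space" "D \<in> sets seq_space" by auto
    have "emeasure past_law {\<xi>. (\<lambda>n. p (\<xi> n)) \<in> C} * emeasure past_law {\<xi>. (\<lambda>n. r (\<xi> n)) \<in> D} =
      emeasure past_law {\<xi>. (\<lambda>n. p (\<xi> n)) \<in> C \<and> (\<lambda>n. r (\<xi> n)) \<in> D}"
      using ind unfolding indep_blocks_def by simp
    then show "emeasure (distr past_law seq_space (\<lambda>\<xi> n. p (\<xi> n))) C * emeasure (distr past_law seq_space (\<lambda>\<xi> n. r (\<xi> n))) D =
      emeasure (distr past_law (seq_space \<Otimes>\<^sub>M seq_space) (\<lambda>\<xi>. (\<lambda>n. p (\<xi> n), \<lambda>n. r (\<xi> n)))) (C \<times> D)"
      by (simp add: emeasure_distr vimage_def)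
  qed (simp cong: sets_pair_measure_cong)
qed

lemma indep_blocks_nn_integral:
  fixes h :: "(nat \<Rightarrow> 'e) \<Rightarrow> (nat \<Rightarrow> 'e) \<Rightarrow> ennreal"
  assumes p: "p \<in> measurable borel (borel :: 'e measure)" and r: "r \<in> measurable borel (borel :: 'e measure)"
    and ind: "indep_blocks p r" and h[measurable]: "(\<lambda>z. h (fst z) (snd z)) \<in> borel_measurable (seq_space \<Otimes>\<^sub>M seq_space)"
  shows "(\<integral>\<^sup>+\<xi>. h (\<lambda>n. p (\<xi> n)) (\<lambda>n. r (\<xi> n)) \<partial>past_law) =
    (\<integral>\<^sup>+\<xi>. \<integral>\<^sup>+\<xi>'. h (\<lambda>n. p (\<xi> n)) (\<lambda>n. r (\<xi>' n)) \<partial>past_law \<partial>past_law)"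
proof -
  interpret F: prob_space past_law by (rule prob_space_past_law)
  note pm[measurable] = map_seq_measurable[OF p] and rm[measurable] = map_seq_measurable[OF r]
  let ?P = "distr past_law seq_space (\<lambda>\<xi> n. p (\<xi> n))" and ?R = "distr past_law seq_space (\<lambda>\<xi> n. r (\<xi> n))"
  interpret P: prob_space ?P by (rule F.prob_space_distr) simp
  interpret R: prob_space ?R by (rule F.prob_space_distr) simp
  interpret PR: pair_sigma_finite ?P ?R ..
  have "(\<integral>\<^sup>+\<xi>. h (\<lambda>n. p (\<xi> n)) (\<lambda>n. r (\<xi> n)) \<partial>past_law) =
    (\<integral>\<^sup>+z. h (fst z) (snd z) \<partial>distr past_law (seq_space \<Otimes>\<^sub>M seq_space) (\<lambda>\<xi>. (\<lambda>n. p (\<xi> n), \<lambda>n. r (\<xi> n))))"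
    by (subst nn_integral_distr) auto
  also have "\<dots> = (\<integral>\<^sup>+z. h (fst z) (snd z) \<partial>(?P \<Otimes>\<^sub>M ?R))" unfolding indep_blocks_pair[OF p r ind] ..
  also have "\<dots> = (\<integral>\<^sup>+\<alpha>. \<integral>\<^sup>+\<beta>. h \<alpha> \<beta> \<partial>?R \<partial>?P)"
  proof -
    have "(\<lambda>z. h (fst z) (snd z)) \<in> borel_measurable (?P \<Otimes>\<^sub>M ?R)"
      using h by (simp cong: measurable_cong_sets sets_pair_measure_cong)
    from R.nn_integral_fst[OF this] show ?thesis by simp
  qed
  also have "\<dots> = (\<integral>\<^sup>+\<alpha>. \<integral>\<^sup>+\<xi>'. h \<alpha> (\<lambda>n. r (\<xi>' n)) \<partial>past_law \<partial>?P)"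
  proof (rule nn_integral_cong)
    fix \<alpha>
    have "(\<lambda>\<beta>. (\<lambda>z. h (fst z) (snd z)) (\<alpha>, \<beta>)) \<in> borel_measurable seq_space"
      by (rule measurable_compose[OF _ h]) (simp add: space_PiM)
    then show "(\<integral>\<^sup>+\<beta>. h \<alpha> \<beta> \<partial>?R) = (\<integral>\<^sup>+\<xi>'. h \<alpha> (\<lambda>n. r (\<xi>' n)) \<partial>past_law)"
      by (subst nn_integral_distr) auto
  qed
  also have "\<dots> = (\<integral>\<^sup>+\<xi>. \<integral>\<^sup>+\<xi>'. h (\<lambda>n. p (\<xi> n)) (\<lambda>n. r (\<xi>' n)) \<partial>past_law \<partial>past_law)"
  proof -
    have "(\<lambda>(\<alpha>, \<xi>'). (\<lambda>z. h (fst z) (snd z)) (\<alpha>, \<lambda>n. r (\<xi>' n))) \<in> borel_measurable (seq_space \<Otimes>\<^sub>M past_law)"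
      unfolding split_beta'
      by (rule measurable_compose[OF _ h]) measurable
    then have "(\<lambda>(\<alpha>, \<xi>'). h \<alpha> (\<lambda>n. r (\<xi>' n))) \<in> borel_measurable (seq_space \<Otimes>\<^sub>M past_law)"
      by simp
    from F.borel_measurable_nn_integral[OF this]
    have "(\<lambda>\<alpha>. \<integral>\<^sup>+\<xi>'. h \<alpha> (\<lambda>n. r (\<xi>' n)) \<partial>past_law) \<in> borel_measurable seq_space" by simp
    then show ?thesis by (subst nn_integral_distr) auto
  qed
  finally show ?thesis .
qed

lemma joint_law_eq_split:
  "bind past_law (\<lambda>\<xi>. distr (Q \<xi>) (seq_space \<Otimes>\<^sub>M borel) (\<lambda>y. (\<xi>, y))) =
    distr past_law (seq_space \<Otimes>\<^sub>M borel) (\<lambda>\<zeta>. (\<lambda>n. \<zeta> (Suc n), \<zeta> 0))"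
proof -
  have [measurable]: "(\<lambda>\<zeta> n. \<zeta> (Suc n)) \<in> measurable seq_space (seq_space :: (nat \<Rightarrow> 'e) measure)"
    by (rule measurable_PiM_single') (auto simp: space_PiM)
  have "distr past_law (seq_space \<Otimes>\<^sub>M borel) (\<lambda>\<zeta>. (\<lambda>n. \<zeta> (Suc n), \<zeta> 0)) =
    distr M (seq_space \<Otimes>\<^sub>M borel) (\<lambda>\<omega>. (past \<eta> \<omega>, \<eta> 1 \<omega>))"
    unfolding past_at_law[of 1, symmetric]
    by (subst distr_distr) (auto simp: comp_def past_at_def past_def[abs_def])
  then show ?thesis by (simp add: joint_law)
qed

text \<open>\<open>Q\<close> is evaluated at the sum of the two component pasts. By independence,
  integrating over the \<open>r\<close>-part separately gives the same as integrating jointly, and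
  this separate integral is how \<open>block_kernel\<close> is built.\<close>

lemma block_marginal:
  assumes p[measurable]: "p \<in> measurable borel (borel :: 'e measure)" and r[measurable]: "r \<in> measurable borel (borel :: 'e measure)"
    and pr: "\<And>y. p y + r y = y" and ind: "indep_blocks p r" and C[measurable]: "C \<in> sets (seq_space \<Otimes>\<^sub>M borel)"
  shows "emeasure past_law {\<zeta>. ((\<lambda>n. p (\<zeta> (Suc n))), p (\<zeta> 0)) \<in> C} =
    (\<integral>\<^sup>+\<xi>. emeasure (block_kernel p r \<xi>) (Pair (\<lambda>n. p (\<xi> n)) -` C) \<partial>past_law)"
proof -
  note pm[measurable] = map_seq_measurable[OF p]
  let ?J = "bind past_law (\<lambda>\<xi>. distr (Q \<xi>) (seq_space \<Otimes>\<^sub>M borel) (\<lambda>y. (\<xi>, y)))"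
  let ?g = "\<lambda>z. ((\<lambda>n. p (fst z n)), p (snd z))"
  have g[measurable]: "?g \<in> measurable (seq_space \<Otimes>\<^sub>M borel) (seq_space \<Otimes>\<^sub>M borel)" by measurable
  have [measurable]: "(\<lambda>\<zeta> n. \<zeta> (Suc n)) \<in> measurable seq_space (seq_space :: (nat \<Rightarrow> 'e) measure)"
    by (rule measurable_PiM_single') (auto simp: space_PiM)
  define D where "D = ?g -` C \<inter> space (seq_space \<Otimes>\<^sub>M borel)"
  have D[measurable]: "D \<in> sets (seq_space \<Otimes>\<^sub>M borel)" unfolding D_def by (rule measurable_sets[OF g C])
  have Deq: "D = ?g -` C" by (simp add: D_def space_pair_measure space_PiM)
  \<comment> \<open>The dependence on the component pasts is separated: \<open>C\<close> reads only
    the \<open>p\<close>-part, \<open>Q\<close> reads both. Independence then replaces the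
    \<open>r\<close>-part by an independent copy.\<close>
  define h where "h \<alpha> \<beta> = emeasure (Q (\<lambda>n. \<alpha> n + \<beta> n)) {y. (\<alpha>, p y) \<in> C}" for \<alpha> \<beta> :: "nat \<Rightarrow> 'e"
  have hm: "(\<lambda>z. h (fst z) (snd z)) \<in> borel_measurable (seq_space \<Otimes>\<^sub>M seq_space)"
  proof -
    have 1: "(\<lambda>z. Q (\<lambda>n. fst z n + snd z n)) \<in> measurable (seq_space \<Otimes>\<^sub>M seq_space) (prob_algebra borel)"
      using measurable_compose[OF add_seq_measurable[of "\<lambda>x. x" "\<lambda>x. x"] Q_kernel] by simp
    let ?k = "\<lambda>w. (fst (fst w), p (snd w)) :: (nat \<Rightarrow> 'e) \<times> 'e"
    have k: "?k \<in> measurable ((seq_space \<Otimes>\<^sub>M seq_space) \<Otimes>\<^sub>M borel) (seq_space \<Otimes>\<^sub>M borel)" by measurable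
    have 2: "?k -` C \<inter> space ((seq_space \<Otimes>\<^sub>M seq_space) \<Otimes>\<^sub>M borel) \<in> sets ((seq_space \<Otimes>\<^sub>M seq_space) \<Otimes>\<^sub>M borel)"
      by (rule measurable_sets[OF k C])
    from emeasure_kernel_section_measurable[OF 1 2] show ?thesis
      by (simp add: h_def space_pair_measure space_PiM vimage_def)
  qed
  have "emeasure past_law {\<zeta>. ((\<lambda>n. p (\<zeta> (Suc n))), p (\<zeta> 0)) \<in> C} = emeasure ?J D"
  proof -
    have "(\<lambda>\<zeta>. (\<lambda>n. \<zeta> (Suc n), \<zeta> 0)) \<in> measurable seq_space (seq_space \<Otimes>\<^sub>M (borel :: 'e measure))"
      by measurable
    then have m: "(\<lambda>\<zeta>. (\<lambda>n. \<zeta> (Suc n), \<zeta> 0)) \<in> measurable past_law (seq_space \<Otimes>\<^sub>M (borel :: 'e measure))"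
      using measurable_cong_sets[OF sets_past_law refl] by blast
    show ?thesis
      unfolding joint_law_eq_split emeasure_distr[OF m D] by (simp add: Deq vimage_def)
  qed
  also have "\<dots> = (\<integral>\<^sup>+\<xi>. emeasure (Q \<xi>) (Pair \<xi> -` D) \<partial>past_law)"
    by (rule bind_pair_emeasure[OF prob_space_past_law _ Q_kernel D]) simp
  also have "\<dots> = (\<integral>\<^sup>+\<xi>. h (\<lambda>n. p (\<xi> n)) (\<lambda>n. r (\<xi> n)) \<partial>past_law)"
    by (simp add: h_def pr Deq vimage_def)
  also have "\<dots> = (\<integral>\<^sup>+\<xi>. \<integral>\<^sup>+\<xi>'. h (\<lambda>n. p (\<xi> n)) (\<lambda>n. r (\<xi>' n)) \<partial>past_law \<partial>past_law)"
    by (rule indep_blocks_nn_integral[OF p r ind hm])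
  also have "\<dots> = (\<integral>\<^sup>+\<xi>. emeasure (block_kernel p r \<xi>) (Pair (\<lambda>n. p (\<xi> n)) -` C) \<partial>past_law)"
  proof (rule nn_integral_cong)
    fix \<xi>
    have "Pair (\<lambda>n. p (\<xi> n)) -` C \<in> sets borel" using C by (rule sets_Pair1)
    from block_kernel_emeasure[OF p r this, of \<xi>]
    show "(\<integral>\<^sup>+\<xi>'. h (\<lambda>n. p (\<xi> n)) (\<lambda>n. r (\<xi>' n)) \<partial>past_law) = emeasure (block_kernel p r \<xi>) (Pair (\<lambda>n. p (\<xi> n)) -` C)"
      by (simp add: h_def vimage_def)
  qed
  finally show ?thesis .
qed

text \<open>Two laws on pairs of blocks are compared, a block being a component past with its next
  value. The true law gives rectangles product measure by independence; so does the law built from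
  the kernels, since each kernel reads only its own component. The factors agree by
  \<open>block_marginal\<close>. Adding the blocks yields a disintegration of the joint law, and its
  uniqueness identifies \<open>Q\<close>.\<close>

theorem block_disintegration:
  assumes p[measurable]: "p \<in> measurable borel (borel :: 'e measure)" and r[measurable]: "r \<in> measurable borel (borel :: 'e measure)"
    and pr: "\<And>y. p y + r y = y" and pp: "\<And>y. p (p y) = p y" "\<And>y. r (r y) = r y" and ind: "indep_blocks p r"
  shows "AE \<xi> in past_law. Q \<xi> = distr (block_kernel r p \<xi> \<Otimes>\<^sub>M block_kernel p r \<xi>) borel (\<lambda>(b, a). a + b)"
proof -
  interpret F: prob_space past_law by (rule prob_space_past_law)
  note pm[measurable] = map_seq_measurable[OF p] and rm[measurable] = map_seq_measurable[OF r]
  note kp[measurable] = block_kernel_measurable[OF p r] and kr[measurable] = block_kernel_measurable[OF r p]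
  have ind': "indep_blocks r p" by (rule indep_blocks_sym[OF ind])
  have rp: "r y + p y = y" for y using pr[of y] by (simp add: add.commute)
  have [measurable]: "(\<lambda>\<zeta> n. \<zeta> (Suc n)) \<in> measurable seq_space (seq_space :: (nat \<Rightarrow> 'e) measure)"
    by (rule measurable_PiM_single') (auto simp: space_PiM)
  have plus[measurable]: "(\<lambda>(b, a). a + b) \<in> measurable (borel \<Otimes>\<^sub>M borel) (borel :: 'e measure)"
    unfolding split_beta by (rule borel_measurable_add'[OF scE']) measurable
  let ?SB = "(seq_space :: (nat \<Rightarrow> 'e) measure) \<Otimes>\<^sub>M (borel :: 'e measure)"
  let ?K = "\<lambda>\<xi>. block_kernel r p \<xi> \<Otimes>\<^sub>M block_kernel p r \<xi>"
  \<comment> \<open>Entry 0 plays the next noise and the entries from 1 on play its past: the past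
    at time 1 has the law of the past at time 0.\<close>
  define \<sigma> where "\<sigma> f \<zeta> = ((\<lambda>n. f (\<zeta> (Suc n))), f (\<zeta> 0))" for f :: "'e \<Rightarrow> 'e" and \<zeta> :: "nat \<Rightarrow> 'e"
  have \<sigma>m[measurable]: "\<sigma> p \<in> measurable seq_space ?SB" "\<sigma> r \<in> measurable seq_space ?SB"
    unfolding \<sigma>_def by measurable
  have split1: "(\<lambda>\<zeta>. (\<lambda>n. \<zeta> (Suc n), \<zeta> 0)) \<in> measurable seq_space ?SB" by measurable
  have split2: "(\<lambda>\<zeta>. (\<sigma> r \<zeta>, \<sigma> p \<zeta>)) \<in> measurable seq_space (?SB \<Otimes>\<^sub>M ?SB)" by measurable
  define \<tau> where "\<tau> \<xi> z = (((\<lambda>n. r (\<xi> n)), fst z), ((\<lambda>n. p (\<xi> n)), snd z))" for \<xi> :: "nat \<Rightarrow> 'e" and z :: "'e \<times> 'e"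
  have \<tau>m[measurable]: "(\<lambda>w. \<tau> (fst w) (snd w)) \<in> measurable (seq_space \<Otimes>\<^sub>M (borel \<Otimes>\<^sub>M borel)) (?SB \<Otimes>\<^sub>M ?SB)"
    unfolding \<tau>_def by measurable
  have \<tau>m1[measurable]: "\<tau> \<xi> \<in> measurable (borel \<Otimes>\<^sub>M borel) (?SB \<Otimes>\<^sub>M ?SB)" for \<xi>
    unfolding \<tau>_def by (measurable; simp add: space_PiM)
  have Km: "?K \<in> measurable past_law (prob_algebra (borel \<Otimes>\<^sub>M borel))" by measurable
  define N1 where "N1 = distr past_law (?SB \<Otimes>\<^sub>M ?SB) (\<lambda>\<zeta>. (\<sigma> r \<zeta>, \<sigma> p \<zeta>))"
  define N2 where "N2 = bind past_law (\<lambda>\<xi>. distr (?K \<xi>) (?SB \<Otimes>\<^sub>M ?SB) (\<tau> \<xi>))"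
  have Nk: "(\<lambda>\<xi>. distr (?K \<xi>) (?SB \<Otimes>\<^sub>M ?SB) (\<tau> \<xi>)) \<in> measurable past_law (prob_algebra (?SB \<Otimes>\<^sub>M ?SB))"
    by (rule measurable_distr_prob_space2[OF Km]) (use \<tau>m in \<open>simp add: split_beta' cong: measurable_cong_sets sets_pair_measure_cong\<close>)
  have N2e: "emeasure N2 W = (\<integral>\<^sup>+\<xi>. emeasure (?K \<xi>) (\<tau> \<xi> -` W) \<partial>past_law)" if W: "W \<in> sets (?SB \<Otimes>\<^sub>M ?SB)" for W
  proof -
    have "emeasure N2 W = (\<integral>\<^sup>+\<xi>. emeasure (distr (?K \<xi>) (?SB \<Otimes>\<^sub>M ?SB) (\<tau> \<xi>)) W \<partial>past_law)"
      unfolding N2_def by (rule emeasure_bind[OF F.not_empty measurable_prob_algebraD[OF Nk] W])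
    also have "\<dots> = (\<integral>\<^sup>+\<xi>. emeasure (?K \<xi>) (\<tau> \<xi> -` W) \<partial>past_law)"
    proof (rule nn_integral_cong)
      fix \<xi>
      have s: "sets (?K \<xi>) = sets (borel \<Otimes>\<^sub>M borel)"
        using kernel_prob_algebraD(2)[OF kp] kernel_prob_algebraD(2)[OF kr] by (simp cong: sets_pair_measure_cong)
      have "\<tau> \<xi> \<in> measurable (?K \<xi>) (?SB \<Otimes>\<^sub>M ?SB)" using \<tau>m1 measurable_cong_sets[OF s refl] by blast
      from emeasure_distr[OF this W]
      show "emeasure (distr (?K \<xi>) (?SB \<Otimes>\<^sub>M ?SB) (\<tau> \<xi>)) W = emeasure (?K \<xi>) (\<tau> \<xi> -` W)"
        using sets_eq_imp_space_eq[OF s] by (simp add: space_pair_measure)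
    qed
    finally show ?thesis .
  qed
  have "N1 = N2"
  proof (rule finite_pair_measure_eqI)
    show "finite_measure N1" unfolding N1_def by (rule F.finite_measure_distr) measurable
    show "sets N1 = sets (?SB \<Otimes>\<^sub>M ?SB)" by (simp add: N1_def)
    show "sets N2 = sets (?SB \<Otimes>\<^sub>M ?SB)" unfolding N2_def by (rule sets_bind) auto
    fix C D assume C[measurable]: "C \<in> sets ?SB" and D[measurable]: "D \<in> sets ?SB"
    let ?s = "\<lambda>\<zeta> :: nat \<Rightarrow> 'e. (\<lambda>n. \<zeta> (Suc n), \<zeta> 0)"
    have sm[measurable]: "?s \<in> measurable seq_space ?SB" by measurable
    have sets_s: "{\<zeta>. ?s \<zeta> \<in> E} \<in> sets seq_space" if "E \<in> sets ?SB" for E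
      using measurable_sets[OF sm that] by (simp add: vimage_def space_PiM)
    define u where "u \<xi> = emeasure (block_kernel r p \<xi>) (Pair (\<lambda>n. r (\<xi> n)) -` C)" for \<xi>
    define w where "w \<xi> = emeasure (block_kernel p r \<xi>) (Pair (\<lambda>n. p (\<xi> n)) -` D)" for \<xi>
    have um: "u \<in> borel_measurable seq_space"
    proof -
      let ?k = "\<lambda>z. ((\<lambda>n. r (fst z n)), snd z)"
      have k: "?k \<in> measurable ?SB ?SB" by measurable
      from emeasure_kernel_section_measurable[OF kr measurable_sets[OF k C]]
      show ?thesis by (simp add: u_def[abs_def] space_pair_measure space_PiM vimage_def)
    qed
    have wm: "w \<in> borel_measurable seq_space"
    proof -
      let ?k = "\<lambda>z. ((\<lambda>n. p (fst z n)), snd z)"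
      have k: "?k \<in> measurable ?SB ?SB" by measurable
      from emeasure_kernel_section_measurable[OF kp measurable_sets[OF k D]]
      show ?thesis by (simp add: w_def[abs_def] space_pair_measure space_PiM vimage_def)
    qed
    have "emeasure N1 (C \<times> D) = emeasure past_law {\<zeta>. \<sigma> r \<zeta> \<in> C \<and> \<sigma> p \<zeta> \<in> D}"
      unfolding N1_def by (subst emeasure_distr) (auto intro!: arg_cong[where f="emeasure past_law"])
    also have "\<dots> = emeasure past_law {\<zeta>. (\<lambda>n. r (\<zeta> n)) \<in> {\<zeta>. ?s \<zeta> \<in> C} \<and> (\<lambda>n. p (\<zeta> n)) \<in> {\<zeta>. ?s \<zeta> \<in> D}}"
      by (simp add: \<sigma>_def)
    also have "\<dots> = emeasure past_law {\<zeta>. (\<lambda>n. r (\<zeta> n)) \<in> {\<zeta>. ?s \<zeta> \<in> C}} * emeasure past_law {\<zeta>. (\<lambda>n. p (\<zeta> n)) \<in> {\<zeta>. ?s \<zeta> \<in> D}}"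
      using ind'[unfolded indep_blocks_def, rule_format, OF sets_s[OF C] sets_s[OF D]] .
    also have "emeasure past_law {\<zeta>. (\<lambda>n. r (\<zeta> n)) \<in> {\<zeta>. ?s \<zeta> \<in> C}} = (\<integral>\<^sup>+\<xi>. u \<xi> \<partial>past_law)"
      using block_marginal[OF r p rp ind' C] by (simp add: u_def)
    also have "emeasure past_law {\<zeta>. (\<lambda>n. p (\<zeta> n)) \<in> {\<zeta>. ?s \<zeta> \<in> D}} = (\<integral>\<^sup>+\<xi>. w \<xi> \<partial>past_law)"
      using block_marginal[OF p r pr ind D] by (simp add: w_def)
    finally have e1: "emeasure N1 (C \<times> D) = (\<integral>\<^sup>+\<xi>. u \<xi> \<partial>past_law) * (\<integral>\<^sup>+\<xi>. w \<xi> \<partial>past_law)" .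
    \<comment> \<open>By idempotence \<open>u\<close> and \<open>w\<close> are functions of their
      respective components alone, so the integral of the product factorises.\<close>
    have ur: "u (\<lambda>n. r (\<xi> n)) = u \<xi>" for \<xi>
      unfolding u_def pp using block_kernel_cong[of r "\<lambda>n. r (\<xi> n)" \<xi> p] by (simp add: pp)
    have wp: "w (\<lambda>n. p (\<xi> n)) = w \<xi>" for \<xi>
      unfolding w_def pp using block_kernel_cong[of p "\<lambda>n. p (\<xi> n)" \<xi> r] by (simp add: pp)
    have "emeasure N2 (C \<times> D) = (\<integral>\<^sup>+\<xi>. emeasure (?K \<xi>) (\<tau> \<xi> -` (C \<times> D)) \<partial>past_law)"
      by (rule N2e) measurable
    also have "\<dots> = (\<integral>\<^sup>+\<xi>. u \<xi> * w \<xi> \<partial>past_law)"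
    proof (rule nn_integral_cong)
      fix \<xi>
      interpret kp: prob_space "block_kernel p r \<xi>" by (rule kernel_prob_algebraD[OF kp])
      have "\<tau> \<xi> -` (C \<times> D) = (Pair (\<lambda>n. r (\<xi> n)) -` C) \<times> (Pair (\<lambda>n. p (\<xi> n)) -` D)" by (auto simp: \<tau>_def)
      moreover have "Pair (\<lambda>n. r (\<xi> n)) -` C \<in> sets (block_kernel r p \<xi>)" "Pair (\<lambda>n. p (\<xi> n)) -` D \<in> sets (block_kernel p r \<xi>)"
        using sets_Pair1[OF C] sets_Pair1[OF D] kernel_prob_algebraD(2)[OF kp] kernel_prob_algebraD(2)[OF kr] by auto
      ultimately show "emeasure (?K \<xi>) (\<tau> \<xi> -` (C \<times> D)) = u \<xi> * w \<xi>"
        using kp.emeasure_pair_measure_Times by (simp add: u_def w_def)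
    qed
    also have "\<dots> = (\<integral>\<^sup>+\<xi>. (\<lambda>\<beta> \<alpha>. u \<beta> * w \<alpha>) (\<lambda>n. r (\<xi> n)) (\<lambda>n. p (\<xi> n)) \<partial>past_law)"
      by (simp add: ur wp)
    also have "\<dots> = (\<integral>\<^sup>+\<xi>. \<integral>\<^sup>+\<xi>'. u (\<lambda>n. r (\<xi> n)) * w (\<lambda>n. p (\<xi>' n)) \<partial>past_law \<partial>past_law)"
      by (rule indep_blocks_nn_integral[OF r p ind']) (use um wm in measurable)
    also have "\<dots> = (\<integral>\<^sup>+\<xi>. u \<xi> \<partial>past_law) * (\<integral>\<^sup>+\<xi>. w \<xi> \<partial>past_law)"
      using um wm by (simp add: ur wp nn_integral_cmult nn_integral_multc)
    finally show "emeasure N1 (C \<times> D) = emeasure N2 (C \<times> D)" using e1 by simp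
  qed
  show ?thesis
  proof (rule kernel_AE_unique[OF prob_space_past_law scE'])
    show "Q \<in> measurable past_law (prob_algebra borel)" by measurable
    show "(\<lambda>\<xi>. distr (?K \<xi>) borel (\<lambda>(b, a). a + b)) \<in> measurable past_law (prob_algebra borel)"
      by (rule measurable_compose[OF Km measurable_distr_prob_space[OF plus]])
    fix D :: "(nat \<Rightarrow> 'e) set" and A :: "'e set" assume "D \<in> sets past_law" and A[measurable]: "A \<in> sets borel"
    then have D[measurable]: "D \<in> sets seq_space" by simp
    \<comment> \<open>The preimage of \<open>D \<times> A\<close> under blockwise addition, which
      undoes the splitting because \<open>p\<close> and \<open>r\<close> add up to the
      identity.\<close>
    define W where "W = {z. ((\<lambda>n. fst (snd z) n + fst (fst z) n) \<in> D \<and> snd (snd z) + snd (fst z) \<in> A)}"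
    have W: "W \<in> sets (?SB \<Otimes>\<^sub>M ?SB)"
    proof -
      have m1: "(\<lambda>z. \<lambda>n. fst (snd z) n + fst (fst z) n) \<in> measurable (?SB \<Otimes>\<^sub>M ?SB) seq_space"
      proof -
        have "(\<lambda>z. (fst (snd z), fst (fst z))) \<in> measurable (?SB \<Otimes>\<^sub>M ?SB) (seq_space \<Otimes>\<^sub>M seq_space)"
          by measurable
        from measurable_compose[OF this add_seq_measurable[of "\<lambda>x. x" "\<lambda>x. x"]] show ?thesis by simp
      qed
      have m2: "(\<lambda>z. snd (snd z) + snd (fst z)) \<in> measurable (?SB \<Otimes>\<^sub>M ?SB) borel"
        by (rule borel_measurable_add'[OF scE']) measurable
      have "(\<lambda>z. \<lambda>n. fst (snd z) n + fst (fst z) n) -` D \<inter> space (?SB \<Otimes>\<^sub>M ?SB) \<inter>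
        ((\<lambda>z. snd (snd z) + snd (fst z)) -` A \<inter> space (?SB \<Otimes>\<^sub>M ?SB)) \<in> sets (?SB \<Otimes>\<^sub>M ?SB)"
        using measurable_sets[OF m1 D] measurable_sets[OF m2 A] by (rule sets.Int)
      then show ?thesis
        by (simp add: W_def space_pair_measure space_PiM vimage_def Collect_conj_eq)
    qed
    have "(\<integral>\<^sup>+\<xi>. indicator D \<xi> * emeasure (Q \<xi>) A \<partial>past_law) =
        emeasure (distr past_law ?SB (\<lambda>\<zeta>. (\<lambda>n. \<zeta> (Suc n), \<zeta> 0))) (D \<times> A)"
      unfolding joint_law_eq_split[symmetric]
      by (rule bind_pair_emeasure_Times[symmetric, OF prob_space_past_law _ Q_kernel D A]) simp
    also have "\<dots> = emeasure N1 W"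
    proof -
      have m1: "(\<lambda>\<zeta>. (\<lambda>n. \<zeta> (Suc n), \<zeta> 0)) \<in> measurable past_law ?SB"
        using split1 measurable_cong_sets[OF sets_past_law refl] by blast
      have m2: "(\<lambda>\<zeta>. (\<sigma> r \<zeta>, \<sigma> p \<zeta>)) \<in> measurable past_law (?SB \<Otimes>\<^sub>M ?SB)"
        using split2 measurable_cong_sets[OF sets_past_law refl] by blast
      have DA: "D \<times> A \<in> sets ?SB" using D A by (rule pair_measureI)
      have "(\<lambda>\<zeta>. (\<lambda>n. \<zeta> (Suc n), \<zeta> 0)) -` (D \<times> A) = (\<lambda>\<zeta>. (\<sigma> r \<zeta>, \<sigma> p \<zeta>)) -` W"
        unfolding W_def \<sigma>_def by (simp add: vimage_def pr)
      then show ?thesis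
        unfolding N1_def emeasure_distr[OF m1 DA] emeasure_distr[OF m2 W] by simp
    qed
    also have "\<dots> = (\<integral>\<^sup>+\<xi>. emeasure (?K \<xi>) (\<tau> \<xi> -` W) \<partial>past_law)"
      unfolding \<open>N1 = N2\<close> by (rule N2e[OF W])
    also have "\<dots> = (\<integral>\<^sup>+\<xi>. indicator D \<xi> * emeasure (distr (?K \<xi>) borel (\<lambda>(b, a). a + b)) A \<partial>past_law)"
    proof (rule nn_integral_cong)
      fix \<xi>
      have s: "sets (?K \<xi>) = sets (borel \<Otimes>\<^sub>M borel)"
        using kernel_prob_algebraD(2)[OF kp] kernel_prob_algebraD(2)[OF kr] by (simp cong: sets_pair_measure_cong)
      have "(\<lambda>(b, a). a + b) \<in> measurable (?K \<xi>) (borel :: 'e measure)" using plus measurable_cong_sets[OF s refl] by blast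
      from emeasure_distr[OF this A]
      have "emeasure (distr (?K \<xi>) borel (\<lambda>(b, a). a + b)) A = emeasure (?K \<xi>) ((\<lambda>(b, a). a + b) -` A)"
        using sets_eq_imp_space_eq[OF s] by (simp add: space_pair_measure)
      moreover have "\<tau> \<xi> -` W = (if \<xi> \<in> D then (\<lambda>(b, a). a + b) -` A else {})"
        by (auto simp: \<tau>_def W_def pr)
      ultimately show "emeasure (?K \<xi>) (\<tau> \<xi> -` W) = indicator D \<xi> * emeasure (distr (?K \<xi>) borel (\<lambda>(b, a). a + b)) A"
        by simp
    qed
    finally show "(\<integral>\<^sup>+\<xi>. indicator D \<xi> * emeasure (Q \<xi>) A \<partial>past_law) =
      (\<integral>\<^sup>+\<xi>. indicator D \<xi> * emeasure (distr (?K \<xi>) borel (\<lambda>(b, a). a + b)) A \<partial>past_law)" .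
  qed
qed

end

section \<open>Verification of the hypotheses\<close>

text \<open>Without noise, \<open>k * j\<close> steps shrink norms by \<open>a ^ j\<close>. Small
  noise perturbs this by an error controlled through a Lipschitz constant of \<open>S\<close> on
  \<open>X \<times> K\<close>; \<open>0 \<in> K\<close> keeps the unperturbed trajectory in
  \<open>X\<close>.\<close>

lemma dissipation_small_noise:
  fixes S :: "'h::real_normed_vector \<times> 'e::real_normed_vector \<Rightarrow> 'h"
  assumes S: "C2_map_bounded S" and X: "compact X" and K: "compact K" "0 \<in> K"
    and X_inv: "\<And>u y. u \<in> X \<Longrightarrow> y \<in> K \<Longrightarrow> S (u, y) \<in> X"
    and S1: "\<exists>k\<ge>1. \<exists>a\<in>{0<..<1}. \<forall>v. norm (((\<lambda>u. S (u, 0)) ^^ k) v) \<le> a * norm v"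
    and "\<epsilon> > 0"
  shows "\<exists>n\<ge>n0. \<exists>d>0. \<forall>x\<in>X. \<forall>\<xi>\<in>past_seqs K. (\<forall>i<n. norm (\<xi> i) < d) \<longrightarrow> norm (run S n x \<xi>) < \<epsilon>"
proof -
  let ?f = "\<lambda>u. S (u, 0)"
  obtain k a where k: "k \<ge> 1" and a: "0 < a" "a < 1" and ka: "\<And>v. norm ((?f ^^ k) v) \<le> a * norm v"
    using S1 by auto
  obtain RX where RX: "RX > 0" "\<And>u. u \<in> X \<Longrightarrow> norm u \<le> RX"
    using compact_imp_bounded[OF X] unfolding bounded_pos by auto
  obtain R where R: "\<And>z. z \<in> X \<times> K \<Longrightarrow> norm z \<le> R"
    using compact_imp_bounded[OF compact_Times[OF X K(1)]] unfolding bounded_iff by auto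
  obtain L where L: "L \<ge> 0" "\<And>z z'. norm z \<le> R \<Longrightarrow> norm z' \<le> R \<Longrightarrow> norm (S z - S z') \<le> L * norm (z - z')"
    using C2_map_bounded_Lipschitz[OF S] by metis
  have kj: "norm ((?f ^^ (k * j)) v) \<le> a ^ j * norm v" for j v
  proof (induction j)
    case (Suc j)
    have "(?f ^^ (k * Suc j)) v = (?f ^^ k) ((?f ^^ (k * j)) v)" by (simp add: funpow_add)
    also have "norm \<dots> \<le> a * norm ((?f ^^ (k * j)) v)" by (rule ka)
    also have "\<dots> \<le> a * (a ^ j * norm v)" using Suc a by (intro mult_left_mono) auto
    finally show ?case by (simp add: mult.assoc)
  qed simp
  have "(\<lambda>j. a ^ j) \<longlonglongrightarrow> 0" using a by (intro LIMSEQ_power_zero) simp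
  then have "\<forall>\<^sub>F j in sequentially. a ^ j < \<epsilon> / (2 * RX)"
    using \<open>\<epsilon> > 0\<close> RX by (intro order_tendstoD) auto
  then obtain j0 where j0: "\<And>j. j \<ge> j0 \<Longrightarrow> a ^ j < \<epsilon> / (2 * RX)" by (auto simp: eventually_sequentially)
  define j where "j = max j0 n0"
  define n where "n = k * j"
  have "n \<ge> j" using k by (simp add: n_def)
  then have n: "n \<ge> n0" by (simp add: j_def)
  \<comment> \<open>The error after \<open>n\<close> steps is at most
    \<open>d * (n * (1 + L)^n)\<close>; the summand 1 beside \<open>n\<close> excludes a zero
    denominator when \<open>n = 0\<close>.\<close>
  define d where "d = \<epsilon> / (2 * (real n + 1) * (1 + L) ^ n)"
  have d: "d > 0" using \<open>\<epsilon> > 0\<close> L by (simp add: d_def)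
  have fX: "(?f ^^ i) x \<in> X" if "x \<in> X" for i x
    by (induction i) (use that X_inv K in auto)
  have err: "norm (run S i x \<xi> - (?f ^^ i) x) \<le> d * (real i * (1 + L) ^ i)"
    if x: "x \<in> X" and "\<xi> \<in> past_seqs K" "\<forall>l<i. norm (\<xi> l) < d" for x i \<xi>
    using that(2,3)
  proof (induction i arbitrary: \<xi>)
    case (Suc i)
    let ?\<xi> = "\<lambda>l. \<xi> (Suc l)"
    have \<xi>: "?\<xi> \<in> past_seqs K" "\<xi> 0 \<in> K" "norm (\<xi> 0) < d" using Suc.prems by (auto simp: past_seqs_def)
    have IH: "norm (run S i x ?\<xi> - (?f ^^ i) x) \<le> d * (real i * (1 + L) ^ i)"
      by (rule Suc.IH[OF \<xi>(1)]) (use Suc.prems in auto)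
    have rX: "run S i x ?\<xi> \<in> X" by (rule run_in[of X K S, OF X_inv]) (use x \<xi> in auto)
    have "norm (run S (Suc i) x \<xi> - (?f ^^ Suc i) x) = norm (S (run S i x ?\<xi>, \<xi> 0) - S ((?f ^^ i) x, 0))" by simp
    also have "\<dots> \<le> L * norm ((run S i x ?\<xi>, \<xi> 0) - ((?f ^^ i) x, 0))"
    proof (rule L(2))
      show "norm (run S i x ?\<xi>, \<xi> 0) \<le> R" by (rule R) (use rX \<xi> in blast)
      show "norm ((?f ^^ i) x, 0::'e) \<le> R" by (rule R) (use fX[OF x] K in blast)
    qed
    also have "\<dots> \<le> L * (d * (real i * (1 + L) ^ i) + d)"
    proof (rule mult_left_mono[OF _ L(1)])
      show "norm ((run S i x ?\<xi>, \<xi> 0) - ((?f ^^ i) x, 0)) \<le> d * (real i * (1 + L) ^ i) + d"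
        using norm_Pair_le[of "run S i x ?\<xi> - (?f ^^ i) x" "\<xi> 0"] IH \<xi>(3) by simp
    qed
    also have "\<dots> \<le> (1 + L) * (d * (real i * (1 + L) ^ i) + d * (1 + L) ^ i)"
    proof (rule mult_mono)
      have "1 \<le> (1 + L) ^ i" using L by (intro one_le_power) simp
      then show "d * (real i * (1 + L) ^ i) + d \<le> d * (real i * (1 + L) ^ i) + d * (1 + L) ^ i"
        using d by (simp add: mult_left_mono)
    qed (use L d in auto)
    also have "\<dots> = d * (real (Suc i) * (1 + L) ^ Suc i)" by (simp add: algebra_simps)
    finally show ?case .
  qed simp
  show ?thesis
  proof (intro exI[of _ n] conjI exI[of _ d] ballI impI n d)
    fix x \<xi> assume x: "x \<in> X" and \<xi>: "\<xi> \<in> past_seqs K" "\<forall>i<n. norm (\<xi> i) < d"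
    have "norm ((?f ^^ n) x) \<le> a ^ j * RX"
      using order_trans[OF kj mult_left_mono[OF RX(2)[OF x]]] a unfolding n_def by simp
    also have "\<dots> < \<epsilon> / (2 * RX) * RX" using j0[of j] RX by (intro mult_strict_right_mono) (auto simp: j_def)
    also have "\<dots> = \<epsilon> / 2" using RX by simp
    finally have 1: "norm ((?f ^^ n) x) < \<epsilon> / 2" .
    have "d * (real n * (1 + L) ^ n) \<le> d * ((real n + 1) * (1 + L) ^ n)"
      using d L by (intro mult_left_mono mult_right_mono) auto
    also have "\<dots> = \<epsilon> / 2"
    proof -
      have "(real n + 1) * (1 + L) ^ n > 0" using L by (intro mult_pos_pos zero_less_power) auto
      moreover have "\<epsilon> / (2 * c) * c = \<epsilon> / 2" if "c > 0" for c :: real using that by simp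
      ultimately show ?thesis unfolding d_def mult.assoc by blast
    qed
    finally have 2: "norm (run S n x \<xi> - (?f ^^ n) x) \<le> \<epsilon> / 2" using err[OF x \<xi>] by linarith
    show "norm (run S n x \<xi>) < \<epsilon>"
      using norm_triangle_ineq[of "run S n x \<xi> - (?f ^^ n) x" "(?f ^^ n) x"] 1 2 by simp
  qed
qed

text \<open>(\<eta>2) for a single time brings the noise arbitrarily near 0 with positive
  probability, while the noise lies in the closed set \<open>K\<close> almost surely. It ensures
  that noise-free trajectories remain in \<open>X\<close>.\<close>

lemma zero_in_noise_support:
  fixes K :: "'e::real_normed_vector set"
  assumes K: "closed K" "K \<noteq> {}"
    and cp: "\<And>\<xi>. \<xi> \<in> past_seqs K \<Longrightarrow> conditioned_process Q K \<xi> (N \<xi>) (\<zeta> \<xi>)"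
    and eta2: "\<forall>n. \<forall>\<delta>>0. \<exists>s. \<exists>\<epsilon>>0. \<forall>\<xi>\<in>past_seqs K.
        measure (N \<xi>) {\<omega>\<in>space (N \<xi>). \<forall>j\<in>{s+1..s+n}. norm (\<zeta> \<xi> j \<omega>) < \<delta>} \<ge> \<epsilon>"
  shows "0 \<in> K"
proof -
  obtain y where "y \<in> K" using K by auto
  then have \<xi>: "(\<lambda>_. y) \<in> past_seqs K" by (simp add: past_seqs_def)
  let ?N = "N (\<lambda>_. y)" and ?z = "\<zeta> (\<lambda>_. y)"
  interpret prob_space ?N using cp[OF \<xi>] by (simp add: conditioned_process_def)
  have "\<exists>x\<in>K. dist x 0 < e" if "e > 0" for e
  proof (rule ccontr)
    assume no: "\<not> ?thesis"
    obtain s \<epsilon> where s: "\<epsilon> > 0" "measure ?N {\<omega>\<in>space ?N. \<forall>j\<in>{s+1..s+1}. norm (?z j \<omega>) < e} \<ge> \<epsilon>"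
      using eta2[rule_format, of e 1] \<open>e > 0\<close> \<xi> by blast
    have z: "?z (s+1) \<in> borel_measurable ?N" "AE \<omega> in ?N. ?z (s+1) \<omega> \<in> K"
      using cp[OF \<xi>] by (auto simp: conditioned_process_def)
    have "AE \<omega> in ?N. \<omega> \<notin> {\<omega>\<in>space ?N. \<forall>j\<in>{s+1..s+1}. norm (?z j \<omega>) < e}"
      using z(2) by eventually_elim (use no in \<open>auto simp: dist_norm\<close>)
    then have "measure ?N {\<omega>\<in>space ?N. \<forall>j\<in>{s+1..s+1}. norm (?z j \<omega>) < e} = 0"
      using z(1) by (subst prob_eq_0) auto
    then show False using s by simp
  qed
  then have "0 \<in> closure K" by (simp add: closure_approachable)
  then show ?thesis using K by simp
qed

context stationary_noise
begin

lemma K_nonempty: "K \<noteq> {}"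
proof
  assume "K = {}"
  then have "AE \<xi> in past_law. False" using AE_past_K(2) by (simp add: past_seqs_def)
  then show False using prob_space.AE_False[OF prob_space_past_law] by simp
qed

lemma mixing_of_split_kernel:
  fixes S :: "'h::{real_normed_vector, complete_space} \<times> 'e \<Rightarrow> 'h"
  assumes sk: "split_kernel S X K G \<iota> Q QA QB q B \<pi> L R"
    and G: "AE \<xi> in past_law. \<xi> \<in> G"
    and X: "compact X" "X \<noteq> {}"
    and W: "finite W" "W \<subseteq> span B" and r: "r > 0" and \<delta>0: "\<delta>0 > 0"
    and steer: "\<And>u u' y0. u \<in> X \<Longrightarrow> u' \<in> X \<Longrightarrow> norm (u' - u) < \<delta>0 \<Longrightarrow> y0 \<in> K \<Longrightarrow>
      \<exists>w\<in>W. \<forall>y\<in>K. norm (y - y0) < r \<longrightarrow>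
        norm (S (u', y + norm (u' - u) *\<^sub>R w) - S (u, y)) \<le> (1/4) * norm (u' - u)"
    and dissip: "\<And>\<epsilon> n0. \<epsilon> > 0 \<Longrightarrow> \<exists>n\<ge>n0. \<exists>d>0. \<forall>x\<in>X. \<forall>\<xi>\<in>past_seqs K. (\<forall>i<n. norm (\<xi> i) < d) \<longrightarrow> norm (run S n x \<xi>) < \<epsilon>"
    and recur: "\<And>n d. n \<ge> 1 \<Longrightarrow> d > 0 \<Longrightarrow> \<exists>s. \<exists>\<epsilon>>0. \<forall>\<xi>\<in>past_seqs K. hit_prob Q {\<xi>. \<forall>i<n. norm (\<xi> i) < d} (s + n) \<xi> \<ge> \<epsilon>"
  shows "\<exists>(\<mu> :: 'h measure) C \<gamma>.
           prob_space \<mu> \<and> sets \<mu> = sets borel \<and> msupport \<mu> \<subseteq> X \<and> C > 0 \<and> \<gamma> > 0 \<and>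
           (\<forall>v. v \<in> borel_measurable M \<and> (AE \<omega> in M. v \<omega> \<in> X) \<and> indep_of_future M \<eta> v \<longrightarrow>
              (\<forall>k. dual_lip_dist (distr M borel (traj S \<eta> v k)) \<mu> \<le> C * exp (- \<gamma> * real k)))"
proof -
  interpret sk: split_kernel S X K G \<iota> Q QA QB q B \<pi> L R by (rule sk)
  have recur': "\<exists>s. \<exists>\<epsilon>>0. \<forall>\<xi>\<in>G. hit_prob Q {\<xi>. \<forall>i<n. norm (\<xi> i) < d} (s + n) \<xi> \<ge> \<epsilon>"
    if "n \<ge> 1" "d > 0" for n d
    using recur[OF that] sk.G_K by (meson subsetD)
  show ?thesis
  proof (rule sk.geometric_contraction[OF W r \<delta>0], goal_cases)
    case (1 u u' y0)
    then show ?case by (rule steer)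
  next
    case (2 \<epsilon> n0)
    then show ?case by (rule dissip)
  next
    case (3 n d)
    then show ?case by (rule recur')
  next
    case (4 C \<gamma>)
    show ?case
      by (rule exponential_mixing[OF sk.S_measurable X sk.X_inv G sk.G_K 4(3) 4(1,2)])
  qed
qed

text \<open>The degenerate splitting: with \<open>\<pi> = 0\<close> the complementary component is
  concentrated at 0, all pasts in \<open>G\<close> are equivalent, and \<open>Q\<close> itself
  carries the Lipschitz density.\<close>

lemma split_kernel_finite_dim:
  fixes S :: "'h::real_normed_vector \<times> 'e \<Rightarrow> 'h"
  assumes scH: "second_countable_type TYPE('h)" and S: "continuous_on UNIV S"
    and X_inv: "\<And>u y. u \<in> X \<Longrightarrow> y \<in> K \<Longrightarrow> S (u, y) \<in> X"
    and K: "compact K" and iota: "\<iota> > 1" and B: "is_finite_basis B"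
    and dens: "density_cond_finite_dim \<iota> K Q B"
  obtains G q L R where "split_kernel S X K G \<iota> Q Q (\<lambda>_. return borel 0) q B (\<lambda>_. 0) L R"
    "AE \<xi> in past_law. \<xi> \<in> G"
proof -
  obtain p where p: "\<And>\<xi> x. \<xi> \<in> past_seqs K \<Longrightarrow> 0 \<le> p \<xi> x"
    "\<And>\<xi>. \<xi> \<in> past_seqs K \<Longrightarrow> Q \<xi> = density (basis_lebesgue B) (\<lambda>x. ennreal (p \<xi> x))"
    "lipschitz_density \<iota> K p"
    using dens unfolding density_cond_finite_dim_def by blast
  obtain L where L: "\<And>\<xi> \<xi>' x x'. \<xi> \<in> past_seqs K \<Longrightarrow> \<xi>' \<in> past_seqs K \<Longrightarrow>
      \<bar>p \<xi> x - p \<xi>' x'\<bar> \<le> L * (past_dist \<iota> \<xi> \<xi>' + norm (x - x'))"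
    using p(3) unfolding lipschitz_density_def by blast
  obtain R where R: "\<And>y. y \<in> K \<Longrightarrow> norm y \<le> R" using compact_imp_bounded[OF K] unfolding bounded_iff by auto
  obtain G where G: "G \<in> sets seq_space" "AE \<xi> in past_law. \<xi> \<in> G" "\<And>\<xi>. \<xi> \<in> G \<Longrightarrow> \<xi> \<in> past_seqs K"
    "\<And>\<xi>. \<xi> \<in> G \<Longrightarrow> AE y in Q \<xi>. case_nat y \<xi> \<in> G"
    using invariant_full_set[OF AE_past_K(2)] by blast
  have AEK: "AE y in Q \<xi>. y \<in> K \<and> case_nat y \<xi> \<in> G" if "\<xi> \<in> G" for \<xi>
    using G(4)[OF that]
  proof eventually_elim
    case (elim y)
    then have "case_nat y \<xi> 0 \<in> K" using G(3) unfolding past_seqs_def by blast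
    then show ?case using elim by simp
  qed
  have L': "\<bar>p \<xi> x - p \<xi>' x'\<bar> \<le> \<bar>L\<bar> * (past_dist \<iota> \<xi> \<xi>' + norm (x - x'))"
    if "\<xi> \<in> past_seqs K" "\<xi>' \<in> past_seqs K" for \<xi> \<xi>' x x'
  proof -
    have "0 \<le> past_dist \<iota> \<xi> \<xi>'" by (rule past_dist_nonneg[OF compact_imp_bounded[OF K] that iota])
    then have "L * (past_dist \<iota> \<xi> \<xi>' + norm (x - x')) \<le> \<bar>L\<bar> * (past_dist \<iota> \<xi> \<xi>' + norm (x - x'))"
      by (intro mult_right_mono) auto
    then show ?thesis using L[OF that, of x x'] by linarith
  qed
  have pm: "p \<xi> \<in> borel_measurable borel" if "\<xi> \<in> past_seqs K" for \<xi>
  proof -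
    have "\<bar>L\<bar>-lipschitz_on UNIV (p \<xi>)"
      using L'[OF that that] by (intro lipschitz_onI) (auto simp: dist_norm)
    then show ?thesis by (intro borel_measurable_continuous_onI lipschitz_on_continuous_on)
  qed
  show thesis
  proof (rule that[of G p "\<bar>L\<bar>" R])
    show "split_kernel S X K G \<iota> Q Q (\<lambda>_. return borel 0) p B (\<lambda>_. 0) \<bar>L\<bar> R"
    proof (rule split_kernel.intro)
      show "(\<lambda>_. return borel (0::'e)) \<in> measurable seq_space (prob_algebra borel)"
        by (rule measurable_const) (simp add: space_prob_algebra prob_space_return)
      fix \<xi> assume \<xi>: "\<xi> \<in> G"
      interpret Q: prob_space "Q \<xi>" by (rule kernel_prob_algebraD[OF Q_kernel])
      interpret Z: prob_space "return borel (0::'e)" by (rule prob_space_return) simp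
      interpret P: pair_sigma_finite "return borel (0::'e)" "Q \<xi>" ..
      note s = kernel_prob_algebraD(2)[OF Q_kernel, of \<xi>]
      show "Q \<xi> = distr (return borel 0 \<Otimes>\<^sub>M Q \<xi>) borel (\<lambda>(b, a). a + b)"
      proof (rule measure_eqI)
        fix A assume "A \<in> sets (Q \<xi>)"
        then have A: "A \<in> sets borel" using s by simp
        have "(\<lambda>(b, a). a + b) \<in> measurable (borel \<Otimes>\<^sub>M borel) (borel :: 'e measure)"
          unfolding split_beta by (rule borel_measurable_add'[OF scE']) measurable
        then have m: "(\<lambda>(b, a). a + b) \<in> measurable (return borel 0 \<Otimes>\<^sub>M Q \<xi>) (borel :: 'e measure)"
          using s by (simp cong: measurable_cong_sets sets_pair_measure_cong)
        let ?D = "(\<lambda>(b, a). a + b) -` A \<inter> space (return borel 0 \<Otimes>\<^sub>M Q \<xi>)"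
        have D: "?D \<in> sets (return borel 0 \<Otimes>\<^sub>M Q \<xi>)" by (rule measurable_sets[OF m A])
        have "emeasure (distr (return borel 0 \<Otimes>\<^sub>M Q \<xi>) borel (\<lambda>(b, a). a + b)) A = emeasure (return borel 0 \<Otimes>\<^sub>M Q \<xi>) ?D"
          by (rule emeasure_distr[OF m A])
        also have "\<dots> = (\<integral>\<^sup>+b. emeasure (Q \<xi>) (Pair b -` ?D) \<partial>return borel 0)"
          by (rule Q.emeasure_pair_measure_alt[OF D])
        also have "\<dots> = emeasure (Q \<xi>) (Pair 0 -` ?D)"
          using Q.measurable_emeasure_Pair[OF D] by (subst nn_integral_return) auto
        also have "Pair 0 -` ?D = A"
          using sets_eq_imp_space_eq[OF s] by (auto simp: space_pair_measure)
        finally show "emeasure (Q \<xi>) A = emeasure (distr (return borel 0 \<Otimes>\<^sub>M Q \<xi>) borel (\<lambda>(b, a). a + b)) A" ..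
      qed (simp add: s)
      \<comment> \<open>\<open>Q \<xi>\<close> is concentrated on the bounded set \<open>K\<close>,
        so its density vanishes almost everywhere outside a ball.\<close>
      have "AE y in density (basis_lebesgue B) (\<lambda>x. ennreal (p \<xi> x)). y \<in> K"
        using AEK[OF \<xi>] unfolding p(2)[OF G(3)[OF \<xi>], symmetric] by eventually_elim simp
      then have "AE y in basis_lebesgue B. 0 < p \<xi> y \<longrightarrow> y \<in> K"
        using pm[OF G(3)[OF \<xi>]] by (subst (asm) AE_density) auto
      then show "AE a in basis_lebesgue B. R < norm a \<longrightarrow> p \<xi> a = 0"
      proof eventually_elim
        case (elim a)
        then show ?case using R[of a] p(1)[OF G(3)[OF \<xi>], of a] by force
      qed
      show "AE b in return borel (0::'e). 0 = b" by (subst AE_return) auto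
    next
      show "bounded_linear (\<lambda>_::'e. 0::'e)" by (rule bounded_linear_zero)
    next
      fix \<xi> \<xi>' :: "nat \<Rightarrow> 'e" assume "\<And>n. \<xi> n - 0 = \<xi>' n - 0"
      then have "\<xi> = \<xi>'" by (auto intro!: ext)
      then show "Q \<xi> = Q \<xi>'" by simp
    qed (use scH scE' S X_inv K iota Q_kernel G AEK p L' B in \<open>auto simp: is_finite_basis_def\<close>)
  qed (rule G(2))
qed

end

section \<open>Product densities\<close>

lemma PiM_density_lborel:
  fixes p :: "'i \<Rightarrow> real \<Rightarrow> ennreal"
  assumes I: "finite I" and [measurable]: "\<And>i. p i \<in> borel_measurable borel"
    and prob: "\<And>i. prob_space (density lborel (p i))"
  shows "Pi\<^sub>M I (\<lambda>i. density lborel (p i)) = density (Pi\<^sub>M I (\<lambda>_. lborel)) (\<lambda>x. \<Prod>i\<in>I. p i (x i))"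
proof -
  interpret L: product_sigma_finite "\<lambda>_. lborel :: real measure" ..
  interpret D: product_sigma_finite "\<lambda>i. density lborel (p i)"
    by (rule product_sigma_finite.intro) (use prob_space_imp_sigma_finite prob in blast)
  have meas: "(\<lambda>x. \<Prod>i\<in>I. p i (x i)) \<in> borel_measurable (Pi\<^sub>M I (\<lambda>_. lborel))" by measurable
  show ?thesis
  proof (rule D.PiM_eqI[OF I, symmetric])
    show "sets (density (Pi\<^sub>M I (\<lambda>_. lborel)) (\<lambda>x. \<Prod>i\<in>I. p i (x i))) = sets (Pi\<^sub>M I (\<lambda>i. density lborel (p i)))"
      unfolding sets_density by (rule sets_PiM_cong) simp_all
    fix A assume A: "\<And>i. i \<in> I \<Longrightarrow> A i \<in> sets (density lborel (p i))"
    then have [measurable]: "i \<in> I \<Longrightarrow> A i \<in> sets borel" for i by simp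
    have E: "Pi\<^sub>E I A \<in> sets (Pi\<^sub>M I (\<lambda>_. lborel))" using I by (intro sets_PiM_I_finite) auto
    have "emeasure (density (Pi\<^sub>M I (\<lambda>_. lborel)) (\<lambda>x. \<Prod>i\<in>I. p i (x i))) (Pi\<^sub>E I A) =
        (\<integral>\<^sup>+x. (\<Prod>i\<in>I. p i (x i)) * indicator (Pi\<^sub>E I A) x \<partial>Pi\<^sub>M I (\<lambda>_. lborel))"
      by (rule emeasure_density[OF meas E])
    also have "\<dots> = (\<integral>\<^sup>+x. (\<Prod>i\<in>I. p i (x i) * indicator (A i) (x i)) \<partial>Pi\<^sub>M I (\<lambda>_. lborel))"
    proof (rule nn_integral_cong)
      fix x assume "x \<in> space (Pi\<^sub>M I (\<lambda>_. lborel :: real measure))"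
      then have "indicator (Pi\<^sub>E I A) x = (\<Prod>i\<in>I. indicator (A i) (x i) :: ennreal)"
        using I by (auto simp: space_PiM PiE_def Pi_iff indicator_def prod_zero_iff)
      then show "(\<Prod>i\<in>I. p i (x i)) * indicator (Pi\<^sub>E I A) x = (\<Prod>i\<in>I. p i (x i) * indicator (A i) (x i))"
        by (simp add: prod.distrib)
    qed
    also have "\<dots> = (\<Prod>i\<in>I. \<integral>\<^sup>+x. p i x * indicator (A i) x \<partial>lborel)"
      by (rule L.product_nn_integral_prod[OF I, of "\<lambda>i x. p i x * indicator (A i) x"]) measurable
    also have "\<dots> = (\<Prod>i\<in>I. emeasure (density lborel (p i)) (A i))"
      by (rule prod.cong) (auto simp: emeasure_density)
    finally show "emeasure (density (Pi\<^sub>M I (\<lambda>_. lborel)) (\<lambda>x. \<Prod>i\<in>I. p i (x i))) (Pi\<^sub>E I A) =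
        (\<Prod>i\<in>I. emeasure (density lborel (p i)) (A i))" .
  qed
qed

text \<open>Telescoping, one factor at a time; \<open>1 \<le> m\<close> allows all powers of the
  bound to be replaced by the largest.\<close>

lemma abs_prod_diff_le:
  fixes a b :: "nat \<Rightarrow> real"
  assumes "1 \<le> m" "\<And>i. \<bar>a i\<bar> \<le> m" "\<And>i. \<bar>b i\<bar> \<le> m"
  shows "\<bar>(\<Prod>i<n. a i) - (\<Prod>i<n. b i)\<bar> \<le> m ^ n * (\<Sum>i<n. \<bar>a i - b i\<bar>)"
proof (induction n)
  case (Suc n)
  have "\<bar>\<Prod>i<n. b i\<bar> \<le> (\<Prod>i<n. m)" unfolding abs_prod using assms by (intro prod_mono) auto
  then have 1: "\<bar>\<Prod>i<n. b i\<bar> \<le> m ^ n" by simp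
  have "(\<Prod>i<Suc n. a i) - (\<Prod>i<Suc n. b i) = a n * ((\<Prod>i<n. a i) - (\<Prod>i<n. b i)) + (\<Prod>i<n. b i) * (a n - b n)"
    by (simp add: algebra_simps)
  also have "\<bar>\<dots>\<bar> \<le> \<bar>a n\<bar> * \<bar>(\<Prod>i<n. a i) - (\<Prod>i<n. b i)\<bar> + \<bar>\<Prod>i<n. b i\<bar> * \<bar>a n - b n\<bar>"
    by (metis abs_mult abs_triangle_ineq)
  also have "\<dots> \<le> m * (m ^ n * (\<Sum>i<n. \<bar>a i - b i\<bar>)) + m ^ n * \<bar>a n - b n\<bar>"
    using assms 1 Suc by (intro add_mono mult_mono) auto
  also have "\<dots> \<le> m * (m ^ n * (\<Sum>i<n. \<bar>a i - b i\<bar>)) + m ^ Suc n * \<bar>a n - b n\<bar>"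
    using assms(1) by (intro add_left_mono mult_right_mono power_increasing) auto
  also have "\<dots> = m ^ Suc n * (\<Sum>i<Suc n. \<bar>a i - b i\<bar>)" by (simp add: algebra_simps)
  finally show ?case .
qed simp

text \<open>A value above \<open>L + 1\<close> would keep the density above 1 on an interval of
  length 1. Such a bound turns a product of Lipschitz coordinate densities into a Lipschitz
  function.\<close>

lemma Lipschitz_density_le:
  fixes p :: "real \<Rightarrow> real"
  assumes prob: "prob_space (density lborel (\<lambda>x. ennreal (p x)))"
    and L: "\<And>x y. \<bar>p x - p y\<bar> \<le> L * \<bar>x - y\<bar>"
  shows "p x \<le> L + 1"
proof (rule ccontr)
  assume "\<not> ?thesis"
  then have big: "p x - L > 1" by simp
  have L0: "L \<ge> 0" using order_trans[OF abs_ge_zero L[of 0 1]] by simp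
  have "L-lipschitz_on UNIV p" using L L0 by (intro lipschitz_onI) (auto simp: dist_real_def)
  then have [measurable]: "p \<in> borel_measurable borel"
    by (intro borel_measurable_continuous_onI lipschitz_on_continuous_on)
  have "ennreal (p x - L) = (\<integral>\<^sup>+y. ennreal (p x - L) * indicator {x..x+1} y \<partial>lborel)"
    by (subst nn_integral_cmult_indicator) auto
  also have "\<dots> \<le> (\<integral>\<^sup>+y. ennreal (p y) \<partial>lborel)"
  proof (rule nn_integral_mono)
    fix y
    show "ennreal (p x - L) * indicator {x..x+1} y \<le> ennreal (p y)"
    proof (cases "y \<in> {x..x+1}")
      case True
      have "L * \<bar>x - y\<bar> \<le> L" using True L0 by (auto simp: abs_if intro: mult_left_le)
      then have "p x - L \<le> p y" using L[of x y] by linarith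
      then show ?thesis using True by (simp add: ennreal_leI)
    qed simp
  qed
  also have "\<dots> = emeasure (density lborel (\<lambda>x. ennreal (p x))) UNIV" by (subst emeasure_density) auto
  also have "\<dots> = 1" using prob_space.emeasure_space_1[OF prob] by simp
  finally have "p x - L \<le> 1" by (simp add: ennreal_le_1)
  then show False using big by simp
qed

section \<open>Projections along an orthonormal basis\<close>

definition onb_proj :: "('e::real_vector \<Rightarrow> 'e \<Rightarrow> real) \<Rightarrow> (nat \<Rightarrow> 'e) \<Rightarrow> nat set \<Rightarrow> 'e \<Rightarrow> 'e" where
  "onb_proj ip f I y = (\<Sum>l\<in>I. ip y (f l) *\<^sub>R f l)"

lemma
  fixes ip :: "'e::real_normed_vector \<Rightarrow> 'e \<Rightarrow> real"
  assumes "hilbert_with_onb ip f"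
  shows onb_orthonormal: "ip (f i) (f j) = (if i = j then 1 else 0)"
    and onb_norm: "norm (f i) = 1"
    and onb_coordinate_le: "\<bar>ip y (f l)\<bar> \<le> norm y"
    and onb_coordinate_bounded_linear: "bounded_linear (\<lambda>y. ip y (f l))"
proof -
  have bl: "bilinear ip" and sym: "\<And>x y. ip x y = ip y x" and ipn: "\<And>x. ip x x = (norm x)\<^sup>2"
    and o: "\<And>i j. ip (f i) (f j) = (if i = j then 1 else 0)"
    using assms by (auto simp: hilbert_with_onb_def)
  show "ip (f i) (f j) = (if i = j then 1 else 0)" by (rule o)
  have "(norm (f i))\<^sup>2 = 1" using ipn[of "f i"] o[of i i] by simp
  then show "norm (f i) = 1" using norm_ge_zero[of "f i"] by (auto simp: power2_eq_1_iff simp del: norm_ge_zero)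
  have le: "\<bar>ip y (f l)\<bar> \<le> norm y" for y
  proof -
    \<comment> \<open>Pythagoras: the left side is the squared norm of the rest, hence
      nonnegative.\<close>
    have "ip (y - ip y (f l) *\<^sub>R f l) (y - ip y (f l) *\<^sub>R f l) = (norm y)\<^sup>2 - (ip y (f l))\<^sup>2"
      using o[of l l] sym[of "f l" y]
      by (simp add: bilinear_lsub[OF bl] bilinear_rsub[OF bl] bilinear_lmul[OF bl] bilinear_rmul[OF bl] ipn[of y] power2_eq_square algebra_simps)
    then have "(ip y (f l))\<^sup>2 \<le> (norm y)\<^sup>2" using ipn[of "y - ip y (f l) *\<^sub>R f l"] by (smt (verit) zero_le_power2)
    then show ?thesis using abs_le_square_iff[of "ip y (f l)" "norm y"] by simp
  qed
  then show "\<bar>ip y (f l)\<bar> \<le> norm y" .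
  show "bounded_linear (\<lambda>y. ip y (f l))"
    by (rule bounded_linear_intro[where K=1]) (use le in \<open>auto simp: bilinear_ladd[OF bl] bilinear_lmul[OF bl]\<close>)
qed

context
  fixes ip :: "'e::real_normed_vector \<Rightarrow> 'e \<Rightarrow> real" and f :: "nat \<Rightarrow> 'e"
  assumes onb: "hilbert_with_onb ip f"
begin

lemmas onb_coordinate_linear = bounded_linear.linear[OF onb_coordinate_bounded_linear[OF onb]]

lemma onb_proj_bounded_linear: "bounded_linear (onb_proj ip f I)"
  unfolding onb_proj_def[abs_def]
  by (intro bounded_linear_sum bounded_linear_scaleR_const onb_coordinate_bounded_linear[OF onb])

lemma onb_coordinate_sum:
  assumes "finite I"
  shows "ip (\<Sum>l\<in>I. c l *\<^sub>R f l) (f k) = (if k \<in> I then c k else 0)"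
proof -
  have "ip (\<Sum>l\<in>I. c l *\<^sub>R f l) (f k) = (\<Sum>l\<in>I. c l * ip (f l) (f k))"
    by (simp add: linear_sum[OF onb_coordinate_linear] linear_scale[OF onb_coordinate_linear])
  also have "\<dots> = (\<Sum>l\<in>I. if l = k then c l else 0)"
    by (rule sum.cong) (auto simp: onb_orthonormal[OF onb])
  finally show ?thesis using assms by simp
qed

lemma onb_coordinate_proj: "finite I \<Longrightarrow> ip (onb_proj ip f I y) (f k) = (if k \<in> I then ip y (f k) else 0)"
  unfolding onb_proj_def by (rule onb_coordinate_sum)

lemma onb_proj_proj: "finite I \<Longrightarrow> onb_proj ip f I (onb_proj ip f I y) = onb_proj ip f I y"
  unfolding onb_proj_def[of ip f I "onb_proj ip f I y"] by (simp add: onb_coordinate_proj) (simp add: onb_proj_def)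

lemma onb_proj_compl_proj: "finite I \<Longrightarrow> onb_proj ip f I (y - onb_proj ip f I y) = 0"
  using linear_diff[OF bounded_linear.linear[OF onb_proj_bounded_linear]] onb_proj_proj by fastforce

lemma onb_proj_norm_le: "norm (onb_proj ip f I y) \<le> real (card I) * norm y"
proof -
  have "norm (onb_proj ip f I y) \<le> (\<Sum>l\<in>I. norm (ip y (f l) *\<^sub>R f l))" unfolding onb_proj_def by (rule norm_sum)
  also have "\<dots> \<le> (\<Sum>l\<in>I. norm y)"
    by (rule sum_mono) (simp add: onb_norm[OF onb] onb_coordinate_le[OF onb])
  finally show ?thesis by simp
qed

lemma onb_inj: "inj f"
proof (rule injI)
  fix i j assume "f i = f j"
  then have "ip (f i) (f j) = ip (f i) (f i)" by simp
  then show "i = j" by (simp add: onb_orthonormal[OF onb] split: if_splits)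
qed

lemma onb_independent: "finite I \<Longrightarrow> independent (f ` I)"
proof (rule independent_if_scalars_zero)
  fix u b assume I: "finite I" and z: "(\<Sum>x\<in>f ` I. u x *\<^sub>R x) = 0" and "b \<in> f ` I"
  then obtain k where k: "k \<in> I" "b = f k" by auto
  have "(\<Sum>l\<in>I. u (f l) *\<^sub>R f l) = 0"
    using z by (subst (asm) sum.reindex) (auto intro: inj_on_subset[OF onb_inj])
  then show "u b = 0"
    using onb_coordinate_sum[OF I, of "\<lambda>l. u (f l)" k] k linear_0[OF onb_coordinate_linear] by simp
qed simp

end

text \<open>Up to null sets, the projection reads the coordinate processes in \<open>I\<close> and
  its complement reads all others; disjoint groups of independent processes are independent.\<close>

lemma onb_blocks_independent:
  fixes \<eta> :: "int \<Rightarrow> 'w \<Rightarrow> 'e::banach"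
  assumes noise: "stationary_noise M \<eta> K Q" and onb: "hilbert_with_onb ip f" and I: "finite I"
    and r: "\<And>l. 0 < r l" "summable r"
    and ind: "prob_space.indep_vars M (\<lambda>_. Pi\<^sub>M UNIV (\<lambda>_. borel)) (\<lambda>l \<omega> k. \<eta>c l k \<omega>) (UNIV :: nat set)"
    and c_le: "\<And>l k. AE \<omega> in M. \<bar>\<eta>c l k \<omega>\<bar> \<le> 1"
    and series: "\<And>k. AE \<omega> in M. (\<lambda>l. (r l * \<eta>c l k \<omega>) *\<^sub>R f l) sums \<eta> k \<omega>"
  shows "stationary_noise.indep_blocks M \<eta> (onb_proj ip f I) (\<lambda>y. y - onb_proj ip f I y)"
proof -
  interpret stationary_noise M \<eta> K Q by (rule noise)
  let ?p = "onb_proj ip f I" and ?r = "\<lambda>y. y - onb_proj ip f I y"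
  let ?T = "Pi\<^sub>M UNIV (\<lambda>_::int. borel :: real measure)"
  \<comment> \<open>The coordinates are bounded by 1 only almost surely. Clipping makes the series
    converge for every coefficient sequence, so that its sum \<open>h\<close> is measurable
    everywhere; almost surely it changes nothing.\<close>
  define clip where "clip t = max (-1) (min 1 t)" for t :: real
  have [measurable]: "clip \<in> borel_measurable borel" unfolding clip_def by measurable
  define w where "w x n l = (if l \<in> I then 0 else (r l * clip (x l (- int n))) *\<^sub>R f l)" for x :: "nat \<Rightarrow> int \<Rightarrow> real" and n l
  define h where "h x n = (\<Sum>l. w x n l)" for x n
  define g where "g x n = (\<Sum>l\<in>I. (r l * x l (- int n)) *\<^sub>R f l)" for x :: "nat \<Rightarrow> int \<Rightarrow> real" and n
  have w_sum: "summable (w x n)" for x n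
  proof (rule summable_comparison_test[OF _ r(2)])
    have "norm (w x n l) \<le> r l" for l
    proof -
      have "\<bar>clip (x l (- int n))\<bar> \<le> 1" by (auto simp: clip_def)
      then have "r l * \<bar>clip (x l (- int n))\<bar> \<le> r l" using r(1)[of l] by (simp add: mult_left_le)
      then show ?thesis using r(1)[of l] by (simp add: w_def onb_norm[OF onb] abs_mult)
    qed
    then show "\<exists>N. \<forall>l\<ge>N. norm (w x n l) \<le> r l" by blast
  qed
  have g_meas: "g \<in> measurable (Pi\<^sub>M I (\<lambda>_. ?T)) seq_space"
  proof (rule measurable_PiM_single')
    fix n :: nat
    have [measurable]: "(\<lambda>x. x l (- int n)) \<in> borel_measurable (Pi\<^sub>M I (\<lambda>_. ?T))" if "l \<in> I" for l
      by (rule measurable_compose[OF measurable_component_singleton[OF that] measurable_component_singleton]) simp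
    show "(\<lambda>x. g x n) \<in> borel_measurable (Pi\<^sub>M I (\<lambda>_. ?T))"
      unfolding g_def by (intro borel_measurable_sum'[OF scE'] borel_measurable_scaleR_const) measurable
  qed (simp add: space_PiM)
  have h_meas: "h \<in> measurable (Pi\<^sub>M (- I) (\<lambda>_. ?T)) seq_space"
  proof (rule measurable_PiM_single')
    fix n :: nat
    have [measurable]: "(\<lambda>x. x l (- int n)) \<in> borel_measurable (Pi\<^sub>M (- I) (\<lambda>_. ?T))" if "l \<in> - I" for l
      by (rule measurable_compose[OF measurable_component_singleton[OF that] measurable_component_singleton]) simp
    have wm: "(\<lambda>x. w x n l) \<in> borel_measurable (Pi\<^sub>M (- I) (\<lambda>_. ?T))" for l
      by (cases "l \<in> I") (auto simp: w_def intro!: borel_measurable_scaleR_const)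
    show "(\<lambda>x. h x n) \<in> borel_measurable (Pi\<^sub>M (- I) (\<lambda>_. ?T))"
    proof (rule borel_measurable_LIMSEQ_metric)
      show "(\<lambda>x. \<Sum>l<m. w x n l) \<in> borel_measurable (Pi\<^sub>M (- I) (\<lambda>_. ?T))" for m
        by (rule borel_measurable_sum'[OF scE' wm])
      show "(\<lambda>m. \<Sum>l<m. w x n l) \<longlonglongrightarrow> h x n" for x
        unfolding h_def by (rule summable_LIMSEQ[OF w_sum])
    qed
  qed (simp add: space_PiM)
  let ?c = "\<lambda>l \<omega> k. \<eta>c l k \<omega>"
  have "indep_var (Pi\<^sub>M I (\<lambda>_. ?T)) (\<lambda>\<omega>. restrict (\<lambda>i. ?c i \<omega>) I) (Pi\<^sub>M (- I) (\<lambda>_. ?T)) (\<lambda>\<omega>. restrict (\<lambda>i. ?c i \<omega>) (- I))"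
    by (rule indep_var_restrict[OF ind]) auto
  note iv0 = indep_var_compose[OF this g_meas h_meas]
  have iv: "indep_var seq_space (\<lambda>\<omega>. g (\<lambda>l. ?c l \<omega>)) seq_space (\<lambda>\<omega>. h (\<lambda>l. ?c l \<omega>))"
  proof -
    have "g \<circ> (\<lambda>\<omega>. restrict (\<lambda>i. ?c i \<omega>) I) = (\<lambda>\<omega>. g (\<lambda>l. ?c l \<omega>))"
      by (auto simp: fun_eq_iff g_def intro!: sum.cong)
    moreover have "h \<circ> (\<lambda>\<omega>. restrict (\<lambda>i. ?c i \<omega>) (- I)) = (\<lambda>\<omega>. h (\<lambda>l. ?c l \<omega>))"
      by (auto simp: fun_eq_iff h_def w_def intro!: suminf_cong)
    ultimately show ?thesis
      using iv0 by simp
  qed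
  have eq: "AE \<omega> in M. (\<lambda>n. ?p (past \<eta> \<omega> n)) = g (\<lambda>l. ?c l \<omega>) \<and> (\<lambda>n. ?r (past \<eta> \<omega> n)) = h (\<lambda>l. ?c l \<omega>)"
  proof -
    have "AE \<omega> in M. \<forall>k. (\<lambda>l. (r l * \<eta>c l k \<omega>) *\<^sub>R f l) sums \<eta> k \<omega>"
      unfolding AE_all_countable using series by blast
    moreover have "AE \<omega> in M. \<forall>l k. \<bar>\<eta>c l k \<omega>\<bar> \<le> 1"
      unfolding AE_all_countable using c_le by blast
    ultimately show ?thesis
    proof eventually_elim
      case (elim \<omega>)
      \<comment> \<open>Orthonormality recovers the coefficients from the sum, since the coordinate
        functionals are continuous.\<close>
      have co: "ip (\<eta> k \<omega>) (f l) = r l * \<eta>c l k \<omega>" for k l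
      proof -
        have "(\<lambda>m. ip ((r m * \<eta>c m k \<omega>) *\<^sub>R f m) (f l)) sums ip (\<eta> k \<omega>) (f l)"
          by (rule bounded_linear.sums[OF onb_coordinate_bounded_linear[OF onb]]) (use elim in blast)
        moreover have "ip ((r m * \<eta>c m k \<omega>) *\<^sub>R f m) (f l) = (if m = l then r m * \<eta>c m k \<omega> else 0)" for m
          by (simp add: linear_scale[OF onb_coordinate_linear[OF onb]] onb_orthonormal[OF onb])
        ultimately have "(\<lambda>m. if m = l then r m * \<eta>c m k \<omega> else 0) sums ip (\<eta> k \<omega>) (f l)" by simp
        moreover have "(\<lambda>m. if m = l then r m * \<eta>c m k \<omega> else 0) sums (r l * \<eta>c l k \<omega>)" by (rule sums_single)
        ultimately show ?thesis by (rule sums_unique2)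
      qed
      have gp: "?p (past \<eta> \<omega> n) = g (\<lambda>l. ?c l \<omega>) n" for n
        by (simp add: onb_proj_def g_def past_def co)
      have "?r (past \<eta> \<omega> n) = h (\<lambda>l. ?c l \<omega>) n" for n
      proof -
        let ?k = "- int n"
        have s1: "(\<lambda>l. (r l * \<eta>c l ?k \<omega>) *\<^sub>R f l) sums \<eta> ?k \<omega>" using elim by blast
        have "(\<lambda>l. if l \<in> I then (r l * \<eta>c l ?k \<omega>) *\<^sub>R f l else 0) sums (\<Sum>l\<in>I. (r l * \<eta>c l ?k \<omega>) *\<^sub>R f l)"
          by (rule sums_If_finite_set[OF I])
        from sums_diff[OF s1 this]
        have "(\<lambda>l. if l \<in> I then 0 else (r l * \<eta>c l ?k \<omega>) *\<^sub>R f l) sums ?r (past \<eta> \<omega> n)"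
          by (simp add: onb_proj_def past_def co if_distrib cong: if_cong)
        moreover have "clip (\<eta>c l ?k \<omega>) = \<eta>c l ?k \<omega>" for l
        proof -
          have "\<bar>\<eta>c l ?k \<omega>\<bar> \<le> 1" using elim by blast
          then show ?thesis by (simp add: clip_def abs_le_iff)
        qed
        then have "w (\<lambda>l. ?c l \<omega>) n = (\<lambda>l. if l \<in> I then 0 else (r l * \<eta>c l ?k \<omega>) *\<^sub>R f l)"
          by (simp add: w_def fun_eq_iff)
        ultimately show ?thesis unfolding h_def by (simp add: sums_iff)
      qed
      then show ?case using gp by auto
    qed
  qed
  have pm: "?p \<in> borel_measurable borel"
    by (intro borel_measurable_continuous_onI linear_continuous_on onb_proj_bounded_linear[OF onb])
  have rm: "?r \<in> borel_measurable borel"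
    by (intro borel_measurable_continuous_onI continuous_on_diff continuous_on_id linear_continuous_on onb_proj_bounded_linear[OF onb])
  note [measurable] = map_seq_measurable[OF pm] map_seq_measurable[OF rm]
  have gm: "(\<lambda>\<omega>. g (\<lambda>l. ?c l \<omega>)) \<in> measurable M seq_space" and hm: "(\<lambda>\<omega>. h (\<lambda>l. ?c l \<omega>)) \<in> measurable M seq_space"
    using indep_var_rv1[OF iv] indep_var_rv2[OF iv] by auto
  note [measurable] = gm hm
  show ?thesis unfolding indep_blocks_def
  proof (intro ballI)
    fix C D :: "(nat \<Rightarrow> 'e) set" assume [measurable]: "C \<in> sets seq_space" "D \<in> sets seq_space"
    have law: "emeasure past_law {\<xi>. P \<xi>} = emeasure M {\<omega>\<in>space M. P (past \<eta> \<omega>)}" if "{\<xi>. P \<xi>} \<in> sets seq_space" for P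
      unfolding past_law_def by (subst emeasure_distr[OF past_measurable that]) (auto intro!: arg_cong[where f="emeasure M"])
    have s1: "{\<xi>. (\<lambda>n. ?p (\<xi> n)) \<in> C} \<in> sets seq_space" "{\<xi>. (\<lambda>n. ?r (\<xi> n)) \<in> D} \<in> sets seq_space"
      using measurable_sets[OF map_seq_measurable[OF pm] \<open>C \<in> sets seq_space\<close>] measurable_sets[OF map_seq_measurable[OF rm] \<open>D \<in> sets seq_space\<close>]
      by (auto simp: vimage_def space_PiM)
    have s2: "{\<xi>. (\<lambda>n. ?p (\<xi> n)) \<in> C \<and> (\<lambda>n. ?r (\<xi> n)) \<in> D} \<in> sets seq_space"
      using sets.Int[OF s1] by (simp add: Collect_conj_eq)
    let ?g = "\<lambda>\<omega>. g (\<lambda>l. ?c l \<omega>)" and ?h = "\<lambda>\<omega>. h (\<lambda>l. ?c l \<omega>)"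
    have swap: "emeasure M {\<omega>\<in>space M. P \<omega>} = emeasure M {\<omega>\<in>space M. P' \<omega>}"
      if "AE \<omega> in M. P \<omega> = P' \<omega>" "{\<omega>\<in>space M. P \<omega>} \<in> sets M" "{\<omega>\<in>space M. P' \<omega>} \<in> sets M" for P P'
      by (rule emeasure_eq_AE) (use that in auto)
    have [measurable]: "(\<lambda>\<omega> n. ?p (past \<eta> \<omega> n)) \<in> measurable M seq_space" "(\<lambda>\<omega> n. ?r (past \<eta> \<omega> n)) \<in> measurable M seq_space"
      by (rule measurable_compose[OF past_measurable map_seq_measurable[OF pm]], rule measurable_compose[OF past_measurable map_seq_measurable[OF rm]])
    have "emeasure past_law {\<xi>. (\<lambda>n. ?p (\<xi> n)) \<in> C \<and> (\<lambda>n. ?r (\<xi> n)) \<in> D} =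
        emeasure M {\<omega>\<in>space M. (\<lambda>n. ?p (past \<eta> \<omega> n)) \<in> C \<and> (\<lambda>n. ?r (past \<eta> \<omega> n)) \<in> D}"
      by (rule law[OF s2])
    also have "\<dots> = emeasure M {\<omega>\<in>space M. ?g \<omega> \<in> C \<and> ?h \<omega> \<in> D}"
      by (rule swap; ((measurable; fail) | (use eq in \<open>eventually_elim, simp\<close>)))
    also have "{\<omega>\<in>space M. ?g \<omega> \<in> C \<and> ?h \<omega> \<in> D} = (\<lambda>\<omega>. (?g \<omega>, ?h \<omega>)) -` (C \<times> D) \<inter> space M" by auto
    also have "emeasure M \<dots> = ennreal (prob (?g -` C \<inter> space M) * prob (?h -` D \<inter> space M))"
      unfolding emeasure_eq_measure by (subst indep_varD[OF iv]) auto
    also have "\<dots> = emeasure M {\<omega>\<in>space M. ?g \<omega> \<in> C} * emeasure M {\<omega>\<in>space M. ?h \<omega> \<in> D}"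
      by (simp add: emeasure_eq_measure ennreal_mult vimage_def Int_def conj_commute)
    also have "emeasure M {\<omega>\<in>space M. ?g \<omega> \<in> C} = emeasure M {\<omega>\<in>space M. (\<lambda>n. ?p (past \<eta> \<omega> n)) \<in> C}"
      by (rule swap; ((measurable; fail) | (use eq in \<open>eventually_elim, simp\<close>)))
    also have "emeasure M {\<omega>\<in>space M. ?h \<omega> \<in> D} = emeasure M {\<omega>\<in>space M. (\<lambda>n. ?r (past \<eta> \<omega> n)) \<in> D}"
      by (rule swap; ((measurable; fail) | (use eq in \<open>eventually_elim, simp\<close>)))
    finally show "emeasure past_law {\<xi>. (\<lambda>n. ?p (\<xi> n)) \<in> C \<and> (\<lambda>n. ?r (\<xi> n)) \<in> D} =
        emeasure past_law {\<xi>. (\<lambda>n. ?p (\<xi> n)) \<in> C} * emeasure past_law {\<xi>. (\<lambda>n. ?r (\<xi> n)) \<in> D}"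
      using law[OF s1(1)] law[OF s1(2)] by simp
  qed
qed

text \<open>Applied to the sum, \<open>p\<close> returns the \<open>\<kappa>a\<close>-summand and
  its complement the \<open>\<kappa>b\<close>-summand, so rectangles in the two components get
  product measure.\<close>

lemma sum_kernel_rectangle:
  fixes p :: "'e::real_normed_vector \<Rightarrow> 'e"
  assumes sc: "second_countable_type TYPE('e)" and a: "prob_space \<kappa>a" "sets \<kappa>a = sets borel"
    and b: "prob_space \<kappa>b" "sets \<kappa>b = sets borel" and p: "bounded_linear p"
    and ae: "AE x in \<kappa>a. p x = x" "AE x in \<kappa>b. p x = 0"
    and A[measurable]: "A \<in> sets borel" and D[measurable]: "D \<in> sets borel"
  shows "emeasure (distr (\<kappa>b \<Otimes>\<^sub>M \<kappa>a) borel (\<lambda>(b, a). a + b)) {y. p y \<in> A \<and> y - p y \<in> D} = emeasure \<kappa>a A * emeasure \<kappa>b D"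
proof -
  interpret a: prob_space \<kappa>a by fact
  interpret b: prob_space \<kappa>b by fact
  have pm[measurable]: "p \<in> borel_measurable borel"
    by (intro borel_measurable_continuous_onI linear_continuous_on p)
  have rm[measurable]: "(\<lambda>y. y - p y) \<in> borel_measurable borel"
    by (intro borel_measurable_continuous_onI continuous_on_diff continuous_on_id linear_continuous_on p)
  have "(\<lambda>(b, a). a + b) \<in> measurable (borel \<Otimes>\<^sub>M borel) (borel :: 'e measure)"
    unfolding split_beta by (rule borel_measurable_add'[OF sc]) measurable
  then have m: "(\<lambda>(b, a). a + b) \<in> measurable (\<kappa>b \<Otimes>\<^sub>M \<kappa>a) (borel :: 'e measure)"
    using a(2) b(2) by (simp cong: measurable_cong_sets sets_pair_measure_cong)
  let ?W = "{y. p y \<in> A \<and> y - p y \<in> D}"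
  have "p -` A \<inter> (\<lambda>y. y - p y) -` D \<in> sets borel"
    using measurable_sets_borel[OF pm A] measurable_sets_borel[OF rm D] by auto
  then have W[measurable]: "?W \<in> sets borel" by (simp add: vimage_def Int_def)
  let ?V = "(\<lambda>(b, a). a + b) -` ?W \<inter> space (\<kappa>b \<Otimes>\<^sub>M \<kappa>a)"
  have V: "?V \<in> sets (\<kappa>b \<Otimes>\<^sub>M \<kappa>a)" by (rule measurable_sets[OF m W])
  have "emeasure (distr (\<kappa>b \<Otimes>\<^sub>M \<kappa>a) borel (\<lambda>(b, a). a + b)) ?W = emeasure (\<kappa>b \<Otimes>\<^sub>M \<kappa>a) ?V"
    by (rule emeasure_distr[OF m W])
  also have "\<dots> = (\<integral>\<^sup>+b. emeasure \<kappa>a (Pair b -` ?V) \<partial>\<kappa>b)" by (rule a.emeasure_pair_measure_alt[OF V])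
  also have "\<dots> = (\<integral>\<^sup>+b. emeasure \<kappa>a A * indicator D b \<partial>\<kappa>b)"
  proof (rule nn_integral_cong_AE, use ae(2) in eventually_elim)
    fix b assume pb: "p b = 0"
    have "emeasure \<kappa>a (Pair b -` ?V) = emeasure \<kappa>a (if b \<in> D then A else {})"
    proof (rule emeasure_eq_AE)
      show "AE x in \<kappa>a. (x \<in> Pair b -` ?V) = (x \<in> (if b \<in> D then A else {}))"
        using ae(1)
      proof eventually_elim
        case (elim x)
        have "p (x + b) = x" using elim pb linear_add[OF bounded_linear.linear[OF p]] by simp
        then show ?case using sets_eq_imp_space_eq[OF a(2)] sets_eq_imp_space_eq[OF b(2)]
          by (auto simp: space_pair_measure)
      qed
    qed (use sets_Pair1[OF V] a(2) in auto)
    then show "emeasure \<kappa>a (Pair b -` ?V) = emeasure \<kappa>a A * indicator D b" by auto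
  qed
  also have "\<dots> = emeasure \<kappa>a A * emeasure \<kappa>b D" using b(2) by (simp add: nn_integral_cmult_indicator)
  finally show ?thesis .
qed

context stationary_noise
begin

lemma AE_block_kernel:
  assumes p: "continuous_on UNIV p" "\<And>y. p (p y) = p y" and r: "r \<in> measurable borel (borel :: 'e measure)"
  shows "AE a in block_kernel p r \<xi>. p a = a"
proof -
  have pm: "p \<in> borel_measurable borel" by (intro borel_measurable_continuous_onI p(1))
  have "closed {a. p a = a}" by (intro closed_Collect_eq p(1) continuous_on_id)
  then have N: "- {a. p a = a} \<in> sets borel" by auto
  have "p -` (- {a. p a = a}) = {}" using p(2) by auto
  then have "emeasure (block_kernel p r \<xi>) (- {a. p a = a}) = 0"
    unfolding block_kernel_emeasure[OF pm r N] by simp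
  then have "- {a. p a = a} \<in> null_sets (block_kernel p r \<xi>)"
    using N kernel_prob_algebraD(2)[OF block_kernel_measurable[OF pm r]] by (simp add: null_sets_def)
  then show ?thesis by (rule AE_I') auto
qed

text \<open>The density on the span of the first \<open>n\<close> basis vectors is a product once
  the coordinates are independent under \<open>Q \<xi>\<close> for each good \<open>\<xi>\<close>.
  This follows from the splittings by single coordinates, which are therefore built into
  \<open>G\<close> together with the splitting by the first \<open>n\<close>.\<close>

lemma split_kernel_onb:
  fixes S :: "'h::real_normed_vector \<times> 'e \<Rightarrow> 'h" and n :: nat and ip f
  defines "\<pi> \<equiv> \<lambda>y. y - onb_proj ip f {..<n} y"
  assumes scH: "second_countable_type TYPE('h)" and S: "continuous_on UNIV S"
    and X_inv: "\<And>u y. u \<in> X \<Longrightarrow> y \<in> K \<Longrightarrow> S (u, y) \<in> X"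
    and K: "compact K" and iota: "\<iota> > 1" and onb: "hilbert_with_onb ip f"
    and blocks: "\<And>I. finite I \<Longrightarrow> indep_blocks (onb_proj ip f I) (\<lambda>y. y - onb_proj ip f I y)"
    and p_nonneg: "\<And>l \<xi> x. \<xi> \<in> past_seqs K \<Longrightarrow> 0 \<le> p l \<xi> x"
    and p_dens: "\<And>l \<xi>. \<xi> \<in> past_seqs K \<Longrightarrow> distr (Q \<xi>) borel (\<lambda>x. ip x (f l)) = density lborel (\<lambda>x. ennreal (p l \<xi> x))"
    and p_lip: "\<And>l. lipschitz_density \<iota> K (p l)"
  obtains G q L R where "split_kernel S X K G \<iota> Q (block_kernel (onb_proj ip f {..<n}) \<pi>)
      (block_kernel \<pi> (onb_proj ip f {..<n})) q (f ` {..<n}) \<pi> L R"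
    "AE \<xi> in past_law. \<xi> \<in> G"
proof -
  let ?P = "\<lambda>I. onb_proj ip f I" and ?PN = "onb_proj ip f {..<n}"
  have Pbl: "bounded_linear (?P I)" for I by (rule onb_proj_bounded_linear[OF onb])
  have Pc: "continuous_on UNIV (?P I)" for I by (rule linear_continuous_on[OF Pbl])
  have rc: "continuous_on UNIV (\<lambda>y. y - ?P I y)" for I by (intro continuous_intros Pc)
  have Pm: "?P I \<in> borel_measurable borel" for I by (intro borel_measurable_continuous_onI Pc)
  have rm: "(\<lambda>y. y - ?P I y) \<in> borel_measurable borel" for I by (intro borel_measurable_continuous_onI rc)
  have cm[measurable]: "(\<lambda>y. ip y b) \<in> borel_measurable borel" if "b \<in> range f" for b
    using that onb_coordinate_bounded_linear[OF onb] by (auto intro!: borel_measurable_continuous_onI linear_continuous_on)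
  have \<pi>bl: "bounded_linear \<pi>" unfolding \<pi>_def by (intro bounded_linear_sub bounded_linear_ident Pbl)
  have \<pi>\<pi>: "\<pi> (\<pi> y) = \<pi> y" for y unfolding \<pi>_def using onb_proj_compl_proj[OF onb] by simp
  have rr: "(y - ?P I y) - ?P I (y - ?P I y) = y - ?P I y" if "finite I" for I y
    using onb_proj_compl_proj[OF onb that] by simp
  define split where "split I \<xi> \<longleftrightarrow> Q \<xi> = distr (block_kernel (\<lambda>y. y - ?P I y) (?P I) \<xi> \<Otimes>\<^sub>M block_kernel (?P I) (\<lambda>y. y - ?P I y) \<xi>)
      borel (\<lambda>(b, a). a + b)" for I \<xi>
  have AE_split: "AE \<xi> in past_law. split I \<xi>" if I: "finite I" for I
    unfolding split_def
    by (rule block_disintegration[OF Pm rm _ onb_proj_proj[OF onb I] rr[OF I] blocks[OF I]]) simp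
  have AEs: "AE \<xi> in past_law. \<xi> \<in> past_seqs K \<and> split {..<n} \<xi> \<and> (\<forall>l. split {l} \<xi>)"
  proof -
    have "AE \<xi> in past_law. \<forall>l. split {l} \<xi>" unfolding AE_all_countable using AE_split by blast
    then show ?thesis using AE_split[of "{..<n}", OF finite_lessThan] AE_past_K(2) by eventually_elim simp
  qed
  obtain G where G: "G \<in> sets seq_space" "AE \<xi> in past_law. \<xi> \<in> G"
    "\<And>\<xi>. \<xi> \<in> G \<Longrightarrow> \<xi> \<in> past_seqs K \<and> split {..<n} \<xi> \<and> (\<forall>l. split {l} \<xi>)"
    "\<And>\<xi>. \<xi> \<in> G \<Longrightarrow> AE y in Q \<xi>. case_nat y \<xi> \<in> G"
    by (rule invariant_full_set[OF AEs]) (rule that)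
  have GK: "\<xi> \<in> past_seqs K" if "\<xi> \<in> G" for \<xi> using G(3) that by blast
  have AEK: "AE y in Q \<xi>. y \<in> K \<and> case_nat y \<xi> \<in> G" if "\<xi> \<in> G" for \<xi>
    using G(4)[OF that]
  proof eventually_elim
    case (elim y)
    then have "case_nat y \<xi> 0 \<in> K" using GK unfolding past_seqs_def by blast
    then show ?case using elim by simp
  qed
  have Qs: "sets (Q \<xi>) = sets borel" "prob_space (Q \<xi>)" "space (Q \<xi>) = UNIV" for \<xi>
    using kernel_prob_algebraD[OF Q_kernel, of \<xi>] sets_eq_imp_space_eq[of "Q \<xi>" borel] by auto
  note [measurable_cong] = Qs(1)
  have rect: "emeasure (Q \<xi>) {y. ?P I y \<in> A \<and> y - ?P I y \<in> D} =
      emeasure (block_kernel (?P I) (\<lambda>y. y - ?P I y) \<xi>) A * emeasure (block_kernel (\<lambda>y. y - ?P I y) (?P I) \<xi>) D"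
    if "split I \<xi>" "finite I" "A \<in> sets borel" "D \<in> sets borel" for I \<xi> A D
  proof -
    have "AE b in block_kernel (\<lambda>y. y - ?P I y) (?P I) \<xi>. b - ?P I b = b"
      by (rule AE_block_kernel[OF rc rr[OF that(2)] Pm])
    then have b: "AE b in block_kernel (\<lambda>y. y - ?P I y) (?P I) \<xi>. ?P I b = 0" by eventually_elim simp
    show ?thesis
      by (subst that(1)[unfolded split_def])
        (rule sum_kernel_rectangle[OF scE' kernel_prob_algebraD[OF block_kernel_measurable[OF Pm rm]]
          kernel_prob_algebraD[OF block_kernel_measurable[OF rm Pm]] Pbl AE_block_kernel[OF Pc onb_proj_proj[OF onb that(2)] rm] b that(3,4)])
  qed
  have marg: "emeasure (Q \<xi>) {y. ?P I y \<in> A} = emeasure (block_kernel (?P I) (\<lambda>y. y - ?P I y) \<xi>) A"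
    "emeasure (Q \<xi>) {y. y - ?P I y \<in> A} = emeasure (block_kernel (\<lambda>y. y - ?P I y) (?P I) \<xi>) A"
    if "split I \<xi>" "finite I" "A \<in> sets borel" for I \<xi> A
  proof -
    have u: "emeasure (block_kernel (?P I) (\<lambda>y. y - ?P I y) \<xi>) UNIV = 1" "emeasure (block_kernel (\<lambda>y. y - ?P I y) (?P I) \<xi>) UNIV = 1"
      using prob_space.emeasure_space_1[OF kernel_prob_algebraD(1)[OF block_kernel_measurable[OF Pm[of I] rm[of I]]], of \<xi>]
        prob_space.emeasure_space_1[OF kernel_prob_algebraD(1)[OF block_kernel_measurable[OF rm[of I] Pm[of I]]], of \<xi>]
        sets_eq_imp_space_eq[OF kernel_prob_algebraD(2)[OF block_kernel_measurable[OF Pm[of I] rm[of I]]], of \<xi>]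
        sets_eq_imp_space_eq[OF kernel_prob_algebraD(2)[OF block_kernel_measurable[OF rm[of I] Pm[of I]]], of \<xi>] by auto
    show "emeasure (Q \<xi>) {y. ?P I y \<in> A} = emeasure (block_kernel (?P I) (\<lambda>y. y - ?P I y) \<xi>) A"
      using rect[OF that(1,2,3), of UNIV] u by simp
    show "emeasure (Q \<xi>) {y. y - ?P I y \<in> A} = emeasure (block_kernel (\<lambda>y. y - ?P I y) (?P I) \<xi>) A"
      using rect[OF that(1,2) _ that(3), of UNIV] u by simp
  qed
  \<comment> \<open>Induction on the set of coordinates: the splitting by \<open>{l}\<close> makes
    coordinate \<open>l\<close> independent of its complement, and the complement still determines
    all other coordinates.\<close>
  have coords: "emeasure (Q \<xi>) {y. \<forall>l\<in>I. ip y (f l) \<in> A l} = (\<Prod>l\<in>I. emeasure (Q \<xi>) {y. ip y (f l) \<in> A l})"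
    if \<xi>: "\<xi> \<in> G" and "finite I" and A: "\<And>l. A l \<in> sets borel" for \<xi> I A
    using \<open>finite I\<close>
  proof induction
    case empty
    show ?case using prob_space.emeasure_space_1[OF Qs(2), of \<xi>] Qs(3) by simp
  next
    case (insert l I)
    have sp: "split {l} \<xi>" using G(3)[OF \<xi>] by blast
    have Am: "(\<lambda>y. ip y (f l)) -` A l \<in> sets borel" for l
      using measurable_sets_borel[OF cm A] by blast
    have [measurable]: "{y. ip y (f l) \<in> A l} \<in> sets borel" for l using Am by (simp add: vimage_def)
    have D: "{y. \<forall>k\<in>I. ip y (f k) \<in> A k} \<in> sets borel"
      using sets.sets_Collect_finite_All'[OF _ insert.hyps(1), of borel "\<lambda>k y. ip y (f k) \<in> A k"] Am
      by (cases "I = {}") (auto simp: vimage_def)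
    have lp: "ip (?P {l} y) (f l) = ip y (f l)" for y by (simp add: onb_coordinate_proj[OF onb])
    have lr: "ip (y - ?P {l} y) (f k) = ip y (f k)" if "k \<in> I" for y k
      using that insert.hyps(2) linear_diff[OF onb_coordinate_linear[OF onb], of y "?P {l} y" k]
      by (auto simp: onb_coordinate_proj[OF onb])
    have e1: "{y. ip y (f l) \<in> A l} = {y. ?P {l} y \<in> {y. ip y (f l) \<in> A l}}" by (simp add: lp)
    have e2: "{y. \<forall>k\<in>I. ip y (f k) \<in> A k} = {y. y - ?P {l} y \<in> {y. \<forall>k\<in>I. ip y (f k) \<in> A k}}" by (simp add: lr)
    have "{y. \<forall>k\<in>insert l I. ip y (f k) \<in> A k} =
        {y. ?P {l} y \<in> {y. ip y (f l) \<in> A l} \<and> y - ?P {l} y \<in> {y. \<forall>k\<in>I. ip y (f k) \<in> A k}}"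
      by (auto simp: lp lr)
    then have "emeasure (Q \<xi>) {y. \<forall>k\<in>insert l I. ip y (f k) \<in> A k} =
        emeasure (Q \<xi>) {y. ip y (f l) \<in> A l} * emeasure (Q \<xi>) {y. \<forall>k\<in>I. ip y (f k) \<in> A k}"
      using rect[OF sp _ _ D, of "{y. ip y (f l) \<in> A l}"] marg(1)[OF sp, of "{y. ip y (f l) \<in> A l}"] marg(2)[OF sp _ D] e1 e2
      by simp
    then show ?case using insert by simp
  qed
  define B where "B = f ` {..<n}"
  have Bf: "finite B" by (simp add: B_def)
  define ix where "ix = inv f"
  have ix: "ix (f l) = l" for l unfolding ix_def by (rule inv_f_f[OF onb_inj[OF onb]])
  have sumB: "(\<Sum>b\<in>B. F b) = (\<Sum>l<n. F (f l))" for F :: "'e \<Rightarrow> 'e"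
    unfolding B_def by (subst sum.reindex) (auto intro: inj_on_subset[OF onb_inj[OF onb]])
  have prodB: "(\<Prod>b\<in>B. F b) = (\<Prod>l<n. F (f l))" for F :: "'e \<Rightarrow> ennreal"
    unfolding B_def by (subst prod.reindex) (auto intro: inj_on_subset[OF onb_inj[OF onb]])
  define q where "q \<xi> a = (\<Prod>l<n. p l \<xi> (ip a (f l)))" for \<xi> a
  obtain L0 where L0: "\<And>l \<xi> \<xi>' x x'. \<xi> \<in> past_seqs K \<Longrightarrow> \<xi>' \<in> past_seqs K \<Longrightarrow>
      \<bar>p l \<xi> x - p l \<xi>' x'\<bar> \<le> L0 l * (past_dist \<iota> \<xi> \<xi>' + norm (x - x'))"
    using p_lip unfolding lipschitz_density_def by metis
  \<comment> \<open>A common bound for the Lipschitz constants of the finitely many coordinate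
    densities, enlarged by 1 so that \<open>2 * m\<close> bounds the densities themselves.\<close>
  define m where "m = 1 + (\<Sum>l<n. \<bar>L0 l\<bar>)"
  have m1: "1 \<le> m" by (simp add: m_def sum_nonneg)
  have L0m: "\<bar>L0 l\<bar> + 1 \<le> m" if "l < n" for l
    using that member_le_sum[of l "{..<n}" "\<lambda>l. \<bar>L0 l\<bar>"] by (simp add: m_def)
  have pd0: "0 \<le> past_dist \<iota> \<xi> \<xi>'" if "\<xi> \<in> past_seqs K" "\<xi>' \<in> past_seqs K" for \<xi> \<xi>'
    by (rule past_dist_nonneg[OF compact_imp_bounded[OF K] that iota])
  have Lm: "\<bar>p l \<xi> x - p l \<xi>' x'\<bar> \<le> m * (past_dist \<iota> \<xi> \<xi>' + \<bar>x - x'\<bar>)"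
    if "l < n" "\<xi> \<in> past_seqs K" "\<xi>' \<in> past_seqs K" for l \<xi> \<xi>' x x'
  proof -
    have "L0 l * (past_dist \<iota> \<xi> \<xi>' + \<bar>x - x'\<bar>) \<le> m * (past_dist \<iota> \<xi> \<xi>' + \<bar>x - x'\<bar>)"
      using L0m[OF that(1)] pd0[OF that(2,3)] by (intro mult_right_mono) auto
    then show ?thesis using L0[OF that(2,3), of l x x'] by simp
  qed
  have p_cont: "continuous_on UNIV (p l \<xi>)" if "\<xi> \<in> past_seqs K" for l \<xi>
  proof -
    have "\<bar>L0 l\<bar>-lipschitz_on UNIV (p l \<xi>)"
    proof (rule lipschitz_onI)
      fix x y
      have "\<bar>p l \<xi> x - p l \<xi> y\<bar> \<le> L0 l * \<bar>x - y\<bar>" using L0[OF that that, of l x y] by (simp add: past_dist_def)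
      also have "\<dots> \<le> \<bar>L0 l\<bar> * \<bar>x - y\<bar>" by (intro mult_right_mono) auto
      finally show "dist (p l \<xi> x) (p l \<xi> y) \<le> \<bar>L0 l\<bar> * dist x y" by (simp add: dist_real_def)
    qed simp
    then show ?thesis by (rule lipschitz_on_continuous_on)
  qed
  have p_meas: "p l \<xi> \<in> borel_measurable borel" if "\<xi> \<in> past_seqs K" for l \<xi>
    by (intro borel_measurable_continuous_onI p_cont that)
  have p_prob: "prob_space (density lborel (\<lambda>x. ennreal (p l \<xi> x)))" if "\<xi> \<in> past_seqs K" for l \<xi>
  proof -
    have "(\<lambda>x. ip x (f l)) \<in> measurable (Q \<xi>) borel" by measurable
    then show ?thesis unfolding p_dens[OF that, symmetric] by (rule prob_space.prob_space_distr[OF Qs(2)])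
  qed
  have p_le: "\<bar>p l \<xi> x\<bar> \<le> 2 * m" if "l < n" "\<xi> \<in> past_seqs K" for l \<xi> x
  proof -
    have "p l \<xi> x \<le> m + 1"
      by (rule Lipschitz_density_le[OF p_prob[OF that(2)]])
        (use Lm[OF that(1) that(2) that(2)] in \<open>simp add: past_dist_def\<close>)
    then show ?thesis using p_nonneg[OF that(2), of l x] m1 by simp
  qed
  define L where "L = (2 * m) ^ n * (real n * m)"
  have q_lip: "\<bar>q \<xi> a - q \<xi>' a'\<bar> \<le> L * (past_dist \<iota> \<xi> \<xi>' + norm (a - a'))"
    if \<xi>: "\<xi> \<in> past_seqs K" "\<xi>' \<in> past_seqs K" for \<xi> \<xi>' a a'
  proof -
    let ?a = "\<lambda>l. if l < n then p l \<xi> (ip a (f l)) else 0" and ?b = "\<lambda>l. if l < n then p l \<xi>' (ip a' (f l)) else 0"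
    have "\<bar>q \<xi> a - q \<xi>' a'\<bar> = \<bar>(\<Prod>l<n. ?a l) - (\<Prod>l<n. ?b l)\<bar>" by (simp add: q_def)
    also have "\<dots> \<le> (2 * m) ^ n * (\<Sum>l<n. \<bar>?a l - ?b l\<bar>)"
      by (rule abs_prod_diff_le) (use p_le \<xi> m1 in auto)
    also have "\<dots> \<le> (2 * m) ^ n * (\<Sum>l<n. m * (past_dist \<iota> \<xi> \<xi>' + norm (a - a')))"
    proof (intro mult_left_mono sum_mono)
      fix l assume "l \<in> {..<n}"
      then have "\<bar>?a l - ?b l\<bar> \<le> m * (past_dist \<iota> \<xi> \<xi>' + \<bar>ip a (f l) - ip a' (f l)\<bar>)" using Lm \<xi> by simp
      also have "ip a (f l) - ip a' (f l) = ip (a - a') (f l)" by (simp add: linear_diff[OF onb_coordinate_linear[OF onb]])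
      also have "m * (past_dist \<iota> \<xi> \<xi>' + \<bar>ip (a - a') (f l)\<bar>) \<le> m * (past_dist \<iota> \<xi> \<xi>' + norm (a - a'))"
        using m1 onb_coordinate_le[OF onb] by (intro mult_left_mono add_left_mono) auto
      finally show "\<bar>?a l - ?b l\<bar> \<le> m * (past_dist \<iota> \<xi> \<xi>' + norm (a - a'))" .
    qed (use m1 in auto)
    also have "\<dots> = L * (past_dist \<iota> \<xi> \<xi>' + norm (a - a'))" by (simp add: L_def)
    finally show ?thesis .
  qed
  have q_nonneg: "0 \<le> q \<xi> a" if "\<xi> \<in> past_seqs K" for \<xi> a
    unfolding q_def using p_nonneg[OF that] by (intro prod_nonneg) auto
  have q_meas: "q \<xi> \<in> borel_measurable borel" if "\<xi> \<in> past_seqs K" for \<xi>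
    unfolding q_def[abs_def]
    by (intro borel_measurable_prod measurable_compose[OF cm p_meas[OF that]]) auto
  \<comment> \<open>On good pasts the average over an independent copy in
    \<open>block_kernel\<close> is the projection of \<open>Q \<xi>\<close> itself, which gives
    access to the given coordinate densities.\<close>
  have QA: "block_kernel ?PN \<pi> \<xi> = distr (Q \<xi>) borel ?PN" if \<xi>: "\<xi> \<in> G" for \<xi>
  proof (rule measure_eqI)
    fix A assume "A \<in> sets (block_kernel ?PN \<pi> \<xi>)"
    then have A: "A \<in> sets borel" using kernel_prob_algebraD(2)[OF block_kernel_measurable[OF Pm rm]] by (simp add: \<pi>_def)
    have "split {..<n} \<xi>" using G(3)[OF \<xi>] by blast
    from marg(1)[OF this finite_lessThan A] show "emeasure (block_kernel ?PN \<pi> \<xi>) A = emeasure (distr (Q \<xi>) borel ?PN) A"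
      using A Pm by (subst emeasure_distr) (auto simp: \<pi>_def vimage_def Qs)
  qed (use kernel_prob_algebraD(2)[OF block_kernel_measurable[OF Pm rm]] in \<open>simp add: \<pi>_def\<close>)
  have dens: "block_kernel ?PN \<pi> \<xi> = density (basis_lebesgue B) (\<lambda>a. ennreal (q \<xi> a))" if \<xi>: "\<xi> \<in> G" for \<xi>
  proof -
    note \<xi>K = GK[OF \<xi>]
    let ?L = "Pi\<^sub>M B (\<lambda>_. lborel :: real measure)" and ?g = "\<lambda>c. \<Sum>b\<in>B. c b *\<^sub>R b"
    let ?c = "\<lambda>y. \<lambda>b\<in>B. ip y b" and ?d = "\<lambda>b x. ennreal (p (ix b) \<xi> x)"
    have dm[measurable]: "?d b \<in> borel_measurable borel" for b using p_meas[OF \<xi>K] by measurable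
    have gm: "?g \<in> borel_measurable ?L" by (rule borel_measurable_linear_combination[OF scE'])
    have cmm: "?c \<in> measurable borel ?L"
      by (rule measurable_restrict) (auto simp: B_def)
    interpret D: product_sigma_finite "\<lambda>b. density lborel (?d b)"
      by (rule product_sigma_finite.intro) (use prob_space_imp_sigma_finite p_prob[OF \<xi>K] in blast)
    have sD: "sets (Pi\<^sub>M B (\<lambda>b. density lborel (?d b))) = sets ?L" by (rule sets_PiM_cong) simp_all
    have "distr (Q \<xi>) ?L ?c = Pi\<^sub>M B (\<lambda>b. density lborel (?d b))"
    proof (rule D.PiM_eqI[OF Bf])
      show "sets (distr (Q \<xi>) ?L ?c) = sets (Pi\<^sub>M B (\<lambda>b. density lborel (?d b)))" using sD by simp
      fix A assume "\<And>b. b \<in> B \<Longrightarrow> A b \<in> sets (density lborel (?d b))"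
      then have A: "\<And>b. b \<in> B \<Longrightarrow> A b \<in> sets borel" by simp
      \<comment> \<open>Filled up by the empty set because \<open>coords\<close> asks for
        measurability at every index.\<close>
      define A' where "A' l = (if l < n then A (f l) else {})" for l
      have A': "A' l \<in> sets borel" for l using A by (auto simp: A'_def B_def)
      have E: "Pi\<^sub>E B A \<in> sets ?L" using Bf A by (intro sets_PiM_I_finite) auto
      have "emeasure (distr (Q \<xi>) ?L ?c) (Pi\<^sub>E B A) = emeasure (Q \<xi>) (?c -` Pi\<^sub>E B A \<inter> space (Q \<xi>))"
        using cmm E by (subst emeasure_distr) (auto simp: measurable_cong_sets[OF Qs(1) refl])
      also have "?c -` Pi\<^sub>E B A \<inter> space (Q \<xi>) = {y. \<forall>l\<in>{..<n}. ip y (f l) \<in> A' l}"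
        by (auto simp: Qs B_def A'_def PiE_def Pi_iff extensional_def)
      also have "emeasure (Q \<xi>) \<dots> = (\<Prod>l<n. emeasure (Q \<xi>) {y. ip y (f l) \<in> A' l})"
        by (rule coords[OF \<xi> _ A']) simp
      also have "\<dots> = (\<Prod>l<n. emeasure (density lborel (?d (f l))) (A (f l)))"
      proof (rule prod.cong[OF refl])
        fix l assume "l \<in> {..<n}"
        then have l: "A' l = A (f l)" by (simp add: A'_def)
        have "emeasure (distr (Q \<xi>) borel (\<lambda>x. ip x (f l))) (A' l) = emeasure (Q \<xi>) {y. ip y (f l) \<in> A' l}"
          using A' by (subst emeasure_distr) (auto simp: vimage_def Qs)
        then show "emeasure (Q \<xi>) {y. ip y (f l) \<in> A' l} = emeasure (density lborel (?d (f l))) (A (f l))"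
          unfolding p_dens[OF \<xi>K] ix l by simp
      qed
      also have "\<dots> = (\<Prod>b\<in>B. emeasure (density lborel (?d b)) (A b))" by (rule prodB[symmetric])
      finally show "emeasure (distr (Q \<xi>) ?L ?c) (Pi\<^sub>E B A) = (\<Prod>b\<in>B. emeasure (density lborel (?d b)) (A b))" .
    qed
    also have "\<dots> = density ?L (\<lambda>x. \<Prod>b\<in>B. ?d b (x b))"
      by (rule PiM_density_lborel[OF Bf dm p_prob[OF \<xi>K]])
    also have "\<dots> = density ?L (\<lambda>x. ennreal (q \<xi> (?g x)))"
    proof (rule density_cong)
      show "AE x in ?L. (\<Prod>b\<in>B. ?d b (x b)) = ennreal (q \<xi> (?g x))"
      proof (rule AE_I2)
        fix x :: "'e \<Rightarrow> real"
        have "ip (?g x) (f l) = x (f l)" if "l < n" for l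
          using that onb_coordinate_sum[OF onb, of "{..<n}" "\<lambda>l. x (f l)" l] by (simp add: sumB)
        then have "q \<xi> (?g x) = (\<Prod>l<n. p l \<xi> (x (f l)))" by (simp add: q_def)
        then show "(\<Prod>b\<in>B. ?d b (x b)) = ennreal (q \<xi> (?g x))"
          unfolding prodB using p_nonneg[OF \<xi>K] by (simp add: prod_ennreal ix)
      qed
      show "(\<lambda>x. ennreal (q \<xi> (?g x))) \<in> borel_measurable ?L"
        using measurable_compose[OF gm q_meas[OF \<xi>K]] by measurable
      show "(\<lambda>x. \<Prod>b\<in>B. ?d b (x b)) \<in> borel_measurable ?L" by measurable
    qed
    finally have law: "distr (Q \<xi>) ?L ?c = density ?L (\<lambda>x. ennreal (q \<xi> (?g x)))" .
    have "?PN = ?g \<circ> ?c"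
      by (auto simp: fun_eq_iff onb_proj_def sumB) (auto simp: B_def intro!: sum.cong)
    then have "distr (Q \<xi>) borel ?PN = distr (distr (Q \<xi>) ?L ?c) borel ?g"
      using distr_distr[OF gm, of ?c "Q \<xi>"] cmm by (simp add: measurable_cong_sets[OF Qs(1) refl])
    also have "\<dots> = density (distr ?L borel ?g) (\<lambda>a. ennreal (q \<xi> a))"
      unfolding law by (rule density_distr[symmetric]) (use q_meas[OF \<xi>K] gm in auto)
    finally show ?thesis unfolding QA[OF \<xi>] basis_lebesgue_def .
  qed
  obtain RK where RK: "\<And>y. y \<in> K \<Longrightarrow> norm y \<le> RK" using compact_imp_bounded[OF K] unfolding bounded_iff by auto
  \<comment> \<open>The factor \<open>real n\<close> comes from the triangle inequality for the
    projection.\<close>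
  define R where "R = real n * RK"
  show thesis
  proof (rule that[of G q L R])
    show "split_kernel S X K G \<iota> Q (block_kernel ?PN \<pi>) (block_kernel \<pi> ?PN) q (f ` {..<n}) \<pi> L R"
    proof (rule split_kernel.intro)
      show "block_kernel ?PN \<pi> \<in> measurable seq_space (prob_algebra borel)" "block_kernel \<pi> ?PN \<in> measurable seq_space (prob_algebra borel)"
        unfolding \<pi>_def by (rule block_kernel_measurable[OF Pm rm], rule block_kernel_measurable[OF rm Pm])
      show "bounded_linear \<pi>" by (rule \<pi>bl)
      show "independent (f ` {..<n})" by (rule onb_independent[OF onb]) simp
      show "0 \<le> L" using m1 by (simp add: L_def)
      show "\<pi> b = 0" if "b \<in> f ` {..<n}" for b
      proof -
        from that obtain k where k: "k < n" "b = f k" by auto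
        have "?PN b = (\<Sum>l<n. if l = k then f l else 0)"
          unfolding onb_proj_def k by (rule sum.cong) (auto simp: onb_orthonormal[OF onb])
        then show ?thesis using k by (simp add: \<pi>_def)
      qed
      show "block_kernel \<pi> ?PN \<xi> = block_kernel \<pi> ?PN \<xi>'" if "\<And>n. \<pi> (\<xi> n) = \<pi> (\<xi>' n)" for \<xi> \<xi>'
        by (rule block_kernel_cong) (rule that)
      show "block_kernel ?PN \<pi> \<xi> = block_kernel ?PN \<pi> \<xi>'" if "\<And>n. \<xi> n - \<pi> (\<xi> n) = \<xi>' n - \<pi> (\<xi>' n)" for \<xi> \<xi>'
        by (rule block_kernel_cong) (use that in \<open>simp add: \<pi>_def\<close>)
      fix \<xi> assume \<xi>: "\<xi> \<in> G"
      show "Q \<xi> = distr (block_kernel \<pi> ?PN \<xi> \<Otimes>\<^sub>M block_kernel ?PN \<pi> \<xi>) borel (\<lambda>(b, a). a + b)"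
        using G(3)[OF \<xi>] by (simp add: split_def \<pi>_def)
      show "block_kernel ?PN \<pi> \<xi> = density (basis_lebesgue (f ` {..<n})) (\<lambda>a. ennreal (q \<xi> a))"
        using dens[OF \<xi>] by (simp add: B_def)
      show "AE b in block_kernel \<pi> ?PN \<xi>. \<pi> b = b"
        by (rule AE_block_kernel[OF linear_continuous_on[OF \<pi>bl] \<pi>\<pi> Pm])
      have "AE y in Q \<xi>. norm (?PN y) \<le> R"
        using AEK[OF \<xi>]
      proof eventually_elim
        case (elim y)
        have "norm (?PN y) \<le> real n * norm y" using onb_proj_norm_le[OF onb, of "{..<n}" y] by simp
        also have "\<dots> \<le> R" using RK elim by (simp add: R_def mult_left_mono)
        finally show ?case .
      qed
      then have "AE a in distr (Q \<xi>) borel ?PN. norm a \<le> R"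
        using Pm by (subst AE_distr_iff) (auto simp: measurable_cong_sets[OF Qs(1) refl])
      then have "AE a in density (basis_lebesgue B) (\<lambda>a. ennreal (q \<xi> a)). norm a \<le> R"
        unfolding dens[OF \<xi>, symmetric] QA[OF \<xi>] .
      then have "AE a in basis_lebesgue B. 0 < q \<xi> a \<longrightarrow> norm a \<le> R"
        using q_meas[OF GK[OF \<xi>]] by (subst (asm) AE_density) auto
      then show "AE a in basis_lebesgue (f ` {..<n}). R < norm a \<longrightarrow> q \<xi> a = 0"
        unfolding B_def[symmetric]
      proof eventually_elim
        case (elim a)
        then show ?case using q_nonneg[OF GK[OF \<xi>], of a] by force
      qed
    qed (use scH scE' S X_inv K iota Q_kernel G(1) GK AEK q_lip q_nonneg in auto)
  qed (rule G(2))
qed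

end

section \<open>Assembly of the two cases\<close>

lemma finite_subset_span_initial:
  fixes f :: "nat \<Rightarrow> 'a::real_vector"
  assumes "finite W" "W \<subseteq> span (range f)"
  obtains n where "W \<subseteq> span (f ` {..<n})"
proof -
  have ex: "\<exists>n. w \<in> span (f ` {..<n})" if "w \<in> span (range f)" for w
    using that
  proof (induction rule: span_induct_alt)
    case base
    show ?case by (intro exI[of _ 0]) (rule span_zero)
  next
    case (step c x y)
    then obtain k n where "x = f k" "y \<in> span (f ` {..<n})" by auto
    moreover have "span (f ` {..<n}) \<subseteq> span (f ` {..<max n (Suc k)})" by (intro span_mono) auto
    ultimately have "c *\<^sub>R x + y \<in> span (f ` {..<max n (Suc k)})"
      by (intro span_add span_scale) (auto intro: span_base)
    then show ?case by blast
  qed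
  have "\<forall>w\<in>W. \<exists>n. w \<in> span (f ` {..<n})" using ex assms(2) by blast
  then obtain g where g: "\<And>w. w \<in> W \<Longrightarrow> w \<in> span (f ` {..<g w})" using bchoice by metis
  have "W \<subseteq> span (f ` {..<\<Sum>w\<in>W. g w})"
  proof
    fix w assume w: "w \<in> W"
    have "span (f ` {..<g w}) \<subseteq> span (f ` {..<\<Sum>w\<in>W. g w})"
      using member_le_sum[OF w, of g] assms(1) by (intro span_mono image_mono) auto
    then show "w \<in> span (f ` {..<\<Sum>w\<in>W. g w})" using g[OF w] by blast
  qed
  then show ?thesis by (rule that)
qed

theorem mainTheorem1:
  fixes M :: "'w measure"
    and \<eta> :: "int \<Rightarrow> 'w \<Rightarrow> 'e::banach"
    and S :: "'h::{real_inner,complete_space} \<times> 'e \<Rightarrow> 'h"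
    and X :: "'h set"
    and K B :: "'e set"
    and ip :: "'e \<Rightarrow> 'e \<Rightarrow> real"
    and f :: "nat \<Rightarrow> 'e"
    and \<iota> :: real
    and Q :: "(nat \<Rightarrow> 'e) \<Rightarrow> 'e measure"
    and N :: "(nat \<Rightarrow> 'e) \<Rightarrow> 'n measure"
    and \<zeta> :: "(nat \<Rightarrow> 'e) \<Rightarrow> nat \<Rightarrow> 'n \<Rightarrow> 'e"
    and J :: "'v::{real_inner,complete_space} \<Rightarrow> 'h"
    and U :: "('h \<times> 'e) set"
  assumes E_space: "is_finite_basis B \<or> hilbert_with_onb ip f"
    and M_prob: "prob_space M"
    and stationary: "stationary_process M \<eta>"
    and K_def: "K = msupport (distr M borel (\<eta> 0))"
    and K_compact: "compact K"
    and S_smooth: "C2_map_bounded S"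
    and X_compact: "compact X"
    and X_nonempty: "X \<noteq> {}"
    and X_invariant: "S ` (X \<times> K) \<subseteq> X"
    and iota: "\<iota> > 1"
    and Q_version: "cond_law_version M \<eta> K Q"
    and eta_process: "\<And>\<xi>. \<xi> \<in> past_seqs K \<Longrightarrow> conditioned_process Q K \<xi> (N \<xi>) (\<zeta> \<xi>)"
    and eta1_finite_dim: "is_finite_basis B \<Longrightarrow> density_cond_finite_dim \<iota> K Q B"
    and eta1_hilbert: "hilbert_with_onb ip f \<Longrightarrow> density_cond_hilbert M \<eta> \<iota> K Q ip f"
    and eta2: "\<forall>n. \<forall>\<delta>>0. \<exists>s. \<exists>\<epsilon>>0. \<forall>\<xi>\<in>past_seqs K.
        measure (N \<xi>) {\<omega>\<in>space (N \<xi>). \<forall>j\<in>{s+1..s+n}. norm (\<zeta> \<xi> j \<omega>) < \<delta>} \<ge> \<epsilon>"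
    and S1: "\<exists>k\<ge>1. \<exists>a\<in>{0<..<1}. \<forall>v. norm (((\<lambda>u. S (u, 0)) ^^ k) v) \<le> a * norm v"
    and S2_embedding: "compact_dense_embedding J"
    and S2_regular: "\<exists>T :: 'h \<times> 'e \<Rightarrow> 'v. C1_map T \<and> (\<forall>z. S z = J (T z))"
    and S2_open: "open U" "X \<times> K \<subseteq> U"
    and S2_dense: "\<forall>(u, y)\<in>U. closure (range (frechet_derivative (\<lambda>y'. S (u, y')) (at y))) = UNIV"
  shows "\<exists>(\<mu> :: 'h measure) C \<gamma>.
           prob_space \<mu> \<and> sets \<mu> = sets borel \<and> msupport \<mu> \<subseteq> X \<and> C > 0 \<and> \<gamma> > 0 \<and>
           (\<forall>v. v \<in> borel_measurable M \<and> (AE \<omega> in M. v \<omega> \<in> X) \<and> indep_of_future M \<eta> v \<longrightarrow>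
              (\<forall>k. dual_lip_dist (distr M borel (traj S \<eta> v k)) \<mu> \<le> C * exp (- \<gamma> * real k)))"
proof -
  have scE: "second_countable_type TYPE('e)"
    using E_space second_countable_type_finite_basis second_countable_type_onb
    unfolding hilbert_with_onb_def by blast
  have scH: "second_countable_type TYPE('h)" by (rule second_countable_type_compact_dense_embedding[OF S2_embedding])
  have noise: "stationary_noise M \<eta> K Q"
    by (intro stationary_noise.intro stationary_noise_axioms.intro M_prob stationary scE K_def Q_version)
  interpret stationary_noise M \<eta> K Q by (rule noise)
  obtain D where D: "\<And>z. (S has_derivative blinfun_apply (D z)) (at z)"
    using S_smooth unfolding C2_map_bounded_def by metis
  have S_cont: "continuous_on UNIV S"
    using D by (meson continuous_at_imp_continuous_on has_derivative_continuous)
  have X_inv: "\<And>u y. u \<in> X \<Longrightarrow> y \<in> K \<Longrightarrow> S (u, y) \<in> X" using X_invariant by blast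
  have K0: "0 \<in> K" by (rule zero_in_noise_support[OF AE_past_K(1) K_nonempty eta_process eta2])
  have dissip: "\<exists>n\<ge>n0. \<exists>d>0. \<forall>x\<in>X. \<forall>\<xi>\<in>past_seqs K. (\<forall>i<n. norm (\<xi> i) < d) \<longrightarrow> norm (run S n x \<xi>) < \<epsilon>"
    if "\<epsilon> > 0" for \<epsilon> n0
    by (rule dissipation_small_noise[OF S_smooth X_compact K_compact K0 X_inv S1 that])
  have recur: "\<exists>s. \<exists>\<epsilon>>0. \<forall>\<xi>\<in>past_seqs K. hit_prob Q {\<xi>. \<forall>i<n. norm (\<xi> i) < d} (s + n) \<xi> \<ge> \<epsilon>"
    if "n \<ge> 1" "d > 0" for n d
  proof -
    obtain s \<epsilon> where s: "\<epsilon> > 0" "\<And>\<xi>. \<xi> \<in> past_seqs K \<Longrightarrow>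
        measure (N \<xi>) {\<omega>\<in>space (N \<xi>). \<forall>j\<in>{s+1..s+n}. norm (\<zeta> \<xi> j \<omega>) < d} \<ge> \<epsilon>"
      using eta2 \<open>d > 0\<close> by blast
    have "hit_prob Q {\<xi>. \<forall>i<n. norm (\<xi> i) < d} (s + n) \<xi> \<ge> \<epsilon>" if "\<xi> \<in> past_seqs K" for \<xi>
      using s(2)[OF that] conditioned_process_hit_prob[OF Q_kernel eta_process[OF that], of s n d] \<open>n \<ge> 1\<close> by simp
    then show ?thesis using s(1) by blast
  qed
  obtain T :: "'h \<times> 'e \<Rightarrow> 'v" where T: "C1_map T" "\<And>z. S z = J (T z)" using S2_regular by blast
  have dense: "closure (range (frechet_derivative (\<lambda>y'. S (u, y')) (at y))) = UNIV" if "u \<in> X" "y \<in> K" for u y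
    using S2_dense S2_open(2) that by blast
  \<comment> \<open>The set of admissible controls is left open: it is the whole space if
    \<open>B\<close> spans it, and the algebraic span of the basis vectors in the Hilbert
    case.\<close>
  note steering = approximate_steering[OF S_smooth X_compact K_compact S2_embedding T dense]
  from E_space show ?thesis
  proof
    assume B: "is_finite_basis B"
    obtain G q L R where sk: "split_kernel S X K G \<iota> Q Q (\<lambda>_. return borel 0) q B (\<lambda>_. 0) L R"
      and G: "AE \<xi> in past_law. \<xi> \<in> G"
      by (rule split_kernel_finite_dim[OF scH S_cont X_inv K_compact iota B eta1_finite_dim[OF B]])
    obtain W r \<delta> where W: "finite W" "r > 0" "\<delta> > 0"
      and steer: "\<And>u u' y0. u \<in> X \<Longrightarrow> u' \<in> X \<Longrightarrow> norm (u' - u) < \<delta> \<Longrightarrow> y0 \<in> K \<Longrightarrow> \<exists>w\<in>W. \<forall>y\<in>K. norm (y - y0) < r \<longrightarrow>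
        norm (S (u', y + norm (u' - u) *\<^sub>R w) - S (u, y)) \<le> (1/4) * norm (u' - u)"
      by (rule steering[of UNIV "1/4"]) auto
    have "W \<subseteq> span B" using B by (simp add: is_finite_basis_def)
    then show ?thesis
      by (rule mixing_of_split_kernel[OF sk G X_compact X_nonempty W(1) _ W(2,3) steer dissip recur])
  next
    assume onb: "hilbert_with_onb ip f"
    note H = eta1_hilbert[OF onb, unfolded density_cond_hilbert_def]
    obtain rr \<eta>c where rr: "\<forall>l. 0 < rr l" "summable rr"
      and ind: "prob_space.indep_vars M (\<lambda>_. Pi\<^sub>M UNIV (\<lambda>_. borel)) (\<lambda>l \<omega> k. \<eta>c l k \<omega>) (UNIV :: nat set)"
      and c_le: "\<forall>l k. AE \<omega> in M. \<bar>\<eta>c l k \<omega>\<bar> \<le> 1"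
      and series: "\<forall>k. AE \<omega> in M. (\<lambda>l. (rr l * \<eta>c l k \<omega>) *\<^sub>R f l) sums \<eta> k \<omega>"
      using conjunct1[OF H] by (elim exE conjE) (rule that)
    obtain p where p: "\<forall>l. \<forall>\<xi>\<in>past_seqs K. (\<forall>x. 0 \<le> p l \<xi> x) \<and>
        distr (Q \<xi>) borel (\<lambda>x. ip x (f l)) = density lborel (\<lambda>x. ennreal (p l \<xi> x))"
      "\<forall>l. lipschitz_density \<iota> K (p l)"
      using conjunct2[OF H] by (elim exE conjE) (rule that)
    obtain W r \<delta> where W: "finite W" "W \<subseteq> span (range f)" "r > 0" "\<delta> > 0"
      and steer: "\<And>u u' y0. u \<in> X \<Longrightarrow> u' \<in> X \<Longrightarrow> norm (u' - u) < \<delta> \<Longrightarrow> y0 \<in> K \<Longrightarrow> \<exists>w\<in>W. \<forall>y\<in>K. norm (y - y0) < r \<longrightarrow>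
        norm (S (u', y + norm (u' - u) *\<^sub>R w) - S (u, y)) \<le> (1/4) * norm (u' - u)"
      by (rule steering[of "span (range f)" "1/4"]) (use onb in \<open>auto simp: hilbert_with_onb_def\<close>)
    \<comment> \<open>Taking controls from the algebraic span, which is dense, ensures that finitely
      many controls involve finitely many basis vectors; this fixes the number \<open>n\<close> of
      coordinates whose joint density is shifted.\<close>
    obtain n where n: "W \<subseteq> span (f ` {..<n})" by (rule finite_subset_span_initial[OF W(1,2)])
    have blocks: "indep_blocks (onb_proj ip f I) (\<lambda>y. y - onb_proj ip f I y)" if "finite I" for I
      by (rule onb_blocks_independent[OF noise onb that rr(1)[rule_format] rr(2) ind
          c_le[rule_format] series[rule_format]])
    obtain G q L R where sk: "split_kernel S X K G \<iota> Q
        (block_kernel (onb_proj ip f {..<n}) (\<lambda>y. y - onb_proj ip f {..<n} y))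
        (block_kernel (\<lambda>y. y - onb_proj ip f {..<n} y) (onb_proj ip f {..<n})) q (f ` {..<n})
        (\<lambda>y. y - onb_proj ip f {..<n} y) L R"
      and G: "AE \<xi> in past_law. \<xi> \<in> G"
      by (rule split_kernel_onb[OF scH S_cont X_inv K_compact iota onb blocks, where p=p]) (use p in blast)+
    show ?thesis
      by (rule mixing_of_split_kernel[OF sk G X_compact X_nonempty W(1) n W(3,4) steer dissip recur])
  qed
qed

end
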